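(* Let $D$ be an ample Cartier $T$-divisor on a projective toric variety $X=X(\Delta)$ over an algebraically closed field $\mathbb{k}$ of arbitrary characteristic. If for some $k\in\mathbb{Z}_{\geq 0}$ one has $L_\sigma\geq k+\Gamma_{\sigma^\vee}$ for each maximal cone $\sigma\in\Delta$, then $D$ is $k$-jet ample.
   Context: Toric conventions. $N$ is a lattice, $M=\operatorname{Hom}(N,\mathbb{Z})$, $N_{\mathbb R}=N\otimes\mathbb R$, $M_{\mathbb R}=M\otimes\mathbb R$, with pairing $\langle\cdot,\cdot\rangle$; $T$ is the torus with character lattice $M$; $\Delta$ is a fan in $N_{\mathbb R}$ and $X(\Delta)$ its toric variety (singularities are allowed). Cones are strictly convex, rational and polyhedral. A $T$-divisor is a $T$-invariant Weil divisor. A lattice element is primitive if it is nonzero and not a positive integer multiple of another lattice element. If $D=\sum_\rho a_\rho D_\rho$ with $D_\rho$ the prime $T$-divisor of the ray $\rho$ with primitive generator $v_\rho$, then $P_D=\{u\in M_{\mathbb R}: \langle u,v_\rho\rangle\geq -a_\rho \text{ for all }\rho\}$. The lattice length of the segment joining $u_1,u_2\in M\otimes\mathbb Q$ is the nonnegative rational number $l$ with $u_1-u_2=lw$ for some primitive $w\in M$. The number $L_\sigma$. For $D$ an ample Cartier $T$-divisor on $X(\Delta)$, maximal cones $\sigma\in\Delta$ correspond to vertices $u_\sigma$ of $P_D$, where $u_\sigma\in M$ satisfies $\operatorname{div}(\chi^{-u_\sigma})|_{U_\sigma}=D|_{U_\sigma}$ on the affine toric variety $U_\sigma$ of $\sigma$.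 $L_\sigma=L_\sigma^D$ is the minimum of the lattice lengths of the edges of $P_D$ having $u_\sigma$ as a vertex. The constant $\Gamma_Q$. Let $Q$ be a cone in $M_{\mathbb R}$ with primitive ray generators $w_1,\dots,w_m\in M$. For $u\in Q$ put $W^Q_{\max}(u)=\max\{\sum_i a_i : u=\sum_i a_iw_i,\ a_i\geq 0 \text{ real}\}$. Let $m_Q$ be the irrelevant maximal ideal of the semigroup algebra $\mathbb k[Q\cap M]$ (spanned by the $\chi^u$ with $0\ne u\in Q\cap M$). For $u\in Q\cap M$ let $k_u^Q=\max\{j\in\mathbb Z_{\geq 0}: \chi^u\in m_Q^j\}$. Let $S_Q=\{\sum_i a_iw_i: 0\leq a_i<1\}$ and $\Gamma_Q=\max\{W^Q_{\max}(u)-k^Q_u : u\in S_Q\cap M\}$. $\sigma^\vee\subseteq M_{\mathbb R}$ denotes the dual cone of $\sigma$. Jet ampleness. A line bundle $L$ on a projective variety $X$ is $k$-jet ample ($k\in\mathbb Z_{\geq 0}$) if for any set $\{x_1,\dots,x_r\}$ of distinct closed points of $X$ and any positive integers $k_1,\dots,k_r$ with $\sum_i k_i=k+1$, the evaluation map $H^0(X,L)\to H^0(X,L\otimes\mathcal O_X/(m_{x_1}^{k_1}\otimes\cdots\otimes m_{x_r}^{k_r}))$ is surjective, where $m_{x_i}$ is the ideal sheaf of $x_i$. A Cartier divisor $D$ is $k$-jet ample if $\mathcal O_X(D)$ is. *)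

theory Defs
  imports
    "HOL-Analysis.Analysis"
    "HOL-Library.Poly_Mapping"
    "HOL-Computational_Algebra.Polynomial"
    "HOL-Computational_Algebra.Fraction_Field"
begin

section \<open>Lattices, cones and fans\<close>

text \<open>
  Both \<open>N\<close> and its dual \<open>M\<close> are \<open>\<int>\<^sup>n\<close>, with \<open>n\<close> the cardinality of the index type, and
  \<open>N\<^sub>\<real>\<close>, \<open>M\<^sub>\<real>\<close> are \<open>real ^ 'n\<close>; the pairing is the inner product.  Lattice vectors are finitely
  supported functions because then the group algebra \<open>('n \<Rightarrow>\<^sub>0 int) \<Rightarrow>\<^sub>0 'k\<close> of Laurent polynomials
  is an instance of \<open>idom\<close> and has a fraction field.  A linear order on the index type is needed only for
  that instance; it plays no mathematical role.
\<close>

type_synonym 'n lattice = "'n \<Rightarrow>\<^sub>0 int"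

definition to_real :: "'n::finite lattice \<Rightarrow> real ^ 'n" where
  "to_real u = (\<chi> i. of_int (Poly_Mapping.lookup u i))"

definition primitive :: "'n::finite lattice \<Rightarrow> bool" where
  "primitive v \<longleftrightarrow>
     v \<noteq> 0 \<and> (\<forall>w m. 0 < (m::int) \<and> to_real v = of_int m *\<^sub>R to_real w \<longrightarrow> w = v)"

definition lattice_points :: "(real ^ 'n::finite) set \<Rightarrow> 'n lattice set" where
  "lattice_points Q = {u. to_real u \<in> Q}"

definition toric_cone :: "(real ^ 'n::finite) set \<Rightarrow> bool" where
  "toric_cone \<sigma> \<longleftrightarrow>
     (\<exists>G :: 'n lattice set. finite G \<and> \<sigma> = convex_cone hull (to_real ` G)) \<and>
     \<sigma> \<inter> uminus ` \<sigma> = {0}"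

definition dual_cone :: "(real ^ 'n::finite) set \<Rightarrow> (real ^ 'n) set" where
  "dual_cone \<sigma> = {u. \<forall>v\<in>\<sigma>. 0 \<le> u \<bullet> v}"

text \<open>The library's faces include the empty set, which is not a face of a cone here.\<close>

definition fan :: "(real ^ 'n::finite) set set \<Rightarrow> bool" where
  "fan \<Delta> \<longleftrightarrow>
     finite \<Delta> \<and> \<Delta> \<noteq> {} \<and> (\<forall>\<sigma>\<in>\<Delta>. toric_cone \<sigma>) \<and>
     (\<forall>\<sigma>\<in>\<Delta>. \<forall>\<tau>. \<tau> face_of \<sigma> \<and> \<tau> \<noteq> {} \<longrightarrow> \<tau> \<in> \<Delta>) \<and>
     (\<forall>\<sigma>\<in>\<Delta>. \<forall>\<tau>\<in>\<Delta>. \<sigma> \<inter> \<tau> face_of \<sigma> \<and> \<sigma> \<inter> \<tau> face_of \<tau>)"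

definition maximal_cones :: "(real ^ 'n::finite) set set \<Rightarrow> (real ^ 'n) set set" where
  "maximal_cones \<Delta> = {\<sigma> \<in> \<Delta>. \<forall>\<tau>\<in>\<Delta>. \<sigma> \<subseteq> \<tau> \<longrightarrow> \<tau> = \<sigma>}"

definition rays :: "(real ^ 'n::finite) set set \<Rightarrow> (real ^ 'n) set set" where
  "rays \<Delta> = {\<rho> \<in> \<Delta>. aff_dim \<rho> = 1}"

definition ray_generator :: "(real ^ 'n::finite) set \<Rightarrow> 'n lattice" where
  "ray_generator \<rho> = (THE v. primitive v \<and> to_real v \<in> \<rho>)"

section \<open>The function field and ideals in subrings of a commutative ring\<close>

type_synonym ('n, 'k) laurent = "'n lattice \<Rightarrow>\<^sub>0 'k"
type_synonym ('n, 'k) function_field = "('n, 'k) laurent fract"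

definition character :: "'n::{finite,linorder} lattice \<Rightarrow> ('n, 'k::field) function_field" where
  "character u = Fract (Poly_Mapping.single u 1) 1"

definition semigroup_algebra :: "(real ^ 'n::finite) set \<Rightarrow> ('n, 'k::zero) laurent set" where
  "semigroup_algebra Q = {f. Poly_Mapping.keys f \<subseteq> lattice_points Q}"

definition ideal_mult :: "'a::comm_ring_1 set \<Rightarrow> 'a set \<Rightarrow> 'a set" where
  "ideal_mult I J = {(\<Sum>i<m. a i * b i) | (m::nat) a b. \<forall>i<m. a i \<in> I \<and> b i \<in> J}"

text \<open>The first argument is the ambient ring, that is, the zeroth power.\<close>

primrec ideal_power :: "'a::comm_ring_1 set \<Rightarrow> 'a set \<Rightarrow> nat \<Rightarrow> 'a set" where
  "ideal_power R I 0 = R"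
| "ideal_power R I (Suc j) = ideal_mult I (ideal_power R I j)"

definition ideal_in :: "'a::comm_ring_1 set \<Rightarrow> 'a set \<Rightarrow> bool" where
  "ideal_in R I \<longleftrightarrow>
     I \<subseteq> R \<and> 0 \<in> I \<and> (\<forall>a\<in>I. \<forall>b\<in>I. a + b \<in> I) \<and> (\<forall>r\<in>R. \<forall>a\<in>I. r * a \<in> I)"

definition maximal_ideal_in :: "'a::comm_ring_1 set \<Rightarrow> 'a set \<Rightarrow> bool" where
  "maximal_ideal_in R m \<longleftrightarrow>
     ideal_in R m \<and> m \<noteq> R \<and> (\<forall>J. ideal_in R J \<and> m \<subseteq> J \<longrightarrow> J = m \<or> J = R)"

definition localization_at :: "'a::field set \<Rightarrow> 'a set \<Rightarrow> 'a set" where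
  "localization_at R m = {a / b | a b. a \<in> R \<and> b \<in> R - m}"

inductive_set subalgebra_generated ::
    "('n::{finite,linorder}, 'k::field) function_field set \<Rightarrow> ('n, 'k) function_field set"
  for G where
  const: "Fract (Poly_Mapping.single 0 c) 1 \<in> subalgebra_generated G"
| gen: "g \<in> G \<Longrightarrow> g \<in> subalgebra_generated G"
| add: "a \<in> subalgebra_generated G \<Longrightarrow> b \<in> subalgebra_generated G \<Longrightarrow>
        a + b \<in> subalgebra_generated G"
| mult: "a \<in> subalgebra_generated G \<Longrightarrow> b \<in> subalgebra_generated G \<Longrightarrow>
        a * b \<in> subalgebra_generated G"

section \<open>The toric variety of a fan\<close>

text \<open>
  A closed point of \<open>U\<^sub>\<sigma>\<close> is a semigroup homomorphism from \<open>\<sigma>\<^sup>\<or> \<inter> M\<close> to the multiplicative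
  monoid of the algebraically closed ground field.  The closed points of \<open>X(\<Delta>)\<close> are obtained by gluing
  the \<open>U\<^sub>\<sigma>\<close> along the \<open>U\<^bsub>\<sigma> \<inter> \<tau>\<^esub>\<close>: a point is a class of pairs \<open>(\<sigma>, x)\<close> with \<open>x \<in> U\<^sub>\<sigma>\<close>.
\<close>

type_synonym ('n, 'k) point = "((real ^ 'n) set \<times> ('n lattice \<Rightarrow> 'k)) set"

definition affine_points :: "(real ^ 'n::finite) set \<Rightarrow> ('n lattice \<Rightarrow> 'k::field) set" where
  "affine_points \<sigma> =
     {x \<in> extensional (lattice_points (dual_cone \<sigma>)).
        x 0 = 1 \<and>
        (\<forall>u\<in>lattice_points (dual_cone \<sigma>). \<forall>v\<in>lattice_points (dual_cone \<sigma>).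
           x (u + v) = x u * x v)}"

definition gluing ::
    "(real ^ 'n::finite) set set \<Rightarrow>
     (((real ^ 'n) set \<times> ('n lattice \<Rightarrow> 'k::field)) \<times> ((real ^ 'n) set \<times> ('n lattice \<Rightarrow> 'k))) set"
  where
  "gluing \<Delta> =
     {((\<sigma>, x), (\<tau>, y)).
        \<sigma> \<in> \<Delta> \<and> \<tau> \<in> \<Delta> \<and> x \<in> affine_points \<sigma> \<and> y \<in> affine_points \<tau> \<and>
        (\<exists>z\<in>affine_points (\<sigma> \<inter> \<tau>).
           x = restrict z (lattice_points (dual_cone \<sigma>)) \<and>
           y = restrict z (lattice_points (dual_cone \<tau>)))}"

definition toric_variety :: "(real ^ 'n::finite) set set \<Rightarrow> ('n, 'k::field) point set" where
  "toric_variety \<Delta> = (SIGMA \<sigma>:\<Delta>. affine_points \<sigma>) // gluing \<Delta>"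

definition eval_at :: "('n::finite lattice \<Rightarrow> 'k::field) \<Rightarrow> ('n, 'k) laurent \<Rightarrow> 'k" where
  "eval_at x f = (\<Sum>u\<in>Poly_Mapping.keys f. Poly_Mapping.lookup f u * x u)"

definition zariski_open ::
    "(real ^ 'n::finite) set set \<Rightarrow> ('n, 'k::field) point set \<Rightarrow> bool" where
  "zariski_open \<Delta> V \<longleftrightarrow>
     V \<subseteq> toric_variety \<Delta> \<and>
     (\<forall>\<sigma>\<in>\<Delta>. \<forall>x\<in>affine_points \<sigma>. gluing \<Delta> `` {(\<sigma>, x)} \<in> V \<longrightarrow>
        (\<exists>f\<in>semigroup_algebra (dual_cone \<sigma>). eval_at x f \<noteq> 0 \<and>
           (\<forall>y\<in>affine_points \<sigma>. eval_at y f \<noteq> 0 \<longrightarrow> gluing \<Delta> `` {(\<sigma>, y)} \<in> V)))"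

text \<open>
  \<open>X(\<Delta>)\<close> is integral with function field the fraction field of the Laurent polynomials.  All sheaves
  below are given by their stalks at closed points, as subsets of the function field.
\<close>

definition local_ring ::
    "('n::{finite,linorder}, 'k::field) point \<Rightarrow> ('n, 'k) function_field set" where
  "local_ring p =
     {Fract a b | \<sigma> x a b. (\<sigma>, x) \<in> p \<and>
        a \<in> semigroup_algebra (dual_cone \<sigma>) \<and> b \<in> semigroup_algebra (dual_cone \<sigma>) \<and>
        eval_at x b \<noteq> 0}"

definition max_ideal_at ::
    "('n::{finite,linorder}, 'k::field) point \<Rightarrow> ('n, 'k) function_field set" where
  "max_ideal_at p =
     {Fract a b | \<sigma> x a b. (\<sigma>, x) \<in> p \<and>
        a \<in> semigroup_algebra (dual_cone \<sigma>) \<and> b \<in> semigroup_algebra (dual_cone \<sigma>) \<and>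
        eval_at x a = 0 \<and> eval_at x b \<noteq> 0}"

text \<open>
  Projectivity: \<open>X(\<Delta>)\<close> is isomorphic to a closed subvariety of a projective space.  An integral such
  subvariety, with \<open>S\<close> the (finite) set of its nonzero homogeneous coordinates read as elements of the
  function field, is covered by the affine varieties with coordinate rings \<open>k[t/s : t \<in> S]\<close>, \<open>s \<in> S\<close>.
  Two separated integral varieties with the same function field are isomorphic over it iff their
  closed points have the same local rings, as subrings of the function field; hence the condition
  below.  The union on its right-hand side is the projective model defined by \<open>S\<close> in Zariski and
  Samuel, Commutative Algebra II, VI.17.
\<close>

definition projective_toric ::
    "'k::field itself \<Rightarrow> (real ^ 'n::{finite,linorder}) set set \<Rightarrow> bool" where
  "projective_toric _ \<Delta> \<longleftrightarrow>
     (\<exists>S :: ('n, 'k) function_field set. finite S \<and> S \<noteq> {} \<and> 0 \<notin> S \<and>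
        local_ring ` toric_variety \<Delta> =
          (\<Union>s\<in>S. let R = subalgebra_generated ((\<lambda>t. t / s) ` S)
                  in localization_at R ` {m. maximal_ideal_in R m}))"

section \<open>Torus-invariant divisors\<close>

text \<open>A \<open>T\<close>-divisor \<open>\<Sum> a\<^sub>\<rho> D\<^sub>\<rho>\<close> is given by its coefficients; only the values on \<open>rays \<Delta>\<close> matter.\<close>

type_synonym 'n tdivisor = "(real ^ 'n) set \<Rightarrow> int"

text \<open>\<open>div(\<chi>\<^sup>u) = \<Sum> \<langle>u, v\<^sub>\<rho>\<rangle> D\<^sub>\<rho>\<close>\<close>

definition character_divisor :: "'n::finite lattice \<Rightarrow> 'n tdivisor" where
  "character_divisor u \<rho> =
     (\<Sum>i\<in>UNIV. Poly_Mapping.lookup u i * Poly_Mapping.lookup (ray_generator \<rho>) i)"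

text \<open>
  The divisor \<open>D\<^sub>\<rho>\<close> meets \<open>U\<^sub>\<sigma>\<close> iff \<open>\<rho>\<close> is a face of \<open>\<sigma>\<close>, so this says that \<open>div(\<chi>\<^bsup>-u\<^esup>)\<close> and \<open>D\<close> have
  the same restriction to \<open>U\<^sub>\<sigma>\<close>.
\<close>

definition local_datum ::
    "(real ^ 'n::finite) set set \<Rightarrow> 'n tdivisor \<Rightarrow> (real ^ 'n) set \<Rightarrow> 'n lattice \<Rightarrow> bool" where
  "local_datum \<Delta> D \<sigma> u \<longleftrightarrow>
     (\<forall>\<rho>\<in>rays \<Delta>. \<rho> face_of \<sigma> \<longrightarrow> character_divisor (- u) \<rho> = D \<rho>)"

text \<open>
  On the affine toric variety \<open>U\<^sub>\<sigma>\<close> a \<open>T\<close>-invariant Cartier divisor is the divisor of a character.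
\<close>

definition cartier :: "(real ^ 'n::finite) set set \<Rightarrow> 'n tdivisor \<Rightarrow> bool" where
  "cartier \<Delta> D \<longleftrightarrow> (\<forall>\<sigma>\<in>\<Delta>. \<exists>u. local_datum \<Delta> D \<sigma> u)"

text \<open>
  \<open>O\<^sub>X(D)\<close> is the subsheaf of the function field generated on \<open>U\<^sub>\<sigma>\<close> by the inverse \<open>\<chi>\<^sup>u\<close> of the local
  equation \<open>\<chi>\<^bsup>-u\<^esup>\<close> of \<open>D\<close>.
\<close>

definition divisor_stalk ::
    "(real ^ 'n::{finite,linorder}) set set \<Rightarrow> 'n tdivisor \<Rightarrow> ('n, 'k::field) point \<Rightarrow>
     ('n, 'k) function_field set" where
  "divisor_stalk \<Delta> D p =
     {character u * g | \<sigma> x u g. (\<sigma>, x) \<in> p \<and> local_datum \<Delta> D \<sigma> u \<and> g \<in> local_ring p}"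

definition sections ::
    "(real ^ 'n::{finite,linorder}) set set \<Rightarrow> 'n tdivisor \<Rightarrow> ('n, 'k::field) point set \<Rightarrow>
     ('n, 'k) function_field set" where
  "sections \<Delta> D V = {f. \<forall>p\<in>V. f \<in> divisor_stalk \<Delta> D p}"

text \<open>The set \<open>X\<^sub>s\<close> of points where a global section \<open>s\<close> of \<open>O\<^sub>X(D)\<close> generates the stalk.\<close>

definition nonvanishing_locus ::
    "(real ^ 'n::{finite,linorder}) set set \<Rightarrow> 'n tdivisor \<Rightarrow> ('n, 'k::field) function_field \<Rightarrow>
     ('n, 'k) point set" where
  "nonvanishing_locus \<Delta> D s =
     {p \<in> toric_variety \<Delta>. s \<notin> ideal_mult (max_ideal_at p) (divisor_stalk \<Delta> D p)}"

text \<open>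
  Ampleness as in EGA II, 4.5.2 (a) and 4.5.3: the sets \<open>X\<^sub>s\<close>, for \<open>s\<close> a global section of some
  \<open>O\<^sub>X(D)\<^bsup>\<otimes>n\<^esup> = O\<^sub>X(nD)\<close> with \<open>n > 0\<close>, form a base of the Zariski topology.
\<close>

definition ample ::
    "'k::field itself \<Rightarrow> (real ^ 'n::{finite,linorder}) set set \<Rightarrow> 'n tdivisor \<Rightarrow> bool" where
  "ample _ \<Delta> D \<longleftrightarrow>
     (\<forall>V :: ('n, 'k) point set. zariski_open \<Delta> V \<longrightarrow>
        (\<forall>p\<in>V. \<exists>n::nat. n > 0 \<and>
           (\<exists>s\<in>sections \<Delta> (\<lambda>\<rho>. int n * D \<rho>) (toric_variety \<Delta>).
              p \<in> nonvanishing_locus \<Delta> (\<lambda>\<rho>. int n * D \<rho>) s \<and>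
              nonvanishing_locus \<Delta> (\<lambda>\<rho>. int n * D \<rho>) s \<subseteq> V)))"

section \<open>Jet ampleness\<close>

text \<open>The stalk at \<open>p\<close> of the ideal sheaf \<open>m\<^sub>q\<close> of a closed point \<open>q\<close>.\<close>

definition point_ideal_stalk ::
    "('n::{finite,linorder}, 'k::field) point \<Rightarrow> ('n, 'k) point \<Rightarrow> ('n, 'k) function_field set"
  where
  "point_ideal_stalk q p = (if p = q then max_ideal_at p else local_ring p)"

text \<open>
  Points with multiplicities are given as a list of pairs \<open>(x\<^sub>i, k\<^sub>i)\<close>.  The stalk at \<open>p\<close> of the
  ideal sheaf of the product of the \<open>m\<^bsub>x\<^sub>i\<^esub>\<close> with exponents \<open>k\<^sub>i\<close> is the product of the stalks.
\<close>

definition jet_ideal_stalk ::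
    "(('n::{finite,linorder}, 'k::field) point \<times> nat) list \<Rightarrow> ('n, 'k) point \<Rightarrow>
     ('n, 'k) function_field set" where
  "jet_ideal_stalk xs p =
     foldr (\<lambda>(q, j). ideal_mult (ideal_power (local_ring p) (point_ideal_stalk q p) j)) xs
       (local_ring p)"

text \<open>
  With \<open>L = O\<^sub>X(D)\<close> and \<open>J\<close> this ideal sheaf, the stalk of \<open>L \<otimes> O\<^sub>X/J\<close> at \<open>p\<close> is \<open>L\<^sub>p / J\<^sub>p L\<^sub>p\<close>; \<open>jet_class\<close>
  gives the residue class of \<open>f\<close>.  A global section of the quotient sheaf \<open>L \<otimes> O\<^sub>X/J\<close> is a family of
  residue classes that comes locally from sections of \<open>L\<close>.
\<close>

definition jet_class ::
    "(real ^ 'n::{finite,linorder}) set set \<Rightarrow> 'n tdivisor \<Rightarrow>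
     (('n, 'k::field) point \<times> nat) list \<Rightarrow> ('n, 'k) function_field \<Rightarrow> ('n, 'k) point \<Rightarrow>
     ('n, 'k) function_field set" where
  "jet_class \<Delta> D xs f p =
     {f + g | g. g \<in> ideal_mult (jet_ideal_stalk xs p) (divisor_stalk \<Delta> D p)}"

definition jet_sections ::
    "(real ^ 'n::{finite,linorder}) set set \<Rightarrow> 'n tdivisor \<Rightarrow>
     (('n, 'k::field) point \<times> nat) list \<Rightarrow>
     (('n, 'k) point \<Rightarrow> ('n, 'k) function_field set) set" where
  "jet_sections \<Delta> D xs =
     {s \<in> extensional (toric_variety \<Delta>).
        \<forall>p\<in>toric_variety \<Delta>. \<exists>V f. zariski_open \<Delta> V \<and> p \<in> V \<and> f \<in> sections \<Delta> D V \<and>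
          (\<forall>q\<in>V. s q = jet_class \<Delta> D xs f q)}"

definition jet_evaluation ::
    "(real ^ 'n::{finite,linorder}) set set \<Rightarrow> 'n tdivisor \<Rightarrow>
     (('n, 'k::field) point \<times> nat) list \<Rightarrow> ('n, 'k) function_field \<Rightarrow>
     (('n, 'k) point \<Rightarrow> ('n, 'k) function_field set)" where
  "jet_evaluation \<Delta> D xs f = restrict (jet_class \<Delta> D xs f) (toric_variety \<Delta>)"

definition jet_ample ::
    "'k::field itself \<Rightarrow> nat \<Rightarrow> (real ^ 'n::{finite,linorder}) set set \<Rightarrow> 'n tdivisor \<Rightarrow> bool"
  where
  "jet_ample _ k \<Delta> D \<longleftrightarrow>
     (\<forall>xs :: (('n, 'k) point \<times> nat) list.
        distinct (map fst xs) \<and> (\<forall>(x, j)\<in>set xs. x \<in> toric_variety \<Delta> \<and> j > 0) \<and>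
        sum_list (map snd xs) = k + 1 \<longrightarrow>
        jet_evaluation \<Delta> D xs ` sections \<Delta> D (toric_variety \<Delta>) = jet_sections \<Delta> D xs)"

section \<open>The numbers \<open>L\<^sub>\<sigma>\<close> and \<open>\<Gamma>\<^sub>Q\<close>\<close>

definition divisor_polytope ::
    "(real ^ 'n::finite) set set \<Rightarrow> 'n tdivisor \<Rightarrow> (real ^ 'n) set" where
  "divisor_polytope \<Delta> D =
     {u. \<forall>\<rho>\<in>rays \<Delta>. - of_int (D \<rho>) \<le> u \<bullet> to_real (ray_generator \<rho>)}"

definition lattice_length :: "real ^ 'n::finite \<Rightarrow> real ^ 'n \<Rightarrow> real" where
  "lattice_length a b = (THE l. 0 \<le> l \<and> (\<exists>w. primitive w \<and> a - b = l *\<^sub>R to_real w))"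

text \<open>
  On a complete fan the maximal cones are full-dimensional, so that the local datum there is unique.
\<close>

definition cone_vertex ::
    "(real ^ 'n::finite) set set \<Rightarrow> 'n tdivisor \<Rightarrow> (real ^ 'n) set \<Rightarrow> 'n lattice" where
  "cone_vertex \<Delta> D \<sigma> = (THE u. local_datum \<Delta> D \<sigma> u)"

definition min_edge_length ::
    "(real ^ 'n::finite) set set \<Rightarrow> 'n tdivisor \<Rightarrow> (real ^ 'n) set \<Rightarrow> real" where
  "min_edge_length \<Delta> D \<sigma> =
     Min {lattice_length (to_real (cone_vertex \<Delta> D \<sigma>)) b | b.
            closed_segment (to_real (cone_vertex \<Delta> D \<sigma>)) b edge_of divisor_polytope \<Delta> D}"

definition ray_generators :: "(real ^ 'n::finite) set \<Rightarrow> 'n lattice set" where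
  "ray_generators Q = {w. primitive w \<and> (\<exists>F. F face_of Q \<and> aff_dim F = 1 \<and> to_real w \<in> F)}"

text \<open>The supremum is attained, for \<open>u\<close> in a strictly convex \<open>Q\<close>, since the set is then compact.\<close>

definition W_max :: "(real ^ 'n::finite) set \<Rightarrow> 'n lattice \<Rightarrow> real" where
  "W_max Q u =
     Sup {(\<Sum>w\<in>ray_generators Q. a w) | a.
            (\<forall>w\<in>ray_generators Q. 0 \<le> a w) \<and>
            to_real u = (\<Sum>w\<in>ray_generators Q. a w *\<^sub>R to_real w)}"

definition irrelevant_ideal :: "(real ^ 'n::finite) set \<Rightarrow> ('n, 'k::zero) laurent set" where
  "irrelevant_ideal Q = {f. Poly_Mapping.keys f \<subseteq> lattice_points Q - {0}}"

definition order_at_fixed_point ::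
    "'k::field itself \<Rightarrow> (real ^ 'n::finite) set \<Rightarrow> 'n lattice \<Rightarrow> nat" where
  "order_at_fixed_point _ Q u =
     (GREATEST j. (Poly_Mapping.single u 1 :: ('n, 'k) laurent) \<in>
        ideal_power (semigroup_algebra Q) (irrelevant_ideal Q) j)"

definition half_open_zonotope :: "(real ^ 'n::finite) set \<Rightarrow> (real ^ 'n) set" where
  "half_open_zonotope Q =
     {(\<Sum>w\<in>ray_generators Q. a w *\<^sub>R to_real w) | a. \<forall>w\<in>ray_generators Q. 0 \<le> a w \<and> a w < 1}"

definition Gamma_const :: "'k::field itself \<Rightarrow> (real ^ 'n::finite) set \<Rightarrow> real" where
  "Gamma_const K Q =
     Max {W_max Q u - real (order_at_fixed_point K Q u) | u.
            u \<in> lattice_points (half_open_zonotope Q)}"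

end

theory Submission
  imports Defs
begin

text \<open>
  Fix a one-parameter subgroup \<open>v\<close> in general position.  It moves each of the given points \<open>p\<close> to a
  fixed point, so \<open>p\<close> lies in an attracting chart \<open>U\<^sub>\<sigma>\<close>, in which a character \<open>\<chi>\<^sup>u\<close> with \<open>u \<noteq> 0\<close> can be
  nonzero at \<open>p\<close> only if \<open>\<langle>u, v\<rangle> > 0\<close>.  Let \<open>e\<^sub>\<sigma>\<close> be the total multiplicity of the points attached to \<open>\<sigma>\<close>,
  so that \<open>\<Sum>\<^sub>\<sigma> e\<^sub>\<sigma> = k + 1\<close>.  If \<open>\<chi>\<^sup>u\<close> is a product of \<open>e\<^sub>\<sigma>\<close> characters \<open>\<chi>\<^bsup>u\<^sub>i\<^esup>\<close> of the maximal ideal, then modulo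
  the product of the \<open>\<chi>\<^bsup>u\<^sub>i\<^esup> - \<chi>\<^bsup>u\<^sub>i\<^esup>(p\<^sub>i)\<close>, which vanishes to the prescribed orders, it is a combination of
  characters of smaller \<open>v\<close>-weight.

  The hypothesis on \<open>L\<^sub>\<sigma>\<close> implies that for a lattice point \<open>m\<close> of \<open>P\<^sub>D\<close> and two vertices \<open>u\<^sub>\<sigma> \<noteq> u\<^sub>\<tau>\<close> the orders
  of \<open>m - u\<^sub>\<sigma>\<close> and \<open>m - u\<^sub>\<tau>\<close> add up to at least \<open>k\<close>; as \<open>e\<^sub>\<sigma> + e\<^sub>\<tau> \<le> k + 1\<close>, the order of \<open>m\<close> is
  smaller than \<open>e\<^sub>\<sigma>\<close> at no more than one vertex.  So \<open>\<chi>\<^sup>m\<close>, corrected by sections obtained before for smaller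
  weight, realises its jet at that vertex and the zero jet at all others.  By induction on the weight all
  jets are realised.

  The polytope enters through two facts: the fan is complete, since every monomial valuation of the function
  field has a centre on a projective variety, and the vertices \<open>u\<^sub>\<sigma>\<close> are pairwise distinct points of
  \<open>P\<^sub>D\<close>, by ampleness and the Nullstellensatz for the torus.
\<close>

subsection \<open>Extending homomorphisms into an algebraically closed field\<close>

text \<open>The constant \<Gamma> enters through one estimate. Splitting the coefficients of a
  lattice vector of the dual cone into integral and fractional parts shows that its coefficient sum
  exceeds its order by at most \<Gamma>. Since the edges at a vertex have length at least k +
  \<Gamma>, a lattice vector of order at most k stays in the corner spanned by initial pieces of
  these edges, hence in the polytope. So a monomial of a chart either is a global section or has
  order above k and can be reduced. Two obstacles shape the argument. The points are not
  torus-fixed, so a high order at a fixed point says nothing directly about vanishing at them; the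
  factors \<chi>^u - c take the place of monomials, and the attracting direction makes the error
  terms smaller. No derivative is taken, which is why the characteristic is arbitrary. Moreover the
  v-weight can be negative on a chart, so descent by it need not end; inside a chart the descent is
  controlled by an integral functional positive on the dual cone, and the v-weight orders only the
  finitely many lattice points of the polytope.\<close>

definition subring_set :: "'a::comm_ring_1 set \<Rightarrow> bool" where
  "subring_set S \<longleftrightarrow> 1 \<in> S \<and> (\<forall>x\<in>S. \<forall>y\<in>S. x - y \<in> S \<and> x * y \<in> S)"

lemma subring_setD:
  assumes "subring_set S"
  shows "1 \<in> S" "0 \<in> S" "x \<in> S \<Longrightarrow> y \<in> S \<Longrightarrow> x - y \<in> S" "x \<in> S \<Longrightarrow> y \<in> S \<Longrightarrow> x * y \<in> S"
    "x \<in> S \<Longrightarrow> - x \<in> S" "x \<in> S \<Longrightarrow> y \<in> S \<Longrightarrow> x + y \<in> S"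
proof -
  show 1: "1 \<in> S" and d: "x \<in> S \<Longrightarrow> y \<in> S \<Longrightarrow> x - y \<in> S" for x y
    using assms by (auto simp: subring_set_def)
  show "x \<in> S \<Longrightarrow> y \<in> S \<Longrightarrow> x * y \<in> S" using assms by (auto simp: subring_set_def)
  show 0: "0 \<in> S" using d[OF 1 1] by simp
  show n: "x \<in> S \<Longrightarrow> - x \<in> S" for x using d[OF 0, of x] by simp
  show "x \<in> S \<Longrightarrow> y \<in> S \<Longrightarrow> x + y \<in> S" using d[OF _ n, of x y] by simp
qed

lemma subring_set_sum:
  assumes "subring_set S" "\<And>i. i \<in> A \<Longrightarrow> f i \<in> S"
  shows "sum f A \<in> S"
  using assms(2) by (induction A rule: infinite_finite_induct) (auto intro: subring_setD[OF assms(1)])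

lemma subring_set_power: "subring_set S \<Longrightarrow> x \<in> S \<Longrightarrow> x ^ n \<in> S"
  by (induction n) (auto intro: subring_setD)

definition prime_ideal_set :: "'a::comm_ring_1 set \<Rightarrow> bool" where
  "prime_ideal_set m \<longleftrightarrow> ideal_in UNIV m \<and> 1 \<notin> m \<and> (\<forall>x y. x * y \<in> m \<longrightarrow> x \<in> m \<or> y \<in> m)"

lemma ideal_inD:
  assumes "ideal_in R I"
  shows "I \<subseteq> R" "0 \<in> I" "a \<in> I \<Longrightarrow> b \<in> I \<Longrightarrow> a + b \<in> I" "r \<in> R \<Longrightarrow> a \<in> I \<Longrightarrow> r * a \<in> I"
    "r \<in> R \<Longrightarrow> a \<in> I \<Longrightarrow> a * r \<in> I"
  using assms by (auto simp: ideal_in_def mult.commute)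

lemma prime_ideal_setD:
  assumes "prime_ideal_set m"
  shows "0 \<in> m" "a \<in> m \<Longrightarrow> b \<in> m \<Longrightarrow> a + b \<in> m" "a \<in> m \<Longrightarrow> r * a \<in> m" "a \<in> m \<Longrightarrow> a * r \<in> m"
    "a \<in> m \<Longrightarrow> b \<in> m \<Longrightarrow> a - b \<in> m" "1 \<notin> m" "x * y \<in> m \<longleftrightarrow> x \<in> m \<or> y \<in> m" "- a \<in> m \<longleftrightarrow> a \<in> m"
proof -
  have i: "ideal_in UNIV m" and p: "1 \<notin> m" "\<And>x y. x * y \<in> m \<Longrightarrow> x \<in> m \<or> y \<in> m"
    using assms by (auto simp: prime_ideal_set_def)
  note D = ideal_inD[OF i]
  show "0 \<in> m" "a \<in> m \<Longrightarrow> b \<in> m \<Longrightarrow> a + b \<in> m" "a \<in> m \<Longrightarrow> r * a \<in> m" "a \<in> m \<Longrightarrow> a * r \<in> m"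
    "1 \<notin> m" for a b r
    using D p(1) by auto
  show "x * y \<in> m \<longleftrightarrow> x \<in> m \<or> y \<in> m" for x y using D(4,5) p(2)[of x y] by blast
  have n: "a \<in> m \<Longrightarrow> - a \<in> m" for a using D(4)[of "-1" a] by simp
  show "a \<in> m \<Longrightarrow> b \<in> m \<Longrightarrow> a - b \<in> m" using D(3)[OF _ n[of b], of a] by simp
  show "- a \<in> m \<longleftrightarrow> a \<in> m" using n[of a] n[of "-a"] by auto
qed

lemma prime_ideal_set_sum:
  assumes "prime_ideal_set m" "\<And>i. i \<in> A \<Longrightarrow> f i \<in> m"
  shows "sum f A \<in> m"
  using assms(2) by (induction A rule: infinite_finite_induct) (auto intro: prime_ideal_setD[OF assms(1)])

lemma prime_ideal_set_power: "prime_ideal_set m \<Longrightarrow> x ^ n \<in> m \<Longrightarrow> x \<in> m"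
  by (induction n) (auto simp: prime_ideal_setD)

definition coeffs_in :: "'a::comm_ring_1 set \<Rightarrow> 'a poly \<Rightarrow> bool" where
  "coeffs_in S p \<longleftrightarrow> (\<forall>i. coeff p i \<in> S)"

definition adjoin :: "'a::comm_ring_1 set \<Rightarrow> 'a \<Rightarrow> 'a set" where
  "adjoin S y = {poly p y | p. coeffs_in S p}"

lemma coeffs_in_intros:
  assumes "subring_set S"
  shows "coeffs_in S p \<Longrightarrow> coeffs_in S q \<Longrightarrow> coeffs_in S (p + q)"
    "coeffs_in S p \<Longrightarrow> coeffs_in S q \<Longrightarrow> coeffs_in S (p - q)"
    "coeffs_in S p \<Longrightarrow> coeffs_in S q \<Longrightarrow> coeffs_in S (p * q)"
    "a \<in> S \<Longrightarrow> coeffs_in S q \<Longrightarrow> coeffs_in S (smult a q)"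
    "a \<in> S \<Longrightarrow> coeffs_in S (monom a n)" "coeffs_in S 0" "coeffs_in S 1"
    "a \<in> S \<Longrightarrow> coeffs_in S p \<Longrightarrow> coeffs_in S (pCons a p)"
  using subring_setD[OF assms]
  by (auto simp: coeffs_in_def coeff_mult coeff_1 coeff_pCons split: nat.split
      intro!: subring_set_sum[OF assms])

lemma subring_set_adjoin:
  assumes "subring_set S" shows "subring_set (adjoin S y)"
  unfolding subring_set_def adjoin_def
proof (intro conjI ballI)
  show "1 \<in> {poly p y |p. coeffs_in S p}"
    using coeffs_in_intros(7)[OF assms] by (intro CollectI exI[of _ 1]) auto
next
  fix a b assume "a \<in> {poly p y |p. coeffs_in S p}" "b \<in> {poly p y |p. coeffs_in S p}"
  then obtain p q where "a = poly p y" "b = poly q y" "coeffs_in S p" "coeffs_in S q" by auto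
  then show "a - b \<in> {poly p y |p. coeffs_in S p}" "a * b \<in> {poly p y |p. coeffs_in S p}"
    using coeffs_in_intros[OF assms]
    by (auto intro: exI[of _ "p - q"] exI[of _ "p * q"])
qed

lemma adjoin_superset: "subring_set S \<Longrightarrow> S \<subseteq> adjoin S y"
  by (auto simp: adjoin_def intro!: exI[of _ "[:_:]"] coeffs_in_intros)

lemma adjoin_gen: "subring_set S \<Longrightarrow> y \<in> adjoin S y"
  by (auto simp: adjoin_def intro!: exI[of _ "[:0,1:]"] coeffs_in_intros subring_setD)

text \<open>A homomorphism of algebras from S / (S \<inter> m) to the field, with \<open>c\<close>
  the structure map. It is kept as a function on the ambient ring, constrained only on
  \<open>S\<close>, so that no quotient ring has to be formed.\<close>

definition residue_hom :: "'a::comm_ring_1 set \<Rightarrow> 'a set \<Rightarrow> ('k \<Rightarrow> 'a) \<Rightarrow> ('a \<Rightarrow> 'k::field) \<Rightarrow> bool" where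
  "residue_hom S m c \<phi> \<longleftrightarrow>
     (\<forall>x\<in>S. \<forall>y\<in>S. \<phi> (x + y) = \<phi> x + \<phi> y \<and> \<phi> (x * y) = \<phi> x * \<phi> y) \<and>
     (\<forall>a. \<phi> (c a) = a) \<and> (\<forall>x\<in>S \<inter> m. \<phi> x = 0)"

lemma residue_homD:
  assumes "residue_hom S m c \<phi>"
  shows "x \<in> S \<Longrightarrow> y \<in> S \<Longrightarrow> \<phi> (x + y) = \<phi> x + \<phi> y" "x \<in> S \<Longrightarrow> y \<in> S \<Longrightarrow> \<phi> (x * y) = \<phi> x * \<phi> y"
    "\<phi> (c a) = a" "x \<in> S \<Longrightarrow> x \<in> m \<Longrightarrow> \<phi> x = 0"
  using assms by (auto simp: residue_hom_def)

lemma residue_hom_0: "residue_hom S m c \<phi> \<Longrightarrow> subring_set S \<Longrightarrow> \<phi> 0 = 0"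
  by (metis add_0 add_cancel_right_right residue_homD(1) subring_setD(2))

lemma residue_hom_sum:
  assumes "residue_hom S m c \<phi>" "subring_set S" "\<And>i. i \<in> A \<Longrightarrow> f i \<in> S"
  shows "\<phi> (sum f A) = (\<Sum>i\<in>A. \<phi> (f i))"
  using assms(3)
proof (induction A rule: infinite_finite_induct)
  case (insert x F)
  then show ?case using residue_homD(1)[OF assms(1)] subring_set_sum[OF assms(2), of F f] by auto
qed (auto simp: residue_hom_0[OF assms(1,2)])

lemma residue_hom_minus:
  assumes "residue_hom S m c \<phi>" "subring_set S" "x \<in> S"
  shows "\<phi> (- x) = - \<phi> x"
proof -
  have "\<phi> x + \<phi> (- x) = \<phi> 0"
    using residue_homD(1)[OF assms(1), of x "-x"] assms subring_setD(5)[OF assms(2)] by auto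
  then show ?thesis using residue_hom_0[OF assms(1,2)] by (simp add: add_eq_0_iff)
qed

lemma residue_hom_power:
  assumes "residue_hom S m c \<phi>" "subring_set S" "x \<in> S" "\<phi> 1 = 1"
  shows "\<phi> (x ^ n) = \<phi> x ^ n"
  by (induction n) (auto simp: assms residue_homD(2)[OF assms(1)] subring_set_power)

lemma map_poly_residue_hom:
  assumes h: "residue_hom S m c \<phi>" and S: "subring_set S" and p: "coeffs_in S p" and q: "coeffs_in S q"
  shows "map_poly \<phi> (p + q) = map_poly \<phi> p + map_poly \<phi> q"
    "map_poly \<phi> (p * q) = map_poly \<phi> p * map_poly \<phi> q"
    "a \<in> S \<Longrightarrow> map_poly \<phi> (smult a p) = smult (\<phi> a) (map_poly \<phi> p)"
    "map_poly \<phi> (- p) = - map_poly \<phi> p"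
proof -
  note [simp] = residue_hom_0[OF h S] coeff_map_poly
  show "map_poly \<phi> (p + q) = map_poly \<phi> p + map_poly \<phi> q"
    using p q by (intro poly_eqI) (auto simp: coeffs_in_def residue_homD(1)[OF h])
  show "map_poly \<phi> (- p) = - map_poly \<phi> p"
    using p by (intro poly_eqI) (auto simp: coeffs_in_def residue_hom_minus[OF h S])
  show "map_poly \<phi> (p * q) = map_poly \<phi> p * map_poly \<phi> q"
  proof (rule poly_eqI)
    fix n
    have "\<phi> (\<Sum>i\<le>n. coeff p i * coeff q (n - i)) = (\<Sum>i\<le>n. \<phi> (coeff p i * coeff q (n - i)))"
      using p q by (intro residue_hom_sum[OF h S]) (auto simp: coeffs_in_def subring_setD[OF S])
    also have "\<dots> = (\<Sum>i\<le>n. \<phi> (coeff p i) * \<phi> (coeff q (n - i)))"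
      using p q by (intro sum.cong) (auto simp: coeffs_in_def residue_homD(2)[OF h])
    finally show "coeff (map_poly \<phi> (p * q)) n = coeff (map_poly \<phi> p * map_poly \<phi> q) n"
      by (simp add: coeff_mult)
  qed
  show "map_poly \<phi> (smult a p) = smult (\<phi> a) (map_poly \<phi> p)" if "a \<in> S"
    using p that by (intro poly_eqI) (auto simp: coeffs_in_def residue_homD(2)[OF h])
qed

text \<open>The extension sends \<open>y\<close> to \<open>e\<close>. The hypothesis on
  \<open>e\<close> makes this well defined: two polynomials with the same value at \<open>y\<close>
  differ by one with value 0 in \<open>m\<close>, whose image has the root \<open>e\<close>.\<close>

lemma residue_hom_extend:
  assumes h: "residue_hom S m c \<phi>" and S: "subring_set S" and m: "prime_ideal_set m"
    and c: "range c \<subseteq> S"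
    and e: "\<And>p. coeffs_in S p \<Longrightarrow> poly p y \<in> m \<Longrightarrow> poly (map_poly \<phi> p) e = 0"
  shows "\<exists>\<psi>. residue_hom (adjoin S y) m c \<psi> \<and>
           (\<forall>p. coeffs_in S p \<longrightarrow> \<psi> (poly p y) = poly (map_poly \<phi> p) e)"
proof -
  note hom = map_poly_residue_hom[OF h S]
  have wd: "poly (map_poly \<phi> p) e = poly (map_poly \<phi> q) e"
    if "coeffs_in S p" "coeffs_in S q" "poly p y = poly q y" for p q
  proof -
    have mq: "coeffs_in S (- q)" using that(2) subring_setD(5)[OF S] by (auto simp: coeffs_in_def)
    have "poly (p + - q) y \<in> m" using that prime_ideal_setD(1)[OF m] by auto
    then have "poly (map_poly \<phi> (p + - q)) e = 0"
      using e[of "p + - q"] that mq coeffs_in_intros(1)[OF S] by blast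
    then show ?thesis using hom(1)[OF that(1) mq] hom(4)[OF that(2) that(2)] by simp
  qed
  define P where "P x = (SOME p. coeffs_in S p \<and> x = poly p y)" for x
  define \<psi> where "\<psi> x = poly (map_poly \<phi> (P x)) e" for x
  have P: "coeffs_in S (P (poly p y)) \<and> poly p y = poly (P (poly p y)) y" if "coeffs_in S p" for p
    unfolding P_def by (rule someI[of _ p]) (use that in auto)
  have \<psi>: "\<psi> (poly p y) = poly (map_poly \<phi> p) e" if "coeffs_in S p" for p
    unfolding \<psi>_def using wd[of "P (poly p y)" p] P[OF that] that by auto
  have "residue_hom (adjoin S y) m c \<psi>"
    unfolding residue_hom_def
  proof (intro conjI ballI allI)
    fix x z assume "x \<in> adjoin S y" "z \<in> adjoin S y"
    then obtain p q where pq: "x = poly p y" "z = poly q y" "coeffs_in S p" "coeffs_in S q"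
      by (auto simp: adjoin_def)
    have "\<psi> (poly (p + q) y) = \<psi> x + \<psi> z"
      using pq \<psi>[of p] \<psi>[of q] \<psi>[of "p + q"] coeffs_in_intros(1)[OF S] hom(1) by simp
    then show "\<psi> (x + z) = \<psi> x + \<psi> z" using pq by simp
    have "\<psi> (poly (p * q) y) = \<psi> x * \<psi> z"
      using pq \<psi>[of p] \<psi>[of q] \<psi>[of "p * q"] coeffs_in_intros(3)[OF S] hom(2) by simp
    then show "\<psi> (x * z) = \<psi> x * \<psi> z" using pq by simp
  next
    fix a
    have "coeffs_in S [:c a:]" using c by (auto intro!: coeffs_in_intros[OF S])
    from \<psi>[OF this] show "\<psi> (c a) = a"
      using residue_homD(3)[OF h] residue_hom_0[OF h S] by (simp add: map_poly_pCons)
  next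
    fix x assume "x \<in> adjoin S y \<inter> m"
    then obtain p where "x = poly p y" "coeffs_in S p" "poly p y \<in> m" by (auto simp: adjoin_def)
    then show "\<psi> x = 0" using \<psi> e by auto
  qed
  with \<psi> show ?thesis by blast
qed

text \<open>Each cancellation of a leading term multiplies \<open>g\<close> by the leading
  coefficient of \<open>h\<close> instead of dividing by it, so all coefficients remain in
  \<open>S\<close>; \<open>N\<close> counts the cancellations.\<close>

lemma pseudo_division_in:
  fixes g h :: "'a::idom poly"
  assumes S: "subring_set S" and h: "coeffs_in S h" "0 < degree h"
  shows "coeffs_in S g \<Longrightarrow> \<exists>N q r. coeffs_in S q \<and> coeffs_in S r \<and>
     smult (lead_coeff h ^ N) g = q * h + r \<and> degree r < degree h"
proof (induction "degree g" arbitrary: g rule: less_induct)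
  case less
  let ?l = "lead_coeff h"
  have l: "?l \<in> S" using h(1) by (auto simp: coeffs_in_def)
  show ?case
  proof (cases "degree g < degree h")
    case True
    then show ?thesis
      using less.prems coeffs_in_intros(6)[OF S] by (intro exI[of _ 0] exI[of _ 0] exI[of _ g]) auto
  next
    case False
    define t where "t = monom (lead_coeff g) (degree g - degree h)"
    define g' where "g' = smult ?l g - t * h"
    have t: "coeffs_in S t"
      unfolding t_def using less.prems by (intro coeffs_in_intros[OF S]) (auto simp: coeffs_in_def)
    have g': "coeffs_in S g'"
      unfolding g'_def using t l h less.prems by (intro coeffs_in_intros[OF S]) auto
    have "degree g' < degree g"
    proof -
      have "g \<noteq> 0" using False h(2) by auto
      have "degree (t * h) \<le> degree g"
        using degree_mult_le[of t h] degree_monom_le[of "lead_coeff g" "degree g - degree h"] False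
        unfolding t_def by linarith
      then have "degree g' \<le> degree g" unfolding g'_def by (intro degree_diff_le) auto
      moreover have "coeff g' (degree g) = 0"
      proof -
        have "coeff (t * h) (degree g) = lead_coeff g * ?l"
          unfolding t_def using False by (simp add: coeff_monom_mult)
        then show ?thesis unfolding g'_def by simp
      qed
      moreover have "degree g > 0" using False h(2) by linarith
      ultimately show ?thesis
        by (metis degree_0 le_neq_implies_less leading_coeff_0_iff)
    qed
    from less.hyps[OF this g'] obtain N q r where
      IH: "coeffs_in S q" "coeffs_in S r" "smult (?l ^ N) g' = q * h + r" "degree r < degree h" by blast
    have "smult (?l ^ Suc N) g = smult (?l ^ N) (g' + t * h)"
      unfolding g'_def by (simp add: mult.commute)
    also have "\<dots> = (q + smult (?l ^ N) t) * h + r"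
      using IH(3) by (simp add: smult_add_right algebra_simps)
    finally show ?thesis
      using IH t l by (intro exI[of _ "Suc N"] exI[of _ "q + smult (?l ^ N) t"] exI[of _ r])
        (auto intro!: coeffs_in_intros[OF S] subring_set_power[OF S])
  qed
qed

lemma truncate_mod_prime:
  fixes p :: "'a::idom poly"
  assumes S: "subring_set S" and m: "prime_ideal_set m"
  shows "coeffs_in S p \<Longrightarrow> coeff p i \<notin> m \<Longrightarrow>
     \<exists>q. coeffs_in S q \<and> degree q \<le> degree p \<and> lead_coeff q \<notin> m \<and> poly p y - poly q y \<in> m"
proof (induction "degree p" arbitrary: p rule: less_induct)
  case less
  show ?case
  proof (cases "lead_coeff p \<in> m")
    case False
    then show ?thesis using less.prems prime_ideal_setD(1)[OF m] by (intro exI[of _ p]) auto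
  next
    case True
    define p' where "p' = p - monom (lead_coeff p) (degree p)"
    have lp: "lead_coeff p \<in> S" using less.prems(1) by (auto simp: coeffs_in_def)
    have p': "coeffs_in S p'"
      unfolding p'_def by (intro coeffs_in_intros[OF S] less.prems(1) lp)
    have i: "i \<noteq> degree p" using True less.prems(2) by auto
    then have ci: "coeff p' i \<notin> m" using less.prems(2) by (simp add: p'_def)
    have "i < degree p"
      using i less.prems(2) le_degree[of p i] prime_ideal_setD(1)[OF m]
      by (metis le_neq_implies_less)
    have "degree p' \<le> degree p" unfolding p'_def by (intro degree_diff_le) (auto intro: degree_monom_le)
    moreover have "coeff p' (degree p) = 0" unfolding p'_def by simp
    ultimately have "degree p' < degree p"
      using \<open>i < degree p\<close> by (metis bot_nat_0.not_eq_extremum degree_0 le_neq_implies_less leading_coeff_0_iff less_nat_zero_code)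
    from less.hyps[OF this p' ci] obtain q where
      q: "coeffs_in S q" "degree q \<le> degree p'" "lead_coeff q \<notin> m" "poly p' y - poly q y \<in> m" by blast
    have "poly p y - poly q y = (poly p' y - poly q y) + lead_coeff p * y ^ degree p"
      unfolding p'_def by (simp add: poly_monom)
    then have "poly p y - poly q y \<in> m"
      using prime_ideal_setD(2,4)[OF m] q(4) True by presburger
    then show ?thesis using q \<open>degree p' < degree p\<close> by (intro exI[of _ q]) auto
  qed
qed

text \<open>One step of the Nullstellensatz. Modulo \<open>m\<close> the new element is either
  transcendental, and all but finitely many values work for it, or algebraic, and a root of the
  image of its minimal relation works, provided that the leading coefficient of this relation and
  some multiple of \<open>b\<close> lying in \<open>S\<close> survive.\<close>

lemma residue_hom_nonvanishing:
  fixes m :: "'a::idom set" and c :: "'k::alg_closed_field \<Rightarrow> 'a"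
  assumes inf: "infinite (UNIV :: 'k set)"
    and S: "subring_set S" and m: "prime_ideal_set m" and c: "range c \<subseteq> S" and c1: "c 1 = 1"
    and ex: "\<And>b. b \<in> S - m \<Longrightarrow> \<exists>\<phi>. residue_hom S m c \<phi> \<and> \<phi> b \<noteq> 0"
    and b: "b \<in> adjoin S y - m"
  shows "\<exists>\<phi>. residue_hom (adjoin S y) m c \<phi> \<and> \<phi> b \<noteq> 0"
proof -
  obtain g where g: "coeffs_in S g" "b = poly g y" using b by (auto simp: adjoin_def)
  have gm: "\<exists>i. coeff g i \<notin> m"
  proof (rule ccontr)
    assume "\<not> ?thesis"
    then have "poly g y \<in> m"
      unfolding poly_altdef by (intro prime_ideal_set_sum[OF m]) (auto intro: prime_ideal_setD[OF m])
    then show False using b g by auto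
  qed
  show ?thesis
  proof (cases "\<exists>p. coeffs_in S p \<and> lead_coeff p \<notin> m \<and> poly p y \<in> m")
    \<comment> \<open>Here \<open>y\<close> is transcendental modulo \<open>m\<close>: a polynomial
      over \<open>S\<close> with value in \<open>m\<close> has all coefficients in \<open>m\<close>,
      so \<open>y\<close> may be sent to anything but the finitely many roots of the image of
      \<open>g\<close>.\<close>
    case False
    have tr: "coeff p i \<in> m" if "coeffs_in S p" "poly p y \<in> m" for p i
    proof (rule ccontr)
      assume "coeff p i \<notin> m"
      from truncate_mod_prime[OF S m that(1) this, of y] obtain q where
        "coeffs_in S q" "lead_coeff q \<notin> m" "poly p y - poly q y \<in> m" by blast
      then show False using False that(2) prime_ideal_setD(5)[OF m, of "poly p y" "poly p y - poly q y"] by auto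
    qed
    obtain i where i: "coeff g i \<notin> m" using gm by blast
    then obtain \<phi> where \<phi>: "residue_hom S m c \<phi>" "\<phi> (coeff g i) \<noteq> 0"
      using ex[of "coeff g i"] g by (auto simp: coeffs_in_def)
    note [simp] = residue_hom_0[OF \<phi>(1) S] coeff_map_poly
    have "map_poly \<phi> g \<noteq> 0" using \<phi>(2) by (metis coeff_0 coeff_map_poly residue_hom_0[OF \<phi>(1) S])
    then have "finite {x. poly (map_poly \<phi> g) x = 0}" by (rule poly_roots_finite)
    then obtain e where e: "poly (map_poly \<phi> g) e \<noteq> 0"
      using inf by (metis (mono_tags, lifting) UNIV_eq_I mem_Collect_eq)
    have "poly (map_poly \<phi> p) e = 0" if "coeffs_in S p" "poly p y \<in> m" for p
    proof -
      have "map_poly \<phi> p = 0"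
        using tr[OF that] that(1) residue_homD(4)[OF \<phi>(1)] by (intro poly_eqI) (auto simp: coeffs_in_def)
      then show ?thesis by simp
    qed
    from residue_hom_extend[OF \<phi>(1) S m c this] e g show ?thesis by metis
  next
    case True
    \<comment> \<open>A relation of least degree for \<open>y\<close> modulo \<open>m\<close>. Its
      leading coefficient lies outside \<open>m\<close> but need not be a unit of \<open>S\<close>,
      whence pseudo-division.\<close>
    define p where "p = (ARG_MIN degree p. coeffs_in S p \<and> lead_coeff p \<notin> m \<and> poly p y \<in> m)"
    have p: "coeffs_in S p" "lead_coeff p \<notin> m" "poly p y \<in> m"
      and pmin: "\<And>q. coeffs_in S q \<Longrightarrow> lead_coeff q \<notin> m \<Longrightarrow> poly q y \<in> m \<Longrightarrow> degree p \<le> degree q"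
      using arg_min_natI[of "\<lambda>p. coeffs_in S p \<and> lead_coeff p \<notin> m \<and> poly p y \<in> m"]
        arg_min_nat_le[of "\<lambda>p. coeffs_in S p \<and> lead_coeff p \<notin> m \<and> poly p y \<in> m" _ degree] True
      unfolding p_def by blast+
    have lp: "lead_coeff p \<in> S" "lead_coeff p \<noteq> 0"
      using p prime_ideal_setD(1)[OF m] by (auto simp: coeffs_in_def)
    have dp: "degree p > 0"
    proof (rule ccontr)
      assume "\<not> degree p > 0"
      then obtain a where "p = [:a:]" by (metis degree_eq_zeroE not_gr_zero)
      then show False using p by auto
    qed
    have small: "coeff r i \<in> m" if "coeffs_in S r" "poly r y \<in> m" "degree r < degree p" for r i
    proof (rule ccontr)
      assume "coeff r i \<notin> m"
      from truncate_mod_prime[OF S m that(1) this, of y] obtain q where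
        q: "coeffs_in S q" "degree q \<le> degree r" "lead_coeff q \<notin> m" "poly r y - poly q y \<in> m" by blast
      then have "poly q y \<in> m" using that(2) prime_ideal_setD(5)[OF m, of "poly r y" "poly r y - poly q y"] by auto
      with pmin[OF q(1,3)] q(2) that(3) show False by linarith
    qed
    \<comment> \<open>\<open>H\<close> collects polynomials of degree below that of \<open>p\<close>
      whose value at \<open>y\<close> is a multiple of \<open>b\<close> modulo \<open>m\<close>. A
      member of degree 0 plays the role of the norm of \<open>b\<close>.\<close>
    define H where "H h \<longleftrightarrow> coeffs_in S h \<and> lead_coeff h \<notin> m \<and> degree h < degree p \<and>
       (\<exists>v. coeffs_in S v \<and> poly h y - b * poly v y \<in> m)" for h
    have trH: "\<exists>h. H h \<and> degree h \<le> degree r"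
      if "coeffs_in S r" "degree r < degree p" "coeffs_in S v" "poly r y - b * poly v y \<in> m" "coeff r i \<notin> m" for r v i
    proof -
      from truncate_mod_prime[OF S m that(1,5), of y] obtain q where
        q: "coeffs_in S q" "degree q \<le> degree r" "lead_coeff q \<notin> m" "poly r y - poly q y \<in> m" by blast
      have "poly q y - b * poly v y \<in> m"
        using prime_ideal_setD(5)[OF m that(4) q(4)] by simp
      then show ?thesis using q that unfolding H_def by (intro exI[of _ q]) auto
    qed
    have "\<exists>h. H h"
    proof -
      obtain N q r where d: "coeffs_in S q" "coeffs_in S r" "smult (lead_coeff p ^ N) g = q * p + r"
        "degree r < degree p" using pseudo_division_in[OF S p(1) dp g(1)] by blast
      have eq: "lead_coeff p ^ N * b = poly q y * poly p y + poly r y"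
        using arg_cong[OF d(3), of "\<lambda>f. poly f y"] g(2) by simp
      have v: "coeffs_in S [:lead_coeff p ^ N:]"
        using lp by (intro coeffs_in_intros[OF S] subring_set_power[OF S])
      have "poly r y - b * poly [:lead_coeff p ^ N:] y = - (poly q y * poly p y)"
        using eq by (simp add: algebra_simps)
      then have m1: "poly r y - b * poly [:lead_coeff p ^ N:] y \<in> m"
        using p(3) prime_ideal_setD(3,8)[OF m] by metis
      have "lead_coeff p ^ N * b \<notin> m"
        using b p(2) prime_ideal_setD(7)[OF m] prime_ideal_set_power[OF m] by blast
      then have "poly r y \<notin> m" using eq p(3) prime_ideal_setD(2,3)[OF m] by metis
      moreover have "poly r y \<in> m" if "\<And>i. coeff r i \<in> m"
        unfolding poly_altdef by (intro prime_ideal_set_sum[OF m]) (auto intro: prime_ideal_setD[OF m] that)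
      ultimately obtain i where "coeff r i \<notin> m" by blast
      from trH[OF d(2,4) v m1 this] show ?thesis by blast
    qed
    define h where "h = (ARG_MIN degree h. H h)"
    have h: "H h" and hmin: "\<And>q. H q \<Longrightarrow> degree h \<le> degree q"
      using arg_min_natI[of H] arg_min_nat_le[of H _ degree] \<open>\<exists>h. H h\<close> unfolding h_def by blast+
    \<comment> \<open>If the least degree were positive, the remainder of \<open>p\<close> on
      division by \<open>h\<close> would lead to a smaller member of \<open>H\<close>. If all its
      coefficients lie in \<open>m\<close>, then q(y) h(y) lies in \<open>m\<close>, and primality
      yields a relation of degree below that of \<open>p\<close>.\<close>
    have dh: "degree h = 0"
    proof (rule ccontr)
      assume "degree h \<noteq> 0"
      then have dh0: "0 < degree h" by simp
      have hS: "coeffs_in S h" "lead_coeff h \<notin> m" "degree h < degree p" using h by (auto simp: H_def)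
      obtain v where v: "coeffs_in S v" "poly h y - b * poly v y \<in> m" using h by (auto simp: H_def)
      obtain N q r where d: "coeffs_in S q" "coeffs_in S r" "smult (lead_coeff h ^ N) p = q * h + r"
        "degree r < degree h" using pseudo_division_in[OF S hS(1) dh0 p(1)] by blast
      have eq: "lead_coeff h ^ N * poly p y = poly q y * poly h y + poly r y"
        using arg_cong[OF d(3), of "\<lambda>f. poly f y"] by simp
      have hl: "lead_coeff h \<noteq> 0" using hS(2) prime_ideal_setD(1)[OF m] by auto
      have qh: "poly q y * poly h y + poly r y \<in> m"
        using p(3) eq prime_ideal_setD(3)[OF m] by metis
      show False
      proof (cases "\<forall>i. coeff r i \<in> m")
        case False
        then obtain i where i: "coeff r i \<notin> m" by blast
        have "poly r y - b * poly (- (q * v)) y =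
            (poly q y * poly h y + poly r y) - poly q y * (poly h y - b * poly v y)"
          by (simp add: algebra_simps)
        then have m1: "poly r y - b * poly (- (q * v)) y \<in> m"
          using qh v(2) prime_ideal_setD(3,5)[OF m] by metis
        have "coeffs_in S (- (q * v))"
          using coeffs_in_intros(3)[OF S d(1) v(1)] subring_setD(5)[OF S] by (auto simp: coeffs_in_def)
        from trH[OF d(2) _ this m1 i] d(4) hS(3) obtain h' where "H h'" "degree h' \<le> degree r" by auto
        with hmin[of h'] d(4) show False by linarith
      next
        case True
        then have "poly r y \<in> m"
          unfolding poly_altdef by (intro prime_ideal_set_sum[OF m]) (auto intro: prime_ideal_setD[OF m])
        then have "poly q y * poly h y \<in> m" using prime_ideal_setD(5)[OF m qh] by force
        moreover have "poly h y \<notin> m" using small[OF hS(1) _ hS(3)] hS(2) by blast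
        ultimately have qm: "poly q y \<in> m" using prime_ideal_setD(7)[OF m] by blast
        have e: "q * h = smult (lead_coeff h ^ N) p - r" using d(3) by simp
        have dl: "degree (smult (lead_coeff h ^ N) p) = degree p" using hl by simp
        have "degree (q * h) = degree p" "lead_coeff (q * h) = lead_coeff h ^ N * lead_coeff p"
        proof -
          have lt: "degree (- r) < degree (smult (lead_coeff h ^ N) p)" using d(4) hS(3) dl by simp
          have e': "q * h = - r + smult (lead_coeff h ^ N) p" using e by simp
          show "degree (q * h) = degree p" unfolding e' using degree_add_eq_right[OF lt] dl by simp
          show "lead_coeff (q * h) = lead_coeff h ^ N * lead_coeff p"
            unfolding e' using lead_coeff_add_le[OF lt] hl by (simp add: lead_coeff_smult)
        qed
        moreover have "q \<noteq> 0" "h \<noteq> 0" using \<open>degree (q * h) = degree p\<close> dp hl by auto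
        ultimately have "degree q < degree p" "lead_coeff q * lead_coeff h = lead_coeff h ^ N * lead_coeff p"
          using degree_mult_eq[of q h] dh0 lead_coeff_mult[of q h] by auto
        moreover have "lead_coeff h ^ N * lead_coeff p \<notin> m"
          using hS(2) p(2) prime_ideal_setD(7)[OF m] prime_ideal_set_power[OF m] by blast
        ultimately show False using small[OF d(1) qm] prime_ideal_setD(4)[OF m] by metis
      qed
    qed
    then obtain a where a: "h = [:a:]" by (metis degree_eq_zeroE)
    obtain v where v: "coeffs_in S v" "poly h y - b * poly v y \<in> m" using h by (auto simp: H_def)
    have aS: "a \<in> S - m" using h a by (auto simp: H_def coeffs_in_def coeff_pCons split: nat.splits)
    have "a * lead_coeff p \<in> S - m"
      using aS lp p(2) prime_ideal_setD(7)[OF m] subring_setD(4)[OF S] by blast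
    \<comment> \<open>The leading coefficient of \<open>p\<close> must survive so that the image of
      \<open>p\<close> has positive degree and hence a root; \<open>a\<close> must survive because
      it is a multiple of \<open>b\<close> modulo \<open>m\<close>.\<close>
    then obtain \<phi> where \<phi>: "residue_hom S m c \<phi>" "\<phi> (a * lead_coeff p) \<noteq> 0" using ex by blast
    have \<phi>1: "\<phi> 1 = 1" using residue_homD(3)[OF \<phi>(1), of 1] c1 by simp
    note [simp] = residue_hom_0[OF \<phi>(1) S] coeff_map_poly
    have nz: "\<phi> a \<noteq> 0" "\<phi> (lead_coeff p) \<noteq> 0"
      using \<phi>(2) residue_homD(2)[OF \<phi>(1), of a "lead_coeff p"] aS lp by auto
    have "degree (map_poly \<phi> p) = degree p" using nz(2)
      by (intro antisym degree_le le_degree) (auto simp: coeff_eq_0)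
    then obtain e where e: "poly (map_poly \<phi> p) e = 0"
      using alg_closed_imp_poly_has_root[of "map_poly \<phi> p"] dp by auto
    have "poly (map_poly \<phi> q) e = 0" if q: "coeffs_in S q" "poly q y \<in> m" for q
    proof -
      obtain N s r where d: "coeffs_in S s" "coeffs_in S r" "smult (lead_coeff p ^ N) q = s * p + r"
        "degree r < degree p" using pseudo_division_in[OF S p(1) dp q(1)] by blast
      have eq: "lead_coeff p ^ N * poly q y = poly s y * poly p y + poly r y"
        using arg_cong[OF d(3), of "\<lambda>f. poly f y"] by simp
      have "poly r y = lead_coeff p ^ N * poly q y - poly s y * poly p y" using eq by simp
      then have "poly r y \<in> m" using q(2) p(3) prime_ideal_setD(3,5)[OF m] by metis
      then have "map_poly \<phi> r = 0"
        using small[OF d(2) _ d(4)] d(2) residue_homD(4)[OF \<phi>(1)] by (intro poly_eqI) (auto simp: coeffs_in_def)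
      have "smult (\<phi> (lead_coeff p ^ N)) (map_poly \<phi> q) = map_poly \<phi> s * map_poly \<phi> p + map_poly \<phi> r"
        using arg_cong[OF d(3), of "map_poly \<phi>"]
          map_poly_residue_hom(3)[OF \<phi>(1) S q(1) q(1), of "lead_coeff p ^ N"]
          map_poly_residue_hom(1)[OF \<phi>(1) S coeffs_in_intros(3)[OF S d(1) p(1)] d(2)]
          map_poly_residue_hom(2)[OF \<phi>(1) S d(1) p(1)] subring_set_power[OF S lp(1)] by simp
      then have "\<phi> (lead_coeff p ^ N) * poly (map_poly \<phi> q) e = 0"
        using e \<open>map_poly \<phi> r = 0\<close> by (metis add_0_right mult_zero_right poly_mult poly_smult)
      then show ?thesis using nz(2) residue_hom_power[OF \<phi>(1) S lp(1) \<phi>1] by simp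
    qed
    from residue_hom_extend[OF \<phi>(1) S m c this] obtain \<psi> where
      \<psi>: "residue_hom (adjoin S y) m c \<psi>" "\<And>p. coeffs_in S p \<Longrightarrow> \<psi> (poly p y) = poly (map_poly \<phi> p) e" by blast
    have "\<psi> b \<noteq> 0"
    proof
      assume 0: "\<psi> b = 0"
      have ha: "a \<in> adjoin S y" "b \<in> adjoin S y" "poly v y \<in> adjoin S y"
        using aS b v(1) adjoin_superset[OF S] by (auto simp: adjoin_def)
      note SA = subring_setD[OF subring_set_adjoin[OF S]]
      have "\<psi> (a - b * poly v y) = 0"
        using v(2) a residue_homD(4)[OF \<psi>(1)] ha SA by auto
      moreover have "\<psi> ((a - b * poly v y) + b * poly v y) = \<psi> (a - b * poly v y) + \<psi> b * \<psi> (poly v y)"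
        using residue_homD(1)[OF \<psi>(1) SA(3)[OF ha(1) SA(4)[OF ha(2,3)]] SA(4)[OF ha(2,3)]]
          residue_homD(2)[OF \<psi>(1) ha(2,3)] by simp
      ultimately have "\<psi> a = 0" using 0 by simp
      moreover have "\<psi> a = \<phi> a"
        using \<psi>(2)[of "[:a:]"] aS by (auto simp: map_poly_pCons intro!: coeffs_in_intros[OF S])
      ultimately show False using nz by simp
    qed
    with \<psi>(1) show ?thesis by blast
  qed
qed

primrec adjoin_list :: "'a::comm_ring_1 set \<Rightarrow> 'a list \<Rightarrow> 'a set" where
  "adjoin_list S [] = S"
| "adjoin_list S (y # ys) = adjoin (adjoin_list S ys) y"

lemma subring_set_adjoin_list: "subring_set S \<Longrightarrow> subring_set (adjoin_list S ys)"
  by (induction ys) (auto simp: subring_set_adjoin)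

lemma adjoin_list_superset:
  assumes "subring_set S" shows "S \<subseteq> adjoin_list S ys"
proof (induction ys)
  case (Cons y ys)
  then show ?case
    using adjoin_superset[OF subring_set_adjoin_list[OF assms], of ys y] by simp
qed simp

lemma adjoin_list_gen:
  assumes "subring_set S" shows "set ys \<subseteq> adjoin_list S ys"
proof (induction ys)
  case (Cons y ys)
  then show ?case
    using adjoin_superset[OF subring_set_adjoin_list[OF assms], of ys y]
      adjoin_gen[OF subring_set_adjoin_list[OF assms], of y ys] by auto
qed simp

text \<open>Over a finite field the product of all X - a, plus 1, is nonconstant and has no
  root.\<close>

lemma infinite_UNIV_alg_closed: "infinite (UNIV :: 'k::alg_closed_field set)"
proof
  assume fin: "finite (UNIV :: 'k set)"
  define p where "p = (\<Prod>a\<in>(UNIV :: 'k set). [:- a, 1:]) + 1"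
  have "degree (\<Prod>a\<in>(UNIV :: 'k set). [:- a, 1:]) = card (UNIV :: 'k set)"
    by (subst degree_prod_eq_sum_degree) auto
  moreover have "card (UNIV :: 'k set) > 0" using fin by (simp add: card_gt_0_iff)
  ultimately have "degree p > 0" unfolding p_def by (subst degree_add_eq_left) auto
  then obtain x where "poly p x = 0" using alg_closed_imp_poly_has_root by blast
  moreover have "poly p x = 1"
  proof -
    have "(\<Prod>a\<in>UNIV. poly [:- a, 1:] x) = 0"
      using fin by (intro prod_zero[OF fin] bexI[of _ x]) auto
    then show ?thesis unfolding p_def by (simp add: poly_prod)
  qed
  ultimately show False by simp
qed

text \<open>With \<open>b\<close> = 1 this is the weak Nullstellensatz for a finitely generated
  algebra modulo \<open>m\<close>; the form with arbitrary \<open>b\<close> is what the induction on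
  the generators needs.\<close>

theorem residue_hom_adjoin_list:
  fixes m :: "'a::idom set" and c :: "'k::alg_closed_field \<Rightarrow> 'a"
  assumes S: "subring_set (range c)" and m: "prime_ideal_set m" and c1: "c 1 = 1"
    and c: "\<And>a b. c (a + b) = c a + c b" "\<And>a b. c (a * b) = c a * c b" and inj: "inj c"
    and b: "b \<in> adjoin_list (range c) ys - m"
  shows "\<exists>\<phi>. residue_hom (adjoin_list (range c) ys) m c \<phi> \<and> \<phi> b \<noteq> 0"
  using b
proof (induction ys arbitrary: b)
  case Nil
  have c0: "c 0 = 0" using c(1)[of 0 0] by (metis add_0 add_cancel_right_right)
  have um: "a = 0" if "c a \<in> m" for a
  proof (rule ccontr)
    assume "a \<noteq> 0"
    then have "c (inverse a) * c a = 1" using c1 c(2)[of "inverse a" a] by simp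
    then show False using that prime_ideal_setD(3)[OF m, of "c a" "c (inverse a)"] prime_ideal_setD(6)[OF m] by simp
  qed
  have "residue_hom (range c) m c (inv c)"
    unfolding residue_hom_def using inj um by (auto simp: c(1)[symmetric] c(2)[symmetric])
  moreover have "inv c b \<noteq> 0" using Nil inj c0 prime_ideal_setD(1)[OF m] by auto
  ultimately show ?case by auto
next
  case (Cons y ys)
  have "range c \<subseteq> adjoin_list (range c) ys" by (rule adjoin_list_superset[OF S])
  from residue_hom_nonvanishing[OF infinite_UNIV_alg_closed subring_set_adjoin_list[OF S] m this c1 Cons.IH]
    Cons.prems show ?case by simp
qed

subsection \<open>Laurent polynomials and the Nullstellensatz for the torus\<close>

text \<open>Zorn's lemma, for ideals of a subset \<open>R\<close> of the ambient ring: the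
  coordinate rings of a projective model are subrings of the function field.\<close>

lemma maximal_ideal_exists:
  assumes R: "1 \<in> R" and I: "ideal_in R I" "1 \<notin> I"
  shows "\<exists>m. maximal_ideal_in R m \<and> I \<subseteq> m \<and> 1 \<notin> m"
proof -
  define \<A> where "\<A> = {J. ideal_in R J \<and> I \<subseteq> J \<and> 1 \<notin> J}"
  have "\<exists>M\<in>\<A>. \<forall>X\<in>\<A>. M \<subseteq> X \<longrightarrow> X = M"
  proof (rule subset_Zorn_nonempty)
    show "\<A> \<noteq> {}" using I by (auto simp: \<A>_def)
    fix C assume C: "C \<noteq> {}" "subset.chain \<A> C"
    have sub: "\<And>X. X \<in> C \<Longrightarrow> X \<in> \<A>" and ch: "\<And>X Y. X \<in> C \<Longrightarrow> Y \<in> C \<Longrightarrow> X \<subseteq> Y \<or> Y \<subseteq> X"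
      using C(2) by (auto simp: subset.chain_def)
    have "ideal_in R (\<Union>C)"
      unfolding ideal_in_def
    proof (intro conjI ballI)
      show "\<Union>C \<subseteq> R" using sub unfolding \<A>_def ideal_in_def by blast
      show "0 \<in> \<Union>C" using C(1) sub by (auto simp: \<A>_def ideal_in_def)
      show "a + b \<in> \<Union>C" if ab: "a \<in> \<Union>C" "b \<in> \<Union>C" for a b
      proof -
        obtain X Y where "X \<in> C" "a \<in> X" "Y \<in> C" "b \<in> Y" using ab by auto
        then obtain Z where "Z \<in> C" "a \<in> Z" "b \<in> Z" using ch[of X Y] by auto
        then show ?thesis using sub[of Z] by (auto simp: \<A>_def ideal_in_def)
      qed
      show "r * a \<in> \<Union>C" if "r \<in> R" "a \<in> \<Union>C" for r a
        using that sub unfolding \<A>_def ideal_in_def by blast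
    qed
    then show "\<Union>C \<in> \<A>" using C(1) sub by (auto simp: \<A>_def)
  qed
  then obtain M where M: "M \<in> \<A>" "\<And>X. X \<in> \<A> \<Longrightarrow> M \<subseteq> X \<Longrightarrow> X = M" by blast
  have "maximal_ideal_in R M"
    unfolding maximal_ideal_in_def
  proof (intro conjI allI impI)
    show "ideal_in R M" "M \<noteq> R" using M(1) R by (auto simp: \<A>_def)
    fix J assume J: "ideal_in R J \<and> M \<subseteq> J"
    show "J = M \<or> J = R"
    proof (cases "1 \<in> J")
      case True
      then have "J = R" using J ideal_inD(1,4)[of R J] by (metis mult.right_neutral subsetI subset_antisym)
      then show ?thesis ..
    next
      case False
      then show ?thesis using M J by (auto simp: \<A>_def)
    qed
  qed
  with M(1) show ?thesis by (auto simp: \<A>_def)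
qed

lemma maximal_ideal_UNIV_prime:
  assumes m: "maximal_ideal_in UNIV m" "1 \<notin> m"
  shows "prime_ideal_set m"
proof -
  have i: "ideal_in UNIV m" using m by (simp add: maximal_ideal_in_def)
  note D = ideal_inD[OF i]
  have "x \<in> m \<or> y \<in> m" if xy: "x * y \<in> m" for x y
  proof (rule ccontr)
    assume n: "\<not> (x \<in> m \<or> y \<in> m)"
    define J where "J = {a + r * x | a r. a \<in> m}"
    have "ideal_in UNIV J"
      unfolding ideal_in_def
    proof (intro conjI ballI)
      show "0 \<in> J" using D(2) unfolding J_def by (intro CollectI exI[of _ 0]) auto
      show "a + b \<in> J" if ab: "a \<in> J" "b \<in> J" for a b
      proof -
        obtain a' r b' s where "a = a' + r * x" "b = b' + s * x" "a' \<in> m" "b' \<in> m"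
          using ab unfolding J_def by blast
        then have "a + b = (a' + b') + (r + s) * x" "a' + b' \<in> m" using D(3) by (auto simp: algebra_simps)
        then show ?thesis unfolding J_def by blast
      qed
      show "r * a \<in> J" if a: "a \<in> J" for r a
      proof -
        obtain a' s where "a = a' + s * x" "a' \<in> m" using a by (auto simp: J_def)
        then have "r * a = r * a' + (r * s) * x" "r * a' \<in> m"
          using D(4)[OF UNIV_I] by (simp_all only: distrib_left mult.assoc)
        then show ?thesis unfolding J_def by blast
      qed
    qed auto
    moreover have "m \<subseteq> J"
    proof
      fix a assume "a \<in> m"
      then have "a = a + 0 * x \<and> a \<in> m" by simp
      then show "a \<in> J" unfolding J_def by blast
    qed
    moreover have "x \<in> J" using D(2) unfolding J_def by (intro CollectI exI[of _ 0] exI[of _ 1]) auto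
    ultimately have "1 \<in> J" using m n by (auto simp: maximal_ideal_in_def)
    then obtain a r where "1 = a + r * x" "a \<in> m" by (auto simp: J_def)
    then have "y = a * y + r * (x * y)" by (metis distrib_right mult.assoc mult_1)
    then show False using n D(3,4,5) \<open>a \<in> m\<close> xy by (metis UNIV_I)
  qed
  then show ?thesis using i m(2) by (auto simp: prime_ideal_set_def)
qed

lemma to_real_simps [simp]:
  "to_real (u + v) = to_real u + to_real v" "to_real 0 = 0" "to_real (- u) = - to_real u"
  "to_real (u - v) = to_real u - to_real v" "to_real (frag_cmul c u) = of_int c *\<^sub>R to_real u"
  by (auto simp: to_real_def vec_eq_iff lookup_add lookup_minus)

lemma to_real_sum: "to_real (sum f A) = (\<Sum>i\<in>A. to_real (f i))"
  by (induction A rule: infinite_finite_induct) auto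

lemma to_real_eq_iff [simp]: "to_real u = to_real v \<longleftrightarrow> u = v"
  by (auto simp: to_real_def vec_eq_iff poly_mapping_eq_iff fun_eq_iff)

lemma to_real_eq_0_iff [simp]: "to_real u = 0 \<longleftrightarrow> u = 0"
  using to_real_eq_iff[of u 0] by (simp del: to_real_eq_iff)

definition pairing :: "'n::finite lattice \<Rightarrow> 'n lattice \<Rightarrow> int" where
  "pairing u v = (\<Sum>i\<in>UNIV. Poly_Mapping.lookup u i * Poly_Mapping.lookup v i)"

lemma inner_to_real: "to_real u \<bullet> to_real v = of_int (pairing u v)"
  by (simp add: to_real_def pairing_def inner_vec_def)

lemma to_real_inner_ge_1: "0 < to_real u \<bullet> to_real v \<Longrightarrow> 1 \<le> to_real u \<bullet> to_real v"
  by (simp add: inner_to_real)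

lemma laurent_expand: "f = (\<Sum>u\<in>Poly_Mapping.keys f. Poly_Mapping.single u (Poly_Mapping.lookup f u))"
proof (rule poly_mapping_eqI)
  fix k
  show "Poly_Mapping.lookup f k =
      Poly_Mapping.lookup (\<Sum>u\<in>Poly_Mapping.keys f. Poly_Mapping.single u (Poly_Mapping.lookup f u)) k"
    by (simp add: lookup_sum lookup_single when_def sum.delta' in_keys_iff)
qed

lemma laurent_times_expand:
  fixes f g :: "'a::comm_monoid_add \<Rightarrow>\<^sub>0 'b::comm_semiring_0"
  shows "f * g = (\<Sum>u\<in>Poly_Mapping.keys f. \<Sum>v\<in>Poly_Mapping.keys g.
    Poly_Mapping.single (u + v) (Poly_Mapping.lookup f u * Poly_Mapping.lookup g v))"
  by (subst laurent_expand[of f], subst laurent_expand[of g])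
    (simp add: sum_product mult_single)

text \<open>No other pair of exponents has the sum u0 + v0, so nothing can cancel there. It is
  applied at extreme exponents: minimal ones for a valuation, and the apex of a pointed
  cone.\<close>

lemma lookup_times_unique:
  fixes f g :: "'a::comm_monoid_add \<Rightarrow>\<^sub>0 'b::comm_semiring_0"
  assumes "\<And>u v. u \<in> Poly_Mapping.keys f \<Longrightarrow> v \<in> Poly_Mapping.keys g \<Longrightarrow> u + v = u0 + v0 \<Longrightarrow> u = u0 \<and> v = v0"
  shows "Poly_Mapping.lookup (f * g) (u0 + v0) = Poly_Mapping.lookup f u0 * Poly_Mapping.lookup g v0"
proof -
  have "Poly_Mapping.lookup (f * g) (u0 + v0) = (\<Sum>u\<in>Poly_Mapping.keys f. \<Sum>v\<in>Poly_Mapping.keys g.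
      (if u = u0 then if v = v0 then Poly_Mapping.lookup f u * Poly_Mapping.lookup g v else 0 else 0))"
    unfolding laurent_times_expand lookup_sum using assms
    by (intro sum.cong) (auto simp: lookup_single when_def)
  also have "\<dots> = (\<Sum>u\<in>Poly_Mapping.keys f. if u = u0 then \<Sum>v\<in>Poly_Mapping.keys g.
      (if v = v0 then Poly_Mapping.lookup f u * Poly_Mapping.lookup g v else 0) else 0)"
    by (intro sum.cong) auto
  also have "\<dots> = Poly_Mapping.lookup f u0 * Poly_Mapping.lookup g v0"
    by (auto simp: sum.delta in_keys_iff)
  finally show ?thesis .
qed

lemma keys_mult_obtain:
  fixes f g :: "'a::comm_monoid_add \<Rightarrow>\<^sub>0 'b::comm_semiring_0"
  assumes "w \<in> Poly_Mapping.keys (f * g)"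
  obtains u v where "u \<in> Poly_Mapping.keys f" "v \<in> Poly_Mapping.keys g" "w = u + v"
  using keys_mult[of f g] assms by auto

section \<open>Monomial valuations of the function field\<close>

definition monomial_ord :: "real ^ 'n::finite \<Rightarrow> ('n, 'k::zero) laurent \<Rightarrow> real" where
  "monomial_ord y f = Min ((\<lambda>u. to_real u \<bullet> y) ` Poly_Mapping.keys f)"

lemma monomial_ord_le: "u \<in> Poly_Mapping.keys f \<Longrightarrow> monomial_ord y f \<le> to_real u \<bullet> y"
  unfolding monomial_ord_def by (intro Min_le) auto

lemma monomial_ord_obtain:
  assumes "f \<noteq> 0" obtains u where "u \<in> Poly_Mapping.keys f" "monomial_ord y f = to_real u \<bullet> y"
proof -
  have "Poly_Mapping.keys f \<noteq> {}" using assms by (auto simp: poly_mapping_eq_iff fun_eq_iff in_keys_iff)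
  then have "monomial_ord y f \<in> (\<lambda>u. to_real u \<bullet> y) ` Poly_Mapping.keys f"
    unfolding monomial_ord_def by (intro Min_in) auto
  then show ?thesis using that by auto
qed

lemma monomial_ord_geI: "f \<noteq> 0 \<Longrightarrow> (\<And>u. u \<in> Poly_Mapping.keys f \<Longrightarrow> c \<le> to_real u \<bullet> y) \<Longrightarrow> c \<le> monomial_ord y f"
  by (metis monomial_ord_obtain)

text \<open>One inequality is termwise. For the other, several exponents may attain the minimum; the
  linear order on the exponents singles out the least of them in \<open>f\<close> and in
  \<open>g\<close>, and the sum of these two arises in only one way.\<close>

lemma monomial_ord_mult:
  fixes f g :: "('n::{finite,linorder}, 'k::field) laurent"
  assumes "f \<noteq> 0" "g \<noteq> 0"
  shows "monomial_ord y (f * g) = monomial_ord y f + monomial_ord y g"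
proof (rule antisym)
  show "monomial_ord y f + monomial_ord y g \<le> monomial_ord y (f * g)"
  proof (rule monomial_ord_geI)
    show "f * g \<noteq> 0" using assms by simp
    fix w assume "w \<in> Poly_Mapping.keys (f * g)"
    then obtain u v where "u \<in> Poly_Mapping.keys f" "v \<in> Poly_Mapping.keys g" "w = u + v"
      by (rule keys_mult_obtain)
    then show "monomial_ord y f + monomial_ord y g \<le> to_real w \<bullet> y"
      using monomial_ord_le[of u f y] monomial_ord_le[of v g y] by (simp add: inner_add_left)
  qed
  have "\<exists>u. u \<in> Poly_Mapping.keys h \<and> monomial_ord y h = to_real u \<bullet> y \<and>
      (\<forall>u'\<in>Poly_Mapping.keys h. to_real u' \<bullet> y = to_real u \<bullet> y \<longrightarrow> u \<le> u')"
    if h: "h \<noteq> 0" for h :: "('n, 'k) laurent"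
  proof -
    define A where "A = {u \<in> Poly_Mapping.keys h. to_real u \<bullet> y = monomial_ord y h}"
    obtain u where "u \<in> Poly_Mapping.keys h" "monomial_ord y h = to_real u \<bullet> y"
      using monomial_ord_obtain[OF h] by blast
    then have "A \<noteq> {}" "finite A" by (auto simp: A_def)
    then have "Min A \<in> A" "\<forall>u'\<in>A. Min A \<le> u'" by auto
    then show ?thesis by (intro exI[of _ "Min A"]) (auto simp: A_def)
  qed
  note * = this
  obtain u0 where u0: "u0 \<in> Poly_Mapping.keys f" "monomial_ord y f = to_real u0 \<bullet> y"
    "\<And>u'. u' \<in> Poly_Mapping.keys f \<Longrightarrow> to_real u' \<bullet> y = to_real u0 \<bullet> y \<Longrightarrow> u0 \<le> u'"
    using *[OF assms(1)] by blast
  obtain v0 where v0: "v0 \<in> Poly_Mapping.keys g" "monomial_ord y g = to_real v0 \<bullet> y"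
    "\<And>u'. u' \<in> Poly_Mapping.keys g \<Longrightarrow> to_real u' \<bullet> y = to_real v0 \<bullet> y \<Longrightarrow> v0 \<le> u'"
    using *[OF assms(2)] by blast
  have "Poly_Mapping.lookup (f * g) (u0 + v0) = Poly_Mapping.lookup f u0 * Poly_Mapping.lookup g v0"
  proof (rule lookup_times_unique)
    fix u v assume uv: "u \<in> Poly_Mapping.keys f" "v \<in> Poly_Mapping.keys g" "u + v = u0 + v0"
    have "to_real u \<bullet> y + to_real v \<bullet> y = to_real u0 \<bullet> y + to_real v0 \<bullet> y"
      using arg_cong[OF uv(3), of "\<lambda>w. to_real w \<bullet> y"] by (simp add: inner_add_left)
    then have "to_real u \<bullet> y = to_real u0 \<bullet> y" "to_real v \<bullet> y = to_real v0 \<bullet> y"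
      using monomial_ord_le[OF uv(1), of y] monomial_ord_le[OF uv(2), of y] u0(2) v0(2) by linarith+
    then have "u0 \<le> u" "v0 \<le> v" using u0(3) v0(3) uv by auto
    then show "u = u0 \<and> v = v0" using uv(3)
      by (metis add.commute add_left_cancel add_left_mono add_right_mono antisym order_eq_refl)
  qed
  then have "u0 + v0 \<in> Poly_Mapping.keys (f * g)" using u0(1) v0(1) by (simp add: in_keys_iff)
  from monomial_ord_le[OF this, of y] show "monomial_ord y (f * g) \<le> monomial_ord y f + monomial_ord y g"
    using u0(2) v0(2) by (simp add: inner_add_left)
qed

lemma monomial_ord_add:
  fixes f g :: "('n::finite, 'k::field) laurent"
  assumes "f + g \<noteq> 0" "c \<le> monomial_ord y f" "c \<le> monomial_ord y g"
  shows "c \<le> monomial_ord y (f + g)"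
proof (rule monomial_ord_geI[OF assms(1)])
  fix u assume "u \<in> Poly_Mapping.keys (f + g)"
  then have "u \<in> Poly_Mapping.keys f \<or> u \<in> Poly_Mapping.keys g" using keys_add[of f g] by blast
  then show "c \<le> to_real u \<bullet> y"
    using monomial_ord_le[of u f y] monomial_ord_le[of u g y] assms by linarith
qed

lemma monomial_ord_single [simp]: "c \<noteq> 0 \<Longrightarrow> monomial_ord y (Poly_Mapping.single u c) = to_real u \<bullet> y"
  by (simp add: monomial_ord_def)

text \<open>Junk at \<open>0\<close>, where the valuation would be infinite.\<close>

definition monomial_val :: "real ^ 'n::{finite,linorder} \<Rightarrow> ('n, 'k::field) function_field \<Rightarrow> real" where
  "monomial_val y z = (SOME r. \<exists>a b. a \<noteq> 0 \<and> b \<noteq> 0 \<and> z = Fract a b \<and> r = monomial_ord y a - monomial_ord y b)"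

lemma monomial_val_Fract:
  fixes a b :: "('n::{finite,linorder}, 'k::field) laurent"
  assumes "a \<noteq> 0" "b \<noteq> 0"
  shows "monomial_val y (Fract a b) = monomial_ord y a - monomial_ord y b"
  unfolding monomial_val_def
proof (rule some_equality)
  fix r assume "\<exists>a' b'. a' \<noteq> 0 \<and> b' \<noteq> 0 \<and> Fract a b = Fract a' b' \<and> r = monomial_ord y a' - monomial_ord y b'"
  then obtain a' b' where *: "a' \<noteq> 0" "b' \<noteq> 0" "Fract a b = Fract a' b'" "r = monomial_ord y a' - monomial_ord y b'" by blast
  then have "monomial_ord y (a * b') = monomial_ord y (a' * b)" using assms by (simp add: eq_fract)
  then show "r = monomial_ord y a - monomial_ord y b"
    using * assms by (simp add: monomial_ord_mult)
qed (use assms in auto)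

lemma Fract_nonzero: "z \<noteq> 0 \<Longrightarrow> \<exists>a b. a \<noteq> 0 \<and> b \<noteq> 0 \<and> z = Fract a b"
  by (cases z rule: Fract_cases_nonzero) auto

lemma monomial_val_mult:
  "z \<noteq> 0 \<Longrightarrow> w \<noteq> 0 \<Longrightarrow> monomial_val y (z * w) = monomial_val y z + monomial_val y w"
  using Fract_nonzero[of z] Fract_nonzero[of w]
  by (auto simp: monomial_val_Fract monomial_ord_mult)

lemma monomial_val_add:
  assumes "z \<noteq> 0" "w \<noteq> 0" "z + w \<noteq> 0" "c \<le> monomial_val y z" "c \<le> monomial_val y w"
  shows "c \<le> monomial_val y (z + w)"
proof -
  obtain a b a' b' where *: "a \<noteq> 0" "b \<noteq> 0" "z = Fract a b" "a' \<noteq> 0" "b' \<noteq> 0" "w = Fract a' b'"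
    using Fract_nonzero assms by metis
  have nz: "a * b' + a' * b \<noteq> 0"
    using assms(3) * by (metis add_fract fract_collapse(1))
  have "c + monomial_ord y b + monomial_ord y b' \<le> monomial_ord y (a * b' + a' * b)"
    by (rule monomial_ord_add[OF nz]) (use * assms in \<open>auto simp: monomial_val_Fract monomial_ord_mult\<close>)
  then show ?thesis using * nz by (simp add: monomial_val_Fract monomial_ord_mult)
qed

lemma monomial_val_1 [simp]: "monomial_val y 1 = 0"
  by (simp add: One_fract_def monomial_val_Fract)

lemma monomial_val_divide:
  assumes "z \<noteq> 0" "w \<noteq> 0" shows "monomial_val y (z / w) = monomial_val y z - monomial_val y w"
  using monomial_val_mult[of "z / w" w y] assms by simp

definition valuation_ring :: "real ^ 'n::{finite,linorder} \<Rightarrow> ('n, 'k::field) function_field set" where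
  "valuation_ring y = {z. z = 0 \<or> 0 \<le> monomial_val y z}"

definition valuation_ideal :: "real ^ 'n::{finite,linorder} \<Rightarrow> ('n, 'k::field) function_field set" where
  "valuation_ideal y = {z. z = 0 \<or> 0 < monomial_val y z}"

lemma valuation_ring_closed:
  shows "z \<in> valuation_ring y \<Longrightarrow> w \<in> valuation_ring y \<Longrightarrow> z + w \<in> valuation_ring y"
    "z \<in> valuation_ring y \<Longrightarrow> w \<in> valuation_ring y \<Longrightarrow> z * w \<in> valuation_ring y"
    "z \<in> valuation_ideal y \<Longrightarrow> w \<in> valuation_ideal y \<Longrightarrow> z + w \<in> valuation_ideal y"
    "z \<in> valuation_ring y \<Longrightarrow> w \<in> valuation_ideal y \<Longrightarrow> z * w \<in> valuation_ideal y"
    "z \<in> valuation_ring y \<Longrightarrow> w \<in> valuation_ring y - valuation_ideal y \<Longrightarrow> z / w \<in> valuation_ring y"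
proof -
  show "z \<in> valuation_ring y \<Longrightarrow> w \<in> valuation_ring y \<Longrightarrow> z + w \<in> valuation_ring y"
    using monomial_val_add[of z w 0 y] by (cases "z = 0 \<or> w = 0 \<or> z + w = 0") (auto simp: valuation_ring_def)
  show "z \<in> valuation_ideal y \<Longrightarrow> w \<in> valuation_ideal y \<Longrightarrow> z + w \<in> valuation_ideal y"
    using monomial_val_add[of z w "min (monomial_val y z) (monomial_val y w)" y]
    by (cases "z = 0 \<or> w = 0 \<or> z + w = 0") (auto simp: valuation_ideal_def)
  show "z \<in> valuation_ring y \<Longrightarrow> w \<in> valuation_ring y \<Longrightarrow> z * w \<in> valuation_ring y"
    "z \<in> valuation_ring y \<Longrightarrow> w \<in> valuation_ideal y \<Longrightarrow> z * w \<in> valuation_ideal y"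
    using monomial_val_mult[of z w y]
    by (cases "z = 0 \<or> w = 0"; force simp: valuation_ring_def valuation_ideal_def)+
  show "z \<in> valuation_ring y \<Longrightarrow> w \<in> valuation_ring y - valuation_ideal y \<Longrightarrow> z / w \<in> valuation_ring y"
    using monomial_val_divide[of z w y]
    by (cases "z = 0 \<or> w = 0"; force simp: valuation_ring_def valuation_ideal_def)
qed

section \<open>Semigroup algebras, evaluation at points, and the torus\<close>

lemma semigroup_algebra_iff: "f \<in> semigroup_algebra Q \<longleftrightarrow> (\<forall>u\<in>Poly_Mapping.keys f. to_real u \<in> Q)"
  by (auto simp: semigroup_algebra_def lattice_points_def)

lemma subring_set_semigroup_algebra:
  assumes "convex_cone Q"
  shows "subring_set (semigroup_algebra Q :: ('n::finite, 'k::field) laurent set)"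
  unfolding subring_set_def
proof (intro conjI ballI)
  show "1 \<in> (semigroup_algebra Q :: ('n, 'k) laurent set)"
    using convex_cone_contains_0[OF assms] by (simp add: semigroup_algebra_iff)
  fix f g :: "('n, 'k) laurent" assume fg: "f \<in> semigroup_algebra Q" "g \<in> semigroup_algebra Q"
  show "f - g \<in> semigroup_algebra Q"
    using fg keys_add[of f "- g"] by (auto simp: semigroup_algebra_iff in_keys_iff)
  show "f * g \<in> semigroup_algebra Q"
    unfolding semigroup_algebra_iff
  proof
    fix w assume "w \<in> Poly_Mapping.keys (f * g)"
    then obtain u v where "u \<in> Poly_Mapping.keys f" "v \<in> Poly_Mapping.keys g" "w = u + v"
      by (rule keys_mult_obtain)
    then show "to_real w \<in> Q" using fg by (auto simp: semigroup_algebra_iff intro: convex_cone_add[OF assms])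
  qed
qed

lemma single_in_semigroup_algebra: "to_real u \<in> Q \<Longrightarrow> Poly_Mapping.single u c \<in> semigroup_algebra Q"
  by (auto simp: semigroup_algebra_iff)

lemma eval_at_superset:
  assumes "finite K" "Poly_Mapping.keys f \<subseteq> K"
  shows "eval_at x f = (\<Sum>u\<in>K. Poly_Mapping.lookup f u * x u)"
  unfolding eval_at_def by (rule sum.mono_neutral_left) (use assms in \<open>auto simp: in_keys_iff\<close>)

lemma eval_at_add: "eval_at x (f + g) = eval_at x f + eval_at x g"
proof -
  have "finite (Poly_Mapping.keys f \<union> Poly_Mapping.keys g)" by simp
  then show ?thesis using keys_add[of f g]
    by (simp add: eval_at_superset[of "Poly_Mapping.keys f \<union> Poly_Mapping.keys g"]
        lookup_add distrib_right sum.distrib)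
qed

lemma eval_at_0 [simp]: "eval_at x 0 = 0" by (simp add: eval_at_def)

lemma eval_at_sum: "eval_at x (sum f A) = (\<Sum>i\<in>A. eval_at x (f i))"
  by (induction A rule: infinite_finite_induct) (auto simp: eval_at_add)

lemma eval_at_single: "eval_at x (Poly_Mapping.single u c) = c * x u"
  by (simp add: eval_at_def)

lemma eval_at_minus: "eval_at x (- f) = - eval_at x f"
  by (simp add: eval_at_def sum_negf)

lemma eval_at_diff: "eval_at x (f - g) = eval_at x f - eval_at x g"
  using eval_at_add[of x f "- g"] by (simp add: eval_at_minus)

lemma eval_at_times:
  assumes "\<And>u v. u \<in> Poly_Mapping.keys f \<Longrightarrow> v \<in> Poly_Mapping.keys g \<Longrightarrow> x (u + v) = x u * x v"
  shows "eval_at x (f * g) = eval_at x f * eval_at x g"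
proof -
  have "eval_at x (f * g) = (\<Sum>u\<in>Poly_Mapping.keys f. \<Sum>v\<in>Poly_Mapping.keys g.
      (Poly_Mapping.lookup f u * x u) * (Poly_Mapping.lookup g v * x v))"
    unfolding laurent_times_expand eval_at_sum eval_at_single
    by (intro sum.cong refl) (simp add: assms)
  also have "\<dots> = eval_at x f * eval_at x g"
    unfolding eval_at_def by (simp add: sum_product)
  finally show ?thesis .
qed

lemma affine_pointsD:
  assumes "x \<in> affine_points \<sigma>"
  shows "x 0 = 1" "to_real u \<in> dual_cone \<sigma> \<Longrightarrow> to_real v \<in> dual_cone \<sigma> \<Longrightarrow> x (u + v) = x u * x v"
    "x \<in> extensional (lattice_points (dual_cone \<sigma>))"
  using assms by (auto simp: affine_points_def lattice_points_def)

lemma eval_at_1: "x \<in> affine_points \<sigma> \<Longrightarrow> eval_at x 1 = 1"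
  using eval_at_single[of x 0 1] by (simp add: affine_pointsD)

lemma eval_at_mult:
  assumes "x \<in> affine_points \<sigma>" "f \<in> semigroup_algebra (dual_cone \<sigma>)" "g \<in> semigroup_algebra (dual_cone \<sigma>)"
  shows "eval_at x (f * g) = eval_at x f * eval_at x g"
  by (rule eval_at_times) (use assms in \<open>auto simp: semigroup_algebra_iff intro!: affine_pointsD(2)\<close>)

lemma convex_cone_dual_cone: "convex_cone (dual_cone \<sigma>)"
  by (auto simp: convex_cone_iff dual_cone_def inner_add_left)

lemma dual_cone_0 [simp]: "dual_cone {0} = UNIV"
  by (auto simp: dual_cone_def)

lemma laurent_subring_UNIV:
  fixes S :: "('n::finite, 'k::field) laurent set"
  assumes S: "subring_set S" and c: "\<And>a. Poly_Mapping.single 0 a \<in> S"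
    and g: "\<And>i. Poly_Mapping.single (Poly_Mapping.single i 1) 1 \<in> S"
      "\<And>i. Poly_Mapping.single (Poly_Mapping.single i (- 1)) 1 \<in> S"
  shows "S = UNIV"
proof -
  note SD = subring_setD[OF S]
  have add: "Poly_Mapping.single (u + v) 1 \<in> S"
    if "Poly_Mapping.single u 1 \<in> S" "Poly_Mapping.single v 1 \<in> S" for u v :: "'n lattice"
    using SD(4)[OF that] by (simp add: mult_single)
  have ax: "Poly_Mapping.single (Poly_Mapping.single i k) 1 \<in> S" for i and k :: int
  proof (induction k rule: int_induct[where k = 0])
    case base
    then show ?case using c[of 1] by simp
  next
    case (step1 j)
    have e: "Poly_Mapping.single i (j + 1) = Poly_Mapping.single i j + Poly_Mapping.single i 1"
      by (rule single_add)
    show ?case unfolding e by (rule add[OF step1(2) g(1)])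
  next
    case (step2 j)
    have e: "Poly_Mapping.single i (j - 1) = Poly_Mapping.single i j + Poly_Mapping.single i (- 1)"
      by (simp flip: single_add)
    show ?case unfolding e by (rule add[OF step2(2) g(2)])
  qed
  have sm: "Poly_Mapping.single (sum h A) 1 \<in> S"
    if "\<And>i. i \<in> A \<Longrightarrow> Poly_Mapping.single (h i) 1 \<in> S" for h :: "'n \<Rightarrow> 'n lattice" and A
    using that
  proof (induction A rule: infinite_finite_induct)
    case (insert i A)
    then show ?case using add by auto
  qed (use c[of 1] in auto)
  have mon: "Poly_Mapping.single u a \<in> S" for u a
  proof -
    have "Poly_Mapping.single u 1 \<in> S"
      by (subst laurent_expand[of u]) (intro sm ax)
    from SD(4)[OF c[of a] this] show ?thesis by (simp add: mult_single)
  qed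
  have "f \<in> S" for f
    by (subst laurent_expand[of f]) (intro subring_set_sum[OF S] mon)
  then show ?thesis by auto
qed

text \<open>The quotient by a maximal ideal containing \<open>I\<close> maps to the ground field.
  The images of the monomials form a homomorphism on the whole lattice, which is a point of the
  torus because \<open>dual_cone {0}\<close> is everything.\<close>

theorem laurent_nullstellensatz:
  fixes I :: "('n::{finite,linorder}, 'k::alg_closed_field) laurent set"
  assumes I: "ideal_in UNIV I" "1 \<notin> I"
  obtains x where "x \<in> affine_points {0}" "\<And>f. f \<in> I \<Longrightarrow> eval_at x f = 0"
proof -
  obtain m where m: "maximal_ideal_in UNIV m" "I \<subseteq> m" "1 \<notin> m"
    using maximal_ideal_exists[OF UNIV_I I] by blast
  have pm: "prime_ideal_set m" by (rule maximal_ideal_UNIV_prime[OF m(1,3)])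
  define c :: "'k \<Rightarrow> ('n, 'k) laurent" where "c = Poly_Mapping.single 0"
  have cs: "c (a + b) = c a + c b" "c (a * b) = c a * c b" "c 1 = 1" "c (a - b) = c a - c b" for a b
    by (auto simp: c_def single_add mult_single single_diff)
  have Sc: "subring_set (range c)"
    unfolding subring_set_def using cs(2,3,4) by (metis (no_types, lifting) rangeE rangeI)
  obtain js where "set js = (UNIV :: 'n set)" using finite_list[of "UNIV :: 'n set"] by auto
  \<comment> \<open>Laurent polynomials are generated by the coordinates together with their
    inverses, hence both signs.\<close>
  define ys :: "('n, 'k) laurent list" where
    "ys = map (\<lambda>i. Poly_Mapping.single (Poly_Mapping.single i 1) 1) js @
          map (\<lambda>i. Poly_Mapping.single (Poly_Mapping.single i (-1)) 1) js"
  have U: "adjoin_list (range c) ys = UNIV"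
  proof (rule laurent_subring_UNIV)
    show "subring_set (adjoin_list (range c) ys)" by (rule subring_set_adjoin_list[OF Sc])
    show "Poly_Mapping.single 0 a \<in> adjoin_list (range c) ys" for a
      using adjoin_list_superset[OF Sc, of ys] by (auto simp: c_def)
    have "set ys \<subseteq> adjoin_list (range c) ys" by (rule adjoin_list_gen[OF Sc])
    then show "Poly_Mapping.single (Poly_Mapping.single i 1) 1 \<in> adjoin_list (range c) ys"
      "Poly_Mapping.single (Poly_Mapping.single i (- 1)) 1 \<in> adjoin_list (range c) ys" for i
      using \<open>set js = UNIV\<close> by (auto simp: ys_def)
  qed
  have "inj c" unfolding c_def by simp
  from residue_hom_adjoin_list[OF Sc pm cs(3) cs(1,2) this, of 1 ys] m(3) U obtain \<phi> where
    \<phi>: "residue_hom UNIV m c \<phi>" by auto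
  define x where "x u = \<phi> (Poly_Mapping.single u 1)" for u
  have SU: "subring_set (UNIV :: ('n, 'k) laurent set)" by (simp add: subring_set_def)
  have ev: "eval_at x f = \<phi> f" for f
  proof -
    have "\<phi> f = (\<Sum>u\<in>Poly_Mapping.keys f. \<phi> (c (Poly_Mapping.lookup f u) * Poly_Mapping.single u 1))"
      by (subst laurent_expand[of f], subst residue_hom_sum[OF \<phi> SU]) (auto simp: c_def mult_single)
    also have "\<dots> = eval_at x f"
      unfolding eval_at_def x_def using residue_homD(2,3)[OF \<phi>] by simp
    finally show ?thesis ..
  qed
  have "\<phi> 1 = 1" using residue_homD(3)[OF \<phi>, of 1] cs(3) by simp
  then have "x \<in> affine_points {0}"
    using residue_homD(2)[OF \<phi>, of "Poly_Mapping.single u 1" "Poly_Mapping.single v 1" for u v]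
    by (auto simp: affine_points_def lattice_points_def extensional_def x_def mult_single single_one)
  moreover have "eval_at x f = 0" if "f \<in> I" for f
    using residue_homD(4)[OF \<phi>, of f] that m(2) ev by auto
  ultimately show ?thesis using that by blast
qed

text \<open>The denominators of \<open>s\<close> form an ideal. Regularity at a point of the torus
  supplies a denominator nonzero there, so the ideal has no zero on the torus and contains
  1.\<close>

corollary regular_on_torus_laurent:
  fixes s :: "('n::{finite,linorder}, 'k::alg_closed_field) function_field"
  assumes "\<And>x :: 'n lattice \<Rightarrow> 'k. x \<in> affine_points {0} \<Longrightarrow> \<exists>a b. s = Fract a b \<and> eval_at x b \<noteq> 0"
  obtains f where "s = Fract f 1"
proof -
  define I where "I = {h. \<exists>f. Fract h 1 * s = Fract f 1}"
  have "ideal_in UNIV I"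
    unfolding ideal_in_def
  proof (intro conjI ballI)
    show "0 \<in> I" unfolding I_def by (auto simp: fract_collapse intro!: exI[of _ 0])
    show "a + b \<in> I" if ab: "a \<in> I" "b \<in> I" for a b
    proof -
      obtain f g where "Fract a 1 * s = Fract f 1" "Fract b 1 * s = Fract g 1" using ab by (auto simp: I_def)
      then have "(Fract a 1 + Fract b 1) * s = Fract f 1 + Fract g 1" by (simp only: distrib_right)
      then show ?thesis by (auto simp: I_def)
    qed
    show "r * a \<in> I" if a: "a \<in> I" for r a
    proof -
      obtain f where "Fract a 1 * s = Fract f 1" using a by (auto simp: I_def)
      then have "Fract r 1 * Fract a 1 * s = Fract r 1 * Fract f 1" by (simp only: mult.assoc)
      then show ?thesis by (auto simp: I_def)
    qed
  qed auto
  moreover have "\<not> (\<forall>f\<in>I. eval_at x f = 0)" if x: "x \<in> affine_points {0}" for x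
  proof -
    obtain a b where ab: "s = Fract a b" "eval_at x b \<noteq> 0" using assms[OF x] by blast
    then have "b \<noteq> 0" by auto
    then have "Fract b 1 * s = Fract a 1" using ab by (simp add: eq_fract mult.commute)
    then have "b \<in> I" by (auto simp: I_def)
    then show ?thesis using ab by blast
  qed
  ultimately have "1 \<in> I" using laurent_nullstellensatz by metis
  then show ?thesis using that by (auto simp: I_def simp flip: One_fract_def)
qed

subsection \<open>Lattices and rational cones\<close>

lemma finite_lattice_bounded:
  assumes "bounded S" shows "finite {u :: 'n::finite lattice. to_real u \<in> S}"
proof -
  obtain B where B: "\<And>x. x \<in> S \<Longrightarrow> norm x \<le> B" using assms by (auto simp: bounded_iff)
  define m where "m = \<lceil>B\<rceil>"
  have "Poly_Mapping.lookup ` {u :: 'n lattice. to_real u \<in> S} \<subseteq> PiE UNIV (\<lambda>_. {- m..m})"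
  proof (intro image_subsetI PiE_I)
    fix u :: "'n lattice" and i assume "u \<in> {u. to_real u \<in> S}"
    then have "\<bar>to_real u $ i\<bar> \<le> B" using B component_le_norm_cart[of "to_real u" i] by fastforce
    then have "\<bar>real_of_int (Poly_Mapping.lookup u i)\<bar> \<le> B" by (simp add: to_real_def)
    then show "Poly_Mapping.lookup u i \<in> {- m..m}" unfolding m_def by (simp add: abs_le_iff) linarith
  qed auto
  then have "finite (Poly_Mapping.lookup ` {u :: 'n lattice. to_real u \<in> S})"
    by (rule finite_subset) (rule finite_PiE, simp_all)
  then show ?thesis by (rule finite_imageD) (simp add: inj_on_def)
qed

text \<open>
  By simultaneous Diophantine approximation \<open>q u\<close> is so close to a lattice vector \<open>m\<close> that \<open>\<langle>m, h\<rangle>\<close>,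
  being an integer, vanishes whenever \<open>\<langle>u, h\<rangle>\<close> does.
\<close>

lemma lattice_sgn_approx:
  fixes u :: "real ^ 'n::finite" and H :: "'n lattice set"
  assumes H: "finite H"
  obtains m :: "'n lattice" where "\<And>h. h \<in> H \<Longrightarrow> sgn (to_real m \<bullet> to_real h) = sgn (u \<bullet> to_real h)"
proof -
  obtain f :: "'n \<Rightarrow> nat" where f: "bij_betw f UNIV {..<CARD('n)}"
    using ex_bij_betw_finite_nat[of "UNIV :: 'n set"] by (auto simp: atLeast0LessThan)
  define g where "g = inv f"
  have gf: "g (f i) = i" and fb: "f i < CARD('n)" for i
    using f unfolding g_def by (auto simp: bij_betw_def)
  define C where "C h = (\<Sum>i\<in>UNIV. \<bar>to_real h $ i\<bar>)" for h :: "'n lattice"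
  \<comment> \<open>The tolerance. If the pairing vanishes, an integer of absolute value below 1 is
    0; otherwise an error below the absolute value of the pairing keeps the sign, the more so after
    multiplication of \<open>u\<close> by q \<ge> 1.\<close>
  define \<delta> where "\<delta> h = (if u \<bullet> to_real h = 0 then 1 else \<bar>u \<bullet> to_real h\<bar>)" for h
  define N where "N = nat \<lceil>\<Sum>h\<in>H. C h / \<delta> h\<rceil> + 1"
  have C0: "0 \<le> C h" and d0: "0 < \<delta> h" for h by (auto simp: C_def \<delta>_def sum_nonneg)
  have CN: "C h / real N < \<delta> h" if h: "h \<in> H" for h
  proof -
    have "C h / \<delta> h \<le> (\<Sum>h\<in>H. C h / \<delta> h)"
      using C0 d0 by (intro member_le_sum[OF h _ H]) (simp add: less_imp_le)
    also have "\<dots> < real N" unfolding N_def by linarith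
    finally show ?thesis using d0[of h] by (simp add: divide_simps mult.commute split: if_splits)
  qed
  have "N > 0" by (simp add: N_def)
  from Dirichlet_approx_simult[OF this, of "CARD('n)" "\<lambda>j. u $ g j"] obtain q p where
    q: "0 < q" and p: "\<And>j. j < CARD('n) \<Longrightarrow> \<bar>of_int q * (u $ g j) - of_int (p j)\<bar> < 1 / N"
    by metis
  define m :: "'n lattice" where "m = Abs_poly_mapping (\<lambda>i. p (f i))"
  have m: "to_real m $ i = of_int (p (f i))" for i
    unfolding m_def to_real_def by (simp add: Abs_poly_mapping_inverse)
  show ?thesis
  proof (rule that)
    fix h assume h: "h \<in> H"
    have "\<bar>of_int q * (u \<bullet> to_real h) - to_real m \<bullet> to_real h\<bar>
        = \<bar>\<Sum>i\<in>UNIV. (of_int q * (u $ i) - to_real m $ i) * to_real h $ i\<bar>"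
      by (simp add: inner_vec_def sum_distrib_left sum_subtractf algebra_simps)
    also have "\<dots> \<le> (\<Sum>i\<in>UNIV. 1 / N * \<bar>to_real h $ i\<bar>)"
    proof (rule order.trans[OF sum_abs], rule sum_mono)
      fix i
      show "\<bar>(of_int q * (u $ i) - to_real m $ i) * to_real h $ i\<bar> \<le> 1 / N * \<bar>to_real h $ i\<bar>"
        using p[OF fb[of i]] unfolding abs_mult m gf by (intro mult_right_mono) auto
    qed
    also have "\<dots> = C h / N" by (simp add: C_def sum_divide_distrib)
    also have "\<dots> < \<delta> h" by (rule CN[OF h])
    finally have lt: "\<bar>of_int q * (u \<bullet> to_real h) - to_real m \<bullet> to_real h\<bar> < \<delta> h" .
    show "sgn (to_real m \<bullet> to_real h) = sgn (u \<bullet> to_real h)"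
    proof (cases "u \<bullet> to_real h = 0")
      case True
      then show ?thesis using lt by (simp add: \<delta>_def inner_to_real flip: of_int_abs)
    next
      case False
      have q1: "1 * \<bar>u \<bullet> to_real h\<bar> \<le> of_int q * \<bar>u \<bullet> to_real h\<bar>" using q by (intro mult_right_mono) auto
      have "\<bar>of_int q * (u \<bullet> to_real h) - to_real m \<bullet> to_real h\<bar> < \<bar>of_int q * (u \<bullet> to_real h)\<bar>"
      proof -
        have "\<bar>of_int q * (u \<bullet> to_real h) - to_real m \<bullet> to_real h\<bar> < \<bar>u \<bullet> to_real h\<bar>"
          using lt False by (simp add: \<delta>_def)
        moreover have "\<bar>of_int q * (u \<bullet> to_real h)\<bar> = of_int q * \<bar>u \<bullet> to_real h\<bar>"
          using q by (simp add: abs_mult)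
        ultimately show ?thesis using q1 by linarith
      qed
      then have "sgn (to_real m \<bullet> to_real h) = sgn (of_int q * (u \<bullet> to_real h))"
        by (auto simp: sgn_if abs_if split: if_splits)
      then show ?thesis using q by (simp add: sgn_mult)
    qed
  qed
qed

text \<open>Among all \<open>w\<close> of which \<open>u\<close> is a positive multiple, one with
  the least sum of absolute coordinates is primitive, because a proper division would lower that
  sum.\<close>

lemma primitive_decompose:
  fixes u :: "'n::finite lattice"
  assumes "u \<noteq> 0"
  obtains w d where "primitive w" "1 \<le> d" "u = frag_cmul d w"
proof -
  define s where "s w = nat (\<Sum>i\<in>UNIV. \<bar>Poly_Mapping.lookup w i\<bar>)" for w :: "'n lattice"
  define P where "P w \<longleftrightarrow> (\<exists>d\<ge>1. u = frag_cmul d w)" for w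
  have "P u" by (auto simp: P_def intro: exI[of _ 1])
  define w where "w = (ARG_MIN s w. P w)"
  have w: "P w" and mn: "\<And>v. P v \<Longrightarrow> s w \<le> s v"
    using arg_min_natI[of P u s] arg_min_nat_le[of P _ s] \<open>P u\<close> unfolding w_def by blast+
  obtain d where d: "1 \<le> d" "u = frag_cmul d w" using w by (auto simp: P_def)
  have "primitive w"
    unfolding primitive_def
  proof (intro conjI allI impI)
    show w0: "w \<noteq> 0" using d assms by auto
    fix v m assume *: "0 < (m::int) \<and> to_real w = of_int m *\<^sub>R to_real v"
    then have wv: "w = frag_cmul m v" using to_real_eq_iff[of w "frag_cmul m v"] by simp
    have "P v" unfolding P_def using d wv * by (intro exI[of _ "d * m"]) (auto simp: int_one_le_iff_zero_less)
    then have le: "s w \<le> s v" by (rule mn)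
    have "int (s w) = m * int (s v)"
      using * unfolding s_def wv by (simp add: abs_mult sum_distrib_left sum_nonneg)
    moreover have "s v > 0"
    proof -
      obtain i where "Poly_Mapping.lookup v i \<noteq> 0" using w0 wv by (auto simp: poly_mapping_eq_iff fun_eq_iff)
      then have "0 < (\<Sum>i\<in>UNIV. \<bar>Poly_Mapping.lookup v i\<bar>)" by (intro sum_pos2[of _ i]) auto
      then show ?thesis by (simp add: s_def)
    qed
    ultimately have m1: "m * int (s v) \<le> 1 * int (s v)" "0 < int (s v)" using le by linarith+
    have "m \<le> 1" by (rule mult_right_le_imp_le[OF m1])
    then have "m = 1" using * by simp
    then show "v = w" using wv by simp
  qed
  then show ?thesis using that d by blast
qed

text \<open>The factor \<open>r\<close> is given as a real number, but comparing a nonzero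
  coordinate makes it rational. In lowest terms its numerator divides \<open>v\<close> and its
  denominator divides \<open>w\<close>, so primitivity makes both 1.\<close>

lemma primitive_parallel:
  assumes "primitive v" "primitive w" "0 < r" "to_real v = r *\<^sub>R to_real w"
  shows "v = w" "r = 1"
proof -
  obtain i where i: "Poly_Mapping.lookup w i \<noteq> 0"
    using assms(2) by (auto simp: primitive_def poly_mapping_eq_iff fun_eq_iff)
  have vi: "real_of_int (Poly_Mapping.lookup v j) = r * real_of_int (Poly_Mapping.lookup w j)" for j
    using assms(4) by (simp add: to_real_def vec_eq_iff)
  have "r = real_of_int (Poly_Mapping.lookup v i) / real_of_int (Poly_Mapping.lookup w i)"
    using vi[of i] i by simp
  then have "r \<in> \<rat>" by simp
  then obtain p q :: nat where pq: "q \<noteq> 0" "\<bar>r\<bar> = real p / real q" "coprime p q"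
    by (rule Rats_abs_nat_div_natE)
  then have r: "r = real p / real q" "p > 0" using assms(3) by (auto intro: gr0I)
  have e: "int q * Poly_Mapping.lookup v j = int p * Poly_Mapping.lookup w j" for j
  proof -
    have "real q * real_of_int (Poly_Mapping.lookup v j) = real p * real_of_int (Poly_Mapping.lookup w j)"
      unfolding vi r using pq(1) by simp
    then have "real_of_int (int q * Poly_Mapping.lookup v j) = real_of_int (int p * Poly_Mapping.lookup w j)"
      by simp
    then show ?thesis by (simp only: of_int_eq_iff)
  qed
  have cop: "coprime (int p) (int q)" using pq(3) by simp
  have dv: "int p dvd Poly_Mapping.lookup v j" for j
    using e[of j] cop by (metis coprime_dvd_mult_right_iff dvd_triv_left)
  have dw: "int q dvd Poly_Mapping.lookup w j" for j
    using e[of j] cop by (metis coprime_commute coprime_dvd_mult_right_iff dvd_triv_left)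
  define v' where "v' = (Abs_poly_mapping (\<lambda>j. Poly_Mapping.lookup v j div int p) :: 'a lattice)"
  define w' where "w' = (Abs_poly_mapping (\<lambda>j. Poly_Mapping.lookup w j div int q) :: 'a lattice)"
  have lv': "Poly_Mapping.lookup v' j = Poly_Mapping.lookup v j div int p" for j
    unfolding v'_def by (simp add: Abs_poly_mapping_inverse)
  have lw': "Poly_Mapping.lookup w' j = Poly_Mapping.lookup w j div int q" for j
    unfolding w'_def by (simp add: Abs_poly_mapping_inverse)
  have v': "v = frag_cmul (int p) v'"
    by (rule poly_mapping_eqI) (simp add: lv' dv)
  have w': "w = frag_cmul (int q) w'"
    by (rule poly_mapping_eqI) (simp add: lw' dw)
  have "v' = v"
    using assms(1) v' r(2) arg_cong[OF v', of to_real] unfolding primitive_def by (metis of_nat_0_less_iff to_real_simps(5))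
  then have p1: "p = 1"
    using v' assms(1) unfolding primitive_def
    by (metis frag_cmul_one frag_cmul_diff_distrib diff_self frag_cmul_eq_0_iff eq_iff_diff_eq_0 of_nat_eq_1_iff)
  have "w' = w"
    using assms(2) w' pq(1) arg_cong[OF w', of to_real] unfolding primitive_def
    by (metis gr0I of_nat_0_less_iff to_real_simps(5))
  then have q1: "q = 1"
    using w' assms(2) unfolding primitive_def
    by (metis frag_cmul_one frag_cmul_diff_distrib diff_self frag_cmul_eq_0_iff eq_iff_diff_eq_0 of_nat_eq_1_iff)
  show "r = 1" using r p1 q1 by simp
  then show "v = w" using assms(4) by simp
qed

section \<open>Convex cones, dual cones and faces\<close>

lemma convex_cone_sum:
  assumes "convex_cone C" "\<And>i. i \<in> A \<Longrightarrow> f i \<in> C"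
  shows "sum f A \<in> C"
  using assms(2)
  by (induction A rule: infinite_finite_induct)
    (auto intro: convex_cone_add[OF assms(1)] convex_cone_contains_0[OF assms(1)])

lemma convex_cone_hull_finite_explicit:
  assumes "finite S"
  shows "convex_cone hull S = {\<Sum>s\<in>S. c s *\<^sub>R s | c. \<forall>s\<in>S. 0 \<le> c s}"
proof
  have "convex_cone {\<Sum>s\<in>S. c s *\<^sub>R s | c. \<forall>s\<in>S. 0 \<le> c s}"
    unfolding convex_cone_iff
  proof (intro conjI ballI allI impI)
    show "0 \<in> {\<Sum>s\<in>S. c s *\<^sub>R s | c. \<forall>s\<in>S. 0 \<le> c s}"
      by (auto intro!: exI[of _ "\<lambda>_. 0"])
    fix x assume x: "x \<in> {\<Sum>s\<in>S. c s *\<^sub>R s | c. \<forall>s\<in>S. 0 \<le> c s}"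
    then obtain a where a: "x = (\<Sum>s\<in>S. a s *\<^sub>R s)" "\<forall>s\<in>S. 0 \<le> a s" by auto
    { fix y assume "y \<in> {\<Sum>s\<in>S. c s *\<^sub>R s | c. \<forall>s\<in>S. 0 \<le> c s}"
      then obtain b where "y = (\<Sum>s\<in>S. b s *\<^sub>R s)" "\<forall>s\<in>S. 0 \<le> b s" by auto
      then show "x + y \<in> {\<Sum>s\<in>S. c s *\<^sub>R s | c. \<forall>s\<in>S. 0 \<le> c s}"
        using a by (auto intro!: exI[of _ "\<lambda>s. a s + b s"] simp: scaleR_left_distrib sum.distrib) }
    show "t *\<^sub>R x \<in> {\<Sum>s\<in>S. c s *\<^sub>R s | c. \<forall>s\<in>S. 0 \<le> c s}" if "0 \<le> t" for t
      using a that by (auto intro!: exI[of _ "\<lambda>s. t * a s"] simp: scaleR_sum_right)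
  qed
  moreover have "S \<subseteq> {\<Sum>s\<in>S. c s *\<^sub>R s | c. \<forall>s\<in>S. 0 \<le> c s}"
  proof
    fix t assume t: "t \<in> S"
    have "(\<Sum>s\<in>S. (if s = t then 1 else 0) *\<^sub>R s) = (\<Sum>s\<in>S. if s = t then s else 0)"
      by (intro sum.cong) auto
    then have "t = (\<Sum>s\<in>S. (if s = t then 1 else 0) *\<^sub>R s)" using t assms by simp
    then show "t \<in> {\<Sum>s\<in>S. c s *\<^sub>R s | c. \<forall>s\<in>S. 0 \<le> c s}"
      by (intro CollectI exI[of _ "\<lambda>s. if s = t then 1 else 0"]) auto
  qed
  ultimately show "convex_cone hull S \<subseteq> {\<Sum>s\<in>S. c s *\<^sub>R s | c. \<forall>s\<in>S. 0 \<le> c s}"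
    by (rule hull_minimal[rotated])
  show "{\<Sum>s\<in>S. c s *\<^sub>R s | c. \<forall>s\<in>S. 0 \<le> c s} \<subseteq> convex_cone hull S"
  proof clarify
    fix c :: "'a \<Rightarrow> real" assume "\<forall>s\<in>S. 0 \<le> c s"
    then show "(\<Sum>s\<in>S. c s *\<^sub>R s) \<in> convex_cone hull S"
      by (intro convex_cone_sum[OF convex_cone_convex_cone_hull] convex_cone_hull_mul hull_inc) auto
  qed
qed

lemma convex_cone_hull_finiteD:
  assumes "v \<in> convex_cone hull S" "finite S"
  shows "\<exists>c. v = (\<Sum>s\<in>S. c s *\<^sub>R s) \<and> (\<forall>s\<in>S. 0 \<le> c s)"
  using assms(1) unfolding convex_cone_hull_finite_explicit[OF assms(2)] by blast

lemma dual_cone_convex_cone_hull: "dual_cone (convex_cone hull S) = {u. \<forall>v\<in>S. 0 \<le> u \<bullet> v}"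
proof -
  have "convex_cone hull S \<subseteq> {v. 0 \<le> u \<bullet> v}" if "\<forall>v\<in>S. 0 \<le> u \<bullet> v" for u
    using that by (intro hull_minimal convex_cone_halfspace_ge) auto
  then show ?thesis by (auto simp: dual_cone_def intro: hull_inc)
qed

lemma dual_cone_separation:
  assumes C: "convex_cone C" "closed C" and z: "z \<notin> C"
  obtains u where "u \<in> dual_cone C" "u \<bullet> z < 0"
proof -
  have "convex C" using C by (simp add: convex_cone_def)
  from separating_hyperplane_closed_point[OF this C(2) z] obtain a b where
    ab: "a \<bullet> z < b" "\<And>x. x \<in> C \<Longrightarrow> b < a \<bullet> x" by blast
  have "b < 0" using ab(2)[OF convex_cone_contains_0[OF C(1)]] by simp
  have "0 \<le> a \<bullet> v" if v: "v \<in> C" for v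
  proof (rule ccontr)
    assume "\<not> 0 \<le> a \<bullet> v"
    then have n: "a \<bullet> v < 0" by simp
    \<comment> \<open>This multiple of \<open>v\<close> has pairing exactly \<open>b\<close>, while
      every point of the cone pairs strictly above \<open>b\<close>.\<close>
    have "(b / (a \<bullet> v)) *\<^sub>R v \<in> C" using n \<open>b < 0\<close>
      by (intro convex_cone_scaleR[OF C(1) _ v]) (simp add: divide_nonpos_neg)
    from ab(2)[OF this] n show False by simp
  qed
  then have "a \<in> dual_cone C" by (simp add: dual_cone_def)
  then show ?thesis using that ab(1) \<open>b < 0\<close> by (meson less_trans)
qed

lemma closed_dual_cone: "closed (dual_cone C)"
proof -
  have "dual_cone C = (\<Inter>v\<in>C. {u. v \<bullet> u \<ge> 0})" by (auto simp: dual_cone_def inner_commute)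
  then show ?thesis by (auto intro: closed_halfspace_ge)
qed

text \<open>x + y is the midpoint of 2x and 2y, which lie in the cone. For x = y the open segment is
  empty, and conicity of the face is used instead.\<close>

lemma face_of_cone_add:
  assumes C: "convex_cone C" and F: "F face_of C" and xy: "x \<in> C" "y \<in> C" "x + y \<in> F"
  shows "x \<in> F" "y \<in> F"
proof -
  have cF: "conic F" using face_of_conic F C by (auto simp: convex_cone_def)
  have 2: "2 *\<^sub>R x \<in> C" "2 *\<^sub>R y \<in> C" using xy convex_cone_scaleR[OF C] by auto
  have "x \<in> F \<and> y \<in> F"
  proof (cases "x = y")
    case True
    then have "(1/2) *\<^sub>R (x + y) = x" by (metis scaleR_half_double)
    then have "x \<in> F" using cF xy(3) conic_mul[of F "x + y" "1/2"] by auto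
    then show ?thesis using True by simp
  next
    case False
    have "x + y \<in> open_segment (2 *\<^sub>R x) (2 *\<^sub>R y)"
      using False by (auto simp: in_segment intro!: exI[of _ "1/2"])
    then have "2 *\<^sub>R x \<in> F" "2 *\<^sub>R y \<in> F" using F 2 xy(3) by (auto simp: face_of_def)
    then show ?thesis using cF conic_mul[of F "2 *\<^sub>R x" "1/2"] conic_mul[of F "2 *\<^sub>R y" "1/2"] by auto
  qed
  then show "x \<in> F" "y \<in> F" by auto
qed

lemma face_of_cone_conic:
  assumes "convex_cone C" "F face_of C" "F \<noteq> {}"
  shows "convex_cone F"
  using face_of_conic[of C F] face_of_imp_convex[OF assms(2)] assms by (auto simp: convex_cone_def)

lemma face_of_cone_sum:
  assumes C: "convex_cone C" and F: "F face_of C" and fin: "finite A" and f: "\<And>i. i \<in> A \<Longrightarrow> f i \<in> C"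
    and s: "sum f A \<in> F" and i: "i \<in> A"
  shows "f i \<in> F"
proof -
  have "sum f A = f i + sum f (A - {i})" using fin i by (rule sum.remove)
  then show ?thesis
    using face_of_cone_add(1)[OF C F f[OF i], of "sum f (A - {i})"] s f convex_cone_sum[OF C, of "A - {i}" f]
    by auto
qed

lemma cone_ray_of_face:
  fixes C :: "'a::euclidean_space set"
  assumes C: "convex_cone C" and \<xi>: "\<And>u. u \<in> C \<Longrightarrow> u \<noteq> 0 \<Longrightarrow> 0 < u \<bullet> \<xi>"
    and F: "F face_of C" "aff_dim F = 1"
  obtains b where "b \<in> F" "b \<noteq> 0" "F = {t *\<^sub>R b | t. 0 \<le> t}"
proof -
  have ne: "F \<noteq> {}" using F(2) by auto
  note cF = face_of_cone_conic[OF C F(1) ne]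
  have FC: "F \<subseteq> C" using F(1) by (rule face_of_imp_subset)
  have d: "dim F = 1"
    using aff_dim_zero[of F] F(2) hull_inc[OF convex_cone_contains_0[OF cF]] by simp
  then have "\<not> F \<subseteq> {0}" by (metis dim_subset dim_singleton dim_empty le_zero_eq one_neq_zero subset_singletonD)
  then obtain b where b: "b \<in> F" "b \<noteq> 0" by auto
  have "F \<subseteq> span {b}"
    using card_ge_dim_independent[of "{b}" F] b d by auto
  then have "x \<in> {t *\<^sub>R b | t. 0 \<le> t}" if x: "x \<in> F" for x
  proof -
    obtain t where t: "x = t *\<^sub>R b" using x \<open>F \<subseteq> span {b}\<close> by (auto simp: span_singleton)
    show ?thesis
    proof (cases "0 \<le> t")
      case False
      then have x0: "x \<noteq> 0" using t b by auto
      have "0 < x \<bullet> \<xi>" "0 < b \<bullet> \<xi>" using \<xi>[OF _ x0] \<xi>[OF _ b(2)] x b(1) FC by blast+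
      then show ?thesis using False t by (simp add: zero_less_mult_iff)
    qed (use t in auto)
  qed
  then have "F = {t *\<^sub>R b | t. 0 \<le> t}" using b convex_cone_scaleR[OF cF] by auto
  then show ?thesis using that b by blast
qed

text \<open>The slice of \<open>C\<close> at height 1 with respect to \<xi> is compact and convex,
  hence the hull of its extreme points by Krein-Milman, and the half-line through an extreme point
  is a one-dimensional face. The form for closed cones serves both a cone and its dual.\<close>

theorem cone_generated_by_rays:
  fixes C :: "'a::euclidean_space set"
  assumes C: "convex_cone C" "closed C" and \<xi>: "\<And>u. u \<in> C \<Longrightarrow> u \<noteq> 0 \<Longrightarrow> 0 < u \<bullet> \<xi>"
  shows "C \<subseteq> convex_cone hull (\<Union>{F. F face_of C \<and> aff_dim F = 1})" (is "_ \<subseteq> ?H")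
proof -
  define B where "B = C \<inter> {u. \<xi> \<bullet> u = 1}"
  \<comment> \<open>A positive lower bound \<open>c\<close> of \<xi> on the unit vectors of
    \<open>C\<close> bounds the norm on the slice by 1 / c.\<close>
  have "compact (C \<inter> sphere 0 1)" using C(2) by (simp add: closed_Int_compact)
  moreover have "continuous_on (C \<inter> sphere 0 1) (\<lambda>u. u \<bullet> \<xi>)" by (intro continuous_intros)
  ultimately obtain c where c: "0 < c" "\<And>u. u \<in> C \<inter> sphere 0 1 \<Longrightarrow> c \<le> u \<bullet> \<xi>"
  proof (cases "C \<inter> sphere 0 1 = {}")
    case False
    assume "compact (C \<inter> sphere 0 1)" "continuous_on (C \<inter> sphere 0 1) (\<lambda>u. u \<bullet> \<xi>)"
    from continuous_attains_inf[OF this(1) False this(2)] obtain x where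
      x: "x \<in> C \<inter> sphere 0 1" "\<And>y. y \<in> C \<inter> sphere 0 1 \<Longrightarrow> x \<bullet> \<xi> \<le> y \<bullet> \<xi>" by blast
    have "0 < x \<bullet> \<xi>" using x(1) by (intro \<xi>) auto
    assume h: "\<And>c. 0 < c \<Longrightarrow> (\<And>u. u \<in> C \<inter> sphere 0 1 \<Longrightarrow> c \<le> u \<bullet> \<xi>) \<Longrightarrow> thesis"
    show thesis by (rule h[OF \<open>0 < x \<bullet> \<xi>\<close>]) (use x(2) in blast)
  next
    case True
    assume h: "\<And>c. 0 < c \<Longrightarrow> (\<And>u. u \<in> C \<inter> sphere 0 1 \<Longrightarrow> c \<le> u \<bullet> \<xi>) \<Longrightarrow> thesis"
    show thesis by (rule h[of 1]) (use True in auto)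
  qed
  have "bounded B"
  proof (rule boundedI)
    fix u assume u: "u \<in> B"
    then have u0: "u \<noteq> 0" by (auto simp: B_def)
    then have "(1 / norm u) *\<^sub>R u \<in> C \<inter> sphere 0 1"
      using u convex_cone_scaleR[OF C(1), of "1 / norm u" u] by (auto simp: B_def)
    from c(2)[OF this] have "c \<le> (1 / norm u) * (u \<bullet> \<xi>)" by simp
    also have "\<dots> = 1 / norm u" using u by (simp add: B_def inner_commute)
    finally show "norm u \<le> 1 / c" using u0 c(1) by (simp add: field_simps)
  qed
  then have "compact B" unfolding B_def using C(2) closed_hyperplane[of \<xi> 1]
    by (simp add: compact_eq_bounded_closed closed_Int)
  moreover have "convex B" unfolding B_def using C(1)
    by (intro convex_Int convex_hyperplane) (auto simp: convex_cone_def)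
  ultimately have KM: "B = convex hull {x. x extreme_point_of B}" by (rule Krein_Milman_Minkowski)
  have ext: "b \<in> ?H" if b: "b extreme_point_of B" for b
  proof -
    have bB: "b \<in> C" "b \<bullet> \<xi> = 1" "b \<noteq> 0" using b by (auto simp: extreme_point_of_def B_def inner_commute)
    define F where "F = {t *\<^sub>R b | t. 0 \<le> t}"
    have "F face_of C"
      unfolding face_of_def
    proof (intro conjI ballI impI)
      show "F \<subseteq> C" unfolding F_def using bB convex_cone_scaleR[OF C(1)] by auto
      show "convex F"
      proof (rule convexI)
        fix x y :: 'a and s t :: real assume "x \<in> F" "y \<in> F" "0 \<le> s" "0 \<le> t" "s + t = 1"
        then show "s *\<^sub>R x + t *\<^sub>R y \<in> F"
          unfolding F_def by clarsimp (metis add_nonneg_nonneg mult_nonneg_nonneg scaleR_left_distrib)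
      qed
      fix x y z assume xy: "x \<in> C" "y \<in> C" and z: "z \<in> F" "z \<in> open_segment x y"
      obtain s where s: "0 < s" "s < 1" "z = (1 - s) *\<^sub>R x + s *\<^sub>R y" "x \<noteq> y"
        using z(2) by (auto simp: in_segment)
      obtain t where t: "z = t *\<^sub>R b" "0 \<le> t" using z(1) by (auto simp: F_def)
      have nn: "0 \<le> x \<bullet> \<xi>" "0 \<le> y \<bullet> \<xi>" using \<xi> xy by (metis inner_zero_left less_imp_le order_refl)+
      have teq: "t = (1 - s) * (x \<bullet> \<xi>) + s * (y \<bullet> \<xi>)"
        using arg_cong[OF s(3), of "\<lambda>v. v \<bullet> \<xi>"] t bB by (simp add: inner_add_left)
      have "x \<in> F \<and> y \<in> F"
      proof (cases "x = 0 \<or> y = 0")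
        case True
        then show ?thesis
        proof
          assume "x = 0"
          then have "s *\<^sub>R y = t *\<^sub>R b" using s t by simp
          then have "(1 / s) *\<^sub>R (s *\<^sub>R y) = (1 / s) *\<^sub>R (t *\<^sub>R b)" by simp
          then have "y = (t / s) *\<^sub>R b" using s by simp
          then show ?thesis using \<open>x = 0\<close> s t unfolding F_def by force
        next
          assume "y = 0"
          then have "(1 - s) *\<^sub>R x = t *\<^sub>R b" using s t by simp
          then have "(1 / (1 - s)) *\<^sub>R ((1 - s) *\<^sub>R x) = (1 / (1 - s)) *\<^sub>R (t *\<^sub>R b)" by simp
          then have "x = (t / (1 - s)) *\<^sub>R b" using s by simp
          then show ?thesis using \<open>y = 0\<close> s t unfolding F_def by force
        qed
      next
        case False
        then have p: "0 < x \<bullet> \<xi>" "0 < y \<bullet> \<xi>" using \<xi> xy by auto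
        define x' y' where "x' = (1 / (x \<bullet> \<xi>)) *\<^sub>R x" and "y' = (1 / (y \<bullet> \<xi>)) *\<^sub>R y"
        have xB: "x' \<in> B" "y' \<in> B"
          using xy p convex_cone_scaleR[OF C(1)] by (auto simp: x'_def y'_def B_def inner_commute)
        have tp: "0 < t" unfolding teq using p s by (simp add: add_pos_pos)
        \<comment> \<open>Rescaling \<open>x\<close> and \<open>y\<close> to height 1 turns the
          weight \<open>s\<close> of \<open>y\<close> into \<open>r\<close>; dividing by the height
          \<open>t\<close> of the point makes the two new weights add up to 1.\<close>
        define r where "r = s * (y \<bullet> \<xi>) / t"
        have "0 < (1 - s) * (x \<bullet> \<xi>)" "0 < s * (y \<bullet> \<xi>)" using p s by auto
        then have r: "0 < r" "r < 1" unfolding r_def using tp teq by auto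
        have r1: "1 - r = (1 - s) * (x \<bullet> \<xi>) / t" unfolding r_def using tp teq by (simp add: field_simps)
        have "(1 - r) *\<^sub>R x' + r *\<^sub>R y' = (1 / t) *\<^sub>R ((1 - s) *\<^sub>R x + s *\<^sub>R y)"
          unfolding r1 x'_def y'_def unfolding r_def using p by (simp add: scaleR_add_right)
        also have "\<dots> = (1 / t) *\<^sub>R (t *\<^sub>R b)" using s(3) t(1) by simp
        also have "\<dots> = b" using tp by simp
        finally have bxy: "b = (1 - r) *\<^sub>R x' + r *\<^sub>R y'" ..
        have "x' = y'"
        proof (rule ccontr)
          assume "x' \<noteq> y'"
          then have "b \<in> open_segment x' y'" using bxy r by (auto simp: in_segment)
          then show False using b xB by (auto simp: extreme_point_of_def)
        qed
        then have "x' = b" "y' = b" using bxy by (auto simp flip: scaleR_left_distrib)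
        moreover have "x = (x \<bullet> \<xi>) *\<^sub>R x'" "y = (y \<bullet> \<xi>) *\<^sub>R y'" using p by (simp_all add: x'_def y'_def)
        ultimately have "x = (x \<bullet> \<xi>) *\<^sub>R b" "y = (y \<bullet> \<xi>) *\<^sub>R b" by simp_all
        then show ?thesis using nn unfolding F_def by blast
      qed
      then show "x \<in> F" "y \<in> F" by auto
    qed
    moreover have "aff_dim F = 1"
    proof -
      have "0 \<in> F" "b \<in> F" unfolding F_def by (auto intro: exI[of _ 0] exI[of _ 1])
      have "F \<subseteq> span {b}" unfolding F_def by (auto simp: span_singleton)
      then have "dim F = 1"
        using dim_subset[of "{b}" F] \<open>b \<in> F\<close> bB(3) dim_subset[of F "span {b}"] by (simp add: dim_singleton)
      then show ?thesis using aff_dim_zero[of F] hull_inc[OF \<open>0 \<in> F\<close>] by simp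
    qed
    moreover have "b \<in> F" unfolding F_def by (auto intro: exI[of _ 1])
    ultimately show ?thesis by (intro hull_inc) auto
  qed
  have BH: "B \<subseteq> ?H"
    by (subst KM, rule hull_minimal) (use ext convex_convex_cone_hull in auto)
  show ?thesis
  proof
    fix u assume u: "u \<in> C"
    show "u \<in> ?H"
    proof (cases "u = 0")
      case False
      then have p: "0 < u \<bullet> \<xi>" using u \<xi> by blast
      then have "(1 / (u \<bullet> \<xi>)) *\<^sub>R u \<in> B"
        using u convex_cone_scaleR[OF C(1)] by (auto simp: B_def inner_commute)
      then have "(u \<bullet> \<xi>) *\<^sub>R ((1 / (u \<bullet> \<xi>)) *\<^sub>R u) \<in> ?H"
        by (rule convex_cone_hull_mul[OF subsetD[OF BH]]) (use p in simp)
      then show ?thesis using p by simp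
    qed (simp add: convex_cone_hull_contains_0)
  qed
qed

text \<open>Constraints that are strict at \<open>p\<close> survive a small move, tight ones survive
  because \<open>q\<close> points inwards; finiteness of \<open>A\<close> gives a common
  bound.\<close>

lemma small_perturbation:
  fixes p q :: "'a \<Rightarrow> real"
  assumes "finite A" "\<And>i. i \<in> A \<Longrightarrow> 0 \<le> p i \<and> (p i = 0 \<longrightarrow> 0 \<le> q i)"
  obtains \<epsilon> where "0 < \<epsilon>" "\<And>t i. 0 < t \<Longrightarrow> t \<le> \<epsilon> \<Longrightarrow> i \<in> A \<Longrightarrow> 0 \<le> p i + t * q i"
proof -
  have "\<exists>\<epsilon>>0. \<forall>t i. 0 < t \<longrightarrow> t \<le> \<epsilon> \<longrightarrow> i \<in> A \<longrightarrow> 0 \<le> p i + t * q i"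
    using assms
  proof (induction A rule: finite_induct)
    case empty
    then show ?case by (auto intro: exI[of _ 1])
  next
    case (insert a A)
    then obtain \<epsilon> where e: "0 < \<epsilon>" "\<forall>t i. 0 < t \<longrightarrow> t \<le> \<epsilon> \<longrightarrow> i \<in> A \<longrightarrow> 0 \<le> p i + t * q i" by auto
    have a: "0 \<le> p a" "p a = 0 \<Longrightarrow> 0 \<le> q a" using insert.prems by auto
    define \<delta> where "\<delta> = (if p a = 0 then 1 else p a / (1 + \<bar>q a\<bar>))"
    have d: "0 < \<delta>" using a by (auto simp: \<delta>_def)
    have "0 \<le> p a + t * q a" if t: "0 < t" "t \<le> \<delta>" for t
    proof (cases "p a = 0")
      case False
      have "t * \<bar>q a\<bar> \<le> t * (1 + \<bar>q a\<bar>)" using t by simp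
      also have "\<dots> \<le> \<delta> * (1 + \<bar>q a\<bar>)" using t by (intro mult_right_mono) auto
      also have "\<dots> = p a" using False by (simp add: \<delta>_def)
      finally have "\<bar>t * q a\<bar> \<le> p a" using t by (simp add: abs_mult)
      then show ?thesis by linarith
    qed (use a t in auto)
    then show ?case using e d by (intro exI[of _ "min \<epsilon> \<delta>"]) auto
  qed
  then show ?thesis using that by blast
qed

section \<open>Rational cones: positivity, rays and separation\<close>

lemma toric_coneE:
  assumes "toric_cone \<sigma>"
  obtains G :: "'n::finite lattice set" where "finite G" "\<sigma> = convex_cone hull (to_real ` G)"
  using assms unfolding toric_cone_def by blast

lemma toric_coneD:
  assumes "toric_cone \<sigma>"
  shows "convex_cone \<sigma>" "closed \<sigma>" "polyhedron \<sigma>" "0 \<in> \<sigma>" "\<And>v. v \<in> \<sigma> \<Longrightarrow> - v \<in> \<sigma> \<Longrightarrow> v = 0"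
proof -
  obtain G :: "'a lattice set" where G: "finite G" "\<sigma> = convex_cone hull (to_real ` G)"
    by (rule toric_coneE[OF assms])
  show "convex_cone \<sigma>" unfolding G by (rule convex_cone_convex_cone_hull)
  then show "0 \<in> \<sigma>" by (rule convex_cone_contains_0)
  show "closed \<sigma>" "polyhedron \<sigma>" unfolding G using G(1)
    by (auto intro: closed_convex_cone_hull polyhedron_convex_cone_hull)
  have "\<sigma> \<inter> uminus ` \<sigma> = {0}" using assms by (simp add: toric_cone_def)
  then show "v \<in> \<sigma> \<Longrightarrow> - v \<in> \<sigma> \<Longrightarrow> v = 0" for v by (metis IntI image_eqI minus_minus singletonD)
qed

text \<open>Strict convexity keeps 0 out of the convex hull of the nonzero generators: otherwise a
  positive multiple of some generator would have its negative in the cone. A hyperplane separating 0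
  from this compact hull gives \<xi>.\<close>

lemma toric_cone_positive:
  fixes \<sigma> :: "(real ^ 'n::finite) set"
  assumes "toric_cone \<sigma>"
  obtains \<xi> where "\<And>v. v \<in> \<sigma> \<Longrightarrow> v \<noteq> 0 \<Longrightarrow> 0 < v \<bullet> \<xi>"
proof -
  obtain G :: "'n lattice set" where G: "finite G" "\<sigma> = convex_cone hull (to_real ` G)"
    by (rule toric_coneE[OF assms])
  define S where "S = to_real ` G - {0}"
  have S: "finite S" using G(1) by (simp add: S_def)
  have S\<sigma>: "S \<subseteq> \<sigma>" unfolding S_def G by (auto intro: hull_inc)
  have "0 \<notin> convex hull S"
  proof
    assume "0 \<in> convex hull S"
    then obtain c where c: "\<forall>s\<in>S. 0 \<le> c s" "sum c S = 1" "(\<Sum>s\<in>S. c s *\<^sub>R s) = 0"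
      using convex_hull_finite[OF S] by auto
    then obtain s where s: "s \<in> S" "c s \<noteq> 0" by (metis sum.neutral zero_neq_one)
    have "c s *\<^sub>R s \<in> \<sigma>" using s S\<sigma> c by (intro convex_cone_scaleR[OF toric_coneD(1)[OF assms]]) auto
    moreover have "- (c s *\<^sub>R s) = (\<Sum>s\<in>S - {s}. c s *\<^sub>R s)"
      using c(3) sum.remove[OF S s(1), of "\<lambda>s. c s *\<^sub>R s"] by (simp add: neg_eq_iff_add_eq_0)
    moreover have "(\<Sum>s\<in>S - {s}. c s *\<^sub>R s) \<in> \<sigma>"
      using S\<sigma> c by (intro convex_cone_sum[OF toric_coneD(1)[OF assms]]
          convex_cone_scaleR[OF toric_coneD(1)[OF assms]]) auto
    ultimately have "c s *\<^sub>R s = 0" using toric_coneD(5)[OF assms] by metis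
    then show False using s by (auto simp: S_def)
  qed
  then obtain a b where ab: "0 < b" "\<forall>x\<in>convex hull S. b < a \<bullet> x"
    using separating_hyperplane_closed_0[of "convex hull S"] S
    by (metis compact_imp_closed convex_convex_hull finite_imp_compact_convex_hull)
  then have pos: "0 < a \<bullet> x" if "x \<in> S" for x using that hull_inc[of x S] by fastforce
  show ?thesis
  proof (rule that[of a])
    fix v assume v: "v \<in> \<sigma>" "v \<noteq> 0"
    then obtain c where c: "v = (\<Sum>s\<in>to_real ` G. c s *\<^sub>R s)" "\<forall>s\<in>to_real ` G. 0 \<le> c s"
      using convex_cone_hull_finiteD[OF _ finite_imageI[OF G(1)]] unfolding G(2) by blast
    have "(\<Sum>s\<in>to_real ` G. c s *\<^sub>R s) \<noteq> 0" using v(2) unfolding c(1) .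
    then obtain s where s: "s \<in> to_real ` G" "c s *\<^sub>R s \<noteq> 0"
      by (rule sum.not_neutral_contains_not_neutral)
    have nn: "0 \<le> c x * (x \<bullet> a)" if "x \<in> to_real ` G" for x
      using c(2) pos[of x] that by (cases "x = 0") (auto simp: S_def inner_commute)
    have "0 < c s" "s \<in> S" using s c(2) by (auto simp: S_def less_le)
    then have "0 < c s * (s \<bullet> a)" using pos[of s] by (simp add: inner_commute)
    also have "\<dots> \<le> (\<Sum>s\<in>to_real ` G. c s * (s \<bullet> a))"
      using nn G(1) s(1) by (intro member_le_sum) auto
    also have "\<dots> = v \<bullet> a" unfolding c(1) by (simp add: inner_sum_left)
    finally show "0 < v \<bullet> a" .
  qed
qed

text \<open>The sum of the generators works: a vector of the dual cone orthogonal to it is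
  orthogonal to every generator, hence to the span. Being a lattice vector, \<xi> is an integral
  height on the lattice points of the dual cone; it bounds orders and drives an induction.\<close>

lemma full_cone_dual_positive:
  fixes \<sigma> :: "(real ^ 'n::finite) set"
  assumes "toric_cone \<sigma>" "span \<sigma> = UNIV"
  obtains \<xi> :: "'n lattice" where "to_real \<xi> \<in> \<sigma>" "\<And>u. u \<in> dual_cone \<sigma> \<Longrightarrow> u \<noteq> 0 \<Longrightarrow> 0 < u \<bullet> to_real \<xi>"
proof -
  obtain G :: "'n lattice set" where G: "finite G" "\<sigma> = convex_cone hull (to_real ` G)"
    by (rule toric_coneE[OF assms(1)])
  define \<xi> where "\<xi> = sum id G"
  show ?thesis
  proof (rule that[of \<xi>])
    show "to_real \<xi> \<in> \<sigma>" unfolding \<xi>_def to_real_sum using G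
      by (intro convex_cone_sum[OF toric_coneD(1)[OF assms(1)]]) (auto intro: hull_inc)
    fix u assume u: "u \<in> dual_cone \<sigma>" "u \<noteq> 0"
    then have nn: "0 \<le> u \<bullet> to_real g" if "g \<in> G" for g
      using that G dual_cone_convex_cone_hull[of "to_real ` G"] by auto
    have "u \<bullet> to_real \<xi> = (\<Sum>g\<in>G. u \<bullet> to_real g)" unfolding \<xi>_def to_real_sum by (simp add: inner_sum_right)
    moreover have "(\<Sum>g\<in>G. u \<bullet> to_real g) \<noteq> 0"
    proof
      assume "(\<Sum>g\<in>G. u \<bullet> to_real g) = 0"
      then have "\<forall>g\<in>G. u \<bullet> to_real g = 0" using nn G(1) by (simp add: sum_nonneg_eq_0_iff)
      then have "to_real ` G \<subseteq> {x. u \<bullet> x = 0}" by auto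
      then have "\<sigma> \<subseteq> {x. u \<bullet> x = 0}" unfolding G(2)
        by (rule hull_minimal) (auto simp: convex_cone_iff inner_add_right)
      then have "span \<sigma> \<subseteq> {x. u \<bullet> x = 0}" by (rule span_minimal) (rule subspace_hyperplane)
      then have "u \<in> {x. u \<bullet> x = 0}" unfolding assms(2) by blast
      then show False using u(2) by simp
    qed
    moreover have "0 \<le> (\<Sum>g\<in>G. u \<bullet> to_real g)" using nn by (rule sum_nonneg)
    ultimately show "0 < u \<bullet> to_real \<xi>" by simp
  qed
qed

lemma primitive_in_ray_unique:
  assumes "F = {t *\<^sub>R b | t. 0 \<le> t}" "primitive v" "primitive w" "to_real v \<in> F" "to_real w \<in> F"
  shows "v = w"
proof -
  obtain s t where st: "to_real v = s *\<^sub>R b" "to_real w = t *\<^sub>R b" "0 \<le> s" "0 \<le> t"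
    using assms by auto
  have "to_real v \<noteq> 0" "to_real w \<noteq> 0" using assms(2,3) by (auto simp: primitive_def)
  then have "0 < s" "0 < t" using st by (auto simp: less_le)
  then have "0 < s / t" "to_real v = (s / t) *\<^sub>R to_real w" using st by auto
  then show ?thesis using primitive_parallel(1)[OF assms(2,3)] by blast
qed

lemma primitive_in_conic:
  assumes F: "convex_cone F" and u: "to_real u \<in> F" "u \<noteq> 0"
  obtains w where "primitive w" "to_real w \<in> F"
proof -
  obtain w d where w: "primitive w" "1 \<le> d" "u = frag_cmul d w" by (rule primitive_decompose[OF u(2)])
  have "(1 / of_int d) *\<^sub>R to_real u \<in> F" using w(2) by (intro convex_cone_scaleR[OF F _ u(1)]) auto
  then have "to_real w \<in> F" using w by simp
  then show ?thesis using that w by blast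
qed

text \<open>A point of the ray is a nonnegative combination of the generators, and a face absorbs
  the summands of its elements; so the ray contains a nonzero generator, which is a lattice
  vector.\<close>

lemma toric_cone_ray_primitive:
  assumes \<sigma>: "toric_cone \<sigma>" and F: "F face_of \<sigma>" "aff_dim F = 1"
  shows "\<exists>!w. primitive w \<and> to_real w \<in> F"
    and "primitive w \<Longrightarrow> to_real w \<in> F \<Longrightarrow> F = {t *\<^sub>R to_real w | t. 0 \<le> t}"
proof -
  note C = toric_coneD(1)[OF \<sigma>]
  obtain \<xi> where \<xi>: "\<And>v. v \<in> \<sigma> \<Longrightarrow> v \<noteq> 0 \<Longrightarrow> 0 < v \<bullet> \<xi>" by (rule toric_cone_positive[OF \<sigma>]) blast
  obtain b where b: "b \<in> F" "b \<noteq> 0" "F = {t *\<^sub>R b | t. 0 \<le> t}" by (rule cone_ray_of_face[OF C \<xi> F])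
  have cF: "convex_cone F" by (rule face_of_cone_conic[OF C F(1)]) (use b in auto)
  obtain G :: "'a lattice set" where G: "finite G" "\<sigma> = convex_cone hull (to_real ` G)"
    by (rule toric_coneE[OF \<sigma>])
  have "b \<in> \<sigma>" using b(1) F(1) face_of_imp_subset by blast
  then obtain c where c: "b = (\<Sum>s\<in>to_real ` G. c s *\<^sub>R s)" "\<forall>s\<in>to_real ` G. 0 \<le> c s"
    using convex_cone_hull_finiteD[OF _ finite_imageI[OF G(1)]] unfolding G(2) by blast
  have "(\<Sum>s\<in>to_real ` G. c s *\<^sub>R s) \<noteq> 0" using b(2) unfolding c(1) .
  then obtain s where s: "s \<in> to_real ` G" "c s *\<^sub>R s \<noteq> 0"
    by (rule sum.not_neutral_contains_not_neutral)
  have G\<sigma>: "to_real ` G \<subseteq> \<sigma>" unfolding G(2) by (rule hull_subset)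
  have cG: "c t *\<^sub>R t \<in> \<sigma>" if "t \<in> to_real ` G" for t
    using that G\<sigma> c(2) by (intro convex_cone_scaleR[OF C]) auto
  have "c s *\<^sub>R s \<in> F"
    by (rule face_of_cone_sum[OF C F(1) finite_imageI[OF G(1)], of to_real "\<lambda>s. c s *\<^sub>R s"])
      (use cG b(1) c(1) s(1) in auto)
  then have "(1 / c s) *\<^sub>R (c s *\<^sub>R s) \<in> F"
    by (rule convex_cone_scaleR[OF cF, rotated]) (use c(2) s(1) in auto)
  then have "s \<in> F" using s by simp
  then obtain g where g: "to_real g \<in> F" "g \<noteq> 0" using s by auto
  obtain w where w: "primitive w" "to_real w \<in> F" by (rule primitive_in_conic[OF cF g])
  show "\<exists>!w. primitive w \<and> to_real w \<in> F"
    using w primitive_in_ray_unique[OF b(3)] by blast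
  show "F = {t *\<^sub>R to_real w | t. 0 \<le> t}" if hw: "primitive w" "to_real w \<in> F" for w
  proof -
    obtain r where r: "to_real w = r *\<^sub>R b" "0 \<le> r" using hw b(3) by auto
    have "r \<noteq> 0" using hw r by (auto simp: primitive_def)
    then have bw: "b = (1 / r) *\<^sub>R to_real w" and "0 < r" using r by auto
    have "t *\<^sub>R b \<in> {t *\<^sub>R to_real w | t. 0 \<le> t}" if "0 \<le> t" for t
      using that \<open>0 < r\<close> by (subst bw) (auto intro!: exI[of _ "t / r"])
    then have "F \<subseteq> {t *\<^sub>R to_real w | t. 0 \<le> t}" using b(3) by blast
    moreover have "{t *\<^sub>R to_real w | t. 0 \<le> t} \<subseteq> F" using hw(2) convex_cone_scaleR[OF cF] by auto
    ultimately show ?thesis by blast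
  qed
qed

text \<open>The dual cone is given by inequalities, so a lattice point on its ray has to be
  produced. A lattice vector with the same signs as \<open>b\<close> on the generators of \<sigma>
  satisfies the same equalities; \<open>b\<close> minus a small multiple of it stays in the dual
  cone, which puts it on the ray.\<close>

lemma dual_cone_ray_primitive:
  fixes \<sigma> :: "(real ^ 'n::finite) set"
  assumes \<sigma>: "toric_cone \<sigma>" "span \<sigma> = UNIV" and F: "F face_of dual_cone \<sigma>" "aff_dim F = 1"
  shows "\<exists>!w. primitive w \<and> to_real w \<in> F"
    and "\<And>w. primitive w \<Longrightarrow> to_real w \<in> F \<Longrightarrow> F = {t *\<^sub>R to_real w | t. 0 \<le> t}"
proof -
  note C = convex_cone_dual_cone[of \<sigma>]
  obtain \<xi> :: "'n lattice" where \<xi>: "\<And>u. u \<in> dual_cone \<sigma> \<Longrightarrow> u \<noteq> 0 \<Longrightarrow> 0 < u \<bullet> to_real \<xi>"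
    by (rule full_cone_dual_positive[OF \<sigma>]) blast
  obtain b where b: "b \<in> F" "b \<noteq> 0" "F = {t *\<^sub>R b | t. 0 \<le> t}" by (rule cone_ray_of_face[OF C \<xi> F])
  have cF: "convex_cone F" by (rule face_of_cone_conic[OF C F(1)]) (use b in auto)
  obtain G :: "'n lattice set" where G: "finite G" "\<sigma> = convex_cone hull (to_real ` G)"
    by (rule toric_coneE[OF \<sigma>(1)])
  have Q: "u \<in> dual_cone \<sigma> \<longleftrightarrow> (\<forall>g\<in>G. 0 \<le> u \<bullet> to_real g)" for u
    using dual_cone_convex_cone_hull[of "to_real ` G"] G(2) by auto
  have bQ: "b \<in> dual_cone \<sigma>" using b(1) F(1) face_of_imp_subset by blast
  \<comment> \<open>Including \<xi> among the test vectors keeps \<open>m\<close> from being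
    0.\<close>
  obtain m :: "'n lattice" where m: "\<And>h. h \<in> insert \<xi> G \<Longrightarrow> sgn (to_real m \<bullet> to_real h) = sgn (b \<bullet> to_real h)"
    by (rule lattice_sgn_approx[of "insert \<xi> G" b]) (use G in auto)
  have m0: "m \<noteq> 0" using m[of \<xi>] \<xi>[OF bQ b(2)] by auto
  have mQ: "to_real m \<in> dual_cone \<sigma>" unfolding Q
    using m bQ Q by (metis insertCI sgn_less sgn_0_0 not_less)
  have "\<exists>\<epsilon>>0. \<forall>g\<in>G. 0 \<le> (b - \<epsilon> *\<^sub>R to_real m) \<bullet> to_real g"
  proof -
    have "0 \<le> b \<bullet> to_real g \<and> (b \<bullet> to_real g = 0 \<longrightarrow> 0 \<le> - (to_real m \<bullet> to_real g))" if g: "g \<in> G" for g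
      using bQ Q g m[of g] by (auto simp: sgn_zero_iff)
    from small_perturbation[OF G(1), of "\<lambda>g. b \<bullet> to_real g" "\<lambda>g. - (to_real m \<bullet> to_real g)", OF this] obtain \<epsilon> where
      "0 < \<epsilon>" "\<And>t g. 0 < t \<Longrightarrow> t \<le> \<epsilon> \<Longrightarrow> g \<in> G \<Longrightarrow> 0 \<le> b \<bullet> to_real g + t * - (to_real m \<bullet> to_real g)" by metis
    then show ?thesis by (intro exI[of _ \<epsilon>]) (auto simp: inner_diff_left)
  qed
  then obtain \<epsilon> where e: "0 < \<epsilon>" "\<forall>g\<in>G. 0 \<le> (b - \<epsilon> *\<^sub>R to_real m) \<bullet> to_real g" by blast
  then have "b - \<epsilon> *\<^sub>R to_real m \<in> dual_cone \<sigma>" by (simp add: Q)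
  moreover have "\<epsilon> *\<^sub>R to_real m \<in> dual_cone \<sigma>" using e(1) mQ by (intro convex_cone_scaleR[OF C]) auto
  ultimately have "\<epsilon> *\<^sub>R to_real m \<in> F"
    using face_of_cone_add(2)[OF C F(1), of "b - \<epsilon> *\<^sub>R to_real m" "\<epsilon> *\<^sub>R to_real m"] b(1) by simp
  then have "(1 / \<epsilon>) *\<^sub>R (\<epsilon> *\<^sub>R to_real m) \<in> F"
    using convex_cone_scaleR[OF cF, of "1 / \<epsilon>"] e(1) by (metis less_imp_le zero_less_divide_1_iff)
  then have mF: "to_real m \<in> F" using e(1) by simp
  obtain w where w: "primitive w" "to_real w \<in> F" by (rule primitive_in_conic[OF cF mF m0])
  show "\<exists>!w. primitive w \<and> to_real w \<in> F"
    using w primitive_in_ray_unique[OF b(3)] by blast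
  show "F = {t *\<^sub>R to_real w | t. 0 \<le> t}" if hw: "primitive w" "to_real w \<in> F" for w
  proof -
    obtain r where r: "to_real w = r *\<^sub>R b" "0 \<le> r" using hw b(3) by auto
    have "r \<noteq> 0" using hw r by (auto simp: primitive_def)
    then have bw: "b = (1 / r) *\<^sub>R to_real w" and "0 < r" using r by auto
    have "t *\<^sub>R b \<in> {t *\<^sub>R to_real w | t. 0 \<le> t}" if "0 \<le> t" for t
      using that \<open>0 < r\<close> by (subst bw) (auto intro!: exI[of _ "t / r"])
    then have "F \<subseteq> {t *\<^sub>R to_real w | t. 0 \<le> t}" using b(3) by blast
    moreover have "{t *\<^sub>R to_real w | t. 0 \<le> t} \<subseteq> F" using hw(2) convex_cone_scaleR[OF cF] by auto
    ultimately show ?thesis by blast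
  qed
qed

lemma ray_generators_dual:
  fixes \<sigma> :: "(real ^ 'n::finite) set"
  assumes \<sigma>: "toric_cone \<sigma>" "span \<sigma> = UNIV"
  shows "finite (ray_generators (dual_cone \<sigma>))"
    and "\<And>w. w \<in> ray_generators (dual_cone \<sigma>) \<Longrightarrow> primitive w \<and> w \<noteq> 0 \<and> to_real w \<in> dual_cone \<sigma>"
    and "\<And>u. u \<in> dual_cone \<sigma> \<Longrightarrow> \<exists>a. (\<forall>w\<in>ray_generators (dual_cone \<sigma>). 0 \<le> a w) \<and>
           u = (\<Sum>w\<in>ray_generators (dual_cone \<sigma>). a w *\<^sub>R to_real w)"
    and "\<And>w. w \<in> ray_generators (dual_cone \<sigma>) \<Longrightarrow> {t *\<^sub>R to_real w | t. 0 \<le> t} face_of dual_cone \<sigma>"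
proof -
  let ?Q = "dual_cone \<sigma>" and ?R = "ray_generators (dual_cone \<sigma>)"
  note ray = dual_cone_ray_primitive[OF \<sigma>]
  obtain G :: "'n lattice set" where G: "finite G" "\<sigma> = convex_cone hull (to_real ` G)"
    by (rule toric_coneE[OF \<sigma>(1)])
  have "?Q = \<Inter> ((\<lambda>g. {u. to_real g \<bullet> u \<ge> 0}) ` G)"
    using dual_cone_convex_cone_hull[of "to_real ` G"] G(2) by (auto simp: inner_commute)
  then have "polyhedron ?Q" using G(1) by (auto intro!: polyhedron_Inter polyhedron_halfspace_ge)
  then have fin: "finite {F. F face_of ?Q}" by (rule finite_polyhedron_faces)
  have "?R \<subseteq> (\<lambda>F. THE w. primitive w \<and> to_real w \<in> F) ` {F. F face_of ?Q}"
  proof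
    fix w assume "w \<in> ?R"
    then obtain F where F: "primitive w" "F face_of ?Q" "aff_dim F = 1" "to_real w \<in> F"
      by (auto simp: ray_generators_def)
    then have "w = (THE w. primitive w \<and> to_real w \<in> F)" using ray(1)[OF F(2,3)] by (metis (mono_tags, lifting) the1_equality)
    then show "w \<in> (\<lambda>F. THE w. primitive w \<and> to_real w \<in> F) ` {F. F face_of ?Q}" using F by blast
  qed
  then show fR: "finite ?R" using fin finite_surj by blast
  show "primitive w \<and> w \<noteq> 0 \<and> to_real w \<in> ?Q" if "w \<in> ?R" for w
    using that by (auto simp: ray_generators_def primitive_def dest: face_of_imp_subset)
  show "{t *\<^sub>R to_real w | t. 0 \<le> t} face_of ?Q" if "w \<in> ?R" for w
    using that ray(2) by (auto simp: ray_generators_def)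
  fix u assume u: "u \<in> ?Q"
  obtain \<xi> :: "'n lattice" where \<xi>: "\<And>u. u \<in> ?Q \<Longrightarrow> u \<noteq> 0 \<Longrightarrow> 0 < u \<bullet> to_real \<xi>"
    by (rule full_cone_dual_positive[OF \<sigma>]) blast
  have "u \<in> convex_cone hull (\<Union>{F. F face_of ?Q \<and> aff_dim F = 1})"
    using cone_generated_by_rays[OF convex_cone_dual_cone closed_dual_cone \<xi>] u by blast
  also have "\<dots> \<subseteq> convex_cone hull (to_real ` ?R)"
  proof (rule hull_minimal)
    show "\<Union>{F. F face_of ?Q \<and> aff_dim F = 1} \<subseteq> convex_cone hull (to_real ` ?R)"
    proof
      fix x assume "x \<in> \<Union>{F. F face_of ?Q \<and> aff_dim F = 1}"
      then obtain F where F: "F face_of ?Q" "aff_dim F = 1" "x \<in> F" by blast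
      obtain w where w: "primitive w" "to_real w \<in> F" using ray(1)[OF F(1,2)] by blast
      then have "w \<in> ?R" using F by (auto simp: ray_generators_def)
      moreover obtain t where "x = t *\<^sub>R to_real w" "0 \<le> t" using ray(2)[OF F(1,2) w] F(3) by blast
      ultimately show "x \<in> convex_cone hull (to_real ` ?R)"
        using convex_cone_hull_mul[OF hull_inc[of "to_real w" "to_real ` ?R" convex_cone]] by auto
    qed
  qed (rule convex_cone_convex_cone_hull)
  finally obtain c where c: "u = (\<Sum>s\<in>to_real ` ?R. c s *\<^sub>R s)" "\<forall>s\<in>to_real ` ?R. 0 \<le> c s"
    using convex_cone_hull_finiteD[OF _ finite_imageI[OF fR]] by blast
  have "inj_on to_real ?R" by (auto simp: inj_on_def)
  then have "u = (\<Sum>w\<in>?R. c (to_real w) *\<^sub>R to_real w)" unfolding c(1) by (simp add: sum.reindex)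
  then show "\<exists>a. (\<forall>w\<in>?R. 0 \<le> a w) \<and> u = (\<Sum>w\<in>?R. a w *\<^sub>R to_real w)"
    using c(2) by (intro exI[of _ "\<lambda>w. c (to_real w)"]) auto
qed

lemma toric_cone_generated_by_rays:
  fixes \<sigma> :: "(real ^ 'n::finite) set"
  assumes "toric_cone \<sigma>"
  shows "\<sigma> = convex_cone hull (\<Union>{F. F face_of \<sigma> \<and> aff_dim F = 1})"
proof
  obtain \<xi> where \<xi>: "\<And>v. v \<in> \<sigma> \<Longrightarrow> v \<noteq> 0 \<Longrightarrow> 0 < v \<bullet> \<xi>" by (rule toric_cone_positive[OF assms]) blast
  show "\<sigma> \<subseteq> convex_cone hull (\<Union>{F. F face_of \<sigma> \<and> aff_dim F = 1})"
    by (rule cone_generated_by_rays[OF toric_coneD(1,2)[OF assms] \<xi>])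
  show "convex_cone hull (\<Union>{F. F face_of \<sigma> \<and> aff_dim F = 1}) \<subseteq> \<sigma>"
    by (rule hull_minimal) (use toric_coneD(1)[OF assms] face_of_imp_subset in blast)+
qed

text \<open>The functional is taken from the relative interior of the dual of C = \<sigma> - \<tau>.
  It then vanishes only on those generators of C whose negatives lie in C, and the face property
  puts these into \<sigma> \<inter> \<tau>.\<close>

lemma toric_cone_separation:
  fixes \<sigma> \<tau> :: "(real ^ 'n::finite) set"
  assumes \<sigma>: "toric_cone \<sigma>" and \<tau>: "toric_cone \<tau>"
    and f: "\<sigma> \<inter> \<tau> face_of \<sigma>" "\<sigma> \<inter> \<tau> face_of \<tau>"
  obtains u :: "'n lattice" where
    "\<And>v. v \<in> \<sigma> \<Longrightarrow> 0 \<le> to_real u \<bullet> v" "\<And>v. v \<in> \<sigma> \<Longrightarrow> to_real u \<bullet> v = 0 \<longleftrightarrow> v \<in> \<tau>"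
    "\<And>v. v \<in> \<tau> \<Longrightarrow> to_real u \<bullet> v \<le> 0" "\<And>v. v \<in> \<tau> \<Longrightarrow> to_real u \<bullet> v = 0 \<longleftrightarrow> v \<in> \<sigma>"
proof -
  obtain G :: "'n lattice set" where G: "finite G" "\<sigma> = convex_cone hull (to_real ` G)"
    by (rule toric_coneE[OF \<sigma>])
  obtain H :: "'n lattice set" where H: "finite H" "\<tau> = convex_cone hull (to_real ` H)"
    by (rule toric_coneE[OF \<tau>])
  define S where "S = G \<union> uminus ` H"
  define C where "C = convex_cone hull (to_real ` S)"
  have S: "finite S" using G H by (simp add: S_def)
  have C: "convex_cone C" "closed C" unfolding C_def using S
    by (auto intro: convex_cone_convex_cone_hull closed_convex_cone_hull)
  have Cst: "\<exists>s\<in>\<sigma>. \<exists>t\<in>\<tau>. x = s - t" if x: "x \<in> C" for x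
  proof -
    have img: "to_real ` S = to_real ` G \<union> uminus ` (to_real ` H)" by (auto simp: S_def image_Un image_image)
    have "convex_cone {s - t | s t. s \<in> \<sigma> \<and> t \<in> \<tau>}"
      unfolding convex_cone_iff
    proof (intro conjI ballI allI impI)
      show "0 \<in> {s - t | s t. s \<in> \<sigma> \<and> t \<in> \<tau>}" using toric_coneD(4)[OF \<sigma>] toric_coneD(4)[OF \<tau>] by force
      fix x assume "x \<in> {s - t | s t. s \<in> \<sigma> \<and> t \<in> \<tau>}"
      then obtain s t where st: "x = s - t" "s \<in> \<sigma>" "t \<in> \<tau>" by auto
      { fix y assume "y \<in> {s - t | s t. s \<in> \<sigma> \<and> t \<in> \<tau>}"
        then obtain s' t' where st': "y = s' - t'" "s' \<in> \<sigma>" "t' \<in> \<tau>" by auto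
        have "x + y = (s + s') - (t + t')" using st st' by simp
        then show "x + y \<in> {s - t | s t. s \<in> \<sigma> \<and> t \<in> \<tau>}"
          using st st' convex_cone_add[OF toric_coneD(1)[OF \<sigma>]] convex_cone_add[OF toric_coneD(1)[OF \<tau>]] by blast }
      show "c *\<^sub>R x \<in> {s - t | s t. s \<in> \<sigma> \<and> t \<in> \<tau>}" if c: "0 \<le> c" for c
        using st c convex_cone_scaleR[OF toric_coneD(1)[OF \<sigma>]] convex_cone_scaleR[OF toric_coneD(1)[OF \<tau>]]
        unfolding st(1) scaleR_diff_right by blast
    qed
    moreover have "to_real ` S \<subseteq> {s - t | s t. s \<in> \<sigma> \<and> t \<in> \<tau>}"
    proof
      fix x assume "x \<in> to_real ` S"
      then consider "x \<in> to_real ` G" | "- x \<in> to_real ` H" unfolding img by auto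
      then show "x \<in> {s - t | s t. s \<in> \<sigma> \<and> t \<in> \<tau>}"
      proof cases
        case 1
        then have "x \<in> \<sigma>" using G(2) hull_inc by metis
        then have "x = x - 0 \<and> x \<in> \<sigma> \<and> 0 \<in> \<tau>" using toric_coneD(4)[OF \<tau>] by simp
        then show ?thesis by blast
      next
        case 2
        then have "- x \<in> \<tau>" using H(2) hull_inc by metis
        then have "x = 0 - (- x) \<and> 0 \<in> \<sigma> \<and> - x \<in> \<tau>" using toric_coneD(4)[OF \<sigma>] by simp
        then show ?thesis by blast
      qed
    qed
    ultimately have "C \<subseteq> {s - t | s t. s \<in> \<sigma> \<and> t \<in> \<tau>}" unfolding C_def by (rule hull_minimal[rotated])
    then show ?thesis using x by blast
  qed
  have "\<exists>u\<in>dual_cone C. to_real g \<in> uminus ` C \<or> 0 < u \<bullet> to_real g" for g :: "'n lattice"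
  proof (cases "- to_real g \<in> C")
    case True
    then have "to_real g \<in> uminus ` C" by force
    moreover have "0 \<in> dual_cone C" by (simp add: dual_cone_def)
    ultimately show ?thesis by blast
  next
    case False
    from dual_cone_separation[OF C False] obtain u where "u \<in> dual_cone C" "u \<bullet> - to_real g < 0" by blast
    then show ?thesis by (intro bexI[of _ u]) auto
  qed
  \<comment> \<open>For each generator one functional that is positive on it whenever its negative
    is not in \<open>C\<close>; all are nonnegative on \<open>C\<close>, so their sum is positive
    wherever one of them is.\<close>
  then obtain U where U: "\<And>g. U g \<in> dual_cone C" "\<And>g. to_real g \<in> uminus ` C \<or> 0 < U g \<bullet> to_real g" by metis
  define u where "u = sum U S"
  have SC: "to_real g \<in> C" if "g \<in> S" for g using that unfolding C_def by (auto intro: hull_inc)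
  have u0: "0 \<le> u \<bullet> to_real g" and u1: "u \<bullet> to_real g = 0 \<Longrightarrow> - to_real g \<in> C" if g: "g \<in> S" for g
  proof -
    have nn: "0 \<le> U h \<bullet> to_real g" for h using U(1)[of h] SC[OF g] by (simp add: dual_cone_def)
    have e: "u \<bullet> to_real g = (\<Sum>h\<in>S. U h \<bullet> to_real g)" by (simp add: u_def inner_sum_left)
    show "0 \<le> u \<bullet> to_real g" unfolding e using nn by (intro sum_nonneg) auto
    show "- to_real g \<in> C" if "u \<bullet> to_real g = 0"
    proof -
      have "U g \<bullet> to_real g = 0" using that nn S g unfolding e by (simp add: sum_nonneg_eq_0_iff)
      then show ?thesis using U(2)[of g] by auto
    qed
  qed
  obtain m :: "'n lattice" where m: "\<And>h. h \<in> S \<Longrightarrow> sgn (to_real m \<bullet> to_real h) = sgn (u \<bullet> to_real h)"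
    by (rule lattice_sgn_approx[OF S, of u]) blast
  have m0: "0 \<le> to_real m \<bullet> to_real g" if g: "g \<in> S" for g
    using m[OF g] u0[OF g] by (metis not_less sgn_less)
  have m1: "- to_real g \<in> C" if g: "g \<in> S" "to_real m \<bullet> to_real g = 0" for g
    using m[OF g(1)] u1[OF g(1)] g(2) by (simp add: sgn_zero_iff)
  have gG: "0 \<le> to_real m \<bullet> to_real g" "to_real m \<bullet> to_real g = 0 \<Longrightarrow> to_real g \<in> \<tau>" if g: "g \<in> G" for g
  proof -
    have gS: "g \<in> S" and g\<sigma>: "to_real g \<in> \<sigma>" using g G(2) by (auto simp: S_def intro: hull_inc)
    show "0 \<le> to_real m \<bullet> to_real g" using m0[OF gS] .
    assume "to_real m \<bullet> to_real g = 0"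
    then obtain s t where st: "s \<in> \<sigma>" "t \<in> \<tau>" "- to_real g = s - t" using Cst[OF m1[OF gS]] by blast
    \<comment> \<open>The vector t = g + s lies in both cones, hence in the face \<sigma> \<inter>
      \<tau>, which then contains the summand g.\<close>
    then have "to_real g + s = t" by (simp add: algebra_simps)
    then have "to_real g + s \<in> \<sigma> \<inter> \<tau>" using st convex_cone_add[OF toric_coneD(1)[OF \<sigma>] g\<sigma> st(1)] by simp
    then show "to_real g \<in> \<tau>" using face_of_cone_add(1)[OF toric_coneD(1)[OF \<sigma>] f(1) g\<sigma> st(1)] by simp
  qed
  have gH: "to_real m \<bullet> to_real g \<le> 0" "to_real m \<bullet> to_real g = 0 \<Longrightarrow> to_real g \<in> \<sigma>" if g: "g \<in> H" for g
  proof -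
    have gS: "- g \<in> S" and g\<tau>: "to_real g \<in> \<tau>" using g H(2) by (auto simp: S_def intro: hull_inc)
    show "to_real m \<bullet> to_real g \<le> 0" using m0[OF gS] by simp
    assume "to_real m \<bullet> to_real g = 0"
    then have "- to_real (- g) \<in> C" by (intro m1[OF gS]) simp
    then obtain s t where st: "s \<in> \<sigma>" "t \<in> \<tau>" "to_real g = s - t" using Cst[of "to_real g"] by auto
    then have "to_real g + t = s" by (simp add: algebra_simps)
    then have "to_real g + t \<in> \<sigma> \<inter> \<tau>" using st convex_cone_add[OF toric_coneD(1)[OF \<tau>] g\<tau> st(2)] by simp
    then show "to_real g \<in> \<sigma>" using face_of_cone_add(1)[OF toric_coneD(1)[OF \<tau>] f(2) g\<tau> st(2)] by simp
  qed
  have half: "0 \<le> r \<bullet> v \<and> (r \<bullet> v = 0 \<longrightarrow> v \<in> K')"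
    if r: "\<And>g. g \<in> A \<Longrightarrow> 0 \<le> r \<bullet> to_real g" "\<And>g. g \<in> A \<Longrightarrow> r \<bullet> to_real g = 0 \<Longrightarrow> to_real g \<in> K'"
      and A: "finite A" and v: "v \<in> convex_cone hull (to_real ` A)" and K: "convex_cone K'"
    for r v and A :: "'n lattice set" and K' :: "(real ^ 'n) set"
  proof -
    obtain c where c: "v = (\<Sum>s\<in>to_real ` A. c s *\<^sub>R s)" "\<forall>s\<in>to_real ` A. 0 \<le> c s"
      using convex_cone_hull_finiteD[OF v finite_imageI[OF A]] by blast
    have e: "r \<bullet> v = (\<Sum>s\<in>to_real ` A. c s * (r \<bullet> s))" unfolding c(1) by (simp add: inner_sum_right)
    have nn: "0 \<le> c s * (r \<bullet> s)" if "s \<in> to_real ` A" for s using c(2) r(1) that by auto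
    have "v \<in> K'" if "r \<bullet> v = 0"
    proof -
      have "\<forall>s\<in>to_real ` A. c s * (r \<bullet> s) = 0" using that nn A unfolding e by (simp add: sum_nonneg_eq_0_iff)
      then have "c s *\<^sub>R s \<in> K'" if s: "s \<in> to_real ` A" for s
        using s r(2) c(2) convex_cone_scaleR[OF K, of "c s" s] convex_cone_contains_0[OF K]
        by (cases "c s = 0") auto
      then show ?thesis unfolding c(1) by (intro convex_cone_sum[OF K]) auto
    qed
    then show ?thesis unfolding e using nn by (auto intro: sum_nonneg)
  qed
  have 1: "0 \<le> to_real m \<bullet> v \<and> (to_real m \<bullet> v = 0 \<longrightarrow> v \<in> \<tau>)" if "v \<in> \<sigma>" for v
    by (rule half[OF gG G(1) _ toric_coneD(1)[OF \<tau>]]) (use that G in auto)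
  have 2: "0 \<le> (- to_real m) \<bullet> v \<and> ((- to_real m) \<bullet> v = 0 \<longrightarrow> v \<in> \<sigma>)" if "v \<in> \<tau>" for v
    by (rule half[OF _ _ H(1) _ toric_coneD(1)[OF \<sigma>]]) (use that H gH in auto)
  show ?thesis
    by (rule that[of m]) (use 1 2 in \<open>auto simp: order_antisym_conv, (metis order_antisym neg_0_le_iff_le inner_minus_left)+\<close>)
qed

subsection \<open>The order \<open>k\<^sub>u\<close> and the constant \<open>\<Gamma>\<close>\<close>

text \<open>The combinatorial form of \<chi>^u lying in the power \<open>j\<close> of the irrelevant
  ideal, free of the field. The remainder \<open>u - sum_list us\<close> may be any lattice point of
  the cone; for \<open>j\<close> = 0 only membership of \<open>u\<close> is left, as the zeroth
  power is the whole ring.\<close>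

definition summands :: "(real ^ 'n::finite) set \<Rightarrow> nat \<Rightarrow> 'n lattice \<Rightarrow> bool" where
  "summands Q j u \<longleftrightarrow> (\<exists>us. length us = j \<and> (\<forall>w\<in>set us. w \<noteq> 0 \<and> to_real w \<in> Q) \<and>
     to_real (u - sum_list us) \<in> Q)"

lemma ideal_multI: "a \<in> I \<Longrightarrow> b \<in> J \<Longrightarrow> a * b \<in> ideal_mult I J"
  unfolding ideal_mult_def by (intro CollectI exI[of _ "1::nat"] exI[of _ "\<lambda>_. a"] exI[of _ "\<lambda>_. b"]) auto

lemma summands_0: "to_real u \<in> Q \<Longrightarrow> summands Q 0 u"
  by (simp add: summands_def)

lemma summands_SucI:
  assumes "summands Q j v" "w \<noteq> 0" "to_real w \<in> Q"
  shows "summands Q (Suc j) (w + v)"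
proof -
  obtain us where us: "length us = j" "\<forall>w\<in>set us. w \<noteq> 0 \<and> to_real w \<in> Q" "to_real (v - sum_list us) \<in> Q"
    using assms(1) by (auto simp: summands_def)
  have e: "w + v - sum_list (w # us) = v - sum_list us" by simp
  show ?thesis unfolding summands_def
    by (rule exI[of _ "w # us"]) (simp add: us assms e del: sum_list.Cons to_real_simps)
qed

lemma summands_SucD:
  assumes "summands Q (Suc j) u"
  obtains w v where "u = w + v" "summands Q j v" "w \<noteq> 0" "to_real w \<in> Q"
proof -
  obtain us where us: "length us = Suc j" "\<forall>w\<in>set us. w \<noteq> 0 \<and> to_real w \<in> Q" "to_real (u - sum_list us) \<in> Q"
    using assms by (auto simp: summands_def)
  obtain w us' where w: "us = w # us'" using us(1) by (cases us) auto
  have "u - w - sum_list us' = u - sum_list us" by (simp add: w)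
  then have "to_real (u - w - sum_list us') \<in> Q" using us(3) by (simp only:)
  then have "summands Q j (u - w)" unfolding summands_def using us(1,2) w by (intro exI[of _ us']) (simp del: to_real_simps)
  moreover have "u = w + (u - w)" by simp
  ultimately show ?thesis using that us(2) w by (meson list.set_intros(1))
qed

lemma summands_add_right:
  assumes "convex_cone Q" "to_real v \<in> Q"
  shows "summands Q j u \<Longrightarrow> summands Q j (u + v)"
proof (induction j arbitrary: u)
  case 0
  then show ?case using assms(2) convex_cone_add[OF assms(1)] by (simp add: summands_def)
next
  case (Suc j)
  obtain w u' where w: "u = w + u'" "summands Q j u'" "w \<noteq> 0" "to_real w \<in> Q" by (rule summands_SucD[OF Suc.prems])
  have "summands Q (Suc j) (w + (u' + v))" by (rule summands_SucI[OF Suc.IH[OF w(2)] w(3,4)])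
  then show ?case by (simp add: w(1) add.assoc)
qed

lemma summands_add:
  assumes "convex_cone Q" "summands Q j v"
  shows "summands Q i u \<Longrightarrow> summands Q (i + j) (u + v)"
proof (induction i arbitrary: u)
  case 0
  then have "to_real u \<in> Q" by (simp add: summands_def)
  from summands_add_right[OF assms(1) this assms(2)] show ?case by (simp add: add.commute)
next
  case (Suc i)
  obtain w u' where w: "u = w + u'" "summands Q i u'" "w \<noteq> 0" "to_real w \<in> Q" by (rule summands_SucD[OF Suc.prems])
  have "summands Q (Suc (i + j)) (w + (u' + v))" by (rule summands_SucI[OF Suc.IH[OF w(2)] w(3,4)])
  then show ?case by (simp add: w(1) add.assoc)
qed

lemma summands_mono:
  assumes "convex_cone Q" "i \<le> j" "summands Q j u"
  shows "summands Q i u"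
  using assms(2,3)
proof (induction j)
  case (Suc j)
  show ?case
  proof (cases "i = Suc j")
    case False
    obtain w v where w: "u = w + v" "summands Q j v" "w \<noteq> 0" "to_real w \<in> Q" by (rule summands_SucD[OF Suc.prems(2)])
    have "summands Q j u" unfolding w(1) using summands_add_right[OF assms(1) w(4,2)] by (simp add: add.commute)
    then show ?thesis using Suc.IH Suc.prems(1) False by simp
  qed (use Suc.prems in auto)
qed auto

lemma summands_multiple:
  assumes "convex_cone Q" "w \<noteq> 0" "to_real w \<in> Q"
  shows "summands Q n (frag_cmul (int n) w)"
proof (induction n)
  case 0
  then show ?case using convex_cone_contains_0[OF assms(1)] by (simp add: summands_def)
next
  case (Suc n)
  have "frag_cmul (int (Suc n)) w = w + frag_cmul (int n) w"
    by (simp add: frag_cmul_distrib add.commute)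
  then show ?case using summands_SucI[OF Suc assms(2,3)] by simp
qed

lemma summands_sum:
  assumes "convex_cone Q" "\<And>i. i \<in> A \<Longrightarrow> summands Q (n i) (u i)"
  shows "summands Q (sum n A) (sum u A)"
  using assms(2)
proof (induction A rule: infinite_finite_induct)
  case (insert i A)
  then show ?case using summands_add[OF assms(1), of "sum n A" "sum u A" "n i" "u i"] by auto
qed (auto simp: summands_def convex_cone_contains_0[OF assms(1)])

text \<open>Powers of the irrelevant ideal are spanned by monomials: an exponent of a product is a
  sum of exponents of the factors, and cancellation only removes exponents.\<close>

lemma keys_ideal_power_summands:
  fixes f :: "('n::finite, 'k::field) laurent"
  assumes Q: "convex_cone Q"
  shows "f \<in> ideal_power (semigroup_algebra Q) (irrelevant_ideal Q) j \<Longrightarrow> u \<in> Poly_Mapping.keys f \<Longrightarrow> summands Q j u"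
proof (induction j arbitrary: f u)
  case 0
  then show ?case by (auto simp: semigroup_algebra_iff intro: summands_0)
next
  case (Suc j)
  obtain m a b where f: "f = (\<Sum>i<(m::nat). a i * b i)"
    "\<forall>i<m. a i \<in> irrelevant_ideal Q \<and> b i \<in> ideal_power (semigroup_algebra Q) (irrelevant_ideal Q) j"
    using Suc.prems(1) by (auto simp: ideal_mult_def)
  have "u \<in> (\<Union>i\<in>{..<m}. Poly_Mapping.keys (a i * b i))"
    using Suc.prems(2) Poly_Mapping.keys_sum[of "\<lambda>i. a i * b i" "{..<m}"] unfolding f(1) by blast
  then obtain i where i: "i < m" "u \<in> Poly_Mapping.keys (a i * b i)" by auto
  obtain v w where vw: "v \<in> Poly_Mapping.keys (a i)" "w \<in> Poly_Mapping.keys (b i)" "u = v + w"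
    by (rule keys_mult_obtain[OF i(2)])
  have "v \<noteq> 0" "to_real v \<in> Q" using f(2) i(1) vw(1) by (auto simp: irrelevant_ideal_def lattice_points_def)
  then show ?case unfolding vw(3) using Suc.IH[of "b i" w] f(2) i(1) vw(2) by (intro summands_SucI) auto
qed

lemma summands_ideal_power:
  shows "summands Q j u \<Longrightarrow>
    (Poly_Mapping.single u 1 :: ('n::finite, 'k::field) laurent) \<in> ideal_power (semigroup_algebra Q) (irrelevant_ideal Q) j"
proof (induction j arbitrary: u)
  case 0
  then show ?case by (simp add: summands_def single_in_semigroup_algebra)
next
  case (Suc j)
  obtain w v where w: "u = w + v" "summands Q j v" "w \<noteq> 0" "to_real w \<in> Q" by (rule summands_SucD[OF Suc.prems])
  have "(Poly_Mapping.single u 1 :: ('n, 'k) laurent) = Poly_Mapping.single w 1 * Poly_Mapping.single v 1"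
    by (simp add: mult_single w(1))
  moreover have "(Poly_Mapping.single w 1 :: ('n, 'k) laurent) \<in> irrelevant_ideal Q"
    using w by (simp add: irrelevant_ideal_def lattice_points_def)
  ultimately show ?case using Suc.IH[OF w(2)] by (simp add: ideal_multI)
qed

text \<open>Every nonzero lattice vector of \<open>Q\<close> has integral height at least 1. This
  makes the greatest \<open>j\<close> in the definition of the order exist.\<close>

lemma summands_bound:
  assumes \<xi>: "\<And>u. u \<in> Q \<Longrightarrow> u \<noteq> 0 \<Longrightarrow> 0 < u \<bullet> to_real \<xi>"
  shows "summands Q j u \<Longrightarrow> real j \<le> to_real u \<bullet> to_real \<xi>"
proof (induction j arbitrary: u)
  case 0
  then show ?case using \<xi>[of "to_real u"] by (cases "u = 0") (auto simp: summands_def)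
next
  case (Suc j)
  obtain w v where w: "u = w + v" "summands Q j v" "w \<noteq> 0" "to_real w \<in> Q" by (rule summands_SucD[OF Suc.prems])
  have "1 \<le> to_real w \<bullet> to_real \<xi>" using \<xi>[of "to_real w"] w by (intro to_real_inner_ge_1) auto
  then show ?case using Suc.IH[OF w(2)] w(1) by (simp add: inner_add_left)
qed

context
  fixes \<sigma> :: "(real ^ 'n::finite) set" and K :: "'k::field itself"
  assumes \<sigma>: "toric_cone \<sigma>" "span \<sigma> = UNIV"
begin

lemma order_at_fixed_point:
  assumes "to_real u \<in> dual_cone \<sigma>"
  shows "summands (dual_cone \<sigma>) (order_at_fixed_point K (dual_cone \<sigma>) u) u"
    and "\<And>j. summands (dual_cone \<sigma>) j u \<Longrightarrow> j \<le> order_at_fixed_point K (dual_cone \<sigma>) u"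
proof -
  obtain \<xi> :: "'n lattice" where \<xi>: "\<And>u. u \<in> dual_cone \<sigma> \<Longrightarrow> u \<noteq> 0 \<Longrightarrow> 0 < u \<bullet> to_real \<xi>"
    by (rule full_cone_dual_positive[OF \<sigma>]) blast
  let ?P = "\<lambda>j. (Poly_Mapping.single u 1 :: ('n, 'k) laurent) \<in>
     ideal_power (semigroup_algebra (dual_cone \<sigma>)) (irrelevant_ideal (dual_cone \<sigma>)) j"
  have P: "?P j \<longleftrightarrow> summands (dual_cone \<sigma>) j u" for j
    using keys_ideal_power_summands[OF convex_cone_dual_cone, of "Poly_Mapping.single u (1::'k)" \<sigma> j u]
      summands_ideal_power[of "dual_cone \<sigma>" j u] by auto
  have bd: "\<forall>j. ?P j \<longrightarrow> j \<le> nat \<lfloor>to_real u \<bullet> to_real \<xi>\<rfloor>"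
    unfolding P using summands_bound[OF \<xi>] by (metis le_nat_floor)
  have "?P 0" unfolding P by (rule summands_0[OF assms])
  have g: "order_at_fixed_point K (dual_cone \<sigma>) u = (GREATEST j. ?P j)" by (simp add: order_at_fixed_point_def)
  show "summands (dual_cone \<sigma>) (order_at_fixed_point K (dual_cone \<sigma>) u) u"
    unfolding g P[symmetric] by (rule GreatestI_nat[of ?P, OF \<open>?P 0\<close>]) (use bd in blast)
  show "j \<le> order_at_fixed_point K (dual_cone \<sigma>) u" if "summands (dual_cone \<sigma>) j u" for j
    unfolding g by (rule Greatest_le_nat[of ?P]) (use bd that P in blast)+
qed

text \<open>The origin of \<Gamma>. The integral parts of the coefficients contribute that many ray
  generators to the order; the fractional parts describe a lattice vector \<open>v\<close> of the
  half-open zonotope, where \<Gamma> compares coefficient sum and order. Orders are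
  superadditive.\<close>

theorem coefficient_sum_le_order:
  assumes a: "\<And>w. w \<in> ray_generators (dual_cone \<sigma>) \<Longrightarrow> 0 \<le> a w"
    and u: "to_real u = (\<Sum>w\<in>ray_generators (dual_cone \<sigma>). a w *\<^sub>R to_real w)"
  shows "(\<Sum>w\<in>ray_generators (dual_cone \<sigma>). a w)
    \<le> real (order_at_fixed_point K (dual_cone \<sigma>) u) + Gamma_const K (dual_cone \<sigma>)"
proof -
  let ?Q = "dual_cone \<sigma>"
  let ?R = "ray_generators ?Q"
  note R = ray_generators_dual[OF \<sigma>]
  note Q = convex_cone_dual_cone[of \<sigma>]
  obtain \<xi> :: "'n lattice" where \<xi>: "\<And>u. u \<in> ?Q \<Longrightarrow> u \<noteq> 0 \<Longrightarrow> 0 < u \<bullet> to_real \<xi>"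
    by (rule full_cone_dual_positive[OF \<sigma>]) blast
  define v where "v = u - (\<Sum>w\<in>?R. frag_cmul (int (nat \<lfloor>a w\<rfloor>)) w)"
  have v: "to_real v = (\<Sum>w\<in>?R. frac (a w) *\<^sub>R to_real w)"
    unfolding v_def to_real_simps to_real_sum u sum_subtractf[symmetric]
    using a by (intro sum.cong) (auto simp: frac_def algebra_simps)
  have vz: "to_real v \<in> half_open_zonotope ?Q"
    unfolding half_open_zonotope_def v
    by (rule CollectI, rule exI[of _ "\<lambda>w. frac (a w)"]) (simp add: frac_lt_1)
  \<comment> \<open>Boundedness makes the set of lattice points finite, so that the maximum defining
    \<Gamma> bounds its members.\<close>
  have "bounded (half_open_zonotope ?Q)"
  proof (rule boundedI)
    fix x assume "x \<in> half_open_zonotope ?Q"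
    then obtain c where c: "x = (\<Sum>w\<in>?R. c w *\<^sub>R to_real w)" "\<forall>w\<in>?R. 0 \<le> c w \<and> c w < 1"
      by (auto simp: half_open_zonotope_def)
    have "norm x \<le> (\<Sum>w\<in>?R. norm (c w *\<^sub>R to_real w))" unfolding c(1) by (rule norm_sum)
    also have "\<dots> \<le> (\<Sum>w\<in>?R. norm (to_real w))"
    proof (rule sum_mono)
      fix w assume "w \<in> ?R"
      then have "0 \<le> c w" "c w \<le> 1" using c(2) by (auto simp: less_imp_le)
      then show "norm (c w *\<^sub>R to_real w) \<le> norm (to_real w)" by (simp add: mult_left_le_one_le)
    qed
    finally show "norm x \<le> (\<Sum>w\<in>?R. norm (to_real w))" .
  qed
  then have fin: "finite (lattice_points (half_open_zonotope ?Q))"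
    unfolding lattice_points_def by (rule finite_lattice_bounded)
  have "{W_max ?Q u - real (order_at_fixed_point K ?Q u) | u. u \<in> lattice_points (half_open_zonotope ?Q)}
      = (\<lambda>u. W_max ?Q u - real (order_at_fixed_point K ?Q u)) ` lattice_points (half_open_zonotope ?Q)" by auto
  then have \<Gamma>: "W_max ?Q v - real (order_at_fixed_point K ?Q v) \<le> Gamma_const K ?Q"
    unfolding Gamma_const_def using fin vz by (intro Max_ge) (auto simp: lattice_points_def)
  have "(\<Sum>w\<in>?R. frac (a w)) \<le> W_max ?Q v"
    unfolding W_max_def
  proof (rule cSup_upper)
    show "(\<Sum>w\<in>?R. frac (a w)) \<in> {(\<Sum>w\<in>?R. c w) | c. (\<forall>w\<in>?R. 0 \<le> c w) \<and> to_real v = (\<Sum>w\<in>?R. c w *\<^sub>R to_real w)}"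
      by (rule CollectI, rule exI[of _ "\<lambda>w. frac (a w)"]) (simp add: v)
    \<comment> \<open>The supremum in \<open>W_max\<close> is an upper bound only for a bounded set.
      Each ray generator has height at least 1, so coefficient sums are at most the height of
      \<open>v\<close>.\<close>
    show "bdd_above {(\<Sum>w\<in>?R. c w) | c. (\<forall>w\<in>?R. 0 \<le> c w) \<and> to_real v = (\<Sum>w\<in>?R. c w *\<^sub>R to_real w)}"
    proof (rule bdd_aboveI[of _ "to_real v \<bullet> to_real \<xi>"])
      fix x assume "x \<in> {(\<Sum>w\<in>?R. c w) | c. (\<forall>w\<in>?R. 0 \<le> c w) \<and> to_real v = (\<Sum>w\<in>?R. c w *\<^sub>R to_real w)}"
      then obtain c where c: "x = (\<Sum>w\<in>?R. c w)" "\<forall>w\<in>?R. 0 \<le> c w" "to_real v = (\<Sum>w\<in>?R. c w *\<^sub>R to_real w)" by blast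
      have "c w * 1 \<le> c w * (to_real w \<bullet> to_real \<xi>)" if "w \<in> ?R" for w
        using c(2) R(2)[OF that] \<xi>[of "to_real w"] that
        by (intro mult_left_mono to_real_inner_ge_1) auto
      then have "x \<le> (\<Sum>w\<in>?R. c w * (to_real w \<bullet> to_real \<xi>))" unfolding c(1) by (intro sum_mono) simp
      also have "\<dots> = to_real v \<bullet> to_real \<xi>" unfolding c(3) by (simp add: inner_sum_left)
      finally show "x \<le> to_real v \<bullet> to_real \<xi>" .
    qed
  qed
  then have 1: "(\<Sum>w\<in>?R. frac (a w)) \<le> real (order_at_fixed_point K ?Q v) + Gamma_const K ?Q"
    using \<Gamma> by linarith
  have vQ: "to_real v \<in> ?Q" unfolding v using R(2)
    by (intro convex_cone_sum[OF Q] convex_cone_scaleR[OF Q]) auto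
  have uQ: "to_real u \<in> ?Q" unfolding u using R(2) a
    by (intro convex_cone_sum[OF Q] convex_cone_scaleR[OF Q]) auto
  have "summands ?Q (\<Sum>w\<in>?R. nat \<lfloor>a w\<rfloor>) (\<Sum>w\<in>?R. frag_cmul (int (nat \<lfloor>a w\<rfloor>)) w)"
    using R(2) by (intro summands_sum[OF Q] summands_multiple[OF Q]) auto
  from summands_add[OF Q order_at_fixed_point(1)[OF vQ] this]
  have "summands ?Q ((\<Sum>w\<in>?R. nat \<lfloor>a w\<rfloor>) + order_at_fixed_point K ?Q v) u" by (simp add: v_def)
  from order_at_fixed_point(2)[OF uQ this]
  have 2: "real (\<Sum>w\<in>?R. nat \<lfloor>a w\<rfloor>) + real (order_at_fixed_point K ?Q v) \<le> real (order_at_fixed_point K ?Q u)" by linarith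
  have "(\<Sum>w\<in>?R. a w) = (\<Sum>w\<in>?R. real (nat \<lfloor>a w\<rfloor>) + frac (a w))"
    using a by (intro sum.cong) (auto simp: frac_def)
  then show ?thesis using 1 2 by (simp add: sum.distrib)
qed

end

subsection \<open>Affine charts and their gluing\<close>

lemma dual_cone_antimono: "\<rho> \<subseteq> \<sigma> \<Longrightarrow> dual_cone \<sigma> \<subseteq> dual_cone \<rho>"
  by (auto simp: dual_cone_def)

lemma semigroup_algebra_mono: "P \<subseteq> Q \<Longrightarrow> semigroup_algebra P \<subseteq> semigroup_algebra Q"
  unfolding semigroup_algebra_iff[abs_def] subset_iff by (auto simp: semigroup_algebra_iff)

lemma dual_cone_multiple: "to_real u \<in> dual_cone \<sigma> \<Longrightarrow> to_real (frag_cmul (int n) u) \<in> dual_cone \<sigma>"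
  using convex_cone_scaleR[OF convex_cone_dual_cone, of "real n" "to_real u" \<sigma>] by simp

text \<open>Geometrically: inside the chart of \<sigma>, the chart of \<rho> is the open set where
  \<chi>^u does not vanish.\<close>

definition cuts_face :: "'n::finite lattice \<Rightarrow> (real ^ 'n) set \<Rightarrow> (real ^ 'n) set \<Rightarrow> bool" where
  "cuts_face u \<sigma> \<rho> \<longleftrightarrow> (\<forall>v\<in>\<sigma>. 0 \<le> to_real u \<bullet> v) \<and> \<rho> = {v \<in> \<sigma>. to_real u \<bullet> v = 0}"

lemma cuts_faceD:
  assumes "cuts_face u \<sigma> \<rho>"
  shows "to_real u \<in> dual_cone \<sigma>" "\<rho> \<subseteq> \<sigma>" "dual_cone \<sigma> \<subseteq> dual_cone \<rho>"
    "to_real u \<in> dual_cone \<rho>" "to_real (- u) \<in> dual_cone \<rho>"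
  using assms by (auto simp: cuts_face_def dual_cone_def)

text \<open>On semigroups: \<open>\<rho>\<^sup>\<or> \<inter> M\<close> is the localisation of \<open>\<sigma>\<^sup>\<or> \<inter> M\<close> at \<open>u\<close>.\<close>

lemma cuts_face_localize:
  assumes \<sigma>: "toric_cone \<sigma>" and u: "cuts_face u \<sigma> \<rho>" and w: "to_real w \<in> dual_cone \<rho>"
  shows "\<exists>N. to_real (w + frag_cmul (int N) u) \<in> dual_cone \<sigma>"
proof -
  obtain G :: "'a lattice set" where G: "finite G" "\<sigma> = convex_cone hull (to_real ` G)"
    by (rule toric_coneE[OF \<sigma>])
  \<comment> \<open>On a generator outside \<rho> the pairing with \<open>u\<close> is at least 1,
    so this many copies of \<open>u\<close> outweigh a negative pairing of \<open>w\<close>; on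
    generators in \<rho> the pairing of \<open>w\<close> is already nonnegative.\<close>
  define N where "N = (\<Sum>g\<in>G. nat \<bar>pairing w g\<bar>)"
  have "0 \<le> to_real (w + frag_cmul (int N) u) \<bullet> to_real g" if g: "g \<in> G" for g
  proof -
    have g\<sigma>: "to_real g \<in> \<sigma>" unfolding G(2) using g by (auto intro: hull_inc)
    have nn: "0 \<le> to_real u \<bullet> to_real g" using u g\<sigma> by (auto simp: cuts_face_def)
    show ?thesis
    proof (cases "to_real u \<bullet> to_real g = 0")
      case True
      then have "to_real g \<in> \<rho>" using u g\<sigma> by (auto simp: cuts_face_def)
      then have "0 \<le> to_real w \<bullet> to_real g" using w by (auto simp: dual_cone_def)
      then show ?thesis using True by (simp add: inner_add_left)
    next
      case False
      then have "1 \<le> to_real u \<bullet> to_real g" using nn by (intro to_real_inner_ge_1) simp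
      then have "real N * 1 \<le> real N * (to_real u \<bullet> to_real g)" by (intro mult_left_mono) auto
      moreover have "nat \<bar>pairing w g\<bar> \<le> N" unfolding N_def by (rule member_le_sum[OF g _ G(1)]) simp
      then have "- (to_real w \<bullet> to_real g) \<le> real N" unfolding inner_to_real by linarith
      ultimately show ?thesis by (simp add: inner_add_left)
    qed
  qed
  then show ?thesis unfolding G(2) dual_cone_convex_cone_hull by blast
qed

lemma cuts_face_localize_mono:
  assumes u: "cuts_face u \<sigma> \<rho>" and "to_real (w + frag_cmul (int N) u) \<in> dual_cone \<sigma>" "N \<le> M"
  shows "to_real (w + frag_cmul (int M) u) \<in> dual_cone \<sigma>"
proof -
  have "to_real (w + frag_cmul (int N) u) + (real M - real N) *\<^sub>R to_real u \<in> dual_cone \<sigma>"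
    using assms cuts_faceD(1)[OF u]
    by (intro convex_cone_add[OF convex_cone_dual_cone] convex_cone_scaleR[OF convex_cone_dual_cone]) auto
  then show ?thesis by (simp add: algebra_simps scaleR_left_diff_distrib)
qed

lemma affine_point_multiple:
  assumes "x \<in> affine_points \<sigma>" "to_real u \<in> dual_cone \<sigma>"
  shows "x (frag_cmul (int n) u) = x u ^ n"
proof (induction n)
  case 0
  then show ?case using affine_pointsD(1)[OF assms(1)] by simp
next
  case (Suc n)
  have "to_real (frag_cmul (int n) u) \<in> dual_cone \<sigma>"
    by (rule dual_cone_multiple[OF assms(2)])
  moreover have "frag_cmul (int (Suc n)) u = u + frag_cmul (int n) u"
    by (simp add: frag_cmul_distrib add.commute)
  ultimately show ?case using affine_pointsD(2)[OF assms(1,2)] Suc by simp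
qed

lemma affine_point_unit:
  assumes "z \<in> affine_points \<rho>" "to_real u \<in> dual_cone \<rho>" "to_real (- u) \<in> dual_cone \<rho>"
  shows "z u \<noteq> 0"
  using affine_pointsD(2)[OF assms] affine_pointsD(1)[OF assms(1)] by auto

lemma affine_points_restrict:
  assumes "z \<in> affine_points \<rho>" "\<rho> \<subseteq> \<sigma>"
  shows "restrict z (lattice_points (dual_cone \<sigma>)) \<in> affine_points \<sigma>"
proof -
  have d: "u \<in> dual_cone \<rho>" if "u \<in> dual_cone \<sigma>" for u using that dual_cone_antimono[OF assms(2)] by blast
  have "u + v \<in> dual_cone \<sigma>" if "u \<in> dual_cone \<sigma>" "v \<in> dual_cone \<sigma>" for u v
    using that by (rule convex_cone_add[OF convex_cone_dual_cone])
  then show ?thesis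
    using affine_pointsD[OF assms(1)] d convex_cone_contains_0[OF convex_cone_dual_cone, of \<sigma>]
    unfolding affine_points_def by (auto simp: lattice_points_def)
qed

lemma affine_point_eqI:
  assumes "x \<in> affine_points \<sigma>" "y \<in> affine_points \<sigma>" "\<And>u. to_real u \<in> dual_cone \<sigma> \<Longrightarrow> x u = y u"
  shows "x = y"
  by (rule extensionalityI[OF affine_pointsD(3)[OF assms(1)] affine_pointsD(3)[OF assms(2)]])
    (use assms(3) in \<open>auto simp: lattice_points_def\<close>)

text \<open>The extension is forced: its value at \<open>w\<close> is x(w + N u) / x(u)^N for any N
  that moves w + N u into the dual cone of \<sigma>, and the quotient does not depend on N.\<close>

lemma affine_point_extend:
  assumes \<sigma>: "toric_cone \<sigma>" and u: "cuts_face u \<sigma> \<rho>" and x: "x \<in> affine_points \<sigma>" and xu: "x u \<noteq> 0"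
  obtains z where "z \<in> affine_points \<rho>" "x = restrict z (lattice_points (dual_cone \<sigma>))"
proof -
  note D = cuts_faceD[OF u] and X = affine_pointsD[OF x]
  have mu: "to_real (frag_cmul (int n) u) \<in> dual_cone \<sigma>" for n
    by (rule dual_cone_multiple[OF D(1)])
  define N where "N w = (SOME N. to_real (w + frag_cmul (int N) u) \<in> dual_cone \<sigma>)" for w
  have N: "to_real (w + frag_cmul (int (N w)) u) \<in> dual_cone \<sigma>" if "to_real w \<in> dual_cone \<rho>" for w
    unfolding N_def using cuts_face_localize[OF \<sigma> u that] by (rule someI_ex)
  define z where "z = restrict (\<lambda>w. x (w + frag_cmul (int (N w)) u) / x u ^ N w) (lattice_points (dual_cone \<rho>))"
  have step: "x (w + frag_cmul (int M) u) / x u ^ M = x (w + frag_cmul (int L) u) / x u ^ L"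
    if "to_real (w + frag_cmul (int L) u) \<in> dual_cone \<sigma>" "L \<le> M" for w L M
  proof -
    have e: "w + frag_cmul (int M) u = (w + frag_cmul (int L) u) + frag_cmul (int (M - L)) u"
      using that(2) by (simp add: add.assoc flip: frag_cmul_distrib)
    have "x (w + frag_cmul (int M) u) = x (w + frag_cmul (int L) u) * x u ^ (M - L)"
      unfolding e X(2)[OF that(1) mu] affine_point_multiple[OF x D(1)] by (rule refl)
    then show ?thesis using that(2) xu by (simp add: power_diff)
  qed
  have zN: "z w = x (w + frag_cmul (int L) u) / x u ^ L"
    if "to_real w \<in> dual_cone \<rho>" "to_real (w + frag_cmul (int L) u) \<in> dual_cone \<sigma>" for w L
    using step[OF that(2), of "max L (N w)"] step[OF N[OF that(1)], of "max L (N w)"] that(1)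
    by (simp add: z_def lattice_points_def)
  have "z \<in> affine_points \<rho>"
    unfolding affine_points_def
  proof (intro CollectI conjI ballI)
    show "z \<in> extensional (lattice_points (dual_cone \<rho>))" unfolding z_def by simp
    have "z 0 = x (0 + frag_cmul (int 0) u) / x u ^ 0"
      by (rule zN) (simp_all add: convex_cone_contains_0[OF convex_cone_dual_cone])
    then show "z 0 = 1" using X(1) by simp
    fix v w assume "v \<in> lattice_points (dual_cone \<rho>)" "w \<in> lattice_points (dual_cone \<rho>)"
    then have vw: "to_real v \<in> dual_cone \<rho>" "to_real w \<in> dual_cone \<rho>" by (auto simp: lattice_points_def)
    have e: "v + w + frag_cmul (int (N v + N w)) u = (v + frag_cmul (int (N v)) u) + (w + frag_cmul (int (N w)) u)"
      by (simp add: frag_cmul_distrib algebra_simps)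
    have m: "to_real (v + w + frag_cmul (int (N v + N w)) u) \<in> dual_cone \<sigma>"
      unfolding e to_real_simps(1)[of "v + frag_cmul (int (N v)) u"]
      by (rule convex_cone_add[OF convex_cone_dual_cone N[OF vw(1)] N[OF vw(2)]])
    have vw': "to_real (v + w) \<in> dual_cone \<rho>"
      using vw convex_cone_add[OF convex_cone_dual_cone] by simp
    show "z (v + w) = z v * z w"
      unfolding zN[OF vw' m] zN[OF vw(1) N[OF vw(1)]] zN[OF vw(2) N[OF vw(2)]]
      unfolding e X(2)[OF N[OF vw(1)] N[OF vw(2)]] by (simp add: power_add)
  qed
  moreover have "x = restrict z (lattice_points (dual_cone \<sigma>))"
  proof (rule affine_point_eqI[OF x affine_points_restrict[OF calculation D(2)]])
    fix w assume w: "to_real w \<in> dual_cone \<sigma>"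
    then have "to_real w \<in> dual_cone \<rho>" using D(3) by blast
    from zN[OF this, of 0] w show "x w = restrict z (lattice_points (dual_cone \<sigma>)) w"
      by (simp add: lattice_points_def)
  qed
  ultimately show ?thesis using that by blast
qed

lemma affine_point_extend_unique:
  assumes \<sigma>: "toric_cone \<sigma>" and u: "cuts_face u \<sigma> \<rho>" and z: "z \<in> affine_points \<rho>" "z' \<in> affine_points \<rho>"
    and eq: "restrict z (lattice_points (dual_cone \<sigma>)) = restrict z' (lattice_points (dual_cone \<sigma>))"
  shows "z = z'"
proof (rule affine_point_eqI[OF z])
  note D = cuts_faceD[OF u]
  fix w assume w: "to_real w \<in> dual_cone \<rho>"
  have e: "z v = z' v" if "to_real v \<in> dual_cone \<sigma>" for v
    using fun_cong[OF eq, of v] that by (simp add: lattice_points_def)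
  obtain N where N: "to_real (w + frag_cmul (int N) u) \<in> dual_cone \<sigma>"
    using cuts_face_localize[OF \<sigma> u w] by blast
  have mu: "to_real (frag_cmul (int N) u) \<in> dual_cone \<rho>"
    by (rule dual_cone_multiple[OF D(4)])
  have "z w * z u ^ N = z' w * z' u ^ N"
    using e[OF N] affine_pointsD(2)[OF z(1) w mu] affine_pointsD(2)[OF z(2) w mu]
      affine_point_multiple[OF z(1) D(4)] affine_point_multiple[OF z(2) D(4)] by simp
  then show "z w = z' w" using e[OF D(1)] affine_point_unit[OF z(1) D(4,5)] by simp
qed

text \<open>The local ring of the chart of \<sigma> at \<open>x\<close>, written with one
  representative, whereas \<open>local_ring\<close> ranges over all representatives of a glued
  point.\<close>

definition chart_ring :: "(real ^ 'n::{finite,linorder}) set \<Rightarrow> ('n lattice \<Rightarrow> 'k::field) \<Rightarrow> ('n, 'k) function_field set" where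
  "chart_ring \<sigma> x = {Fract a b | a b. a \<in> semigroup_algebra (dual_cone \<sigma>) \<and>
     b \<in> semigroup_algebra (dual_cone \<sigma>) \<and> eval_at x b \<noteq> 0}"

definition chart_ideal :: "(real ^ 'n::{finite,linorder}) set \<Rightarrow> ('n lattice \<Rightarrow> 'k::field) \<Rightarrow> ('n, 'k) function_field set" where
  "chart_ideal \<sigma> x = {Fract a b | a b. a \<in> semigroup_algebra (dual_cone \<sigma>) \<and>
     b \<in> semigroup_algebra (dual_cone \<sigma>) \<and> eval_at x a = 0 \<and> eval_at x b \<noteq> 0}"

lemma eval_at_cong: "(\<And>u. u \<in> Poly_Mapping.keys f \<Longrightarrow> x u = y u) \<Longrightarrow> eval_at x f = eval_at y f"
  unfolding eval_at_def by (rule sum.cong) auto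

lemma eval_at_restrict:
  "f \<in> semigroup_algebra (dual_cone \<sigma>) \<Longrightarrow> eval_at (restrict z (lattice_points (dual_cone \<sigma>))) f = eval_at z f"
  by (rule eval_at_cong) (auto simp: semigroup_algebra_iff lattice_points_def)

text \<open>Passing to the smaller chart inverts only \<chi>^u, which is nonzero at
  \<open>z\<close>; multiplying numerator and denominator by a power of \<chi>^u brings a fraction
  back to the larger chart.\<close>

lemma chart_ring_restrict:
  fixes z :: "'n::{finite,linorder} lattice \<Rightarrow> 'k::field"
  assumes \<sigma>: "toric_cone \<sigma>" and u: "cuts_face u \<sigma> \<rho>" and z: "z \<in> affine_points \<rho>"
  defines "x \<equiv> restrict z (lattice_points (dual_cone \<sigma>))"
  shows "chart_ring \<sigma> x = chart_ring \<rho> z" "chart_ideal \<sigma> x = chart_ideal \<rho> z"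
proof -
  note D = cuts_faceD[OF u]
  have sub: "f \<in> semigroup_algebra (dual_cone \<rho>)" if "f \<in> semigroup_algebra (dual_cone \<sigma>)" for f :: "('n, 'k) laurent"
    using that semigroup_algebra_mono[OF D(3)] by blast
  have ev: "eval_at x f = eval_at z f" if "f \<in> semigroup_algebra (dual_cone \<sigma>)" for f
    unfolding x_def by (rule eval_at_restrict[OF that])
  have loc: "\<exists>N. \<forall>M\<ge>N. Poly_Mapping.single (frag_cmul (int M) u) 1 * f \<in> semigroup_algebra (dual_cone \<sigma>)"
    if f: "f \<in> semigroup_algebra (dual_cone \<rho>)" for f :: "('n, 'k) laurent"
  proof -
    have "\<forall>w\<in>Poly_Mapping.keys f. \<exists>N. to_real (w + frag_cmul (int N) u) \<in> dual_cone \<sigma>"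
      using f cuts_face_localize[OF \<sigma> u] by (auto simp: semigroup_algebra_iff)
    then obtain n where n: "\<forall>w\<in>Poly_Mapping.keys f. to_real (w + frag_cmul (int (n w)) u) \<in> dual_cone \<sigma>" by metis
    have "Poly_Mapping.single (frag_cmul (int M) u) 1 * f \<in> semigroup_algebra (dual_cone \<sigma>)"
      if M: "sum n (Poly_Mapping.keys f) \<le> M" for M
      unfolding semigroup_algebra_iff
    proof
      fix v assume v: "v \<in> Poly_Mapping.keys (Poly_Mapping.single (frag_cmul (int M) u) 1 * f)"
      obtain a w where "a \<in> Poly_Mapping.keys (Poly_Mapping.single (frag_cmul (int M) u) (1::'k))"
        "w \<in> Poly_Mapping.keys f" "v = a + w" by (rule keys_mult_obtain[OF v])
      then have w: "w \<in> Poly_Mapping.keys f" "v = w + frag_cmul (int M) u" by (auto simp: add.commute)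
      have nw: "n w \<le> sum n (Poly_Mapping.keys f)" using w(1) by (intro member_le_sum) auto
      show "to_real v \<in> dual_cone \<sigma>" unfolding w(2)
        by (rule cuts_face_localize_mono[OF u bspec[OF n w(1)] order.trans[OF nw M]])
    qed
    then show ?thesis by blast
  qed
  have ev2: "eval_at z (Poly_Mapping.single (frag_cmul (int M) u) 1 * f) = z u ^ M * eval_at z f"
    if f: "f \<in> semigroup_algebra (dual_cone \<rho>)" for f and M
  proof -
    have "Poly_Mapping.single (frag_cmul (int M) u) 1 \<in> semigroup_algebra (dual_cone \<rho>)"
      by (rule single_in_semigroup_algebra[OF dual_cone_multiple[OF D(4)]])
    from eval_at_mult[OF z this f] show ?thesis
      by (simp add: eval_at_single affine_point_multiple[OF z D(4)])
  qed
  have zu: "z u \<noteq> 0" by (rule affine_point_unit[OF z D(4,5)])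
  have tr: "\<exists>a' b'. Fract a b = Fract a' b' \<and> a' \<in> semigroup_algebra (dual_cone \<sigma>) \<and> b' \<in> semigroup_algebra (dual_cone \<sigma>)
      \<and> eval_at x b' \<noteq> 0 \<and> (eval_at z a = 0 \<longrightarrow> eval_at x a' = 0)"
    if ab: "a \<in> semigroup_algebra (dual_cone \<rho>)" "b \<in> semigroup_algebra (dual_cone \<rho>)" "eval_at z b \<noteq> 0" for a b
  proof -
    obtain N1 where N1: "\<forall>M\<ge>N1. Poly_Mapping.single (frag_cmul (int M) u) 1 * a \<in> semigroup_algebra (dual_cone \<sigma>)"
      using loc[OF ab(1)] by blast
    obtain N2 where N2: "\<forall>M\<ge>N2. Poly_Mapping.single (frag_cmul (int M) u) 1 * b \<in> semigroup_algebra (dual_cone \<sigma>)"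
      using loc[OF ab(2)] by blast
    define c where "c = (Poly_Mapping.single (frag_cmul (int (max N1 N2)) u) 1 :: ('n, 'k) laurent)"
    have cA: "c * a \<in> semigroup_algebra (dual_cone \<sigma>)" "c * b \<in> semigroup_algebra (dual_cone \<sigma>)"
      using N1 N2 by (auto simp: c_def)
    have "c \<noteq> 0" unfolding c_def by (metis lookup_single_eq lookup_zero zero_neq_one)
    then have "Fract a b = Fract (c * a) (c * b)" by (simp add: mult_fract_cancel)
    moreover have "eval_at x (c * b) \<noteq> 0" "eval_at z a = 0 \<longrightarrow> eval_at x (c * a) = 0"
      using ev[OF cA(1)] ev[OF cA(2)] ev2[OF ab(1)] ev2[OF ab(2)] zu ab(3) by (auto simp: c_def)
    ultimately show ?thesis using cA by blast
  qed
  show "chart_ring \<sigma> x = chart_ring \<rho> z"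
  proof
    show "chart_ring \<sigma> x \<subseteq> chart_ring \<rho> z" unfolding chart_ring_def using sub ev by force
    show "chart_ring \<rho> z \<subseteq> chart_ring \<sigma> x"
    proof
      fix h assume "h \<in> chart_ring \<rho> z"
      then obtain a b where "h = Fract a b" "a \<in> semigroup_algebra (dual_cone \<rho>)"
        "b \<in> semigroup_algebra (dual_cone \<rho>)" "eval_at z b \<noteq> 0" by (auto simp: chart_ring_def)
      then show "h \<in> chart_ring \<sigma> x" using tr[of a b] unfolding chart_ring_def by blast
    qed
  qed
  show "chart_ideal \<sigma> x = chart_ideal \<rho> z"
  proof
    show "chart_ideal \<sigma> x \<subseteq> chart_ideal \<rho> z" unfolding chart_ideal_def using sub ev by force
    show "chart_ideal \<rho> z \<subseteq> chart_ideal \<sigma> x"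
    proof
      fix h assume "h \<in> chart_ideal \<rho> z"
      then obtain a b where "h = Fract a b" "a \<in> semigroup_algebra (dual_cone \<rho>)"
        "b \<in> semigroup_algebra (dual_cone \<rho>)" "eval_at z b \<noteq> 0" "eval_at z a = 0" by (auto simp: chart_ideal_def)
      then show "h \<in> chart_ideal \<sigma> x" using tr[of a b] unfolding chart_ideal_def by blast
    qed
  qed
qed

section \<open>Points and local rings of the glued variety\<close>

locale toric_fan =
  fixes \<Delta> :: "(real ^ 'n::{finite,linorder}) set set"
  assumes fan: "fan \<Delta>"
begin

lemma cone: "\<sigma> \<in> \<Delta> \<Longrightarrow> toric_cone \<sigma>" and finite_cones: "finite \<Delta>" and cones_nonempty: "\<Delta> \<noteq> {}"
  and face: "\<sigma> \<in> \<Delta> \<Longrightarrow> \<rho> face_of \<sigma> \<Longrightarrow> \<rho> \<noteq> {} \<Longrightarrow> \<rho> \<in> \<Delta>"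
  and inter_face: "\<sigma> \<in> \<Delta> \<Longrightarrow> \<tau> \<in> \<Delta> \<Longrightarrow> \<sigma> \<inter> \<tau> face_of \<sigma>" "\<sigma> \<in> \<Delta> \<Longrightarrow> \<tau> \<in> \<Delta> \<Longrightarrow> \<sigma> \<inter> \<tau> face_of \<tau>"
  using fan unfolding fan_def by blast+

lemma inter_cone:
  assumes "\<sigma> \<in> \<Delta>" "\<tau> \<in> \<Delta>" shows "\<sigma> \<inter> \<tau> \<in> \<Delta>"
  using face[OF assms(1) inter_face(1)[OF assms]] toric_coneD(4)[OF cone] assms by auto

lemma separating_character:
  assumes "\<sigma> \<in> \<Delta>" "\<tau> \<in> \<Delta>"
  obtains u where "cuts_face u \<sigma> (\<sigma> \<inter> \<tau>)" "cuts_face (- u) \<tau> (\<sigma> \<inter> \<tau>)"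
proof -
  obtain u :: "'n lattice" where "\<And>v. v \<in> \<sigma> \<Longrightarrow> 0 \<le> to_real u \<bullet> v" "\<And>v. v \<in> \<sigma> \<Longrightarrow> to_real u \<bullet> v = 0 \<longleftrightarrow> v \<in> \<tau>"
    "\<And>v. v \<in> \<tau> \<Longrightarrow> to_real u \<bullet> v \<le> 0" "\<And>v. v \<in> \<tau> \<Longrightarrow> to_real u \<bullet> v = 0 \<longleftrightarrow> v \<in> \<sigma>"
    by (rule toric_cone_separation[OF cone[OF assms(1)] cone[OF assms(2)] inter_face[OF assms]]) blast
  then show ?thesis by (intro that[of u]) (auto simp: cuts_face_def)
qed

lemma gluingE:
  assumes "((\<sigma>, x), (\<tau>, y)) \<in> gluing \<Delta>"
  obtains z where "\<sigma> \<in> \<Delta>" "\<tau> \<in> \<Delta>" "x \<in> affine_points \<sigma>" "y \<in> affine_points \<tau>" "z \<in> affine_points (\<sigma> \<inter> \<tau>)"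
    "x = restrict z (lattice_points (dual_cone \<sigma>))" "y = restrict z (lattice_points (dual_cone \<tau>))"
  using assms unfolding gluing_def by auto

lemma gluingI:
  assumes "\<sigma> \<in> \<Delta>" "\<tau> \<in> \<Delta>" "z \<in> affine_points (\<sigma> \<inter> \<tau>)"
  shows "((\<sigma>, restrict z (lattice_points (dual_cone \<sigma>))), (\<tau>, restrict z (lattice_points (dual_cone \<tau>)))) \<in> gluing \<Delta>"
  using assms affine_points_restrict[OF assms(3), of \<sigma>] affine_points_restrict[OF assms(3), of \<tau>]
  by (auto simp: gluing_def)

lemma gluing_chart:
  assumes "((\<sigma>, x), (\<tau>, y)) \<in> gluing \<Delta>"
  shows "chart_ring \<sigma> x = chart_ring \<tau> y" "chart_ideal \<sigma> x = chart_ideal \<tau> y"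
proof -
  obtain z where z: "\<sigma> \<in> \<Delta>" "\<tau> \<in> \<Delta>" "z \<in> affine_points (\<sigma> \<inter> \<tau>)"
    "x = restrict z (lattice_points (dual_cone \<sigma>))" "y = restrict z (lattice_points (dual_cone \<tau>))"
    using gluingE[OF assms] by metis
  obtain u where u: "cuts_face u \<sigma> (\<sigma> \<inter> \<tau>)" "cuts_face (- u) \<tau> (\<sigma> \<inter> \<tau>)" by (rule separating_character[OF z(1,2)])
  show "chart_ring \<sigma> x = chart_ring \<tau> y" "chart_ideal \<sigma> x = chart_ideal \<tau> y"
    unfolding z(4,5) using chart_ring_restrict[OF cone[OF z(1)] u(1) z(3)] chart_ring_restrict[OF cone[OF z(2)] u(2) z(3)]
    by simp_all
qed

text \<open>Transitivity is the point. The middle point \<open>y\<close> lies in the overlaps with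
  both neighbours, so the sum of the two separating characters does not vanish at \<open>y\<close>;
  hence \<open>y\<close> comes from the chart of the triple intersection, and with it the outer
  points.\<close>

lemma equiv_gluing:
  "equiv (SIGMA \<sigma>:\<Delta>. affine_points \<sigma>) (gluing \<Delta> :: (((real, 'n) vec set \<times> ('n lattice \<Rightarrow> 'k::field)) \<times> _) set)"
  (is "equiv ?A ?G")
proof (rule equivI)
  show "?G \<subseteq> ?A \<times> ?A" by (auto simp: gluing_def)
  show "refl_on ?A ?G"
  proof (rule refl_onI)
    fix p :: "(real, 'n) vec set \<times> ('n lattice \<Rightarrow> 'k)" assume "p \<in> ?A"
    then obtain \<sigma> x where p: "p = (\<sigma>, x)" "\<sigma> \<in> \<Delta>" "x \<in> affine_points \<sigma>" by auto
    have "x = restrict x (lattice_points (dual_cone \<sigma>))"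
      using affine_pointsD(3)[OF p(3)] by (simp add: extensional_restrict)
    then show "(p, p) \<in> ?G" using gluingI[OF p(2) p(2), of x] p by simp
  qed
  show "sym ?G"
    by (rule symI) (auto simp: gluing_def Int_commute)
  show "trans ?G"
  proof (rule transI)
    fix p q r :: "(real, 'n) vec set \<times> ('n lattice \<Rightarrow> 'k)"
    assume pq: "(p, q) \<in> ?G" and qr: "(q, r) \<in> ?G"
    obtain \<sigma> x \<tau> y \<rho> w where e: "p = (\<sigma>, x)" "q = (\<tau>, y)" "r = (\<rho>, w)" by (metis surj_pair)
    obtain z1 where z1: "\<sigma> \<in> \<Delta>" "\<tau> \<in> \<Delta>" "y \<in> affine_points \<tau>" "z1 \<in> affine_points (\<sigma> \<inter> \<tau>)"
      "x = restrict z1 (lattice_points (dual_cone \<sigma>))" "y = restrict z1 (lattice_points (dual_cone \<tau>))"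
      using gluingE[OF pq[unfolded e]] by metis
    obtain z2 where z2: "\<rho> \<in> \<Delta>" "z2 \<in> affine_points (\<tau> \<inter> \<rho>)"
      "y = restrict z2 (lattice_points (dual_cone \<tau>))" "w = restrict z2 (lattice_points (dual_cone \<rho>))"
      using gluingE[OF qr[unfolded e]] by metis
    obtain u1 where u1: "cuts_face u1 \<tau> (\<sigma> \<inter> \<tau>)"
      using separating_character[OF z1(2,1)] by (metis Int_commute)
    obtain u2 where u2: "cuts_face u2 \<tau> (\<tau> \<inter> \<rho>)" using separating_character[OF z1(2) z2(1)] by metis
    have u: "cuts_face (u1 + u2) \<tau> (\<sigma> \<inter> \<tau> \<inter> \<rho>)"
    proof -
      have "to_real u1 \<bullet> v + to_real u2 \<bullet> v = 0 \<longleftrightarrow> to_real u1 \<bullet> v = 0 \<and> to_real u2 \<bullet> v = 0" if "v \<in> \<tau>" for v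
        using u1 u2 that by (intro add_nonneg_eq_0_iff) (auto simp: cuts_face_def)
      then show ?thesis using u1 u2 unfolding cuts_face_def by (auto simp: inner_add_left)
    qed
    have "y u1 = z1 u1" unfolding z1(6) using cuts_faceD(1)[OF u1] by (simp add: lattice_points_def)
    moreover have "y u2 = z2 u2" unfolding z2(3) using cuts_faceD(1)[OF u2] by (simp add: lattice_points_def)
    ultimately have nz: "y u1 \<noteq> 0" "y u2 \<noteq> 0"
      using affine_point_unit[OF z1(4) cuts_faceD(4,5)[OF u1]] affine_point_unit[OF z2(2) cuts_faceD(4,5)[OF u2]]
      by simp_all
    then have "y (u1 + u2) \<noteq> 0" using affine_pointsD(2)[OF z1(3) cuts_faceD(1)[OF u1] cuts_faceD(1)[OF u2]] by simp
    from affine_point_extend[OF cone[OF z1(2)] u z1(3) this] obtain z where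
      z: "z \<in> affine_points (\<sigma> \<inter> \<tau> \<inter> \<rho>)" "y = restrict z (lattice_points (dual_cone \<tau>))" by blast
    have big: "restrict z (lattice_points (dual_cone \<kappa>)) = z'"
      if \<kappa>: "\<sigma> \<inter> \<tau> \<inter> \<rho> \<subseteq> \<kappa>" "\<kappa> \<subseteq> \<tau>" "cuts_face u \<tau> \<kappa>" "z' \<in> affine_points \<kappa>"
        "y = restrict z' (lattice_points (dual_cone \<tau>))" for \<kappa> u z'
    proof (rule affine_point_extend_unique[OF cone[OF z1(2)] \<kappa>(3) affine_points_restrict[OF z(1) \<kappa>(1)] \<kappa>(4)])
      have "restrict (restrict z (lattice_points (dual_cone \<kappa>))) (lattice_points (dual_cone \<tau>))
          = restrict z (lattice_points (dual_cone \<tau>))"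
        using cuts_faceD(3)[OF \<kappa>(3)] by (auto simp: restrict_def lattice_points_def fun_eq_iff)
      then show "restrict (restrict z (lattice_points (dual_cone \<kappa>))) (lattice_points (dual_cone \<tau>)) =
          restrict z' (lattice_points (dual_cone \<tau>))" using z(2) \<kappa>(5) by simp
    qed
    have rr: "restrict (restrict z (lattice_points (dual_cone \<kappa>))) (lattice_points (dual_cone \<mu>))
        = restrict z (lattice_points (dual_cone \<mu>))" if "\<kappa> \<subseteq> \<mu>" for \<kappa> \<mu>
      using dual_cone_antimono[OF that] by (auto simp: restrict_def lattice_points_def fun_eq_iff)
    have "restrict z (lattice_points (dual_cone (\<sigma> \<inter> \<tau>))) = z1"
      by (rule big[OF _ _ u1 z1(4,6)]) auto
    moreover have "restrict z (lattice_points (dual_cone (\<tau> \<inter> \<rho>))) = z2"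
      by (rule big[OF _ _ u2 z2(2,3)]) auto
    ultimately have x: "x = restrict z (lattice_points (dual_cone \<sigma>))" and w: "w = restrict z (lattice_points (dual_cone \<rho>))"
      using z1(5) z2(4) rr[of "\<sigma> \<inter> \<tau>" \<sigma>] rr[of "\<tau> \<inter> \<rho>" \<rho>] by auto
    have "restrict z (lattice_points (dual_cone (\<sigma> \<inter> \<rho>))) \<in> affine_points (\<sigma> \<inter> \<rho>)"
      by (rule affine_points_restrict[OF z(1)]) auto
    from gluingI[OF z1(1) z2(1) this] show "(p, r) \<in> ?G"
      unfolding e x w using rr[of "\<sigma> \<inter> \<rho>" \<sigma>] rr[of "\<sigma> \<inter> \<rho>" \<rho>] by simp
  qed
qed

lemma point_rep:
  fixes p :: "('n, 'k::field) point"
  assumes "p \<in> toric_variety \<Delta>" "(\<sigma>, x) \<in> p"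
  shows "\<sigma> \<in> \<Delta>" "x \<in> affine_points \<sigma>" "p = gluing \<Delta> `` {(\<sigma>, x)}"
    "\<And>\<tau> y. (\<tau>, y) \<in> p \<Longrightarrow> ((\<sigma>, x), (\<tau>, y)) \<in> gluing \<Delta>"
proof -
  show g: "\<And>\<tau> y. (\<tau>, y) \<in> p \<Longrightarrow> ((\<sigma>, x), (\<tau>, y)) \<in> gluing \<Delta>"
    using quotient_eq_iff[OF equiv_gluing, of p p "(\<sigma>, x)"] assms unfolding toric_variety_def by blast
  from g[OF assms(2)] show s: "\<sigma> \<in> \<Delta>" "x \<in> affine_points \<sigma>" by (auto simp: gluing_def)
  have "gluing \<Delta> `` {(\<sigma>, x)} \<in> (SIGMA \<sigma>:\<Delta>. affine_points \<sigma>) // gluing \<Delta>"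
    using s by (intro quotientI) auto
  moreover have "(\<sigma>, x) \<in> gluing \<Delta> `` {(\<sigma>, x)}" using g[OF assms(2)] by auto
  ultimately show "p = gluing \<Delta> `` {(\<sigma>, x)}"
    using quotient_eqI[OF equiv_gluing, of p "gluing \<Delta> `` {(\<sigma>, x)}" "(\<sigma>, x)" "(\<sigma>, x)"] assms g[OF assms(2)]
    unfolding toric_variety_def by blast
qed

lemma point_in:
  assumes "\<sigma> \<in> \<Delta>" "x \<in> affine_points \<sigma>"
  shows "gluing \<Delta> `` {(\<sigma>, x)} \<in> toric_variety \<Delta>" "(\<sigma>, x) \<in> gluing \<Delta> `` {(\<sigma>, x)}"
proof -
  show "gluing \<Delta> `` {(\<sigma>, x)} \<in> toric_variety \<Delta>"
    unfolding toric_variety_def using assms by (intro quotientI) auto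
  show "(\<sigma>, x) \<in> gluing \<Delta> `` {(\<sigma>, x)}"
    using equiv_class_self[OF equiv_gluing, of "(\<sigma>, x)"] assms by auto
qed

lemma point_obtain:
  assumes "p \<in> toric_variety \<Delta>" obtains \<sigma> x where "(\<sigma>, x) \<in> p"
  using in_quotient_imp_non_empty[OF equiv_gluing] assms unfolding toric_variety_def by fastforce

lemma local_ring_eq:
  assumes "p \<in> toric_variety \<Delta>" "(\<sigma>, x) \<in> p"
  shows "local_ring p = chart_ring \<sigma> x" "max_ideal_at p = chart_ideal \<sigma> x"
proof -
  have "local_ring p = (\<Union>(\<tau>, y)\<in>p. chart_ring \<tau> y)" "max_ideal_at p = (\<Union>(\<tau>, y)\<in>p. chart_ideal \<tau> y)"
    unfolding local_ring_def max_ideal_at_def chart_ring_def chart_ideal_def by blast+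
  moreover have e: "chart_ring \<tau> y = chart_ring \<sigma> x" "chart_ideal \<tau> y = chart_ideal \<sigma> x" if "(\<tau>, y) \<in> p" for \<tau> y
    using gluing_chart[OF point_rep(4)[OF assms that]] by auto
  have "(\<Union>(\<tau>, y)\<in>p. chart_ring \<tau> y) = (\<Union>q\<in>p. chart_ring \<sigma> x)"
    "(\<Union>(\<tau>, y)\<in>p. chart_ideal \<tau> y) = (\<Union>q\<in>p. chart_ideal \<sigma> x)"
    by (intro SUP_cong[OF refl], simp only: split_beta e prod.collapse)+
  ultimately show "local_ring p = chart_ring \<sigma> x" "max_ideal_at p = chart_ideal \<sigma> x"
    using assms(2) by auto
qed

end

lemma subring_set_chart_ring:
  fixes x :: "'n::{finite,linorder} lattice \<Rightarrow> 'k::field"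
  assumes x: "x \<in> affine_points \<sigma>"
  shows "subring_set (chart_ring \<sigma> x)"
    and "a \<in> semigroup_algebra (dual_cone \<sigma>) \<Longrightarrow> Fract a 1 \<in> chart_ring \<sigma> x"
    and "a \<in> semigroup_algebra (dual_cone \<sigma>) \<Longrightarrow> eval_at x a = 0 \<Longrightarrow> Fract a 1 \<in> chart_ideal \<sigma> x"
    and "ideal_in (chart_ring \<sigma> x) (chart_ideal \<sigma> x)"
proof -
  let ?A = "semigroup_algebra (dual_cone \<sigma>) :: ('n, 'k) laurent set"
  note S = subring_setD[OF subring_set_semigroup_algebra[OF convex_cone_dual_cone[of \<sigma>]]]
  note ev = eval_at_mult[OF x] eval_at_add[of x] eval_at_diff[of x]
  have e1: "eval_at x 1 = 1" by (rule eval_at_1[OF x])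
  show R: "Fract a 1 \<in> chart_ring \<sigma> x" if "a \<in> ?A" for a
    unfolding chart_ring_def using that e1 S(1) by (intro CollectI exI[of _ a] exI[of _ 1]) auto
  show "Fract a 1 \<in> chart_ideal \<sigma> x" if "a \<in> ?A" "eval_at x a = 0" for a
    unfolding chart_ideal_def using that e1 S(1) by (intro CollectI exI[of _ a] exI[of _ 1]) auto
  have nz: "b \<noteq> 0" if "eval_at x b \<noteq> 0" for b :: "('n, 'k) laurent" using that by auto
  show "subring_set (chart_ring \<sigma> x)"
    unfolding subring_set_def
  proof (intro conjI ballI)
    show "1 \<in> chart_ring \<sigma> x" using R[OF S(1)] by (simp add: One_fract_def)
    fix g h assume "g \<in> chart_ring \<sigma> x" "h \<in> chart_ring \<sigma> x"
    then obtain a b c d where g: "g = Fract a b" "a \<in> ?A" "b \<in> ?A" "eval_at x b \<noteq> 0"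
      and h: "h = Fract c d" "c \<in> ?A" "d \<in> ?A" "eval_at x d \<noteq> 0" unfolding chart_ring_def by blast
    have bd: "b * d \<in> ?A" "eval_at x (b * d) \<noteq> 0" using g h S(4) ev(1) by auto
    have "g - h = Fract (a * d - c * b) (b * d)" unfolding g(1) h(1) by (rule diff_fract[OF nz[OF g(4)] nz[OF h(4)]])
    moreover have "a * d - c * b \<in> ?A" using g h S(3,4) by auto
    ultimately show "g - h \<in> chart_ring \<sigma> x" unfolding chart_ring_def using bd by blast
    have "g * h = Fract (a * c) (b * d)" unfolding g(1) h(1) by (rule mult_fract)
    moreover have "a * c \<in> ?A" using g h S(4) by auto
    ultimately show "g * h \<in> chart_ring \<sigma> x" unfolding chart_ring_def using bd by blast
  qed
  show "ideal_in (chart_ring \<sigma> x) (chart_ideal \<sigma> x)"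
    unfolding ideal_in_def
  proof (intro conjI ballI)
    show "chart_ideal \<sigma> x \<subseteq> chart_ring \<sigma> x" unfolding chart_ring_def chart_ideal_def by blast
    show "0 \<in> chart_ideal \<sigma> x"
      unfolding chart_ideal_def using e1 S(1,2) by (intro CollectI exI[of _ 0] exI[of _ 1]) (auto simp: fract_collapse)
    fix g h assume h: "h \<in> chart_ideal \<sigma> x"
    then obtain c d where h: "h = Fract c d" "c \<in> ?A" "d \<in> ?A" "eval_at x c = 0" "eval_at x d \<noteq> 0"
      unfolding chart_ideal_def by blast
    { assume "g \<in> chart_ideal \<sigma> x"
      then obtain a b where g: "g = Fract a b" "a \<in> ?A" "b \<in> ?A" "eval_at x a = 0" "eval_at x b \<noteq> 0"
        unfolding chart_ideal_def by blast
      have bd: "b * d \<in> ?A" "eval_at x (b * d) \<noteq> 0" using g h S(4) ev(1) by auto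
      have "g + h = Fract (a * d + c * b) (b * d)" unfolding g(1) h(1) by (rule add_fract[OF nz[OF g(5)] nz[OF h(5)]])
      moreover have "a * d \<in> ?A" "c * b \<in> ?A" using g h S(4) by auto
      then have "a * d + c * b \<in> ?A" by (rule S(6))
      moreover have "eval_at x (a * d + c * b) = 0" using g h ev by simp
      ultimately show "g + h \<in> chart_ideal \<sigma> x" unfolding chart_ideal_def using bd by blast }
    { assume "g \<in> chart_ring \<sigma> x"
      then obtain a b where g: "g = Fract a b" "a \<in> ?A" "b \<in> ?A" "eval_at x b \<noteq> 0"
        unfolding chart_ring_def by blast
      have bd: "b * d \<in> ?A" "eval_at x (b * d) \<noteq> 0" using g h S(4) ev(1) by auto
      have "g * h = Fract (a * c) (b * d)" unfolding g(1) h(1) by (rule mult_fract)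
      moreover have "a * c \<in> ?A" "eval_at x (a * c) = 0" using g h S(4) ev by auto
      ultimately show "g * h \<in> chart_ideal \<sigma> x" unfolding chart_ideal_def using bd by blast }
  qed
qed

subsection \<open>Projective toric varieties have complete fans\<close>

lemma span_full_interior:
  fixes \<tau> :: "(real ^ 'n::finite) set"
  assumes "convex_cone \<tau>" "span \<tau> = UNIV"
  shows "interior \<tau> = rel_interior \<tau>" "aff_dim \<tau> = int CARD('n)"
proof -
  have "0 \<in> \<tau>" by (rule convex_cone_contains_0[OF assms(1)])
  then have "affine hull \<tau> = UNIV" using affine_hull_span_0[of \<tau>] hull_inc assms(2) by metis
  then show "interior \<tau> = rel_interior \<tau>" by (simp add: rel_interior_interior)
  show "aff_dim \<tau> = int CARD('n)"
    using aff_dim_eq_full[of \<tau>] \<open>affine hull \<tau> = UNIV\<close> by simp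
qed

text \<open>A small step from \<open>z\<close> in direction -u stays in \<tau> and strictly lowers
  the pairing with \<open>u\<close>.\<close>

lemma interior_dual_positive:
  assumes "z \<in> interior \<tau>" "u \<in> dual_cone \<tau>" "u \<noteq> 0"
  shows "0 < u \<bullet> z"
proof -
  obtain e where e: "0 < e" "ball z e \<subseteq> \<tau>" using assms(1) by (auto simp: mem_interior)
  define w where "w = z - (e / (2 * norm u)) *\<^sub>R u"
  have "w \<in> ball z e" using e assms(3) by (simp add: w_def dist_norm)
  then have "0 \<le> u \<bullet> w" using e(2) assms(2) by (auto simp: dual_cone_def)
  moreover have "u \<bullet> w = u \<bullet> z - (e / (2 * norm u)) * (u \<bullet> u)" by (simp add: w_def inner_diff_right)
  moreover have "0 < (e / (2 * norm u)) * (u \<bullet> u)" using e(1) assms(3) by simp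
  ultimately show ?thesis by linarith
qed

text \<open>A finite union of proper subspaces is a null set.\<close>

lemma finite_union_subspaces_ne_UNIV:
  fixes \<S> :: "(real ^ 'n::finite) set set"
  assumes "finite \<S>"
  obtains v where "\<And>\<sigma>. \<sigma> \<in> \<S> \<Longrightarrow> span \<sigma> \<noteq> UNIV \<Longrightarrow> v \<notin> span \<sigma>"
proof -
  have "negligible (\<Union>\<sigma>\<in>{\<sigma> \<in> \<S>. span \<sigma> \<noteq> UNIV}. span \<sigma>)"
  proof (rule negligible_Union)
    show "finite (span ` {\<sigma> \<in> \<S>. span \<sigma> \<noteq> UNIV})" using assms by simp
    fix t assume "t \<in> span ` {\<sigma> \<in> \<S>. span \<sigma> \<noteq> UNIV}"
    then obtain \<sigma> where t: "t = span \<sigma>" "span \<sigma> \<noteq> UNIV" by auto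
    have "dim t < DIM(real ^ 'n)"
      using t dim_eq_full[of \<sigma>] dim_subset_UNIV[of \<sigma>] by (simp add: le_less)
    then show "negligible t" by (rule negligible_lowdim)
  qed
  then have "(\<Union>\<sigma>\<in>{\<sigma> \<in> \<S>. span \<sigma> \<noteq> UNIV}. span \<sigma>) \<noteq> UNIV" using non_negligible_UNIV by metis
  then show ?thesis using that by blast
qed

context toric_fan
begin

lemma complete_of_projective:
  assumes "projective_toric TYPE('k::field) \<Delta>"
  shows "\<Union>\<Delta> = UNIV"
proof -
  obtain S :: "('n, 'k) function_field set" where S: "finite S" "S \<noteq> {}" "0 \<notin> S"
    "local_ring ` toric_variety \<Delta> = (\<Union>s\<in>S. let R = subalgebra_generated ((\<lambda>t. t / s) ` S)
       in localization_at R ` {m. maximal_ideal_in R m})"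
    using assms unfolding projective_toric_def by blast
  have lat: "to_real y \<in> \<Union>\<Delta>" for y :: "'n lattice"
  proof -
    let ?y = "to_real y"
    let ?V = "valuation_ring ?y :: ('n, 'k) function_field set"
    let ?I = "valuation_ideal ?y :: ('n, 'k) function_field set"
    \<comment> \<open>Dividing by the coordinate \<open>s\<close> of least valuation puts all t / s
      into the valuation ring: the centre of the valuation lies on the affine piece of
      \<open>s\<close>.\<close>
    have "Min (monomial_val ?y ` S) \<in> monomial_val ?y ` S" using S(1,2) by (intro Min_in) auto
    then obtain s where s: "s \<in> S" "monomial_val ?y s = Min (monomial_val ?y ` S)" by auto
    have smin: "monomial_val ?y s \<le> monomial_val ?y t" if "t \<in> S" for t
      unfolding s(2) using S(1) that by (intro Min_le) auto
    define R where "R = subalgebra_generated ((\<lambda>t. t / s) ` S)"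
    have cV: "Fract (Poly_Mapping.single 0 c) 1 \<in> ?V" for c :: 'k
    proof (cases "c = 0")
      case True
      then show ?thesis by (simp add: valuation_ring_def fract_collapse)
    next
      case False
      have n: "Poly_Mapping.single (0 :: 'n lattice) c \<noteq> 0" using False by (metis lookup_single_eq lookup_zero)
      have "monomial_ord ?y (1 :: ('n, 'k) laurent) = 0"
        by (subst single_one[symmetric], subst monomial_ord_single) auto
      then have "monomial_val ?y (Fract (Poly_Mapping.single (0 :: 'n lattice) c) 1) = 0"
        using monomial_val_Fract[OF n, of 1 ?y] monomial_ord_single[OF False, of ?y 0] by simp
      then show ?thesis by (simp add: valuation_ring_def)
    qed
    have RV: "h \<in> ?V" if "h \<in> R" for h
      using that unfolding R_def
    proof induction
      case (gen g)
      then obtain t where t: "g = t / s" "t \<in> S" by auto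
      have "t \<noteq> 0" "s \<noteq> 0" using t(2) s(1) S(3) by auto
      then have "0 \<le> monomial_val ?y g" unfolding t(1) using smin[OF t(2)] by (simp add: monomial_val_divide)
      then show ?case by (simp add: valuation_ring_def)
    next
      case (const c)
      show ?case by (rule cV)
    next
      case (add a b)
      from add.IH show ?case by (rule valuation_ring_closed(1))
    next
      case (mult a b)
      from mult.IH show ?case by (rule valuation_ring_closed(2))
    qed
    have R1: "1 \<in> R" "0 \<in> R"
      using subalgebra_generated.const[of 1 "(\<lambda>t. t / s) ` S"] subalgebra_generated.const[of 0 "(\<lambda>t. t / s) ` S"]
      by (simp_all add: R_def fract_collapse)
    \<comment> \<open>This is the ideal of the centre. It need not be maximal, but a closed point in
      its closure suffices: denominators outside \<open>m\<close> are units of the valuation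
      ring.\<close>
    have "ideal_in R (R \<inter> ?I)"
      unfolding ideal_in_def
    proof (intro conjI ballI)
      show "0 \<in> R \<inter> ?I" using R1 by (simp add: valuation_ideal_def)
      show "a + b \<in> R \<inter> ?I" if "a \<in> R \<inter> ?I" "b \<in> R \<inter> ?I" for a b
        using that valuation_ring_closed(3)[of a ?y b] unfolding R_def by (auto intro: subalgebra_generated.add)
      show "r * a \<in> R \<inter> ?I" if "r \<in> R" "a \<in> R \<inter> ?I" for r a
        using that valuation_ring_closed(4)[OF RV[OF that(1)], of a] unfolding R_def
        by (auto intro: subalgebra_generated.mult)
    qed simp
    moreover have "1 \<notin> R \<inter> ?I" by (simp add: valuation_ideal_def)
    ultimately obtain m where m: "maximal_ideal_in R m" "R \<inter> ?I \<subseteq> m"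
      using maximal_ideal_exists[OF R1(1)] by blast
    have "localization_at R m \<in> local_ring ` toric_variety \<Delta>"
      unfolding S(4) Let_def using s(1) m(1) R_def by blast
    then obtain p where p: "p \<in> toric_variety \<Delta>" "local_ring p = localization_at R m" by auto
    have sub: "local_ring p \<subseteq> ?V"
    proof
      fix h assume "h \<in> local_ring p"
      then obtain a b where ab: "h = a / b" "a \<in> R" "b \<in> R - m" unfolding p(2) localization_at_def by blast
      then have "b \<in> ?V - ?I" using RV m(2) by blast
      then show "h \<in> ?V" unfolding ab(1) by (rule valuation_ring_closed(5)[OF RV[OF ab(2)]])
    qed
    obtain \<sigma> x where x: "(\<sigma>, x) \<in> p" by (rule point_obtain[OF p(1)])
    note rep = point_rep[OF p(1) x]
    have pos: "0 \<le> to_real u \<bullet> ?y" if u: "to_real u \<in> dual_cone \<sigma>" for u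
    proof -
      have "Fract (Poly_Mapping.single u (1::'k)) 1 \<in> chart_ring \<sigma> x"
        by (rule subring_set_chart_ring(2)[OF rep(2) single_in_semigroup_algebra[OF u]])
      then have V: "Fract (Poly_Mapping.single u (1::'k)) 1 \<in> ?V"
        using sub local_ring_eq(1)[OF p(1) x] by blast
      have n: "Poly_Mapping.single u (1::'k) \<noteq> 0" by (metis lookup_single_eq lookup_zero zero_neq_one)
      have "monomial_ord ?y (1 :: ('n, 'k) laurent) = 0"
        by (subst single_one[symmetric], subst monomial_ord_single) auto
      then have "monomial_val ?y (Fract (Poly_Mapping.single u (1::'k)) 1) = to_real u \<bullet> ?y"
        using monomial_val_Fract[OF n, of 1 ?y] by simp
      then show ?thesis using V n by (auto simp: valuation_ring_def eq_fract Zero_fract_def)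
    qed
    \<comment> \<open>Bipolarity. The separating vector is real, while \<open>pos\<close> speaks of
      lattice vectors; sign approximation with \<open>y\<close> among the test vectors bridges the
      gap, and for this \<open>y\<close> is taken from the lattice.\<close>
    have "?y \<in> \<sigma>"
    proof (rule ccontr)
      assume "?y \<notin> \<sigma>"
      then obtain u where u: "u \<in> dual_cone \<sigma>" "u \<bullet> ?y < 0"
        using dual_cone_separation[OF toric_coneD(1,2)[OF cone[OF rep(1)]]] by blast
      obtain G :: "'n lattice set" where G: "finite G" "\<sigma> = convex_cone hull (to_real ` G)"
        by (rule toric_coneE[OF cone[OF rep(1)]])
      obtain w :: "'n lattice" where w: "\<And>h. h \<in> insert y G \<Longrightarrow> sgn (to_real w \<bullet> to_real h) = sgn (u \<bullet> to_real h)"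
        by (rule lattice_sgn_approx[of "insert y G" u]) (use G in auto)
      have "to_real w \<in> dual_cone \<sigma>"
        unfolding G(2) dual_cone_convex_cone_hull
      proof (intro CollectI ballI)
        fix v assume "v \<in> to_real ` G"
        then obtain g where g: "v = to_real g" "g \<in> G" by auto
        have "v \<in> \<sigma>" unfolding G(2) g(1) using g(2) by (auto intro: hull_inc)
        then have "0 \<le> u \<bullet> v" using u(1) by (auto simp: dual_cone_def)
        then show "0 \<le> to_real w \<bullet> v" using w[of g] g by (simp add: sgn_if split: if_splits)
      qed
      moreover have "to_real w \<bullet> ?y < 0" using w[of y] u(2) by (simp add: sgn_if split: if_splits)
      ultimately show False using pos by (meson not_less)
    qed
    then show ?thesis using rep(1) by blast
  qed
  \<comment> \<open>Cones that cover the lattice cover all rational vectors, which are dense, and a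
    finite union of closed cones is closed.\<close>
  have "closed (\<Union>\<Delta>)" using finite_cones cone toric_coneD(2) by (intro closed_Union) auto
  moreover have "y \<in> closure (\<Union>\<Delta>)" for y :: "(real, 'n) vec"
    unfolding closure_approachable
  proof (intro allI impI)
    fix e :: real assume e: "0 < e"
    define N where "N = nat \<lceil>real CARD('n) / e\<rceil> + 1"
    have N: "0 < N" "real CARD('n) / e < real N" unfolding N_def by linarith+
    define u :: "'n lattice" where "u = Abs_poly_mapping (\<lambda>i. \<lfloor>real N * (y $ i)\<rfloor>)"
    have u: "to_real u $ i = of_int \<lfloor>real N * (y $ i)\<rfloor>" for i
      unfolding u_def to_real_def by (simp add: Abs_poly_mapping_inverse)
    obtain \<sigma> where \<sigma>: "\<sigma> \<in> \<Delta>" "to_real u \<in> \<sigma>" using lat[of u] by blast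
    have "(1 / real N) *\<^sub>R to_real u \<in> \<sigma>"
      by (rule convex_cone_scaleR[OF toric_coneD(1)[OF cone[OF \<sigma>(1)]] _ \<sigma>(2)]) simp
    moreover have "dist ((1 / real N) *\<^sub>R to_real u) y < e"
    proof -
      have "norm ((1 / real N) *\<^sub>R to_real u - y) \<le> (\<Sum>i\<in>UNIV. \<bar>((1 / real N) *\<^sub>R to_real u - y) $ i\<bar>)"
        by (rule norm_le_l1_cart)
      also have "\<dots> \<le> (\<Sum>i\<in>(UNIV::'n set). 1 / real N)"
      proof (rule sum_mono)
        fix i
        have "\<bar>of_int \<lfloor>real N * (y $ i)\<rfloor> - real N * (y $ i)\<bar> \<le> 1" by linarith
        then have "\<bar>of_int \<lfloor>real N * (y $ i)\<rfloor> - real N * (y $ i)\<bar> / real N \<le> 1 / real N"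
          using N(1) by (intro divide_right_mono) auto
        moreover have "((1 / real N) *\<^sub>R to_real u - y) $ i = (of_int \<lfloor>real N * (y $ i)\<rfloor> - real N * (y $ i)) / real N"
          using N(1) by (simp add: u field_simps)
        ultimately show "\<bar>((1 / real N) *\<^sub>R to_real u - y) $ i\<bar> \<le> 1 / real N" by (simp add: abs_divide)
      qed
      also have "\<dots> = real CARD('n) / real N" by simp
      also have "\<dots> < e" using N e by (simp add: divide_simps mult.commute split: if_splits)
      finally show ?thesis by (simp add: dist_norm)
    qed
    ultimately show "\<exists>y'\<in>\<Union>\<Delta>. dist y' y < e" using \<sigma>(1) by blast
  qed
  ultimately show ?thesis by (metis UNIV_eq_I closure_closed)
qed

end

section \<open>Complete fans and generic directions\<close>

locale complete_toric_fan = toric_fan \<Delta> for \<Delta> :: "(real ^ 'n::{finite,linorder}) set set" +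
  assumes complete: "\<Union>\<Delta> = UNIV"
begin

text \<open>A minimal cone containing \<open>z\<close> has it in none of its facets, as these belong
  to the fan.\<close>

lemma cone_in_rel_interior:
  obtains \<kappa> where "\<kappa> \<in> \<Delta>" "z \<in> rel_interior \<kappa>"
proof -
  have fin: "finite {\<kappa> \<in> \<Delta>. z \<in> \<kappa>}" using finite_cones by simp
  obtain \<sigma> where "\<sigma> \<in> \<Delta>" "z \<in> \<sigma>" using complete by blast
  then have ne: "{\<kappa> \<in> \<Delta>. z \<in> \<kappa>} \<noteq> {}" by blast
  obtain \<kappa> where \<kappa>: "\<kappa> \<in> \<Delta>" "z \<in> \<kappa>" and mn: "\<And>\<mu>. \<mu> \<in> \<Delta> \<Longrightarrow> z \<in> \<mu> \<Longrightarrow> \<mu> \<subseteq> \<kappa> \<Longrightarrow> \<kappa> = \<mu>"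
    using finite_has_minimal[OF fin ne] by blast
  have "z \<in> rel_interior \<kappa>"
  proof (rule ccontr)
    assume "z \<notin> rel_interior \<kappa>"
    then have "z \<in> rel_frontier \<kappa>"
      using \<kappa>(2) toric_coneD(2)[OF cone[OF \<kappa>(1)]] by (simp add: rel_frontier_def)
    then obtain F where F: "F facet_of \<kappa>" "z \<in> F"
      using rel_frontier_of_polyhedron[OF toric_coneD(3)[OF cone[OF \<kappa>(1)]]] by auto
    then have "F \<in> \<Delta>" using face[OF \<kappa>(1), of F] facet_of_imp_face_of by blast
    then have "\<kappa> = F" using mn[of F] F facet_of_imp_subset by blast
    then show False using F(1) by (simp add: facet_of_def)
  qed
  then show ?thesis using that \<kappa>(1) by blast
qed

text \<open>General position: a perturbation in such a direction ends inside a full-dimensional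
  cone. The vector may be irrational; only comparisons of pairings with it are used.\<close>

definition generic :: "(real, 'n::{finite,linorder}) vec \<Rightarrow> bool" where
  "generic v \<longleftrightarrow> (\<forall>\<sigma>\<in>\<Delta>. span \<sigma> \<noteq> UNIV \<longrightarrow> v \<notin> span \<sigma>)"

lemma generic_exists: obtains v where "generic v"
  using finite_union_subspaces_ne_UNIV[OF finite_cones] unfolding generic_def by metis

text \<open>Points approaching a relative interior point \<open>w\<close> of \<gamma> along
  \<open>v\<close> fall infinitely often into the relative interior of one cone \<tau>. Two of them
  differ by a multiple of \<open>v\<close>, so genericity makes \<tau> full-dimensional. Their limit
  \<open>w\<close> lies in \<tau>, and the face \<gamma> \<inter> \<tau>, containing a relative
  interior point of \<gamma>, is \<gamma>.\<close>

lemma perturb_into_full_cone: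
  assumes v: "generic v" and \<gamma>: "\<gamma> \<in> \<Delta>"
  obtains \<tau> w \<epsilon> where "\<tau> \<in> \<Delta>" "span \<tau> = UNIV" "\<gamma> \<subseteq> \<tau>" "w \<in> \<gamma>" "0 < \<epsilon>" "w + \<epsilon> *\<^sub>R v \<in> interior \<tau>"
proof -
  note C = toric_coneD[OF cone[OF \<gamma>]]
  have "rel_interior \<gamma> \<noteq> {}" using C(1,4) rel_interior_eq_empty[of \<gamma>] by (auto simp: convex_cone_def)
  then obtain w where w: "w \<in> rel_interior \<gamma>" by blast
  define z where "z n = w + (1 / real (Suc n)) *\<^sub>R v" for n
  have "\<exists>\<kappa>. \<kappa> \<in> \<Delta> \<and> z n \<in> rel_interior \<kappa>" for n using cone_in_rel_interior[of "z n"] by blast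
  then obtain f where f: "\<And>n. f n \<in> \<Delta>" "\<And>n. z n \<in> rel_interior (f n)" by metis
  have "finite (range f)" using finite_subset[OF _ finite_cones] f(1) by blast
  then obtain n0 where inf: "infinite {n. f n = f n0}"
    using pigeonhole_infinite[of "UNIV :: nat set" f] by auto
  define \<tau> where "\<tau> = f n0"
  have \<tau>: "\<tau> \<in> \<Delta>" unfolding \<tau>_def by (rule f(1))
  note T = toric_coneD[OF cone[OF \<tau>]]
  have z\<tau>: "z n \<in> rel_interior \<tau>" if "f n = f n0" for n using f(2)[of n] that by (simp add: \<tau>_def)
  obtain n1 where n1: "f n1 = f n0" "n0 < n1" using inf by (metis (mono_tags, lifting) infinite_nat_iff_unbounded mem_Collect_eq)
  have "v \<in> span \<tau>"
  proof -
    define c where "c = 1 / real (Suc n0) - 1 / real (Suc n1)"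
    have c: "c \<noteq> 0" using n1(2) by (simp add: c_def divide_inverse)
    have "z n0 - z n1 = c *\<^sub>R v" by (simp add: z_def c_def scaleR_diff_left)
    moreover have "z n0 \<in> span \<tau>" "z n1 \<in> span \<tau>"
      using z\<tau>[of n0] z\<tau>[of n1] n1(1) rel_interior_subset[of \<tau>] span_base by blast+
    ultimately have "c *\<^sub>R v \<in> span \<tau>" using span_diff by metis
    then have "(1 / c) *\<^sub>R (c *\<^sub>R v) \<in> span \<tau>" by (rule span_scale)
    then show ?thesis using c by simp
  qed
  then have full: "span \<tau> = UNIV" using v \<tau> by (auto simp: generic_def)
  have "w \<in> closure \<tau>"
    unfolding closure_approachable
  proof (intro allI impI)
    fix e :: real assume e: "0 < e"
    obtain m where m: "norm v / e < real m" using reals_Archimedean2 by blast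
    obtain n where n: "f n = f n0" "m < n"
      using inf by (metis (mono_tags, lifting) infinite_nat_iff_unbounded mem_Collect_eq)
    have "norm v / e < real (Suc n)" using m n(2) by linarith
    then have "norm v / real (Suc n) < e" using e by (simp add: divide_simps mult.commute split: if_splits)
    moreover have "dist (z n) w = norm v / real (Suc n)" by (simp add: z_def dist_norm)
    ultimately show "\<exists>y\<in>\<tau>. dist y w < e" using z\<tau>[OF n(1)] rel_interior_subset[of \<tau>] by (intro bexI[of _ "z n"]) auto
  qed
  then have "w \<in> \<tau>" using T(2) by (simp add: closure_closed)
  moreover have wg: "w \<in> \<gamma>" using w rel_interior_subset by blast
  ultimately have "\<gamma> \<inter> \<tau> \<inter> rel_interior \<gamma> \<noteq> {}" using w by blast
  from subset_of_face_of[OF inter_face(1)[OF \<gamma> \<tau>] order_refl this] have "\<gamma> \<subseteq> \<tau>" by blast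
  moreover have "w + (1 / real (Suc n0)) *\<^sub>R v \<in> interior \<tau>"
    using z\<tau>[of n0] span_full_interior(1)[OF T(1) full] by (simp add: z_def)
  ultimately show ?thesis by (intro that[of \<tau> w "1 / real (Suc n0)"]) (use \<tau> full wg in auto)
qed

lemma full_cone_maximal:
  assumes "\<tau> \<in> \<Delta>" "span \<tau> = UNIV" "\<sigma> \<in> \<Delta>" "\<tau> \<subseteq> \<sigma>"
  shows "\<sigma> = \<tau>"
proof (rule ccontr)
  assume ne: "\<sigma> \<noteq> \<tau>"
  have "\<tau> face_of \<sigma>" using inter_face(2)[OF assms(1,3)] assms(4) by (simp add: Int_absorb2)
  moreover have "convex \<sigma>" using toric_coneD(1)[OF cone[OF assms(3)]] by (simp add: convex_cone_def)
  ultimately have "aff_dim \<tau> < aff_dim \<sigma>" using face_of_aff_dim_lt ne by metis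
  moreover have "aff_dim \<sigma> \<le> int CARD('n)" using aff_dim_le_DIM[of \<sigma>] by simp
  ultimately show False
    using span_full_interior(2)[OF toric_coneD(1)[OF cone[OF assms(1)]] assms(2)] by simp
qed

lemma maximal_cones_eq: "maximal_cones \<Delta> = {\<sigma> \<in> \<Delta>. span \<sigma> = UNIV}"
proof
  show "{\<sigma> \<in> \<Delta>. span \<sigma> = UNIV} \<subseteq> maximal_cones \<Delta>"
    unfolding maximal_cones_def using full_cone_maximal by blast
  show "maximal_cones \<Delta> \<subseteq> {\<sigma> \<in> \<Delta>. span \<sigma> = UNIV}"
  proof
    fix \<sigma> assume \<sigma>: "\<sigma> \<in> maximal_cones \<Delta>"
    obtain v where v: "generic v" by (rule generic_exists)
    have \<sigma>\<Delta>: "\<sigma> \<in> \<Delta>" using \<sigma> by (simp add: maximal_cones_def)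
    obtain \<tau> where "\<tau> \<in> \<Delta>" "span \<tau> = UNIV" "\<sigma> \<subseteq> \<tau>"
      using perturb_into_full_cone[OF v \<sigma>\<Delta>] by metis
    then show "\<sigma> \<in> {\<sigma> \<in> \<Delta>. span \<sigma> = UNIV}" using \<sigma> by (auto simp: maximal_cones_def)
  qed
qed

lemma maximal_coneD:
  assumes "\<sigma> \<in> maximal_cones \<Delta>"
  shows "\<sigma> \<in> \<Delta>" "toric_cone \<sigma>" "span \<sigma> = UNIV"
  using assms cone by (auto simp: maximal_cones_eq)

lemma maximal_cone_above:
  assumes "\<gamma> \<in> \<Delta>" obtains \<tau> where "\<tau> \<in> maximal_cones \<Delta>" "\<gamma> \<subseteq> \<tau>" "\<gamma> face_of \<tau>"
proof -
  obtain v where v: "generic v" by (rule generic_exists)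
  obtain \<tau> where t: "\<tau> \<in> \<Delta>" "span \<tau> = UNIV" "\<gamma> \<subseteq> \<tau>" using perturb_into_full_cone[OF v assms] by metis
  moreover have "\<gamma> face_of \<tau>" using inter_face(2)[OF assms t(1)] t(3) by (simp add: Int_absorb2)
  ultimately show ?thesis using that by (auto simp: maximal_cones_eq)
qed

lemma maximal_cones_cover: obtains \<tau> where "\<tau> \<in> maximal_cones \<Delta>" "z \<in> \<tau>"
proof -
  obtain \<gamma> where "\<gamma> \<in> \<Delta>" "z \<in> \<gamma>" using complete by blast
  then show ?thesis using that maximal_cone_above by blast
qed

lemma finite_maximal_cones: "finite (maximal_cones \<Delta>)"
  using finite_cones by (auto simp: maximal_cones_def)

end

subsection \<open>Ampleness and strict convexity\<close>

text \<open>The torus-fixed point of the chart. For a full-dimensional cone only 0 is invertible in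
  the semigroup, which makes this a homomorphism.\<close>

definition fixed_point :: "(real ^ 'n::finite) set \<Rightarrow> 'n lattice \<Rightarrow> 'k::field" where
  "fixed_point \<sigma> = restrict (\<lambda>u. if u = 0 then 1 else 0) (lattice_points (dual_cone \<sigma>))"

lemma dual_cone_pointed:
  assumes "toric_cone \<sigma>" "span \<sigma> = UNIV" "u \<in> dual_cone \<sigma>" "v \<in> dual_cone \<sigma>" "u + v = 0"
  shows "u = 0" "v = 0"
proof -
  obtain \<xi> where \<xi>: "\<And>u. u \<in> dual_cone \<sigma> \<Longrightarrow> u \<noteq> 0 \<Longrightarrow> 0 < u \<bullet> to_real \<xi>"
    by (rule full_cone_dual_positive[OF assms(1,2)]) blast
  have "u \<bullet> to_real \<xi> + v \<bullet> to_real \<xi> = 0" using assms(5) by (metis inner_add_left inner_zero_left)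
  then show "u = 0" using \<xi>[OF assms(3)] \<xi>[OF assms(4)] by (cases "v = 0") (use assms(5) in \<open>fastforce+\<close>)
  then show "v = 0" using assms(5) by simp
qed

lemma fixed_point_affine:
  fixes \<sigma> :: "(real ^ 'n::finite) set"
  assumes "toric_cone \<sigma>" "span \<sigma> = UNIV"
  shows "(fixed_point \<sigma> :: 'n lattice \<Rightarrow> 'k::field) \<in> affine_points \<sigma>"
proof -
  have "u + v = 0 \<longleftrightarrow> u = 0 \<and> v = 0" if "to_real u \<in> dual_cone \<sigma>" "to_real v \<in> dual_cone \<sigma>" for u v :: "'n lattice"
    using dual_cone_pointed[OF assms that] by (metis add_0 to_real_eq_0_iff to_real_simps(1))
  then show ?thesis
    using convex_cone_contains_0[OF convex_cone_dual_cone[of \<sigma>]] convex_cone_add[OF convex_cone_dual_cone[of \<sigma>]]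
    unfolding affine_points_def fixed_point_def by (auto simp: lattice_points_def)
qed

lemma eval_at_fixed_point:
  fixes f :: "('n::finite, 'k::field) laurent"
  assumes "f \<in> semigroup_algebra (dual_cone \<sigma>)"
  shows "eval_at (fixed_point \<sigma>) f = Poly_Mapping.lookup f 0"
proof -
  have "eval_at (fixed_point \<sigma>) f = eval_at (\<lambda>u. if u = 0 then 1 else 0) f"
    unfolding fixed_point_def by (rule eval_at_restrict[OF assms])
  also have "\<dots> = (\<Sum>u\<in>Poly_Mapping.keys f. if u = 0 then Poly_Mapping.lookup f u else 0)"
    unfolding eval_at_def by (rule sum.cong) auto
  also have "\<dots> = Poly_Mapping.lookup f 0" by (simp add: in_keys_iff)
  finally show ?thesis .
qed

section \<open>Cartier data and stalks of the line bundle\<close>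

context toric_fan
begin

lemma ray_generator:
  assumes "\<rho> \<in> rays \<Delta>"
  shows "primitive (ray_generator \<rho>)" "to_real (ray_generator \<rho>) \<in> \<rho>" "\<rho> = {t *\<^sub>R to_real (ray_generator \<rho>) | t. 0 \<le> t}"
proof -
  have r: "\<rho> \<in> \<Delta>" "aff_dim \<rho> = 1" using assms by (auto simp: rays_def)
  have "convex \<rho>" using toric_coneD(1)[OF cone[OF r(1)]] by (simp add: convex_cone_def)
  then have f: "\<rho> face_of \<rho>" by (rule face_of_refl)
  note P = toric_cone_ray_primitive[OF cone[OF r(1)] f r(2)]
  from theI'[OF P(1)] show 1: "primitive (ray_generator \<rho>)" "to_real (ray_generator \<rho>) \<in> \<rho>"
    unfolding ray_generator_def by auto
  show "\<rho> = {t *\<^sub>R to_real (ray_generator \<rho>) | t. 0 \<le> t}" by (rule P(2)[OF 1])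
qed

lemma dual_cone_iff_rays:
  assumes "\<sigma> \<in> \<Delta>"
  shows "u \<in> dual_cone \<sigma> \<longleftrightarrow> (\<forall>\<rho>\<in>rays \<Delta>. \<rho> face_of \<sigma> \<longrightarrow> 0 \<le> u \<bullet> to_real (ray_generator \<rho>))"
proof
  assume u: "u \<in> dual_cone \<sigma>"
  show "\<forall>\<rho>\<in>rays \<Delta>. \<rho> face_of \<sigma> \<longrightarrow> 0 \<le> u \<bullet> to_real (ray_generator \<rho>)"
    using u ray_generator(2) face_of_imp_subset unfolding dual_cone_def by blast
next
  assume u: "\<forall>\<rho>\<in>rays \<Delta>. \<rho> face_of \<sigma> \<longrightarrow> 0 \<le> u \<bullet> to_real (ray_generator \<rho>)"
  have "0 \<le> u \<bullet> v" if F: "F face_of \<sigma>" "aff_dim F = 1" "v \<in> F" for F v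
  proof -
    have R: "F \<in> rays \<Delta>" using face[OF assms F(1)] F by (auto simp: rays_def)
    obtain t where "v = t *\<^sub>R to_real (ray_generator F)" "0 \<le> t" using ray_generator(3)[OF R] F(3) by blast
    moreover have "0 \<le> u \<bullet> to_real (ray_generator F)" using u F(1) R by blast
    ultimately show ?thesis by simp
  qed
  then have "u \<in> dual_cone (convex_cone hull (\<Union>{F. F face_of \<sigma> \<and> aff_dim F = 1}))"
    unfolding dual_cone_convex_cone_hull by blast
  then show "u \<in> dual_cone \<sigma>" using toric_cone_generated_by_rays[OF cone[OF assms]] by simp
qed

lemma local_datum_iff:
  "local_datum \<Delta> D \<sigma> u \<longleftrightarrow> (\<forall>\<rho>\<in>rays \<Delta>. \<rho> face_of \<sigma> \<longrightarrow> to_real u \<bullet> to_real (ray_generator \<rho>) = - of_int (D \<rho>))"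
proof -
  have "character_divisor (- u) \<rho> = - pairing u (ray_generator \<rho>)" for \<rho> :: "(real, 'n) vec set"
    by (simp add: character_divisor_def pairing_def sum_negf)
  moreover have "- pairing u v = d \<longleftrightarrow> to_real u \<bullet> to_real v = - of_int d" for v :: "'n lattice" and d
    unfolding inner_to_real by (metis add.inverse_inverse of_int_eq_iff of_int_minus)
  ultimately show ?thesis unfolding local_datum_def by simp
qed

text \<open>Both data compute the coefficients of \<open>D\<close> along the rays of the common
  face, so \<open>u - w\<close> is orthogonal to it. Exchanging the roles gives the opposite sign,
  so membership in the dual cone is recorded.\<close>

lemma local_datum_diff:
  assumes "\<sigma> \<in> \<Delta>" "\<tau> \<in> \<Delta>" "local_datum \<Delta> D \<sigma> u" "local_datum \<Delta> D \<tau> w"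
  shows "to_real (u - w) \<in> dual_cone (\<sigma> \<inter> \<tau>)"
  unfolding dual_cone_iff_rays[OF inter_cone[OF assms(1,2)]]
proof (intro ballI impI)
  fix \<rho> assume r: "\<rho> \<in> rays \<Delta>" "\<rho> face_of \<sigma> \<inter> \<tau>"
  have "\<rho> face_of \<sigma>" "\<rho> face_of \<tau>"
    using face_of_trans[OF r(2)] inter_face assms(1,2) by blast+
  then show "0 \<le> to_real (u - w) \<bullet> to_real (ray_generator \<rho>)"
    using assms(3,4) r(1) unfolding local_datum_iff by (simp add: inner_diff_left)
qed

lemma local_datum_unique:
  assumes "\<sigma> \<in> \<Delta>" "span \<sigma> = UNIV" "local_datum \<Delta> D \<sigma> u" "local_datum \<Delta> D \<sigma> w"
  shows "u = w"
proof -
  have "to_real (u - w) \<in> dual_cone \<sigma>" "to_real (w - u) \<in> dual_cone \<sigma>"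
    using local_datum_diff[OF assms(1,1,3,4)] local_datum_diff[OF assms(1,1,4,3)] by simp_all
  from dual_cone_pointed(1)[OF cone[OF assms(1)] assms(2) this] show ?thesis by simp
qed

lemma local_datum_multiple:
  "local_datum \<Delta> D \<sigma> u \<Longrightarrow> local_datum \<Delta> (\<lambda>\<rho>. int n * D \<rho>) \<sigma> (frag_cmul (int n) u)"
  unfolding local_datum_iff by simp

lemma character_mult: "character u * character v = (character (u + v) :: ('n, 'k::field) function_field)"
  by (simp add: character_def mult_single)

text \<open>Another chart with another local datum changes the generator by a character that is a
  unit on the overlap, so a single chart and datum describe the stalk.\<close>

lemma divisor_stalk_eq:
  fixes p :: "('n, 'k::field) point"
  assumes p: "p \<in> toric_variety \<Delta>" "(\<sigma>, x) \<in> p" and u: "local_datum \<Delta> D \<sigma> u"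
  shows "divisor_stalk \<Delta> D p = {character u * g | g. g \<in> chart_ring \<sigma> x}"
proof
  note rep = point_rep[OF p]
  show "{character u * g | g. g \<in> chart_ring \<sigma> x} \<subseteq> divisor_stalk \<Delta> D p"
    using p(2) u local_ring_eq(1)[OF p] unfolding divisor_stalk_def by blast
  show "divisor_stalk \<Delta> D p \<subseteq> {character u * g | g. g \<in> chart_ring \<sigma> x}"
  proof
    fix f assume "f \<in> divisor_stalk \<Delta> D p"
    then obtain \<tau> y w g where f: "f = character w * g" "(\<tau>, y) \<in> p" "local_datum \<Delta> D \<tau> w" "g \<in> local_ring p"
      unfolding divisor_stalk_def by blast
    have \<tau>: "\<tau> \<in> \<Delta>" using point_rep(1)[OF p(1) f(2)] .
    obtain z where z: "z \<in> affine_points (\<sigma> \<inter> \<tau>)" "x = restrict z (lattice_points (dual_cone \<sigma>))"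
      using gluingE[OF rep(4)[OF f(2)]] by metis
    obtain s where s: "cuts_face s \<sigma> (\<sigma> \<inter> \<tau>)" by (rule separating_character[OF rep(1) \<tau>])
    have eq: "chart_ring \<sigma> x = chart_ring (\<sigma> \<inter> \<tau>) z"
      unfolding z(2) by (rule chart_ring_restrict(1)[OF cone[OF rep(1)] s z(1)])
    have "to_real (w - u) \<in> dual_cone (\<sigma> \<inter> \<tau>)"
      using local_datum_diff[OF \<tau> rep(1) f(3) u] by (simp add: Int_commute)
    then have "character (w - u) \<in> chart_ring (\<sigma> \<inter> \<tau>) z"
      unfolding character_def by (intro subring_set_chart_ring(2)[OF z(1)] single_in_semigroup_algebra)
    then have "character (w - u) * g \<in> chart_ring \<sigma> x"
      using f(4) eq local_ring_eq(1)[OF p] subring_setD(4)[OF subring_set_chart_ring(1)[OF rep(2)]] by simp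
    moreover have "f = character u * (character (w - u) * g)"
      unfolding f(1) mult.assoc[symmetric] character_mult by simp
    ultimately show "f \<in> {character u * g | g. g \<in> chart_ring \<sigma> x}" by blast
  qed
qed

lemma zero_cone: "{0} \<in> \<Delta>"
proof -
  obtain \<sigma> where \<sigma>: "\<sigma> \<in> \<Delta>" using cones_nonempty by blast
  note C = toric_coneD[OF cone[OF \<sigma>]]
  obtain \<xi> where \<xi>: "\<And>v. v \<in> \<sigma> \<Longrightarrow> v \<noteq> 0 \<Longrightarrow> 0 < v \<bullet> \<xi>" by (rule toric_cone_positive[OF cone[OF \<sigma>]]) blast
  have "0 extreme_point_of \<sigma>"
    unfolding extreme_point_of_def
  proof (intro conjI ballI notI)
    show "0 \<in> \<sigma>" by (rule C(4))
    fix a b assume ab: "a \<in> \<sigma>" "b \<in> \<sigma>" "0 \<in> open_segment a b"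
    then obtain t where t: "0 < t" "t < 1" "0 = (1 - t) *\<^sub>R a + t *\<^sub>R b" "a \<noteq> b" by (auto simp: in_segment)
    have "0 = (1 - t) * (a \<bullet> \<xi>) + t * (b \<bullet> \<xi>)"
      using arg_cong[OF t(3), of "\<lambda>v. v \<bullet> \<xi>"] by (simp add: inner_add_left)
    moreover have "0 \<le> a \<bullet> \<xi>" "0 \<le> b \<bullet> \<xi>" using \<xi>[OF ab(1)] \<xi>[OF ab(2)] by (cases "a = 0"; cases "b = 0"; force)+
    moreover have "0 < a \<bullet> \<xi> \<or> 0 < b \<bullet> \<xi>" using \<xi>[OF ab(1)] \<xi>[OF ab(2)] t(4) by blast
    moreover have "0 \<le> (1 - t) * (a \<bullet> \<xi>)" "0 \<le> t * (b \<bullet> \<xi>)" using calculation(2,3) t(1,2) by auto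
    ultimately show False using t(1,2) by (metis add_nonneg_eq_0_iff diff_gt_0_iff_gt less_irrefl mult_pos_pos)
  qed
  then have "{0} face_of \<sigma>" by (simp add: face_of_singleton)
  then show ?thesis using face[OF \<sigma>] by blast
qed

end

context complete_toric_fan
begin

text \<open>
  A section of a multiple \<open>n D\<close> whose nonvanishing locus is a neighbourhood of the fixed point of
  \<open>\<sigma>\<close> inside \<open>U\<^sub>\<sigma>\<close> is a Laurent polynomial \<open>f\<close>; the coefficient of \<open>n u\<^sub>\<tau>\<close> in \<open>f\<close> is nonzero
  precisely for \<open>\<tau> = \<sigma>\<close>.
\<close>

lemma ample_vertices:
  assumes ample: "ample TYPE('k::alg_closed_field) \<Delta> D"
    and c: "cartier \<Delta> D"
    and \<sigma>: "\<sigma> \<in> maximal_cones \<Delta>" and u\<sigma>: "local_datum \<Delta> D \<sigma> u\<sigma>"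
    and \<tau>: "\<tau> \<in> maximal_cones \<Delta>" and u\<tau>: "local_datum \<Delta> D \<tau> u\<tau>"
  shows "to_real (u\<sigma> - u\<tau>) \<in> dual_cone \<tau>" and "\<tau> \<noteq> \<sigma> \<Longrightarrow> u\<tau> \<noteq> u\<sigma>"
proof -
  note S = maximal_coneD[OF \<sigma>] and T = maximal_coneD[OF \<tau>]
  define pt where "pt \<kappa> = gluing \<Delta> `` {(\<kappa>, fixed_point \<kappa> :: 'n lattice \<Rightarrow> 'k)}" for \<kappa>
  have fp: "fixed_point \<kappa> \<in> affine_points \<kappa>" if "\<kappa> \<in> maximal_cones \<Delta>" for \<kappa>
    by (rule fixed_point_affine[OF maximal_coneD(2,3)[OF that]])
  have pt: "pt \<kappa> \<in> toric_variety \<Delta>" "(\<kappa>, fixed_point \<kappa>) \<in> pt \<kappa>" if "\<kappa> \<in> maximal_cones \<Delta>" for \<kappa>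
    unfolding pt_def by (rule point_in[OF maximal_coneD(1)[OF that] fp[OF that]])+
  define V :: "('n, 'k) point set" where "V = {q \<in> toric_variety \<Delta>. \<exists>x. (\<sigma>, x) \<in> q}"
  \<comment> \<open>\<open>V\<close> is the chart of \<sigma>. Inside another chart \<kappa> it is
    the nonvanishing set of the character separating \<kappa> from \<sigma>.\<close>
  have "zariski_open \<Delta> V"
    unfolding zariski_open_def
  proof (intro conjI ballI impI)
    show "V \<subseteq> toric_variety \<Delta>" by (auto simp: V_def)
    fix \<kappa> and y :: "'n lattice \<Rightarrow> 'k"
    assume \<kappa>: "\<kappa> \<in> \<Delta>" "y \<in> affine_points \<kappa>" "gluing \<Delta> `` {(\<kappa>, y)} \<in> V"
    note q = point_in[OF \<kappa>(1,2)]
    obtain x where x: "(\<sigma>, x) \<in> gluing \<Delta> `` {(\<kappa>, y)}" using \<kappa>(3) by (auto simp: V_def)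
    obtain z where z: "z \<in> affine_points (\<kappa> \<inter> \<sigma>)" "y = restrict z (lattice_points (dual_cone \<kappa>))"
      using gluingE[OF point_rep(4)[OF q x]] by metis
    obtain w where w: "cuts_face w \<kappa> (\<kappa> \<inter> \<sigma>)" by (rule separating_character[OF \<kappa>(1) S(1)])
    note W = cuts_faceD[OF w]
    show "\<exists>f\<in>semigroup_algebra (dual_cone \<kappa>). eval_at y f \<noteq> 0 \<and>
        (\<forall>y'\<in>affine_points \<kappa>. eval_at y' f \<noteq> 0 \<longrightarrow> gluing \<Delta> `` {(\<kappa>, y')} \<in> V)"
    proof (intro bexI[of _ "Poly_Mapping.single w 1"] conjI ballI impI)
      show "Poly_Mapping.single w 1 \<in> semigroup_algebra (dual_cone \<kappa>)" by (rule single_in_semigroup_algebra[OF W(1)])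
      have "y w = z w" unfolding z(2) using W(1) by (simp add: lattice_points_def)
      then show "eval_at y (Poly_Mapping.single w 1) \<noteq> 0"
        using affine_point_unit[OF z(1) W(4,5)] by (simp add: eval_at_single)
      fix y' :: "'n lattice \<Rightarrow> 'k" assume y': "y' \<in> affine_points \<kappa>" "eval_at y' (Poly_Mapping.single w 1) \<noteq> 0"
      then have "y' w \<noteq> 0" by (simp add: eval_at_single)
      from affine_point_extend[OF cone[OF \<kappa>(1)] w y'(1) this] obtain z' where
        z': "z' \<in> affine_points (\<kappa> \<inter> \<sigma>)" "y' = restrict z' (lattice_points (dual_cone \<kappa>))" by blast
      have "(\<sigma>, restrict z' (lattice_points (dual_cone \<sigma>))) \<in> gluing \<Delta> `` {(\<kappa>, y')}"
        using gluingI[OF \<kappa>(1) S(1) z'(1)] z'(2) by auto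
      then show "gluing \<Delta> `` {(\<kappa>, y')} \<in> V" using point_in(1)[OF \<kappa>(1) y'(1)] by (auto simp: V_def)
    qed
  qed
  moreover have "pt \<sigma> \<in> V" using pt[OF \<sigma>] by (auto simp: V_def)
  ultimately obtain n s where n: "0 < (n::nat)" and
    s: "s \<in> sections \<Delta> (\<lambda>\<rho>. int n * D \<rho>) (toric_variety \<Delta>)"
      "pt \<sigma> \<in> nonvanishing_locus \<Delta> (\<lambda>\<rho>. int n * D \<rho>) s"
      "nonvanishing_locus \<Delta> (\<lambda>\<rho>. int n * D \<rho>) s \<subseteq> V"
    using ample unfolding ample_def by blast
  let ?D = "\<lambda>\<rho>. int n * D \<rho>"
  have stalk: "s \<in> divisor_stalk \<Delta> ?D q" if "q \<in> toric_variety \<Delta>" for q using s(1) that by (auto simp: sections_def)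
  \<comment> \<open>On the torus a section of the line bundle is a regular function, since the local
    generators are characters.\<close>
  obtain f where f: "s = Fract f 1"
  proof (rule regular_on_torus_laurent[of s])
    fix x :: "'n lattice \<Rightarrow> 'k" assume x: "x \<in> affine_points {0}"
    obtain u0 where "local_datum \<Delta> D {0} u0" using c zero_cone by (auto simp: cartier_def)
    note l0 = local_datum_multiple[OF this, of n]
    note q = point_in[OF zero_cone x]
    obtain g where g: "s = character (frag_cmul (int n) u0) * g" "g \<in> chart_ring {0} x"
      using stalk[OF q(1)] divisor_stalk_eq[OF q l0] by blast
    then obtain a b where "g = Fract a b" "eval_at x b \<noteq> 0" by (auto simp: chart_ring_def)
    then show "\<exists>a b. s = Fract a b \<and> eval_at x b \<noteq> 0" unfolding g(1) character_def by auto
  qed blast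
  \<comment> \<open>From f b = \<chi>^c a with c = n u and \<open>b\<close> nonzero at the fixed
    point: comparing monomial orders in every direction of \<kappa> puts all exponents of
    \<open>f\<close> into c plus the dual cone, and then the exponent c of f b arises only from c in
    \<open>f\<close> and 0 in \<open>b\<close>.\<close>
  have local: "Poly_Mapping.lookup f (frag_cmul (int n) u) * Poly_Mapping.lookup b 0 = Poly_Mapping.lookup a 0 \<and>
      (\<forall>w\<in>Poly_Mapping.keys f. to_real (w - frag_cmul (int n) u) \<in> dual_cone \<kappa>)"
    if \<kappa>: "\<kappa> \<in> maximal_cones \<Delta>" and ab: "a \<in> semigroup_algebra (dual_cone \<kappa>)" "b \<in> semigroup_algebra (dual_cone \<kappa>)"
      "eval_at (fixed_point \<kappa>) b \<noteq> 0" "s = character (frag_cmul (int n) u) * Fract a b" and f0: "f \<noteq> 0"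
    for \<kappa> a b u
  proof -
    let ?c = "frag_cmul (int n) u"
    have b0: "Poly_Mapping.lookup b 0 \<noteq> 0" using ab(3) eval_at_fixed_point[OF ab(2)] by simp
    then have bn: "b \<noteq> 0" by auto
    have eq: "f * b = Poly_Mapping.single ?c 1 * a"
      using ab(4) bn unfolding f character_def by (simp add: eq_fract)
    have an: "a \<noteq> 0" using eq f0 bn by auto
    have key: "to_real (w - ?c) \<in> dual_cone \<kappa>" if w: "w \<in> Poly_Mapping.keys f" for w
      unfolding dual_cone_def
    proof (intro CollectI ballI)
      fix y assume y: "y \<in> \<kappa>"
      have nn: "0 \<le> to_real v \<bullet> y" if "v \<in> Poly_Mapping.keys a \<or> v \<in> Poly_Mapping.keys b" for v
        using that ab(1,2) y by (auto simp: semigroup_algebra_iff dual_cone_def)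
      have sn: "Poly_Mapping.single ?c (1::'k) \<noteq> 0" by (metis lookup_single_eq lookup_zero zero_neq_one)
      have "monomial_ord y b \<le> to_real 0 \<bullet> y" using b0 by (intro monomial_ord_le) (simp add: in_keys_iff)
      moreover have "0 \<le> monomial_ord y a" using nn by (intro monomial_ord_geI[OF an]) blast
      moreover have "monomial_ord y f + monomial_ord y b = to_real ?c \<bullet> y + monomial_ord y a"
        using arg_cong[OF eq, of "monomial_ord y"] unfolding monomial_ord_mult[OF f0 bn] monomial_ord_mult[OF sn an]
        by simp
      ultimately have "to_real ?c \<bullet> y \<le> monomial_ord y f" by simp
      also have "\<dots> \<le> to_real w \<bullet> y" by (rule monomial_ord_le[OF w])
      finally show "0 \<le> to_real (w - ?c) \<bullet> y" by (simp add: inner_diff_left)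
    qed
    have "Poly_Mapping.lookup (f * b) (?c + 0) = Poly_Mapping.lookup f ?c * Poly_Mapping.lookup b 0"
    proof (rule lookup_times_unique)
      fix v w assume vw: "v \<in> Poly_Mapping.keys f" "w \<in> Poly_Mapping.keys b" "v + w = ?c + 0"
      have "to_real (v - ?c) + to_real w = 0" using arg_cong[OF vw(3), of to_real] by (simp add: algebra_simps)
      moreover have "to_real w \<in> dual_cone \<kappa>" using vw(2) ab(2) by (auto simp: semigroup_algebra_iff)
      ultimately have "to_real w = 0"
        using dual_cone_pointed(2)[OF maximal_coneD(2,3)[OF \<kappa>] key[OF vw(1)]] by blast
      then show "v = ?c \<and> w = 0" using vw(3) by simp
    qed
    moreover have "Poly_Mapping.lookup (Poly_Mapping.single ?c 1 * a) (?c + 0) = 1 * Poly_Mapping.lookup a 0"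
      by (subst lookup_times_unique) auto
    ultimately show ?thesis using eq key by simp
  qed
  \<comment> \<open>The numerator vanishes at the fixed point exactly when the section fails to
    generate the stalk there.\<close>
  have rep: "\<exists>a b. a \<in> semigroup_algebra (dual_cone \<kappa>) \<and> b \<in> semigroup_algebra (dual_cone \<kappa>) \<and>
      eval_at (fixed_point \<kappa>) b \<noteq> 0 \<and> s = character (frag_cmul (int n) u) * Fract a b \<and>
      (pt \<kappa> \<notin> nonvanishing_locus \<Delta> ?D s \<longrightarrow> eval_at (fixed_point \<kappa>) a = 0) \<and>
      (eval_at (fixed_point \<kappa>) a = 0 \<longrightarrow> pt \<kappa> \<notin> nonvanishing_locus \<Delta> ?D s)"
    if \<kappa>: "\<kappa> \<in> maximal_cones \<Delta>" and u: "local_datum \<Delta> D \<kappa> u" for \<kappa> u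
  proof -
    let ?c = "frag_cmul (int n) u" and ?x = "fixed_point \<kappa> :: 'n lattice \<Rightarrow> 'k"
    note st = divisor_stalk_eq[OF pt[OF \<kappa>] local_datum_multiple[OF u, of n]]
    note le = local_ring_eq[OF pt[OF \<kappa>]]
    note I = ideal_inD[OF subring_set_chart_ring(4)[OF fp[OF \<kappa>]]]
    note R1 = subring_setD(1)[OF subring_set_chart_ring(1)[OF fp[OF \<kappa>]]]
    have nv: "pt \<kappa> \<notin> nonvanishing_locus \<Delta> ?D s \<longleftrightarrow> s \<in> ideal_mult (chart_ideal \<kappa> ?x) {character ?c * g | g. g \<in> chart_ring \<kappa> ?x}"
      using pt(1)[OF \<kappa>] st le(2) by (simp add: nonvanishing_locus_def)
    have up: "h \<in> chart_ideal \<kappa> ?x \<Longrightarrow> s = character ?c * h \<Longrightarrow> pt \<kappa> \<notin> nonvanishing_locus \<Delta> ?D s" for h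
    proof -
      assume h: "h \<in> chart_ideal \<kappa> ?x" "s = character ?c * h"
      have m: "h * (character ?c * 1) \<in> ideal_mult (chart_ideal \<kappa> ?x) {character ?c * g | g. g \<in> chart_ring \<kappa> ?x}"
        using R1 by (intro ideal_multI h(1)) blast
      have e: "s = h * (character ?c * 1)" unfolding h(2) by (simp add: mult.commute)
      show ?thesis unfolding nv unfolding e by (rule m)
    qed
    show ?thesis
    proof (cases "pt \<kappa> \<in> nonvanishing_locus \<Delta> ?D s")
      case True
      obtain g where g: "s = character ?c * g" "g \<in> chart_ring \<kappa> ?x" using stalk[OF pt(1)[OF \<kappa>]] st by blast
      then obtain a b where ab: "g = Fract a b" "a \<in> semigroup_algebra (dual_cone \<kappa>)"
        "b \<in> semigroup_algebra (dual_cone \<kappa>)" "eval_at ?x b \<noteq> 0" by (auto simp: chart_ring_def)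
      have "eval_at ?x a \<noteq> 0"
      proof
        assume "eval_at ?x a = 0"
        then have "g \<in> chart_ideal \<kappa> ?x" unfolding chart_ideal_def ab(1) using ab(2-4) by blast
        from up[OF this g(1)] True show False by blast
      qed
      then show ?thesis using ab g True by blast
    next
      case False
      then obtain m \<alpha> \<beta> where mm: "s = (\<Sum>i<(m::nat). \<alpha> i * \<beta> i)"
        "\<forall>i<m. \<alpha> i \<in> chart_ideal \<kappa> ?x \<and> \<beta> i \<in> {character ?c * g | g. g \<in> chart_ring \<kappa> ?x}"
        unfolding nv ideal_mult_def by blast
      then have "\<forall>i<m. \<exists>g. \<beta> i = character ?c * g \<and> g \<in> chart_ring \<kappa> ?x" by blast
      then obtain \<gamma> where \<gamma>: "\<forall>i<m. \<beta> i = character ?c * \<gamma> i \<and> \<gamma> i \<in> chart_ring \<kappa> ?x" by metis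
      define h where "h = (\<Sum>i<m. \<gamma> i * \<alpha> i)"
      have "(\<Sum>i<j. \<gamma> i * \<alpha> i) \<in> chart_ideal \<kappa> ?x" if "j \<le> m" for j
        using that
      proof (induction j)
        case (Suc j)
        then have "\<gamma> j * \<alpha> j \<in> chart_ideal \<kappa> ?x" using mm(2) \<gamma> by (intro I(4)) auto
        then show ?case using Suc I(3) by simp
      qed (use I(2) in simp)
      then have hI: "h \<in> chart_ideal \<kappa> ?x" unfolding h_def by blast
      have "s = character ?c * h"
        unfolding mm(1) h_def sum_distrib_left using \<gamma> by (intro sum.cong) (auto simp: algebra_simps)
      then show ?thesis using hI False unfolding chart_ideal_def by blast
    qed
  qed
  obtain a b where A: "a \<in> semigroup_algebra (dual_cone \<sigma>)" "b \<in> semigroup_algebra (dual_cone \<sigma>)"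
    "eval_at (fixed_point \<sigma>) b \<noteq> 0" "s = character (frag_cmul (int n) u\<sigma>) * Fract a b" "eval_at (fixed_point \<sigma>) a \<noteq> 0"
    using rep[OF \<sigma> u\<sigma>] s(2) by blast
  have f0: "f \<noteq> 0"
  proof
    assume "f = 0"
    have bn: "b \<noteq> 0" using A(3) by auto
    have "Fract (0 :: ('n, 'k) laurent) 1 = Fract (Poly_Mapping.single (frag_cmul (int n) u\<sigma>) 1 * a) b"
      using A(4) \<open>f = 0\<close> unfolding f character_def by simp
    then have "0 * b = Poly_Mapping.single (frag_cmul (int n) u\<sigma>) 1 * a * 1"
      by (subst (asm) eq_fract(1)[OF one_neq_zero bn])
    moreover have "Poly_Mapping.single (frag_cmul (int n) u\<sigma>) (1::'k) \<noteq> 0"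
      by (metis lookup_single_eq lookup_zero zero_neq_one)
    ultimately have "a = 0" by simp
    then show False using A(5) by simp
  qed
  have l0: "Poly_Mapping.lookup f (frag_cmul (int n) u\<sigma>) \<noteq> 0"
    using local[OF \<sigma> A(1-4) f0] A(5) eval_at_fixed_point[OF A(1)] by auto
  obtain a' b' where B: "a' \<in> semigroup_algebra (dual_cone \<tau>)" "b' \<in> semigroup_algebra (dual_cone \<tau>)"
    "eval_at (fixed_point \<tau>) b' \<noteq> 0" "s = character (frag_cmul (int n) u\<tau>) * Fract a' b'"
    "pt \<tau> \<notin> nonvanishing_locus \<Delta> ?D s \<longrightarrow> eval_at (fixed_point \<tau>) a' = 0"
    using rep[OF \<tau> u\<tau>] by blast
  note L = local[OF \<tau> B(1-4) f0]
  \<comment> \<open>n u\<sigma> occurs in \<open>f\<close>, and by \<open>L\<close> all exponents of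
    \<open>f\<close> lie in n u\<tau> plus the dual cone of \<tau>; the factor n is then divided
    out.\<close>
  have "to_real (frag_cmul (int n) u\<sigma> - frag_cmul (int n) u\<tau>) \<in> dual_cone \<tau>"
    using L l0 by (simp add: in_keys_iff del: to_real_simps)
  then have "(1 / real n) *\<^sub>R (real n *\<^sub>R to_real (u\<sigma> - u\<tau>)) \<in> dual_cone \<tau>"
    by (intro convex_cone_scaleR[OF convex_cone_dual_cone, of "1 / real n"]) (simp_all add: scaleR_diff_right)
  then show "to_real (u\<sigma> - u\<tau>) \<in> dual_cone \<tau>" using n by simp
  show "u\<tau> \<noteq> u\<sigma>" if ne: "\<tau> \<noteq> \<sigma>"
  proof
    assume u: "u\<tau> = u\<sigma>"
    \<comment> \<open>Otherwise a character separating \<tau> from \<sigma> would be nonzero at the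
      fixed point of \<tau>, hence trivial, and \<tau> would be contained in \<sigma>.\<close>
    have "pt \<tau> \<notin> V"
    proof
      assume "pt \<tau> \<in> V"
      then obtain x where x: "(\<sigma>, x) \<in> pt \<tau>" by (auto simp: V_def)
      obtain z where z: "z \<in> affine_points (\<tau> \<inter> \<sigma>)" "(fixed_point \<tau> :: 'n lattice \<Rightarrow> 'k) = restrict z (lattice_points (dual_cone \<tau>))"
        using gluingE[OF point_rep(4)[OF pt[OF \<tau>] x]] by metis
      obtain w where w: "cuts_face w \<tau> (\<tau> \<inter> \<sigma>)" by (rule separating_character[OF T(1) S(1)])
      note W = cuts_faceD[OF w]
      have "(fixed_point \<tau> :: 'n lattice \<Rightarrow> 'k) w = z w" unfolding z(2) using W(1) by (simp add: lattice_points_def)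
      then have "(fixed_point \<tau> w :: 'k) \<noteq> 0" using affine_point_unit[OF z(1) W(4,5)] by simp
      then have "w = 0" using W(1) by (auto simp: fixed_point_def lattice_points_def split: if_splits)
      then have "\<tau> \<subseteq> \<sigma>" using w by (auto simp: cuts_face_def)
      then show False using full_cone_maximal[OF T(1,3) S(1)] ne by blast
    qed
    then have "eval_at (fixed_point \<tau>) a' = 0" using B(5) s(3) by blast
    then have "Poly_Mapping.lookup a' 0 = 0" using eval_at_fixed_point[OF B(1)] by simp
    moreover have "Poly_Mapping.lookup b' 0 \<noteq> 0" using eval_at_fixed_point[OF B(2)] B(3) by simp
    ultimately show False using L l0 u by auto
  qed
qed

end

subsection \<open>Edges of the polytope and orders at two vertices\<close>

lemma primitive_uminus: "primitive w \<Longrightarrow> primitive (- w)"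
  unfolding primitive_def
  by (metis add.inverse_inverse neg_equal_0_iff_equal scaleR_minus_right to_real_simps(3))

lemma lattice_length_eq:
  assumes w: "primitive w" and r: "0 < r" and b: "b - a = r *\<^sub>R to_real w"
  shows "lattice_length a b = r"
  unfolding lattice_length_def
proof (rule the_equality)
  have ab: "a - b = r *\<^sub>R to_real (- w)" using b by (simp add: algebra_simps)
  then show "0 \<le> r \<and> (\<exists>w. primitive w \<and> a - b = r *\<^sub>R to_real w)"
    using r primitive_uminus[OF w] by (intro conjI exI[of _ "- w"]) simp_all
  fix l assume "0 \<le> l \<and> (\<exists>w. primitive w \<and> a - b = l *\<^sub>R to_real w)"
  then obtain v where v: "0 \<le> l" "primitive v" "a - b = l *\<^sub>R to_real v" by blast
  have w0: "to_real w \<noteq> 0" using w by (simp add: primitive_def)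
  have "l \<noteq> 0" using v(3) ab r w0 by auto
  then have l: "0 < l" using v(1) by simp
  have "l *\<^sub>R to_real v = r *\<^sub>R to_real (- w)" using v(3) ab by (simp only:)
  then have "(1 / l) *\<^sub>R (l *\<^sub>R to_real v) = (1 / l) *\<^sub>R (r *\<^sub>R to_real (- w))" by (simp only:)
  then have "to_real v = (r / l) *\<^sub>R to_real (- w)" using l by simp
  from primitive_parallel(2)[OF v(2) primitive_uminus[OF w] _ this] have "r / l = 1" using l r by simp
  then show "l = r" using l by simp
qed

text \<open>With s the coefficient sum, the point lies at ratio s / L on the segment from
  \<open>v\<close> to the point p of coefficient sum \<open>L\<close> on the same half-line, and p
  is a convex combination of the points v + L f(i).\<close>

lemma convex_corner:
  fixes f :: "'i \<Rightarrow> 'a::real_vector"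
  assumes P: "convex P" "v \<in> P" and f: "\<And>i. i \<in> I \<Longrightarrow> v + L *\<^sub>R f i \<in> P" and I: "finite I"
    and a: "\<And>i. i \<in> I \<Longrightarrow> 0 \<le> a i" "sum a I \<le> L"
  shows "v + (\<Sum>i\<in>I. a i *\<^sub>R f i) \<in> P"
proof (cases "sum a I = 0")
  case True
  then have "\<forall>i\<in>I. a i = 0" using a(1) I by (simp add: sum_nonneg_eq_0_iff)
  then show ?thesis using P(2) by simp
next
  case False
  define s where "s = sum a I"
  have s: "0 < s" using False sum_nonneg[of I a] a(1) by (simp add: s_def)
  then have L: "0 < L" using a(2) by (simp add: s_def)
  define p where "p = (\<Sum>i\<in>I. (a i / s) *\<^sub>R (v + L *\<^sub>R f i))"
  have "sum (\<lambda>i. a i / s) I = 1" using s by (simp add: s_def flip: sum_divide_distrib)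
  then have pP: "p \<in> P" unfolding p_def using a(1) f s by (intro convex_sum[OF I P(1)]) auto
  have "p = (\<Sum>i\<in>I. (a i / s)) *\<^sub>R v + (\<Sum>i\<in>I. (a i / s) *\<^sub>R (L *\<^sub>R f i))"
    by (simp add: p_def scaleR_add_right sum.distrib scaleR_sum_left)
  also have "\<dots> = v + (L / s) *\<^sub>R (\<Sum>i\<in>I. a i *\<^sub>R f i)"
    using \<open>sum (\<lambda>i. a i / s) I = 1\<close> by (simp add: scaleR_sum_right mult.commute)
  finally have p: "p = v + (L / s) *\<^sub>R (\<Sum>i\<in>I. a i *\<^sub>R f i)" .
  have "(1 - s / L) *\<^sub>R v + (s / L) *\<^sub>R p \<in> P"
    using s L a(2) by (intro convexD[OF P(1) P(2) pP]) (auto simp: s_def)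
  also have "(1 - s / L) *\<^sub>R v + (s / L) *\<^sub>R p = v + (\<Sum>i\<in>I. a i *\<^sub>R f i)"
    unfolding p using s L by (simp add: scaleR_add_right scaleR_left_diff_distrib)
  finally show ?thesis .
qed

text \<open>
  If the segment were not a face, an affine relation between \<open>s\<close>, \<open>t\<close> and the remaining points would
  allow to shift the weights of \<open>m\<close> until one of those of \<open>s\<close> and \<open>t\<close> vanishes.
\<close>

lemma segment_face_of_positive_weights:
  fixes E :: "'a::euclidean_space set"
  assumes E: "finite E" and m: "m \<in> convex hull E" and st: "s \<noteq> t"
    and pos: "\<And>c. (\<And>e. e \<in> E \<Longrightarrow> 0 \<le> c e) \<Longrightarrow> sum c E = 1 \<Longrightarrow> (\<Sum>e\<in>E. c e *\<^sub>R e) = m \<Longrightarrow>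
        s \<in> E \<and> t \<in> E \<and> 0 < c s \<and> 0 < c t"
  shows "closed_segment s t face_of convex hull E"
proof -
  obtain c where c: "\<forall>e\<in>E. 0 \<le> c e" "sum c E = 1" "(\<Sum>e\<in>E. c e *\<^sub>R e) = m"
    using m convex_hull_finite[OF E] by auto
  have stE: "s \<in> E" "t \<in> E" and cst: "0 < c s" "0 < c t" using pos[of c] c by auto
  \<comment> \<open>Disjointness of these two sets is the criterion for the hull of \<open>s\<close>
    and \<open>t\<close> to be a face.\<close>
  have "affine hull {s, t} \<inter> convex hull (E - {s, t}) = {}"
  proof (rule ccontr)
    assume "affine hull {s, t} \<inter> convex hull (E - {s, t}) \<noteq> {}"
    then obtain p where p: "p \<in> affine hull {s, t}" "p \<in> convex hull (E - {s, t})" by blast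
    obtain x y where xy: "x + y = 1" "p = x *\<^sub>R s + y *\<^sub>R t" using p(1) by (auto simp: affine_hull_2)
    obtain d where d: "\<forall>e\<in>E - {s, t}. 0 \<le> d e" "sum d (E - {s, t}) = 1" "(\<Sum>e\<in>E - {s, t}. d e *\<^sub>R e) = p"
      using p(2) convex_hull_finite[of "E - {s, t}"] E by auto
    \<comment> \<open>The weights of \<open>m\<close> moved by \<delta> along the affine relation.
      Both sides of the relation have total weight 1 and barycentre p, so total and barycentre stay
      the same.\<close>
    define g where "g \<delta> e = (if e = s then c s - \<delta> * x else if e = t then c t - \<delta> * y else c e + \<delta> * d e)" for \<delta> e
    have split: "sum h E = h s + h t + sum h (E - {s, t})" for h :: "'a \<Rightarrow> 'b::comm_monoid_add"
    proof -
      have "sum h E = h s + sum h (E - {s})" by (rule sum.remove[OF E stE(1)])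
      also have "sum h (E - {s}) = h t + sum h (E - {s} - {t})" using E stE st by (intro sum.remove) auto
      also have "E - {s} - {t} = E - {s, t}" by blast
      finally show ?thesis by (simp add: add.assoc)
    qed
    have g1: "sum (g \<delta>) E = 1" for \<delta>
    proof -
      have "sum (g \<delta>) (E - {s, t}) = (\<Sum>e\<in>E - {s, t}. c e + \<delta> * d e)" by (rule sum.cong) (auto simp: g_def)
      also have "\<dots> = sum c (E - {s, t}) + \<delta>" using d(2) by (simp add: sum.distrib flip: sum_distrib_left)
      finally have e: "sum (g \<delta>) (E - {s, t}) = sum c (E - {s, t}) + \<delta>" .
      have "sum (g \<delta>) E = g \<delta> s + g \<delta> t + (sum c (E - {s, t}) + \<delta>)" unfolding split[of "g \<delta>"] e ..
      also have "\<dots> = (c s + c t + sum c (E - {s, t})) + \<delta> * (1 - (x + y))"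
        using st by (simp add: g_def algebra_simps)
      also have "\<dots> = 1" using c(2) split[of c] xy(1) by simp
      finally show ?thesis .
    qed
    have g2: "(\<Sum>e\<in>E. g \<delta> e *\<^sub>R e) = m" for \<delta>
    proof -
      have "(\<Sum>e\<in>E - {s, t}. g \<delta> e *\<^sub>R e) = (\<Sum>e\<in>E - {s, t}. c e *\<^sub>R e + \<delta> *\<^sub>R (d e *\<^sub>R e))"
        by (rule sum.cong) (auto simp: g_def scaleR_left_distrib)
      also have "\<dots> = (\<Sum>e\<in>E - {s, t}. c e *\<^sub>R e) + \<delta> *\<^sub>R p"
        unfolding sum.distrib scaleR_sum_right[symmetric] d(3) ..
      finally have e: "(\<Sum>e\<in>E - {s, t}. g \<delta> e *\<^sub>R e) = (\<Sum>e\<in>E - {s, t}. c e *\<^sub>R e) + \<delta> *\<^sub>R p" .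
      have "(\<Sum>e\<in>E. g \<delta> e *\<^sub>R e) = g \<delta> s *\<^sub>R s + g \<delta> t *\<^sub>R t + ((\<Sum>e\<in>E - {s, t}. c e *\<^sub>R e) + \<delta> *\<^sub>R p)"
        unfolding split[of "\<lambda>e. g \<delta> e *\<^sub>R e"] e ..
      also have "\<dots> = c s *\<^sub>R s + c t *\<^sub>R t + (\<Sum>e\<in>E - {s, t}. c e *\<^sub>R e)"
        using st unfolding xy(2) by (simp add: g_def algebra_simps)
      also have "\<dots> = m" using c(3) split[of "\<lambda>e. c e *\<^sub>R e"] by simp
      finally show ?thesis .
    qed
    \<comment> \<open>As x + y = 1, one of the two is positive; \<delta> is the first value at which
      the weight of \<open>s\<close> or of \<open>t\<close> reaches 0.\<close>
    have "\<exists>\<delta>\<ge>0. 0 \<le> c s - \<delta> * x \<and> 0 \<le> c t - \<delta> * y \<and> (c s - \<delta> * x = 0 \<or> c t - \<delta> * y = 0)"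
    proof (cases "0 < x \<and> (y \<le> 0 \<or> c s / x \<le> c t / y)")
      case True
      have "(c s / x) * y \<le> c t"
      proof (cases "y \<le> 0")
        case True
        have "(c s / x) * y \<le> 0" using True \<open>0 < x \<and> _\<close> cst by (intro mult_nonneg_nonpos) auto
        then show ?thesis using cst by linarith
      next
        case False
        then have "c s / x \<le> c t / y" using \<open>0 < x \<and> _\<close> by blast
        then show ?thesis using False by (simp add: pos_le_divide_eq)
      qed
      then show ?thesis using True cst by (intro exI[of _ "c s / x"]) auto
    next
      case False
      then have y: "0 < y" using xy(1) by (cases "0 < x") auto
      have "(c t / y) * x \<le> c s"
      proof (cases "x \<le> 0")
        case True
        have "(c t / y) * x \<le> 0" using True y cst by (intro mult_nonneg_nonpos) auto
        then show ?thesis using cst by linarith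
      next
        case x: False
        then have "c t / y \<le> c s / x" using False by auto
        then show ?thesis using x by (simp add: pos_le_divide_eq)
      qed
      then show ?thesis using y cst by (intro exI[of _ "c t / y"]) auto
    qed
    then obtain \<delta> where \<delta>: "0 \<le> \<delta>" "0 \<le> c s - \<delta> * x" "0 \<le> c t - \<delta> * y" "c s - \<delta> * x = 0 \<or> c t - \<delta> * y = 0" by blast
    have "0 \<le> g \<delta> e" if "e \<in> E" for e using that \<delta> c(1) d(1) by (auto simp: g_def)
    from pos[of "g \<delta>", OF this g1 g2] have "0 < g \<delta> s" "0 < g \<delta> t" by auto
    then show False using \<delta>(4) st by (auto simp: g_def)
  qed
  then have "convex hull {s, t} face_of convex hull E"
    using stE by (intro face_of_convex_hulls[OF E]) auto
  then show ?thesis by (simp add: segment_convex_hull)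
qed

text \<open>\<open>vertex_diff\<close> and \<open>vertex_distinct\<close> say that the support
  function of \<open>D\<close> is strictly convex; they are all that the study of the polytope takes
  from ampleness.\<close>

locale polarized_toric_fan = complete_toric_fan \<Delta> for \<Delta> :: "(real ^ 'n::{finite,linorder}) set set" +
  fixes D :: "'n tdivisor"
  assumes vertex_datum: "\<sigma> \<in> maximal_cones \<Delta> \<Longrightarrow> local_datum \<Delta> D \<sigma> (cone_vertex \<Delta> D \<sigma>)"
    and vertex_diff: "\<sigma> \<in> maximal_cones \<Delta> \<Longrightarrow> \<tau> \<in> maximal_cones \<Delta> \<Longrightarrow>
      to_real (cone_vertex \<Delta> D \<sigma> - cone_vertex \<Delta> D \<tau>) \<in> dual_cone \<tau>"
    and vertex_distinct: "\<sigma> \<in> maximal_cones \<Delta> \<Longrightarrow> \<tau> \<in> maximal_cones \<Delta> \<Longrightarrow> \<sigma> \<noteq> \<tau> \<Longrightarrow>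
      cone_vertex \<Delta> D \<sigma> \<noteq> cone_vertex \<Delta> D \<tau>"
begin

abbreviation "vtx \<equiv> cone_vertex \<Delta> D"
abbreviation "pvtx \<sigma> \<equiv> to_real (vtx \<sigma>)"
abbreviation "P \<equiv> divisor_polytope \<Delta> D"

text \<open>Every ray is a face of some maximal cone, whose vertex attains the bound imposed by that
  ray; so the inequalities may be grouped by maximal cones.\<close>

lemma mem_polytope_iff: "x \<in> P \<longleftrightarrow> (\<forall>\<sigma>\<in>maximal_cones \<Delta>. x - pvtx \<sigma> \<in> dual_cone \<sigma>)"
proof
  assume x: "x \<in> P"
  show "\<forall>\<sigma>\<in>maximal_cones \<Delta>. x - pvtx \<sigma> \<in> dual_cone \<sigma>"
  proof
    fix \<sigma> assume \<sigma>: "\<sigma> \<in> maximal_cones \<Delta>"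
    show "x - pvtx \<sigma> \<in> dual_cone \<sigma>"
      unfolding dual_cone_iff_rays[OF maximal_coneD(1)[OF \<sigma>]]
      using x vertex_datum[OF \<sigma>] unfolding local_datum_iff divisor_polytope_def
      by (auto simp: inner_diff_left)
  qed
next
  assume x: "\<forall>\<sigma>\<in>maximal_cones \<Delta>. x - pvtx \<sigma> \<in> dual_cone \<sigma>"
  show "x \<in> P"
    unfolding divisor_polytope_def
  proof (intro CollectI ballI)
    fix \<rho> assume \<rho>: "\<rho> \<in> rays \<Delta>"
    then have "\<rho> \<in> \<Delta>" by (simp add: rays_def)
    then obtain \<tau> where \<tau>: "\<tau> \<in> maximal_cones \<Delta>" "\<rho> face_of \<tau>" by (rule maximal_cone_above)
    have "0 \<le> (x - pvtx \<tau>) \<bullet> to_real (ray_generator \<rho>)"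
      using x \<tau> \<rho> dual_cone_iff_rays[OF maximal_coneD(1)[OF \<tau>(1)]] by blast
    moreover have "pvtx \<tau> \<bullet> to_real (ray_generator \<rho>) = - of_int (D \<rho>)"
      using vertex_datum[OF \<tau>(1)] \<tau>(2) \<rho> unfolding local_datum_iff by blast
    ultimately show "- of_int (D \<rho>) \<le> x \<bullet> to_real (ray_generator \<rho>)" by (simp add: inner_diff_left)
  qed
qed

lemma vertex_in: "\<sigma> \<in> maximal_cones \<Delta> \<Longrightarrow> pvtx \<sigma> \<in> P"
  unfolding mem_polytope_iff using vertex_diff by simp

lemma finite_rays: "finite (rays \<Delta>)" using finite_cones by (simp add: rays_def)

text \<open>Completeness gives boundedness: each direction lies in a maximal cone, whose vertex
  bounds that direction from below on \<open>P\<close>.\<close>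

lemma polytope_P: "polytope P" "convex P" "compact P"
proof -
  have "P = (\<Inter>\<rho>\<in>rays \<Delta>. {u. to_real (ray_generator \<rho>) \<bullet> u \<ge> - of_int (D \<rho>)})"
    by (auto simp: divisor_polytope_def inner_commute)
  then have ph: "polyhedron P" using finite_rays by (auto intro!: polyhedron_Inter polyhedron_halfspace_ge)
  have "\<exists>B. \<forall>x\<in>P. B \<le> x \<bullet> y" for y
  proof -
    obtain \<tau> where \<tau>: "\<tau> \<in> maximal_cones \<Delta>" "y \<in> \<tau>" by (rule maximal_cones_cover)
    have "pvtx \<tau> \<bullet> y \<le> x \<bullet> y" if "x \<in> P" for x
    proof -
      have "x - pvtx \<tau> \<in> dual_cone \<tau>" using that \<tau>(1) mem_polytope_iff by blast
      then show ?thesis using \<tau>(2) by (auto simp: dual_cone_def inner_diff_left)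
    qed
    then show ?thesis by blast
  qed
  then obtain B where B: "\<And>x y. x \<in> P \<Longrightarrow> B y \<le> x \<bullet> y" by metis
  have "bounded P"
  proof (rule boundedI)
    fix x assume x: "x \<in> P"
    have "norm x \<le> (\<Sum>i\<in>UNIV. \<bar>x $ i\<bar>)" by (rule norm_le_l1_cart)
    also have "\<dots> \<le> (\<Sum>i\<in>UNIV. \<bar>B (axis i 1)\<bar> + \<bar>B (- axis i 1)\<bar>)"
    proof (rule sum_mono)
      fix i
      have "x \<bullet> axis i 1 = x $ i" by (simp add: inner_axis)
      then show "\<bar>x $ i\<bar> \<le> \<bar>B (axis i 1)\<bar> + \<bar>B (- axis i 1)\<bar>"
        using B[OF x, of "axis i 1"] B[OF x, of "- axis i 1"] by simp
    qed
    finally show "norm x \<le> (\<Sum>i\<in>UNIV. \<bar>B (axis i 1)\<bar> + \<bar>B (- axis i 1)\<bar>)" .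
  qed
  then show "polytope P" using ph by (simp add: polytope_eq_bounded_polyhedron)
  then show "convex P" "compact P" by (auto intro: polytope_imp_convex polytope_imp_compact)
qed

text \<open>If \<open>v\<close> were outside \<sigma>, then v + \<epsilon> y with y interior to
  \<sigma> would lie in another maximal cone \<kappa>. Pairing with the vertex of \<kappa> is not
  above pairing with that of \<sigma> at this point, yet not below it at \<open>v\<close> and
  strictly above it at y.\<close>

lemma vertex_strict:
  assumes \<sigma>: "\<sigma> \<in> maximal_cones \<Delta>" and \<tau>: "\<tau> \<in> maximal_cones \<Delta>" and v: "v \<in> \<tau>"
    and eq: "pvtx \<sigma> \<bullet> v = pvtx \<tau> \<bullet> v"
  shows "v \<in> \<sigma>"
proof (rule ccontr)
  assume n: "v \<notin> \<sigma>"
  note S = maximal_coneD[OF \<sigma>] and T = maximal_coneD[OF \<tau>]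
  note CS = toric_coneD[OF S(2)]
  have "interior \<sigma> = rel_interior \<sigma>" by (rule span_full_interior(1)[OF CS(1) S(3)])
  moreover have "rel_interior \<sigma> \<noteq> {}" using CS(1,4) rel_interior_eq_empty[of \<sigma>] by (auto simp: convex_cone_def)
  ultimately obtain y where y: "y \<in> interior \<sigma>" by blast
  obtain e where e: "0 < e" "\<And>z. dist z v < e \<Longrightarrow> z \<notin> \<sigma>"
    using CS(2) n open_dist[of "- \<sigma>"] by (auto simp: open_Compl)
  define \<epsilon> where "\<epsilon> = e / (2 * (1 + norm y))"
  have ny: "0 < 1 + norm y" by (simp add: add_pos_nonneg)
  have \<epsilon>: "0 < \<epsilon>" using e(1) ny by (simp add: \<epsilon>_def)
  have "\<epsilon> * norm y \<le> \<epsilon> * (1 + norm y)" using \<epsilon> by simp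
  also have "e / (2 * c) * c = e / 2" if "0 < c" for c using that by simp
  from this[OF ny] have "\<epsilon> * (1 + norm y) = e / 2" by (simp only: \<epsilon>_def)
  also have "\<dots> < e" using e(1) by simp
  finally have z: "v + \<epsilon> *\<^sub>R y \<notin> \<sigma>" using \<epsilon> by (intro e(2)) (simp add: dist_norm)
  obtain \<kappa> where \<kappa>: "\<kappa> \<in> maximal_cones \<Delta>" "v + \<epsilon> *\<^sub>R y \<in> \<kappa>" by (rule maximal_cones_cover)
  have ne: "\<kappa> \<noteq> \<sigma>" using \<kappa>(2) z by blast
  have y\<sigma>: "y \<in> \<sigma>" using y interior_subset by blast
  have 1: "0 \<le> (pvtx \<sigma> - pvtx \<kappa>) \<bullet> (v + \<epsilon> *\<^sub>R y)"
    using vertex_diff[OF \<sigma> \<kappa>(1)] \<kappa>(2) by (auto simp: dual_cone_def)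
  have 2: "0 \<le> (pvtx \<kappa> - pvtx \<tau>) \<bullet> v"
    using vertex_diff[OF \<kappa>(1) \<tau>] v by (auto simp: dual_cone_def)
  have d: "pvtx \<kappa> - pvtx \<sigma> \<in> dual_cone \<sigma>" using vertex_diff[OF \<kappa>(1) \<sigma>] by simp
  have "pvtx \<kappa> - pvtx \<sigma> \<noteq> 0" using vertex_distinct[OF \<kappa>(1) \<sigma> ne] by simp
  from interior_dual_positive[OF y d this] have "0 < (pvtx \<kappa> - pvtx \<sigma>) \<bullet> y" .
  then have "0 < \<epsilon> * ((pvtx \<kappa> - pvtx \<sigma>) \<bullet> y)" using \<epsilon> by simp
  then show False using 1 2 eq by (simp add: inner_diff_left inner_add_right algebra_simps)
qed

text \<open>Near the vertex the polytope coincides with the translated dual cone, because an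
  inequality tight at the vertex belongs to a ray inside \<sigma>. So a ray of the dual cone cuts
  out a nondegenerate face, which is a segment by compactness.\<close>

lemma edge_at_vertex:
  assumes \<sigma>: "\<sigma> \<in> maximal_cones \<Delta>" and w: "w \<in> ray_generators (dual_cone \<sigma>)"
  obtains r where "0 < r" "closed_segment (pvtx \<sigma>) (pvtx \<sigma> + r *\<^sub>R to_real w) edge_of P"
proof -
  note S = maximal_coneD[OF \<sigma>]
  note RG = ray_generators_dual[OF S(2,3)]
  define F where "F = {t *\<^sub>R to_real w | t. 0 \<le> t}"
  have F: "F face_of dual_cone \<sigma>" unfolding F_def by (rule RG(4)[OF w])
  have w0: "w \<noteq> 0" "to_real w \<in> dual_cone \<sigma>" using RG(2)[OF w] by auto
  have sub: "P \<subseteq> (+) (pvtx \<sigma>) ` dual_cone \<sigma>"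
  proof
    fix x assume "x \<in> P"
    then have "x - pvtx \<sigma> \<in> dual_cone \<sigma>" using \<sigma> mem_polytope_iff by blast
    then show "x \<in> (+) (pvtx \<sigma>) ` dual_cone \<sigma>" by (intro image_eqI[of _ _ "x - pvtx \<sigma>"]) auto
  qed
  have "(+) (pvtx \<sigma>) ` F \<inter> P face_of (+) (pvtx \<sigma>) ` dual_cone \<sigma> \<inter> P"
    using F by (intro face_of_slice polytope_P(2)) simp
  then have face: "(+) (pvtx \<sigma>) ` F \<inter> P face_of P" using sub by (simp add: Int_absorb1)
  define T where "T = {t. 0 \<le> t \<and> pvtx \<sigma> + t *\<^sub>R to_real w \<in> P}"
  have slice: "(+) (pvtx \<sigma>) ` F \<inter> P = (\<lambda>t. pvtx \<sigma> + t *\<^sub>R to_real w) ` T"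
    unfolding F_def T_def by auto
  \<comment> \<open>For a tight inequality strict convexity places the ray generator in \<sigma>,
    where \<open>w\<close> is nonnegative.\<close>
  have "0 \<le> (pvtx \<sigma> \<bullet> to_real (ray_generator \<rho>) + of_int (D \<rho>)) \<and>
      (pvtx \<sigma> \<bullet> to_real (ray_generator \<rho>) + of_int (D \<rho>) = 0 \<longrightarrow> 0 \<le> to_real w \<bullet> to_real (ray_generator \<rho>))"
    if \<rho>: "\<rho> \<in> rays \<Delta>" for \<rho>
  proof (intro conjI impI)
    show "0 \<le> pvtx \<sigma> \<bullet> to_real (ray_generator \<rho>) + of_int (D \<rho>)"
      using vertex_in[OF \<sigma>] \<rho> by (auto simp: divisor_polytope_def)
    assume 0: "pvtx \<sigma> \<bullet> to_real (ray_generator \<rho>) + of_int (D \<rho>) = 0"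
    have "\<rho> \<in> \<Delta>" using \<rho> by (simp add: rays_def)
    then obtain \<tau> where \<tau>: "\<tau> \<in> maximal_cones \<Delta>" "\<rho> \<subseteq> \<tau>" "\<rho> face_of \<tau>" by (rule maximal_cone_above)
    have "pvtx \<tau> \<bullet> to_real (ray_generator \<rho>) = - of_int (D \<rho>)"
      using vertex_datum[OF \<tau>(1)] \<tau>(3) \<rho> unfolding local_datum_iff by blast
    then have "to_real (ray_generator \<rho>) \<in> \<sigma>"
      using 0 ray_generator(2)[OF \<rho>] \<tau>(2) by (intro vertex_strict[OF \<sigma> \<tau>(1)]) auto
    then show "0 \<le> to_real w \<bullet> to_real (ray_generator \<rho>)" using w0(2) by (auto simp: dual_cone_def)
  qed
  from small_perturbation[OF finite_rays, of "\<lambda>\<rho>. pvtx \<sigma> \<bullet> to_real (ray_generator \<rho>) + of_int (D \<rho>)"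
      "\<lambda>\<rho>. to_real w \<bullet> to_real (ray_generator \<rho>)", OF this]
  obtain \<epsilon> where \<epsilon>: "0 < \<epsilon>" "\<And>t \<rho>. 0 < t \<Longrightarrow> t \<le> \<epsilon> \<Longrightarrow> \<rho> \<in> rays \<Delta> \<Longrightarrow>
      0 \<le> pvtx \<sigma> \<bullet> to_real (ray_generator \<rho>) + of_int (D \<rho>) + t * (to_real w \<bullet> to_real (ray_generator \<rho>))" by metis
  have "pvtx \<sigma> + \<epsilon> *\<^sub>R to_real w \<in> P"
    unfolding divisor_polytope_def
  proof (intro CollectI ballI)
    fix \<rho> assume "\<rho> \<in> rays \<Delta>"
    from \<epsilon>(2)[OF \<epsilon>(1) order_refl this]
    show "- of_int (D \<rho>) \<le> (pvtx \<sigma> + \<epsilon> *\<^sub>R to_real w) \<bullet> to_real (ray_generator \<rho>)"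
      unfolding inner_add_left inner_scaleR_left by linarith
  qed
  then have \<epsilon>T: "\<epsilon> \<in> T" using \<epsilon>(1) by (simp add: T_def)
  have "T = {0..} \<inter> (\<lambda>t. pvtx \<sigma> + t *\<^sub>R to_real w) -` P" by (auto simp: T_def)
  moreover have "closed ((\<lambda>t. pvtx \<sigma> + t *\<^sub>R to_real w) -` P)"
    using polytope_P(3) by (intro closed_vimage compact_imp_closed continuous_intros)
  ultimately have "closed T" by (simp add: closed_Int)
  moreover have "bounded T"
  proof -
    obtain B where B: "\<And>x. x \<in> P \<Longrightarrow> norm x \<le> B" using compact_imp_bounded[OF polytope_P(3)] by (auto simp: bounded_iff)
    have nw: "0 < norm (to_real w)" using w0(1) by simp
    show ?thesis
    proof (rule boundedI)
      fix t assume "t \<in> T"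
      then have t: "0 \<le> t" "pvtx \<sigma> + t *\<^sub>R to_real w \<in> P" by (auto simp: T_def)
      have "t * norm (to_real w) = norm ((pvtx \<sigma> + t *\<^sub>R to_real w) - pvtx \<sigma>)" using t(1) by simp
      also have "\<dots> \<le> norm (pvtx \<sigma> + t *\<^sub>R to_real w) + norm (pvtx \<sigma>)" by (rule norm_triangle_ineq4)
      also have "\<dots> \<le> B + B" using B[OF t(2)] B[OF vertex_in[OF \<sigma>]] by simp
      finally show "norm t \<le> (B + B) / norm (to_real w)" using nw t(1) by (simp add: pos_le_divide_eq)
    qed
  qed
  ultimately have "compact T" by (simp add: compact_eq_bounded_closed)
  then obtain r where r: "r \<in> T" "\<And>t. t \<in> T \<Longrightarrow> t \<le> r"
    using compact_attains_sup[of T] \<epsilon>T by blast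
  have r0: "0 < r" using r(2)[OF \<epsilon>T] \<epsilon>(1) by simp
  have "(\<lambda>t. pvtx \<sigma> + t *\<^sub>R to_real w) ` T = closed_segment (pvtx \<sigma>) (pvtx \<sigma> + r *\<^sub>R to_real w)"
  proof
    show "(\<lambda>t. pvtx \<sigma> + t *\<^sub>R to_real w) ` T \<subseteq> closed_segment (pvtx \<sigma>) (pvtx \<sigma> + r *\<^sub>R to_real w)"
    proof
      fix x assume "x \<in> (\<lambda>t. pvtx \<sigma> + t *\<^sub>R to_real w) ` T"
      then obtain t where t: "x = pvtx \<sigma> + t *\<^sub>R to_real w" "t \<in> T" by blast
      have "0 \<le> t" "t \<le> r" using t(2) r(2) by (auto simp: T_def)
      moreover have "x = (1 - t / r) *\<^sub>R pvtx \<sigma> + (t / r) *\<^sub>R (pvtx \<sigma> + r *\<^sub>R to_real w)"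
        using r0 by (simp add: t(1) scaleR_add_right scaleR_left_diff_distrib)
      ultimately show "x \<in> closed_segment (pvtx \<sigma>) (pvtx \<sigma> + r *\<^sub>R to_real w)"
        unfolding closed_segment_def using r0 by (intro CollectI exI[of _ "t / r"]) simp
    qed
    have "pvtx \<sigma> \<in> P" "pvtx \<sigma> + r *\<^sub>R to_real w \<in> P" using vertex_in[OF \<sigma>] r(1) by (auto simp: T_def)
    then have seg: "closed_segment (pvtx \<sigma>) (pvtx \<sigma> + r *\<^sub>R to_real w) \<subseteq> P"
      using polytope_P(2) by (simp add: closed_segment_subset)
    show "closed_segment (pvtx \<sigma>) (pvtx \<sigma> + r *\<^sub>R to_real w) \<subseteq> (\<lambda>t. pvtx \<sigma> + t *\<^sub>R to_real w) ` T"
    proof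
      fix x assume x: "x \<in> closed_segment (pvtx \<sigma>) (pvtx \<sigma> + r *\<^sub>R to_real w)"
      then obtain s where s: "0 \<le> s" "s \<le> 1" "x = (1 - s) *\<^sub>R pvtx \<sigma> + s *\<^sub>R (pvtx \<sigma> + r *\<^sub>R to_real w)"
        by (auto simp: closed_segment_def)
      have "x = pvtx \<sigma> + (s * r) *\<^sub>R to_real w" using s(3) by (simp add: algebra_simps)
      moreover have "s * r \<in> T" using calculation x seg s r0 by (auto simp: T_def)
      ultimately show "x \<in> (\<lambda>t. pvtx \<sigma> + t *\<^sub>R to_real w) ` T" by blast
    qed
  qed
  moreover have "aff_dim (closed_segment (pvtx \<sigma>) (pvtx \<sigma> + r *\<^sub>R to_real w)) = 1"
    using r0 w0(1) by (simp add: segment_convex_hull aff_dim_convex_hull)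
  ultimately have "closed_segment (pvtx \<sigma>) (pvtx \<sigma> + r *\<^sub>R to_real w) edge_of P"
    using face slice by (simp add: edge_of_def)
  then show ?thesis using that r0 by blast
qed

text \<open>The minimum is over a finite set: a polytope has finitely many faces, and a segment
  together with one end determines the other end.\<close>

lemma min_edge_length_le:
  assumes e: "closed_segment (pvtx \<sigma>) b edge_of P" and w: "primitive w" "0 < r" "b - pvtx \<sigma> = r *\<^sub>R to_real w"
  shows "min_edge_length \<Delta> D \<sigma> \<le> r"
proof -
  let ?B = "{b. closed_segment (pvtx \<sigma>) b edge_of P}"
  have "finite {F. F face_of P}" by (rule finite_polytope_faces[OF polytope_P(1)])
  then have "finite (closed_segment (pvtx \<sigma>) ` ?B)" by (rule rev_finite_subset) (auto simp: edge_of_def)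
  moreover have "inj_on (closed_segment (pvtx \<sigma>)) ?B" by (auto simp: inj_on_def doubleton_eq_iff)
  ultimately have "finite ?B" by (rule finite_imageD)
  moreover have "{lattice_length (pvtx \<sigma>) b | b. closed_segment (pvtx \<sigma>) b edge_of P} = lattice_length (pvtx \<sigma>) ` ?B" by auto
  ultimately have "min_edge_length \<Delta> D \<sigma> \<le> lattice_length (pvtx \<sigma>) b"
    unfolding min_edge_length_def using e by (intro Min_le) auto
  then show ?thesis using lattice_length_eq[OF w] by simp
qed

lemma min_edge_point:
  assumes \<sigma>: "\<sigma> \<in> maximal_cones \<Delta>" and L: "0 \<le> min_edge_length \<Delta> D \<sigma>"
    and e: "closed_segment (pvtx \<sigma>) (pvtx \<sigma> + r *\<^sub>R to_real w) edge_of P" and w: "primitive w" "0 < r"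
  shows "pvtx \<sigma> + min_edge_length \<Delta> D \<sigma> *\<^sub>R to_real w \<in> P"
proof -
  let ?L = "min_edge_length \<Delta> D \<sigma>"
  have "?L \<le> r" by (rule min_edge_length_le[OF e w]) simp
  then have "(1 - ?L / r) *\<^sub>R pvtx \<sigma> + (?L / r) *\<^sub>R (pvtx \<sigma> + r *\<^sub>R to_real w) \<in> closed_segment (pvtx \<sigma>) (pvtx \<sigma> + r *\<^sub>R to_real w)"
    unfolding closed_segment_def using L w(2) by (intro CollectI exI[of _ "?L / r"]) simp
  moreover have "(1 - ?L / r) *\<^sub>R pvtx \<sigma> + (?L / r) *\<^sub>R (pvtx \<sigma> + r *\<^sub>R to_real w) = pvtx \<sigma> + ?L *\<^sub>R to_real w"
    using w(2) by (simp add: scaleR_add_right scaleR_left_diff_distrib)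
  ultimately show ?thesis using edge_of_imp_subset[OF e] by auto
qed

end

section \<open>Consequences of the bound on the edge lengths\<close>

locale jet_toric_fan = polarized_toric_fan \<Delta> D
  for \<Delta> :: "(real ^ 'n::{finite,linorder}) set set" and D :: "'n tdivisor" +
  fixes K :: "'k::alg_closed_field itself" and k :: nat
  assumes edge_length: "\<sigma> \<in> maximal_cones \<Delta> \<Longrightarrow> real k + Gamma_const K (dual_cone \<sigma>) \<le> min_edge_length \<Delta> D \<sigma>"
begin

abbreviation "ord \<sigma> \<equiv> order_at_fixed_point K (dual_cone \<sigma>)"
abbreviation "RG \<sigma> \<equiv> ray_generators (dual_cone \<sigma>)"
abbreviation "L \<sigma> \<equiv> min_edge_length \<Delta> D \<sigma>"

text \<open>\<Gamma> is nonnegative, by the coefficient estimate at 0, whose order is 0.\<close>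

lemma length_nonneg:
  assumes \<sigma>: "\<sigma> \<in> maximal_cones \<Delta>" shows "0 \<le> L \<sigma>"
proof -
  note S = maximal_coneD[OF \<sigma>]
  have 0: "to_real 0 \<in> dual_cone \<sigma>" by (simp add: convex_cone_contains_0[OF convex_cone_dual_cone])
  obtain \<xi> :: "'n lattice" where \<xi>: "\<And>u. u \<in> dual_cone \<sigma> \<Longrightarrow> u \<noteq> 0 \<Longrightarrow> 0 < u \<bullet> to_real \<xi>"
    by (rule full_cone_dual_positive[OF S(2,3)]) blast
  have "real (ord \<sigma> 0) \<le> 0"
    using summands_bound[OF \<xi> order_at_fixed_point(1)[OF S(2,3) 0, of K]] by simp
  moreover have "(\<Sum>w\<in>RG \<sigma>. 0) \<le> real (ord \<sigma> 0) + Gamma_const K (dual_cone \<sigma>)"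
    by (rule coefficient_sum_le_order[OF S(2,3)]) simp_all
  ultimately show ?thesis using edge_length[OF \<sigma>] by simp
qed

lemma vertex_corner:
  assumes \<sigma>: "\<sigma> \<in> maximal_cones \<Delta>" and a: "\<And>w. w \<in> RG \<sigma> \<Longrightarrow> 0 \<le> a w" "(\<Sum>w\<in>RG \<sigma>. a w) \<le> L \<sigma>"
  shows "pvtx \<sigma> + (\<Sum>w\<in>RG \<sigma>. a w *\<^sub>R to_real w) \<in> P"
proof (rule convex_corner[OF polytope_P(2) vertex_in[OF \<sigma>] _ _ a])
  note S = maximal_coneD[OF \<sigma>]
  show "finite (RG \<sigma>)" by (rule ray_generators_dual(1)[OF S(2,3)])
  fix w assume w: "w \<in> RG \<sigma>"
  obtain r where "0 < r" "closed_segment (pvtx \<sigma>) (pvtx \<sigma> + r *\<^sub>R to_real w) edge_of P"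
    by (rule edge_at_vertex[OF \<sigma> w])
  then show "pvtx \<sigma> + L \<sigma> *\<^sub>R to_real w \<in> P"
    using min_edge_point[OF \<sigma> length_nonneg[OF \<sigma>]] ray_generators_dual(2)[OF S(2,3) w] by blast
qed

lemma vertex_coefficients:
  assumes \<sigma>: "\<sigma> \<in> maximal_cones \<Delta>" and x: "x \<in> P"
  obtains a where "\<And>w. w \<in> RG \<sigma> \<Longrightarrow> 0 \<le> a w" "x - pvtx \<sigma> = (\<Sum>w\<in>RG \<sigma>. a w *\<^sub>R to_real w)"
proof -
  have "x - pvtx \<sigma> \<in> dual_cone \<sigma>" using \<sigma> x mem_polytope_iff by blast
  from ray_generators_dual(3)[OF maximal_coneD(2,3)[OF \<sigma>] this] that show ?thesis by blast
qed

text \<open>Order at most \<open>k\<close> forces a coefficient sum of at most k + \<Gamma>, hence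
  at most \<open>L \<sigma>\<close>, so the point lies in the corner of \<open>P\<close> at
  \<sigma>.\<close>

lemma small_order_in_polytope:
  assumes \<sigma>: "\<sigma> \<in> maximal_cones \<Delta>" and u: "to_real u \<in> dual_cone \<sigma>" and o: "ord \<sigma> u \<le> k"
  shows "pvtx \<sigma> + to_real u \<in> P"
proof -
  note S = maximal_coneD[OF \<sigma>]
  obtain a where a: "\<forall>w\<in>RG \<sigma>. 0 \<le> a w" "to_real u = (\<Sum>w\<in>RG \<sigma>. a w *\<^sub>R to_real w)"
    using ray_generators_dual(3)[OF S(2,3) u] by blast
  have "(\<Sum>w\<in>RG \<sigma>. a w) \<le> real (ord \<sigma> u) + Gamma_const K (dual_cone \<sigma>)"
    by (rule coefficient_sum_le_order[OF S(2,3)]) (use a in auto)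
  then have "(\<Sum>w\<in>RG \<sigma>. a w) \<le> L \<sigma>" using o edge_length[OF \<sigma>] by linarith
  from vertex_corner[OF \<sigma> _ this] show ?thesis using a by simp
qed

text \<open>A point other than the vertex with coefficient sum below \<open>L \<sigma>\<close> lies
  strictly between the vertex and the point \<open>p\<close> of coefficient sum
  \<open>L \<sigma>\<close> on the same half-line, so it is not extreme.\<close>

lemma extreme_point_coefficients:
  assumes \<sigma>: "\<sigma> \<in> maximal_cones \<Delta>" and e: "e extreme_point_of P" "e \<noteq> pvtx \<sigma>"
  obtains a where "\<And>w. w \<in> RG \<sigma> \<Longrightarrow> 0 \<le> a w" "e - pvtx \<sigma> = (\<Sum>w\<in>RG \<sigma>. a w *\<^sub>R to_real w)"
    "L \<sigma> \<le> (\<Sum>w\<in>RG \<sigma>. a w)"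
proof -
  note S = maximal_coneD[OF \<sigma>]
  have eP: "e \<in> P" using e(1) by (simp add: extreme_point_of_def)
  obtain a where a: "\<And>w. w \<in> RG \<sigma> \<Longrightarrow> 0 \<le> a w" "e - pvtx \<sigma> = (\<Sum>w\<in>RG \<sigma>. a w *\<^sub>R to_real w)"
    by (rule vertex_coefficients[OF \<sigma> eP]) blast
  have "L \<sigma> \<le> (\<Sum>w\<in>RG \<sigma>. a w)"
  proof (rule ccontr)
    assume "\<not> ?thesis"
    then have lt: "(\<Sum>w\<in>RG \<sigma>. a w) < L \<sigma>" by simp
    define s where "s = (\<Sum>w\<in>RG \<sigma>. a w) / L \<sigma>"
    have "0 \<le> (\<Sum>w\<in>RG \<sigma>. a w)" by (rule sum_nonneg[OF a(1)])
    then have L: "0 < L \<sigma>" using lt by linarith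
    have s1: "s < 1" using lt L by (simp add: s_def)
    have s0: "s \<noteq> 0"
    proof
      assume "s = 0"
      then have "\<forall>w\<in>RG \<sigma>. a w = 0"
        using L a(1) ray_generators_dual(1)[OF S(2,3)] by (simp add: s_def sum_nonneg_eq_0_iff)
      then have "e - pvtx \<sigma> = 0" unfolding a(2) by simp
      then show False using e(2) by simp
    qed
    have s: "0 < s" using s0 L sum_nonneg[of "RG \<sigma>" a] a(1) by (simp add: s_def)
    define p where "p = pvtx \<sigma> + (\<Sum>w\<in>RG \<sigma>. (a w / s) *\<^sub>R to_real w)"
    have "(\<Sum>w\<in>RG \<sigma>. a w) = s * L \<sigma>" using L by (simp add: s_def)
    then have "(\<Sum>w\<in>RG \<sigma>. a w / s) = L \<sigma>" using s by (simp flip: sum_divide_distrib)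
    then have pP: "p \<in> P" unfolding p_def using a(1) s by (intro vertex_corner[OF \<sigma>]) auto
    have "s *\<^sub>R (p - pvtx \<sigma>) = e - pvtx \<sigma>"
      unfolding p_def a(2) using s by (simp add: scaleR_sum_right)
    then have ep: "e = (1 - s) *\<^sub>R pvtx \<sigma> + s *\<^sub>R p" by (simp add: algebra_simps)
    have "p \<noteq> pvtx \<sigma>" using ep e(2) by (auto simp: algebra_simps)
    then have "e \<in> open_segment (pvtx \<sigma>) p" using ep s s1 by (auto simp: in_segment)
    then show False using e(1) pP vertex_in[OF \<sigma>] by (auto simp: extreme_point_of_def)
  qed
  with a that show ?thesis by blast
qed

definition "verts = {e. e extreme_point_of P}"

lemma verts: "finite verts" "P = convex hull verts"
  unfolding verts_def
  by (rule finite_polyhedron_extreme_points[OF polytope_imp_polyhedron[OF polytope_P(1)]],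
      rule Krein_Milman_Minkowski[OF polytope_P(3,2)])

text \<open>Seen from \<sigma>, every other extreme point has coefficient sum at least
  \<open>L \<sigma>\<close>, and averaging preserves this if the vertex of \<sigma> has weight 0.
  Comparison with the order leaves \<open>k\<close> after \<Gamma> cancels.\<close>

lemma order_ge_off_vertex:
  assumes \<sigma>: "\<sigma> \<in> maximal_cones \<Delta>" and c: "\<And>e. e \<in> verts \<Longrightarrow> 0 \<le> c e" "sum c verts = 1"
    and m: "(\<Sum>e\<in>verts. c e *\<^sub>R e) = to_real m" and z: "pvtx \<sigma> \<in> verts \<Longrightarrow> c (pvtx \<sigma>) = 0"
  shows "k \<le> ord \<sigma> (m - vtx \<sigma>)"
proof -
  note S = maximal_coneD[OF \<sigma>]
  have rep: "\<exists>a. (\<forall>w\<in>RG \<sigma>. 0 \<le> a w) \<and> e - pvtx \<sigma> = (\<Sum>w\<in>RG \<sigma>. a w *\<^sub>R to_real w) \<and>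
      (e = pvtx \<sigma> \<or> L \<sigma> \<le> (\<Sum>w\<in>RG \<sigma>. a w))" if "e \<in> verts" for e
  proof (cases "e = pvtx \<sigma>")
    case True
    then show ?thesis by (intro exI[of _ "\<lambda>_. 0"]) simp
  next
    case False
    have ex: "e extreme_point_of P" using that by (simp add: verts_def)
    obtain a where "\<And>w. w \<in> RG \<sigma> \<Longrightarrow> 0 \<le> a w" "e - pvtx \<sigma> = (\<Sum>w\<in>RG \<sigma>. a w *\<^sub>R to_real w)"
      "L \<sigma> \<le> (\<Sum>w\<in>RG \<sigma>. a w)" by (rule extreme_point_coefficients[OF \<sigma> ex False]) blast
    then show ?thesis by blast
  qed
  define Q where "Q e a \<longleftrightarrow> (\<forall>w\<in>RG \<sigma>. 0 \<le> a w) \<and> e - pvtx \<sigma> = (\<Sum>w\<in>RG \<sigma>. a w *\<^sub>R to_real w) \<and>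
      (e = pvtx \<sigma> \<or> L \<sigma> \<le> (\<Sum>w\<in>RG \<sigma>. a w))" for e a
  have "\<exists>a. Q e a" if "e \<in> verts" for e unfolding Q_def by (rule rep[OF that])
  then obtain a where a': "\<And>e. e \<in> verts \<Longrightarrow> Q e (a e)" by metis
  have a: "\<And>e w. e \<in> verts \<Longrightarrow> w \<in> RG \<sigma> \<Longrightarrow> 0 \<le> a e w"
    "\<And>e. e \<in> verts \<Longrightarrow> e - pvtx \<sigma> = (\<Sum>w\<in>RG \<sigma>. a e w *\<^sub>R to_real w)"
    "\<And>e. e \<in> verts \<Longrightarrow> e = pvtx \<sigma> \<or> L \<sigma> \<le> (\<Sum>w\<in>RG \<sigma>. a e w)"
    using a' unfolding Q_def by blast+
  define b where "b w = (\<Sum>e\<in>verts. c e * a e w)" for w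
  have "to_real (m - vtx \<sigma>) = (\<Sum>e\<in>verts. c e *\<^sub>R e) - (\<Sum>e\<in>verts. c e) *\<^sub>R pvtx \<sigma>" using m c(2) by simp
  also have "\<dots> = (\<Sum>e\<in>verts. c e *\<^sub>R (e - pvtx \<sigma>))"
    by (simp add: scaleR_sum_left scaleR_diff_right sum_subtractf)
  also have "\<dots> = (\<Sum>e\<in>verts. \<Sum>w\<in>RG \<sigma>. (c e * a e w) *\<^sub>R to_real w)"
    by (rule sum.cong) (simp_all add: a(2) scaleR_sum_right)
  also have "\<dots> = (\<Sum>w\<in>RG \<sigma>. b w *\<^sub>R to_real w)"
    by (subst sum.swap) (simp add: b_def scaleR_sum_left)
  finally have mb: "to_real (m - vtx \<sigma>) = (\<Sum>w\<in>RG \<sigma>. b w *\<^sub>R to_real w)" .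
  have "0 \<le> b w" if "w \<in> RG \<sigma>" for w unfolding b_def using a(1) c(1) that by (intro sum_nonneg) simp
  from coefficient_sum_le_order[OF S(2,3) this mb]
  have 1: "(\<Sum>w\<in>RG \<sigma>. b w) \<le> real (ord \<sigma> (m - vtx \<sigma>)) + Gamma_const K (dual_cone \<sigma>)" .
  have "c e * L \<sigma> \<le> c e * (\<Sum>w\<in>RG \<sigma>. a e w)" if "e \<in> verts" for e
    using a(3)[OF that] c(1)[OF that] z that by (cases "e = pvtx \<sigma>") (auto intro: mult_left_mono)
  then have "(\<Sum>e\<in>verts. c e * L \<sigma>) \<le> (\<Sum>e\<in>verts. c e * (\<Sum>w\<in>RG \<sigma>. a e w))" by (rule sum_mono)
  also have "\<dots> = (\<Sum>w\<in>RG \<sigma>. b w)" unfolding b_def sum_distrib_left by (rule sum.swap)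
  finally have "L \<sigma> \<le> (\<Sum>w\<in>RG \<sigma>. b w)" using c(2) by (simp flip: sum_distrib_right)
  then show ?thesis using 1 edge_length[OF \<sigma>] by linarith
qed

text \<open>
  If \<open>m\<close> has small order at both vertices, each of its convex representations involves both of
  them; hence they span an edge of \<open>P\<close>, with primitive direction \<open>w\<close>, and \<open>m + q w\<close> still lies in \<open>P\<close>
  for \<open>q = k - ord \<sigma> (m - u\<^sub>\<sigma>)\<close>.  Walking back by \<open>q\<close> steps \<open>-w\<close> shows that \<open>m\<close> has order at least \<open>q\<close> at \<open>\<tau>\<close>.
\<close>

theorem orders_at_two_vertices:
  assumes \<sigma>: "\<sigma> \<in> maximal_cones \<Delta>" and \<tau>: "\<tau> \<in> maximal_cones \<Delta>" and ne: "\<sigma> \<noteq> \<tau>" and m: "to_real m \<in> P"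
  shows "k \<le> ord \<sigma> (m - vtx \<sigma>) + ord \<tau> (m - vtx \<tau>)"
proof (rule ccontr)
  assume "\<not> ?thesis"
  then have lt: "ord \<sigma> (m - vtx \<sigma>) + ord \<tau> (m - vtx \<tau>) < k" by simp
  note S = maximal_coneD[OF \<sigma>] and T = maximal_coneD[OF \<tau>]
  have dist: "pvtx \<sigma> \<noteq> pvtx \<tau>" using vertex_distinct[OF \<sigma> \<tau> ne] by simp
  have "closed_segment (pvtx \<sigma>) (pvtx \<tau>) face_of convex hull verts"
  proof (rule segment_face_of_positive_weights[OF verts(1) _ dist])
    show "to_real m \<in> convex hull verts" using m verts(2) by simp
    fix c assume c: "\<And>e. e \<in> verts \<Longrightarrow> 0 \<le> c e" "sum c verts = 1" "(\<Sum>e\<in>verts. c e *\<^sub>R e) = to_real m"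
    have "\<not> k \<le> ord \<sigma> (m - vtx \<sigma>)" "\<not> k \<le> ord \<tau> (m - vtx \<tau>)" using lt by auto
    then have "\<not> (pvtx \<sigma> \<in> verts \<longrightarrow> c (pvtx \<sigma>) = 0)" "\<not> (pvtx \<tau> \<in> verts \<longrightarrow> c (pvtx \<tau>) = 0)"
      using order_ge_off_vertex[OF \<sigma> c] order_ge_off_vertex[OF \<tau> c] by blast+
    then show "pvtx \<sigma> \<in> verts \<and> pvtx \<tau> \<in> verts \<and> 0 < c (pvtx \<sigma>) \<and> 0 < c (pvtx \<tau>)"
      using c(1) by (auto simp: less_le)
  qed
  then have face: "closed_segment (pvtx \<sigma>) (pvtx \<tau>) face_of P" using verts(2) by simp
  have "vtx \<tau> - vtx \<sigma> \<noteq> 0" using vertex_distinct[OF \<sigma> \<tau> ne] by simp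
  then obtain w d where w: "primitive w" "1 \<le> d" "vtx \<tau> - vtx \<sigma> = frag_cmul d w" by (rule primitive_decompose)
  have wd: "pvtx \<tau> = pvtx \<sigma> + of_int d *\<^sub>R to_real w"
    using arg_cong[OF w(3), of to_real] by (simp add: algebra_simps)
  have "closed_segment (pvtx \<sigma>) (pvtx \<sigma> + of_int d *\<^sub>R to_real w) edge_of P"
    using face dist unfolding wd edge_of_def by (simp add: segment_convex_hull aff_dim_convex_hull)
  from min_edge_point[OF \<sigma> length_nonneg[OF \<sigma>] this w(1)] w(2)
  have Lw: "pvtx \<sigma> + L \<sigma> *\<^sub>R to_real w \<in> P" by simp
  define q where "q = k - ord \<sigma> (m - vtx \<sigma>)"
  have q: "real q = real k - real (ord \<sigma> (m - vtx \<sigma>))" "0 < q" using lt by (auto simp: q_def of_nat_diff)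
  obtain a where a: "\<And>v. v \<in> RG \<sigma> \<Longrightarrow> 0 \<le> a v" "to_real m - pvtx \<sigma> = (\<Sum>v\<in>RG \<sigma>. a v *\<^sub>R to_real v)"
    by (rule vertex_coefficients[OF \<sigma> m]) blast
  have "(\<Sum>v\<in>RG \<sigma>. a v) \<le> real (ord \<sigma> (m - vtx \<sigma>)) + Gamma_const K (dual_cone \<sigma>)"
    by (rule coefficient_sum_le_order[OF S(2,3) a(1)]) (use a(2) in auto)
  then have aL: "(\<Sum>v\<in>RG \<sigma>. a v) + real q \<le> L \<sigma>" using edge_length[OF \<sigma>] q(1) by linarith
  have a0: "0 \<le> (\<Sum>v\<in>RG \<sigma>. a v)" using a(1) by (intro sum_nonneg) auto
  \<comment> \<open>\<open>m\<close> lies in the corner of size L - q at \<sigma>. Stretched by t =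
    L / (L - q) it lies in the corner of size L, and the convex combination with the edge point at
    distance L, of weight r = q / L, gives \<open>m\<close> plus q steps along the edge. If L = q,
    then \<open>m\<close> is the vertex itself.\<close>
  have mq: "to_real m + real q *\<^sub>R to_real w \<in> P"
  proof (cases "L \<sigma> = real q")
    case True
    then have "(\<Sum>v\<in>RG \<sigma>. a v) = 0" using aL a0 by linarith
    then have "\<forall>v\<in>RG \<sigma>. a v = 0" using a(1) ray_generators_dual(1)[OF S(2,3)] by (simp add: sum_nonneg_eq_0_iff)
    then have "to_real m - pvtx \<sigma> = 0" unfolding a(2) by simp
    then show ?thesis using Lw True by simp
  next
    case False
    then have Lq: "0 < L \<sigma> - real q" "0 < L \<sigma>" using aL a0 q(2) by linarith+
    define t where "t = L \<sigma> / (L \<sigma> - real q)"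
    have t: "0 < t" using Lq by (simp add: t_def)
    have "t * (\<Sum>v\<in>RG \<sigma>. a v) \<le> t * (L \<sigma> - real q)" using aL t by (intro mult_left_mono) auto
    also have "\<dots> = L \<sigma>" using Lq by (simp add: t_def)
    finally have "(\<Sum>v\<in>RG \<sigma>. t * a v) \<le> L \<sigma>" by (simp add: sum_distrib_left)
    from vertex_corner[OF \<sigma> _ this] a(1) t
    have "pvtx \<sigma> + (\<Sum>v\<in>RG \<sigma>. (t * a v) *\<^sub>R to_real v) \<in> P" by simp
    then have A: "pvtx \<sigma> + t *\<^sub>R (to_real m - pvtx \<sigma>) \<in> P" unfolding a(2) by (simp add: scaleR_sum_right)
    define r where "r = real q / L \<sigma>"
    have r: "0 \<le> r" "r \<le> 1" "(1 - r) * t = 1" "r * L \<sigma> = real q"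
      using Lq by (auto simp: r_def t_def field_simps)
    have "(1 - r) *\<^sub>R (pvtx \<sigma> + t *\<^sub>R (to_real m - pvtx \<sigma>)) + r *\<^sub>R (pvtx \<sigma> + L \<sigma> *\<^sub>R to_real w) \<in> P"
      using r by (intro convexD[OF polytope_P(2) A Lw]) auto
    also have "(1 - r) *\<^sub>R (pvtx \<sigma> + t *\<^sub>R (to_real m - pvtx \<sigma>)) + r *\<^sub>R (pvtx \<sigma> + L \<sigma> *\<^sub>R to_real w)
        = ((1 - r) *\<^sub>R pvtx \<sigma> + r *\<^sub>R pvtx \<sigma>) + ((1 - r) * t) *\<^sub>R (to_real m - pvtx \<sigma>) + (r * L \<sigma>) *\<^sub>R to_real w"
      by (simp only: scaleR_add_right scaleR_scaleR) (simp only: ac_simps)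
    also have "\<dots> = to_real m + real q *\<^sub>R to_real w"
      unfolding r(3,4) by (simp flip: scaleR_left_distrib)
    finally show ?thesis .
  qed
  \<comment> \<open>The edge runs from \<sigma> to \<tau>, so its reversed direction points from the
    vertex of \<tau> into \<open>P\<close>.\<close>
  have "pvtx \<sigma> - pvtx \<tau> \<in> dual_cone \<tau>" using vertex_diff[OF \<sigma> \<tau>] by simp
  then have "(1 / of_int d) *\<^sub>R (pvtx \<sigma> - pvtx \<tau>) \<in> dual_cone \<tau>"
    by (rule convex_cone_scaleR[OF convex_cone_dual_cone, rotated]) (use w(2) in simp)
  then have nw: "to_real (- w) \<in> dual_cone \<tau>" using w(2) by (simp add: wd)
  have w0: "- w \<noteq> 0" using w(1) by (simp add: primitive_def)
  have "to_real m + real q *\<^sub>R to_real w - pvtx \<tau> \<in> dual_cone \<tau>" using mq mem_polytope_iff \<tau> by blast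
  then have rest: "to_real (m + frag_cmul (int q) w - vtx \<tau>) \<in> dual_cone \<tau>" by simp
  have "frag_cmul (int q) (- w) + (m + frag_cmul (int q) w - vtx \<tau>) = m - vtx \<tau>"
    by (rule poly_mapping_eqI) (simp add: lookup_add lookup_minus)
  with summands_add_right[OF convex_cone_dual_cone rest summands_multiple[OF convex_cone_dual_cone w0 nw, of q]]
  have "summands (dual_cone \<tau>) q (m - vtx \<tau>)" by (simp only:)
  moreover have "to_real (m - vtx \<tau>) \<in> dual_cone \<tau>" using m mem_polytope_iff \<tau> by simp
  ultimately have "q \<le> ord \<tau> (m - vtx \<tau>)" using order_at_fixed_point(2)[OF T(2,3)] by blast
  then show False using lt by (simp add: q_def)
qed

end

subsection \<open>Attracting charts and the reduction of monomials\<close>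

lemma ideal_mult_0: "0 \<in> ideal_mult I J"
  unfolding ideal_mult_def by (intro CollectI exI[of _ 0]) auto

lemma ideal_mult_add:
  assumes "x \<in> ideal_mult I J" "y \<in> ideal_mult I J" shows "x + y \<in> ideal_mult I J"
proof -
  obtain m a b where x: "x = (\<Sum>i<(m::nat). a i * b i)" "\<forall>i<m. a i \<in> I \<and> b i \<in> J"
    using assms(1) unfolding ideal_mult_def by blast
  obtain n c d where y: "y = (\<Sum>i<(n::nat). c i * d i)" "\<forall>i<n. c i \<in> I \<and> d i \<in> J"
    using assms(2) unfolding ideal_mult_def by blast
  define e where "e i = (if i < m then a i else c (i - m))" for i
  define g where "g i = (if i < m then b i else d (i - m))" for i
  have "(\<Sum>i<m + n. e i * g i) = (\<Sum>i<m. e i * g i) + (\<Sum>i<n. e (m + i) * g (m + i))"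
    by (induction n) (simp_all add: add.assoc)
  also have "\<dots> = x + y" unfolding x(1) y(1) by (simp add: e_def g_def)
  finally have "x + y = (\<Sum>i<m + n. e i * g i)" ..
  moreover have "\<forall>i<m + n. e i \<in> I \<and> g i \<in> J" using x(2) y(2) by (auto simp: e_def g_def)
  ultimately show ?thesis unfolding ideal_mult_def by blast
qed

lemma ideal_mult_scale:
  assumes "\<And>b. b \<in> J \<Longrightarrow> r * b \<in> J" "x \<in> ideal_mult I J" shows "r * x \<in> ideal_mult I J"
proof -
  obtain m a b where x: "x = (\<Sum>i<(m::nat). a i * b i)" "\<forall>i<m. a i \<in> I \<and> b i \<in> J"
    using assms(2) unfolding ideal_mult_def by blast
  have "r * x = (\<Sum>i<m. a i * (r * b i))" unfolding x(1) sum_distrib_left by (simp add: mult.left_commute)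
  then show ?thesis unfolding ideal_mult_def using x(2) assms(1)
    by (intro CollectI exI[of _ m] exI[of _ a] exI[of _ "\<lambda>i. r * b i"]) auto
qed

lemma ideal_mult_mono:
  assumes "I \<subseteq> I'" shows "ideal_mult I J \<subseteq> ideal_mult I' J"
proof
  fix x assume "x \<in> ideal_mult I J"
  then obtain m a b where x: "x = (\<Sum>i<(m::nat). a i * b i)" "\<forall>i<m. a i \<in> I \<and> b i \<in> J"
    unfolding ideal_mult_def by blast
  then have "\<forall>i<m. a i \<in> I' \<and> b i \<in> J" using assms by blast
  then show "x \<in> ideal_mult I' J" unfolding ideal_mult_def using x(1) by blast
qed

lemma one_in_ideal_power: "1 \<in> R \<Longrightarrow> 1 \<in> ideal_power R R j"
  by (induction j) (use ideal_multI[of 1 _ 1] in auto)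

lemma power_in_ideal_power: "1 \<in> R \<Longrightarrow> z \<in> I \<Longrightarrow> z ^ j \<in> ideal_power R I j"
  by (induction j) (auto intro: ideal_multI)

abbreviation (input) emb :: "'a::idom \<Rightarrow> 'a fract" where "emb a \<equiv> Fract a 1"

lemma emb_simps:
  "emb (a + b) = emb a + emb b" "emb (a - b) = emb a - emb b" "emb (a * b) = emb a * emb b"
  "emb 1 = 1" "emb 0 = 0" "emb (- a) = - emb a"
  by (simp_all add: One_fract_def Zero_fract_def)

lemma emb_sum: "emb (sum f A) = (\<Sum>i\<in>A. emb (f i))"
proof (induction A rule: infinite_finite_induct)
  case (insert i A)
  show ?case unfolding sum.insert[OF insert.hyps] emb_simps(1) insert.IH ..
qed (simp_all add: fract_collapse)

lemma emb_power: "emb (a ^ n) = emb a ^ n"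
  by (induction n) (simp_all only: power_0 power_Suc emb_simps)

lemma eval_at_constant: "x \<in> affine_points \<sigma> \<Longrightarrow> eval_at x (Poly_Mapping.single 0 c) = c"
  by (simp add: eval_at_single affine_pointsD(1))

lemma eval_at_power:
  assumes "x \<in> affine_points \<sigma>" "f \<in> semigroup_algebra (dual_cone \<sigma>)"
  shows "eval_at x (f ^ n) = eval_at x f ^ n"
proof (induction n)
  case 0
  then show ?case using eval_at_1[OF assms(1)] by simp
next
  case (Suc n)
  have "f ^ n \<in> semigroup_algebra (dual_cone \<sigma>)"
    by (rule subring_set_power[OF subring_set_semigroup_algebra[OF convex_cone_dual_cone] assms(2)])
  then show ?case using eval_at_mult[OF assms, of "f ^ n"] Suc by simp
qed

lemma eval_at_prod:
  assumes "x \<in> affine_points \<sigma>" "\<And>i. i \<in> A \<Longrightarrow> f i \<in> semigroup_algebra (dual_cone \<sigma>)"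
  shows "prod f A \<in> semigroup_algebra (dual_cone \<sigma>) \<and> eval_at x (prod f A) = (\<Prod>i\<in>A. eval_at x (f i))"
  using assms(2)
proof (induction A rule: infinite_finite_induct)
  case (insert i A)
  note S = subring_setD[OF subring_set_semigroup_algebra[OF convex_cone_dual_cone[of \<sigma>]]]
  have fA: "f i \<in> semigroup_algebra (dual_cone \<sigma>)" "prod f A \<in> semigroup_algebra (dual_cone \<sigma>)"
    "eval_at x (prod f A) = (\<Prod>i\<in>A. eval_at x (f i))" using insert by auto
  show ?case unfolding prod.insert[OF insert.hyps(1,2)] using S(4)[OF fA(1,2)] eval_at_mult[OF assms(1) fA(1,2)] fA(3) by simp
qed (use subring_setD(1)[OF subring_set_semigroup_algebra[OF convex_cone_dual_cone[of \<sigma>]]] eval_at_1[OF assms(1)] in auto)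

context complete_toric_fan
begin

text \<open>
  The Bialynicki-Birula decomposition: in the chart \<open>U\<^sub>\<tau>\<close> found here the one-parameter subgroup of
  \<open>v\<close> moves the point to the fixed point of \<open>\<tau>\<close>.
\<close>

lemma attracting_chart:
  fixes p :: "('n, 'k::field) point"
  assumes v: "generic v" and p: "p \<in> toric_variety \<Delta>"
  shows "\<exists>\<tau> x. \<tau> \<in> maximal_cones \<Delta> \<and> (\<tau>, x) \<in> p \<and>
    (\<forall>u. to_real u \<in> dual_cone \<tau> \<longrightarrow> x u \<noteq> 0 \<longrightarrow> u = 0 \<or> 0 < to_real u \<bullet> v)"
proof -
  have fin: "finite {\<kappa> \<in> \<Delta>. \<exists>y. (\<kappa>, y) \<in> p}" using finite_cones by simp
  obtain \<sigma> x0 where x0: "(\<sigma>, x0) \<in> p" by (rule point_obtain[OF p])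
  then have ne: "{\<kappa> \<in> \<Delta>. \<exists>y. (\<kappa>, y) \<in> p} \<noteq> {}" using point_rep(1)[OF p x0] by blast
  \<comment> \<open>Minimality of \<gamma> means that the point lies in the torus orbit of
    \<gamma>.\<close>
  obtain \<gamma> where g: "\<gamma> \<in> {\<kappa> \<in> \<Delta>. \<exists>y. (\<kappa>, y) \<in> p}"
    "\<forall>\<kappa>\<in>{\<kappa> \<in> \<Delta>. \<exists>y. (\<kappa>, y) \<in> p}. \<kappa> \<subseteq> \<gamma> \<longrightarrow> \<gamma> = \<kappa>"
    using finite_has_minimal[OF fin ne] by meson
  then obtain y where \<gamma>: "\<gamma> \<in> \<Delta>" "(\<gamma>, y) \<in> p" by blast
  have mn: "\<gamma> = \<kappa>" if "\<kappa> \<in> \<Delta>" "(\<kappa>, z) \<in> p" "\<kappa> \<subseteq> \<gamma>" for \<kappa> z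
    using g(2) that by blast
  note rep = point_rep[OF p \<gamma>(2)]
  \<comment> \<open>A character nonzero at the point but not orthogonal to \<gamma> would cut out a
    proper face whose chart still contains the point.\<close>
  have perp: "to_real u \<bullet> w = 0" if u: "to_real u \<in> dual_cone \<gamma>" "y u \<noteq> 0" and w: "w \<in> \<gamma>" for u w
  proof -
    define \<kappa> where "\<kappa> = \<gamma> \<inter> {w. to_real u \<bullet> w = 0}"
    have "convex \<gamma>" using toric_coneD(1)[OF cone[OF \<gamma>(1)]] by (simp add: convex_cone_def)
    then have "\<kappa> face_of \<gamma>" unfolding \<kappa>_def
      using u(1) by (intro face_of_Int_supporting_hyperplane_ge) (auto simp: dual_cone_def)
    moreover have "0 \<in> \<kappa>" using toric_coneD(4)[OF cone[OF \<gamma>(1)]] by (simp add: \<kappa>_def)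
    ultimately have \<kappa>: "\<kappa> \<in> \<Delta>" using face[OF \<gamma>(1)] by blast
    have c: "cuts_face u \<gamma> \<kappa>" using u(1) by (auto simp: cuts_face_def \<kappa>_def dual_cone_def)
    obtain z where z: "z \<in> affine_points \<kappa>" "y = restrict z (lattice_points (dual_cone \<gamma>))"
      by (rule affine_point_extend[OF cone[OF \<gamma>(1)] c rep(2) u(2)])
    have "\<gamma> \<inter> \<kappa> = \<kappa>" by (auto simp: \<kappa>_def)
    then have "((\<gamma>, y), (\<kappa>, restrict z (lattice_points (dual_cone \<kappa>)))) \<in> gluing \<Delta>"
      using gluingI[OF \<gamma>(1) \<kappa>, of z] z by simp
    then have "(\<kappa>, restrict z (lattice_points (dual_cone \<kappa>))) \<in> p" using rep(3) by blast
    from mn[OF \<kappa> this] have "\<gamma> = \<kappa>" by (auto simp: \<kappa>_def)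
    then show ?thesis using w by (auto simp: \<kappa>_def)
  qed
  obtain \<tau> w \<epsilon> where \<tau>: "\<tau> \<in> \<Delta>" "span \<tau> = UNIV" "\<gamma> \<subseteq> \<tau>" "w \<in> \<gamma>" "0 < \<epsilon>" "w + \<epsilon> *\<^sub>R v \<in> interior \<tau>"
    by (rule perturb_into_full_cone[OF v \<gamma>(1)])
  define x where "x = restrict y (lattice_points (dual_cone \<tau>))"
  have "\<gamma> \<inter> \<tau> = \<gamma>" using \<tau>(3) by blast
  moreover have "y = restrict y (lattice_points (dual_cone \<gamma>))"
    using affine_pointsD(3)[OF rep(2)] by (simp add: extensional_restrict)
  ultimately have "((\<gamma>, y), (\<tau>, x)) \<in> gluing \<Delta>"
    using gluingI[OF \<gamma>(1) \<tau>(1), of y] rep(2) by (simp add: x_def)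
  then have "(\<tau>, x) \<in> p" using rep(3) by blast
  moreover have "\<tau> \<in> maximal_cones \<Delta>" using \<tau> by (simp add: maximal_cones_eq)
  moreover have "u = 0 \<or> 0 < to_real u \<bullet> v" if u: "to_real u \<in> dual_cone \<tau>" "x u \<noteq> 0" for u
  proof (cases "u = 0")
    case False
    have "to_real u \<in> dual_cone \<gamma>" using u(1) dual_cone_antimono[OF \<tau>(3)] by blast
    moreover have "y u \<noteq> 0" using u by (auto simp: x_def lattice_points_def)
    ultimately have "to_real u \<bullet> w = 0" using perp \<tau>(4) by blast
    \<comment> \<open>\<open>u\<close> is orthogonal to \<open>w\<close> and positive on the
      interior of \<tau>, so the positivity comes from \<open>v\<close>.\<close>
    moreover have "0 < to_real u \<bullet> (w + \<epsilon> *\<^sub>R v)" using interior_dual_positive[OF \<tau>(6) u(1)] False by simp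
    ultimately show ?thesis using \<tau>(5) by (simp add: inner_add_right zero_less_mult_iff)
  qed simp
  ultimately show ?thesis by blast
qed

lemma divisor_stalk_module:
  fixes p :: "('n, 'k::field) point"
  assumes p: "p \<in> toric_variety \<Delta>" "(\<sigma>, x) \<in> p" and u: "local_datum \<Delta> D \<sigma> u"
  shows "f \<in> divisor_stalk \<Delta> D p \<Longrightarrow> g \<in> divisor_stalk \<Delta> D p \<Longrightarrow> f + g \<in> divisor_stalk \<Delta> D p"
    and "r \<in> local_ring p \<Longrightarrow> g \<in> divisor_stalk \<Delta> D p \<Longrightarrow> r * g \<in> divisor_stalk \<Delta> D p"
proof -
  note st = divisor_stalk_eq[OF p u] and le = local_ring_eq(1)[OF p]
  note S = subring_setD[OF subring_set_chart_ring(1)[OF point_rep(2)[OF p]]]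
  show "f + g \<in> divisor_stalk \<Delta> D p" if fg: "f \<in> divisor_stalk \<Delta> D p" "g \<in> divisor_stalk \<Delta> D p"
  proof -
    obtain a b where "f = character u * a" "g = character u * b" "a \<in> chart_ring \<sigma> x" "b \<in> chart_ring \<sigma> x"
      using fg unfolding st by blast
    then have "f + g = character u * (a + b) \<and> a + b \<in> chart_ring \<sigma> x" using S(6) by (simp add: distrib_left)
    then show ?thesis unfolding st by blast
  qed
  show "r * g \<in> divisor_stalk \<Delta> D p" if rg: "r \<in> local_ring p" "g \<in> divisor_stalk \<Delta> D p"
  proof -
    obtain b where "g = character u * b" "b \<in> chart_ring \<sigma> x" using rg(2) unfolding st by blast
    then have "r * g = character u * (r * b) \<and> r * b \<in> chart_ring \<sigma> x" using S(4) rg(1) le by (simp add: mult.left_commute)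
    then show ?thesis unfolding st by blast
  qed
qed

end

section \<open>Jets at the given points\<close>

locale jet_points = jet_toric_fan \<Delta> D K k
  for \<Delta> :: "(real ^ 'n::{finite,linorder}) set set" and D :: "'n tdivisor"
    and K :: "'k::alg_closed_field itself" and k :: nat +
  fixes X :: "('n, 'k) point set" and mlt :: "('n, 'k) point \<Rightarrow> nat" and v :: "real ^ 'n::{finite,linorder}"
    and T :: "('n, 'k) point \<Rightarrow> (real ^ 'n::{finite,linorder}) set" and pt :: "('n, 'k) point \<Rightarrow> 'n lattice \<Rightarrow> 'k"
  assumes finX: "finite X" and X: "X \<subseteq> toric_variety \<Delta>" and mlt: "(\<Sum>p\<in>X. mlt p) = k + 1"
    and T: "p \<in> X \<Longrightarrow> T p \<in> maximal_cones \<Delta>" and pt: "p \<in> X \<Longrightarrow> (T p, pt p) \<in> p"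
    and attract: "p \<in> X \<Longrightarrow> to_real u \<in> dual_cone (T p) \<Longrightarrow> pt p u \<noteq> 0 \<Longrightarrow> u = 0 \<or> 0 < to_real u \<bullet> v"
begin

abbreviation "O\<^sub>p p \<equiv> chart_ring (T p) (pt p)"
abbreviation "\<mm> p \<equiv> chart_ideal (T p) (pt p)"
abbreviation "A \<sigma> \<equiv> semigroup_algebra (dual_cone \<sigma>) :: ('n, 'k) laurent set"

text \<open>Congruence modulo \<open>small p\<close> is equality of jets at \<open>p\<close> to the
  prescribed multiplicity.\<close>

definition small :: "('n::{finite,linorder}, 'k::alg_closed_field) point \<Rightarrow> ('n, 'k) function_field set" where
  "small p = ideal_mult (ideal_power (local_ring p) (max_ideal_at p) (mlt p)) (divisor_stalk \<Delta> D p)"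

lemma pX: "p \<in> X \<Longrightarrow> p \<in> toric_variety \<Delta>" using X by blast

lemma pt_affine: "p \<in> X \<Longrightarrow> pt p \<in> affine_points (T p)"
  using point_rep(2)[OF pX pt] .

lemmas ring_p = subring_setD[OF subring_set_chart_ring(1)[OF pt_affine]]
lemmas ring_A = subring_setD[OF subring_set_semigroup_algebra[OF convex_cone_dual_cone]]
lemmas emb_ring = subring_set_chart_ring(2)[OF pt_affine]
lemmas emb_ideal = subring_set_chart_ring(3)[OF pt_affine]

lemma stalk_p:
  assumes "p \<in> X"
  shows "divisor_stalk \<Delta> D p = {character (vtx (T p)) * g | g. g \<in> O\<^sub>p p}"
    "local_ring p = O\<^sub>p p" "max_ideal_at p = \<mm> p"
  using divisor_stalk_eq[OF pX pt vertex_datum[OF T]] local_ring_eq[OF pX pt] assms by simp_all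

lemma small_0: "0 \<in> small p"
  unfolding small_def by (rule ideal_mult_0)

lemma small_add: "f \<in> small p \<Longrightarrow> g \<in> small p \<Longrightarrow> f + g \<in> small p"
  unfolding small_def by (rule ideal_mult_add)

lemma small_scale:
  assumes p: "p \<in> X" and "r \<in> O\<^sub>p p" "f \<in> small p" shows "r * f \<in> small p"
  using assms(3) unfolding small_def
  by (rule ideal_mult_scale[rotated])
    (use divisor_stalk_module(2)[OF pX[OF p] pt[OF p] vertex_datum[OF T[OF p]]] stalk_p(2)[OF p] assms(2) in blast)

lemma small_uminus: assumes "p \<in> X" "f \<in> small p" shows "- f \<in> small p"
proof -
  have "- 1 \<in> O\<^sub>p p" using ring_p(5)[OF assms(1) ring_p(1)[OF assms(1)]] .
  from small_scale[OF assms(1) this assms(2)] show ?thesis by simp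
qed

lemma small_diff: "p \<in> X \<Longrightarrow> f \<in> small p \<Longrightarrow> g \<in> small p \<Longrightarrow> f - g \<in> small p"
  using small_add[of f p "- g"] small_uminus[of p g] by simp

lemma small_sum: "(\<And>i. i \<in> I \<Longrightarrow> f i \<in> small p) \<Longrightarrow> sum f I \<in> small p"
  by (induction I rule: infinite_finite_induct) (auto intro: small_0 small_add)

lemma smallI:
  assumes p: "p \<in> X" and g: "g \<in> ideal_power (O\<^sub>p p) (\<mm> p) (mlt p)" and r: "r \<in> O\<^sub>p p"
  shows "character (vtx (T p)) * (g * r) \<in> small p"
proof -
  have "g * (character (vtx (T p)) * r) \<in> small p"
    unfolding small_def stalk_p[OF p] using r by (intro ideal_multI g) blast
  then show ?thesis by (simp add: mult.left_commute)
qed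

lemma small_emb_scale:
  assumes "p \<in> X" "a \<in> A (T p)" "f \<in> small p" shows "f * emb a \<in> small p"
  using small_scale[OF assms(1) emb_ring[OF assms(1,2)] assms(3)] by (simp add: mult.commute)

abbreviation "V \<equiv> sections \<Delta> D (toric_variety \<Delta>) :: ('n, 'k) function_field set"

lemma any_chart:
  fixes p :: "('n, 'k) point"
  assumes "p \<in> toric_variety \<Delta>"
  obtains \<tau> x where "\<tau> \<in> maximal_cones \<Delta>" "(\<tau>, x) \<in> p"
proof -
  obtain v where "generic v" by (rule generic_exists)
  from attracting_chart[OF this assms] that show ?thesis by blast
qed

lemma sections_add: "f \<in> V \<Longrightarrow> g \<in> V \<Longrightarrow> f + g \<in> V"
proof -
  assume fg: "f \<in> V" "g \<in> V"
  have "f + g \<in> divisor_stalk \<Delta> D p" if p: "p \<in> toric_variety \<Delta>" for p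
  proof -
    obtain \<tau> x where t: "\<tau> \<in> maximal_cones \<Delta>" "(\<tau>, x) \<in> p" by (rule any_chart[OF p])
    show ?thesis
      by (rule divisor_stalk_module(1)[OF p t(2) vertex_datum[OF t(1)]]) (use fg p in \<open>auto simp: sections_def\<close>)
  qed
  then show "f + g \<in> V" by (simp add: sections_def)
qed

lemma sections_scale: "f \<in> V \<Longrightarrow> emb (Poly_Mapping.single 0 c) * f \<in> V"
proof -
  assume f: "f \<in> V"
  have "emb (Poly_Mapping.single 0 c) * f \<in> divisor_stalk \<Delta> D p" if p: "p \<in> toric_variety \<Delta>" for p :: "('n, 'k) point"
  proof -
    obtain \<tau> x where t: "\<tau> \<in> maximal_cones \<Delta>" "(\<tau>, x) \<in> p" by (rule any_chart[OF p])
    have "Poly_Mapping.single 0 c \<in> A \<tau>"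
      by (rule single_in_semigroup_algebra) (simp add: convex_cone_contains_0[OF convex_cone_dual_cone])
    then have "emb (Poly_Mapping.single 0 c) \<in> local_ring p"
      unfolding local_ring_eq(1)[OF p t(2)] by (rule subring_set_chart_ring(2)[OF point_rep(2)[OF p t(2)]])
    then show ?thesis
      by (rule divisor_stalk_module(2)[OF p t(2) vertex_datum[OF t(1)]]) (use f p in \<open>auto simp: sections_def\<close>)
  qed
  then show ?thesis by (simp add: sections_def)
qed

lemma sections_0: "0 \<in> V"
proof -
  have "0 \<in> divisor_stalk \<Delta> D p" if p: "p \<in> toric_variety \<Delta>" for p :: "('n, 'k) point"
  proof -
    obtain \<tau> x where t: "\<tau> \<in> maximal_cones \<Delta>" "(\<tau>, x) \<in> p" by (rule any_chart[OF p])
    have "(0 :: ('n, 'k) function_field) = character (vtx \<tau>) * 0" by simp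
    then show ?thesis unfolding divisor_stalk_eq[OF p t(2) vertex_datum[OF t(1)]]
      using subring_setD(2)[OF subring_set_chart_ring(1)[OF point_rep(2)[OF p t(2)]]] by blast
  qed
  then show ?thesis by (simp add: sections_def)
qed

lemma sections_sum: "(\<And>i. i \<in> I \<Longrightarrow> f i \<in> V) \<Longrightarrow> sum f I \<in> V"
  by (induction I rule: infinite_finite_induct) (auto intro: sections_0 sections_add)

lemma emb_single_uminus: "emb (Poly_Mapping.single 0 (- 1)) * f = (- f :: ('n, 'k) function_field)"
proof -
  have "emb (Poly_Mapping.single 0 (- 1)) = (- 1 :: ('n, 'k) function_field)"
    by (simp add: single_uminus One_fract_def)
  then show ?thesis by simp
qed

lemma sections_diff: "f \<in> V \<Longrightarrow> g \<in> V \<Longrightarrow> f - g \<in> V"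
  using sections_add[of f "- g"] sections_scale[of g "- 1"] unfolding emb_single_uminus by simp

lemma sections_character:
  assumes "to_real m \<in> P" shows "character m \<in> V"
proof -
  have "character m \<in> divisor_stalk \<Delta> D p" if p: "p \<in> toric_variety \<Delta>" for p :: "('n, 'k) point"
  proof -
    obtain \<tau> x where t: "\<tau> \<in> maximal_cones \<Delta>" "(\<tau>, x) \<in> p" by (rule any_chart[OF p])
    have "to_real (m - vtx \<tau>) \<in> dual_cone \<tau>" using assms mem_polytope_iff t(1) by simp
    then have "character (m - vtx \<tau>) \<in> chart_ring \<tau> x"
      unfolding character_def
      by (intro subring_set_chart_ring(2)[OF point_rep(2)[OF p t(2)]] single_in_semigroup_algebra)
    moreover have "character m = (character (vtx \<tau>) * character (m - vtx \<tau>) :: ('n, 'k) function_field)"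
      by (simp add: character_mult)
    ultimately show ?thesis unfolding divisor_stalk_eq[OF p t(2) vertex_datum[OF t(1)]] by blast
  qed
  then show ?thesis by (simp add: sections_def)
qed

end

lemma count_list_replicate: "count_list (replicate n x) y = (if x = y then n else 0)"
  by (induction n) auto

lemma list_with_multiplicities:
  assumes "finite S"
  shows "\<exists>ps. length ps = sum n S \<and> (\<forall>p\<in>S. count_list ps p = n p) \<and> set ps \<subseteq> S"
  using assms
proof (induction S rule: finite_induct)
  case (insert x S)
  then obtain ps where ps: "length ps = sum n S" "\<forall>p\<in>S. count_list ps p = n p" "set ps \<subseteq> S" by blast
  have "count_list ps x = 0" using ps(3) insert.hyps(2) by (auto simp: count_list_0_iff)
  then show ?case using ps insert.hyps
    by (intro exI[of _ "replicate (n x) x @ ps"]) (auto simp: count_list_replicate count_list_append)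
qed simp

context jet_points
begin

text \<open>Functions on the chart of \<sigma> whose jets at the points attached to \<sigma> come
  from a global section with zero jets at all other points. The aim is that every function of the
  chart is of this kind; linearity reduces it to monomials.\<close>

definition good :: "(real ^ 'n::{finite,linorder}) set \<Rightarrow> ('n, 'k::alg_closed_field) laurent set" where
  "good \<sigma> = {h \<in> semigroup_algebra (dual_cone \<sigma>). \<exists>F\<in>sections \<Delta> D (toric_variety \<Delta>). \<forall>p\<in>X.
     (T p = \<sigma> \<longrightarrow> F - character (cone_vertex \<Delta> D \<sigma>) * Fract h 1 \<in> small p) \<and> (T p \<noteq> \<sigma> \<longrightarrow> F \<in> small p)}"

text \<open>The total multiplicity of the points attached to \<sigma>, not to be confused with the
  pairing with \<open>v\<close> by which monomials are compared.\<close>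

definition weight :: "(real ^ 'n::{finite,linorder}) set \<Rightarrow> nat" where
  "weight \<sigma> = (\<Sum>p\<in>{p \<in> X. T p = \<sigma>}. mlt p)"

lemma good_add:
  assumes "g \<in> good \<sigma>" "h \<in> good \<sigma>" shows "g + h \<in> good \<sigma>"
proof -
  obtain F where F: "g \<in> A \<sigma>" "F \<in> V" "\<forall>p\<in>X. (T p = \<sigma> \<longrightarrow> F - character (vtx \<sigma>) * emb g \<in> small p) \<and> (T p \<noteq> \<sigma> \<longrightarrow> F \<in> small p)"
    using assms(1) unfolding good_def by blast
  obtain G where G: "h \<in> A \<sigma>" "G \<in> V" "\<forall>p\<in>X. (T p = \<sigma> \<longrightarrow> G - character (vtx \<sigma>) * emb h \<in> small p) \<and> (T p \<noteq> \<sigma> \<longrightarrow> G \<in> small p)"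
    using assms(2) unfolding good_def by blast
  have "F + G - character (vtx \<sigma>) * emb (g + h) = (F - character (vtx \<sigma>) * emb g) + (G - character (vtx \<sigma>) * emb h)"
    unfolding emb_simps(1) distrib_left by (rule add_diff_add)
  then have "\<forall>p\<in>X. (T p = \<sigma> \<longrightarrow> F + G - character (vtx \<sigma>) * emb (g + h) \<in> small p) \<and> (T p \<noteq> \<sigma> \<longrightarrow> F + G \<in> small p)"
    using F(3) G(3) small_add by metis
  moreover have "g + h \<in> A \<sigma>" by (rule ring_A(6)[OF F(1) G(1)])
  ultimately show ?thesis unfolding good_def using sections_add[OF F(2) G(2)] by blast
qed

lemma constant_in_A: "Poly_Mapping.single 0 c \<in> A \<sigma>"
  by (rule single_in_semigroup_algebra) (simp add: convex_cone_contains_0[OF convex_cone_dual_cone])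

lemma good_scale:
  assumes "h \<in> good \<sigma>" shows "Poly_Mapping.single 0 c * h \<in> good \<sigma>"
proof -
  let ?c = "Poly_Mapping.single 0 c :: ('n, 'k) laurent"
  obtain F where F: "h \<in> A \<sigma>" "F \<in> V" "\<forall>p\<in>X. (T p = \<sigma> \<longrightarrow> F - character (vtx \<sigma>) * emb h \<in> small p) \<and> (T p \<noteq> \<sigma> \<longrightarrow> F \<in> small p)"
    using assms(1) unfolding good_def by blast
  have sc: "emb ?c * f \<in> small p" if "p \<in> X" "f \<in> small p" for p f
    by (rule small_scale[OF that(1) emb_ring[OF that(1) constant_in_A] that(2)])
  have "emb ?c * F - character (vtx \<sigma>) * emb (?c * h) = emb ?c * (F - character (vtx \<sigma>) * emb h)"
    unfolding emb_simps(3) by (simp only: right_diff_distrib mult.left_commute)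
  then have "\<forall>p\<in>X. (T p = \<sigma> \<longrightarrow> emb ?c * F - character (vtx \<sigma>) * emb (?c * h) \<in> small p) \<and> (T p \<noteq> \<sigma> \<longrightarrow> emb ?c * F \<in> small p)"
    using F(3) sc by metis
  moreover have "?c * h \<in> A \<sigma>" by (rule ring_A(4)[OF constant_in_A F(1)])
  ultimately show ?thesis unfolding good_def using sections_scale[OF F(2)] by blast
qed

text \<open>The zero section realises these jets.\<close>

lemma small_good:
  assumes "h \<in> A \<sigma>" "\<And>p. p \<in> X \<Longrightarrow> T p = \<sigma> \<Longrightarrow> character (vtx \<sigma>) * emb h \<in> small p"
  shows "h \<in> good \<sigma>"
proof -
  have "\<forall>p\<in>X. (T p = \<sigma> \<longrightarrow> 0 - character (vtx \<sigma>) * emb h \<in> small p) \<and> (T p \<noteq> \<sigma> \<longrightarrow> 0 \<in> small p)"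
    using small_diff[OF _ small_0 assms(2)] small_0 by blast
  then show ?thesis unfolding good_def using sections_0 assms(1) by blast
qed

lemma good_0: "0 \<in> good \<sigma>"
  by (rule small_good[OF ring_A(2)]) (simp only: emb_simps mult_zero_right small_0)

lemma good_of_keys:
  assumes "\<And>u. u \<in> Poly_Mapping.keys h \<Longrightarrow> Poly_Mapping.single u 1 \<in> good \<sigma>"
  shows "h \<in> good \<sigma>"
proof -
  have s: "sum f B \<in> good \<sigma>" if "\<And>i. i \<in> B \<Longrightarrow> f i \<in> good \<sigma>" for f and B :: "'n lattice set"
    using that by (induction B rule: infinite_finite_induct) (auto intro: good_0 good_add)
  have "Poly_Mapping.single u c \<in> good \<sigma>" if "u \<in> Poly_Mapping.keys h" for u c
    using good_scale[OF assms[OF that], of c] by (simp add: mult_single)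
  then show ?thesis by (subst laurent_expand[of h]) (rule s)
qed

text \<open>A pair (u, q) contributes \<chi>^u - \<chi>^u(q), which vanishes at q. A list is used
  because a point occurs as often as its multiplicity requires.\<close>

definition factors :: "('n::{finite,linorder} lattice \<times> ('n, 'k::alg_closed_field) point) list \<Rightarrow> ('n, 'k) laurent" where
  "factors l = prod_list (map (\<lambda>(u, q). Poly_Mapping.single u 1 - Poly_Mapping.single 0 (pt q u)) l)"

lemma factors_Cons: "factors ((u, q) # l) = (Poly_Mapping.single u 1 - Poly_Mapping.single 0 (pt q u)) * factors l"
  by (simp add: factors_def)

lemma factor_in_A: "to_real u \<in> dual_cone \<sigma> \<Longrightarrow> Poly_Mapping.single u 1 - Poly_Mapping.single 0 c \<in> A \<sigma>"
  by (rule ring_A(3)[OF single_in_semigroup_algebra constant_in_A])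

lemma factors_in_A: "\<forall>w\<in>set l. to_real (fst w) \<in> dual_cone \<sigma> \<Longrightarrow> factors l \<in> A \<sigma>"
proof (induction l)
  case Nil
  then show ?case using ring_A(1) by (simp add: factors_def)
next
  case (Cons w l)
  obtain u q where w: "w = (u, q)" by (cases w)
  show ?case unfolding w factors_Cons
    by (rule ring_A(4)[OF factor_in_A]) (use Cons w in auto)
qed

text \<open>A factor belonging to \<open>p\<close> lies in the maximal ideal at \<open>p\<close>;
  the others are merely regular there and are collected in \<open>r\<close>.\<close>

lemma factors_in_ideal_power:
  assumes p: "p \<in> X"
  shows "\<forall>w\<in>set l. to_real (fst w) \<in> dual_cone (T p) \<Longrightarrow>
    \<exists>g r. emb (factors l) = g * r \<and> g \<in> ideal_power (O\<^sub>p p) (\<mm> p) (count_list (map snd l) p) \<and> r \<in> O\<^sub>p p"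
proof (induction l)
  case Nil
  have "emb (factors []) = 1 * 1" by (simp add: factors_def One_fract_def)
  then show ?case using ring_p(1)[OF p] by (metis count_list.simps(1) ideal_power.simps(1) list.simps(8))
next
  case (Cons w l)
  obtain u q where w: "w = (u, q)" by (cases w)
  then have u: "to_real u \<in> dual_cone (T p)" using Cons.prems by simp
  obtain g r where gr: "emb (factors l) = g * r" "g \<in> ideal_power (O\<^sub>p p) (\<mm> p) (count_list (map snd l) p)" "r \<in> O\<^sub>p p"
    using Cons by auto
  let ?f = "Poly_Mapping.single u 1 - Poly_Mapping.single 0 (pt q u) :: ('n, 'k) laurent"
  have fA: "?f \<in> A (T p)" by (rule factor_in_A[OF u])
  show ?case
  proof (cases "q = p")
    case True
    have "eval_at (pt p) ?f = 0"
      unfolding eval_at_diff eval_at_single True using affine_pointsD(1)[OF pt_affine[OF p]] by simp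
    then have "emb ?f \<in> \<mm> p" using emb_ideal[OF p] fA by blast
    then have "emb ?f * g \<in> ideal_power (O\<^sub>p p) (\<mm> p) (count_list (map snd (w # l)) p)"
      using gr(2) True w by (simp add: ideal_multI)
    moreover have "emb (factors (w # l)) = (emb ?f * g) * r"
      unfolding w factors_Cons emb_simps(3) gr(1) by (simp only: mult.assoc)
    ultimately show ?thesis using gr(3) by blast
  next
    case False
    have "emb ?f * r \<in> O\<^sub>p p" by (rule ring_p(4)[OF p emb_ring[OF p fA] gr(3)])
    moreover have "emb (factors (w # l)) = g * (emb ?f * r)"
      unfolding w factors_Cons emb_simps(3) gr(1) by (simp only: mult.left_commute)
    moreover have "count_list (map snd (w # l)) p = count_list (map snd l) p" using False w by simp
    ultimately show ?thesis using gr(2) by metis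
  qed
qed

lemma keys_single_mult:
  fixes f :: "('n, 'k) laurent"
  assumes "w \<in> Poly_Mapping.keys (Poly_Mapping.single u c * f)"
  shows "c \<noteq> 0" "\<exists>w'\<in>Poly_Mapping.keys f. w = u + w'"
proof -
  obtain a b where ab: "a \<in> Poly_Mapping.keys (Poly_Mapping.single u c)" "b \<in> Poly_Mapping.keys f" "w = a + b"
    by (rule keys_mult_obtain[OF assms])
  have "c \<noteq> 0 \<and> a = u" using ab(1) by (auto split: if_splits)
  then show "c \<noteq> 0" "\<exists>w'\<in>Poly_Mapping.keys f. w = u + w'" using ab by auto
qed

text \<open>Expanding the product, a factor contributes its constant only if the attracting direction lowers the weight.\<close>

lemma factors_leading_term:
  "\<forall>w\<in>set l. fst w \<noteq> 0 \<and> to_real (fst w) \<in> dual_cone \<sigma> \<and> snd w \<in> X \<and> T (snd w) = \<sigma> \<Longrightarrow>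
   to_real (sum_list (map fst l)) \<in> dual_cone \<sigma> \<and>
   (\<forall>w\<in>Poly_Mapping.keys (factors l - Poly_Mapping.single (sum_list (map fst l)) 1).
     to_real w \<in> dual_cone \<sigma> \<and> to_real (sum_list (map fst l) - w) \<in> dual_cone \<sigma> \<and>
     0 < to_real (sum_list (map fst l) - w) \<bullet> v)"
proof (induction l)
  case Nil
  then show ?case by (simp add: factors_def convex_cone_contains_0[OF convex_cone_dual_cone])
next
  case (Cons x l)
  obtain u q where x: "x = (u, q)" by (cases x)
  let ?s = "sum_list (map fst l)" and ?c = "pt q u"
  define r where "r = factors l - Poly_Mapping.single ?s 1"
  have u: "u \<noteq> 0" "to_real u \<in> dual_cone \<sigma>" "q \<in> X" "T q = \<sigma>" using Cons.prems x by auto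
  have s: "to_real ?s \<in> dual_cone \<sigma>" and r: "\<And>w. w \<in> Poly_Mapping.keys r \<Longrightarrow> to_real w \<in> dual_cone \<sigma> \<and>
      to_real (?s - w) \<in> dual_cone \<sigma> \<and> 0 < to_real (?s - w) \<bullet> v"
    using Cons unfolding r_def by auto
  note add = convex_cone_add[OF convex_cone_dual_cone[of \<sigma>]]
  have cv: "0 < to_real u \<bullet> v" if "?c \<noteq> 0" using attract[OF u(3)] u that by blast
  have fl: "factors l = r + Poly_Mapping.single ?s 1" by (simp add: r_def)
  have "factors (x # l) - Poly_Mapping.single (u + ?s) 1 =
      Poly_Mapping.single u 1 * r - Poly_Mapping.single 0 ?c * r - Poly_Mapping.single ?s ?c"
    unfolding x factors_Cons fl by (simp add: left_diff_distrib right_diff_distrib distrib_left mult_single)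
  then have e: "factors (x # l) - Poly_Mapping.single (u + ?s) 1 =
      Poly_Mapping.single u 1 * r + - (Poly_Mapping.single 0 ?c * r + Poly_Mapping.single ?s ?c)" by simp
  have key: "to_real w \<in> dual_cone \<sigma> \<and> to_real (u + ?s - w) \<in> dual_cone \<sigma> \<and> 0 < to_real (u + ?s - w) \<bullet> v"
    if w: "w \<in> Poly_Mapping.keys (factors (x # l) - Poly_Mapping.single (u + ?s) 1)" for w
  proof -
    have "w \<in> Poly_Mapping.keys (Poly_Mapping.single u 1 * r) \<or> w \<in> Poly_Mapping.keys (Poly_Mapping.single 0 ?c * r) \<or>
        w \<in> Poly_Mapping.keys (Poly_Mapping.single ?s ?c)"
      using w unfolding e in_keys_iff lookup_add lookup_uminus by auto
    then consider (a) "w \<in> Poly_Mapping.keys (Poly_Mapping.single u 1 * r)"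
      | (b) "w \<in> Poly_Mapping.keys (Poly_Mapping.single 0 ?c * r)" | (c) "w \<in> Poly_Mapping.keys (Poly_Mapping.single ?s ?c)" by blast
    then show ?thesis
    proof cases
      case a
      obtain w' where w': "w' \<in> Poly_Mapping.keys r" "w = u + w'" using keys_single_mult(2)[OF a] by blast
      have eq: "u + ?s - w = ?s - w'" using w'(2) by simp
      have "to_real w \<in> dual_cone \<sigma>" using add[OF u(2), of "to_real w'"] r[OF w'(1)] w'(2) by simp
      then show ?thesis unfolding eq using r[OF w'(1)] by blast
    next
      case b
      obtain w' where w': "w' \<in> Poly_Mapping.keys r" "w = w'" using keys_single_mult(2)[OF b] by auto
      have d: "to_real (u + ?s - w) = to_real u + to_real (?s - w)" by simp
      have "0 < to_real u \<bullet> v + to_real (?s - w) \<bullet> v"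
        using cv[OF keys_single_mult(1)[OF b]] r[OF w'(1)] w'(2) by (intro add_pos_pos) auto
      then have "0 < to_real (u + ?s - w) \<bullet> v" unfolding d inner_add_left .
      moreover have "to_real (u + ?s - w) \<in> dual_cone \<sigma>" unfolding d using r[OF w'(1)] w'(2) by (intro add[OF u(2)]) auto
      ultimately show ?thesis using r[OF w'(1)] w'(2) by blast
    next
      case c
      then have "?c \<noteq> 0" "w = ?s" by (auto split: if_splits)
      then show ?thesis using cv s u(2) by simp
    qed
  qed
  have ms: "sum_list (map fst (x # l)) = u + ?s" by (simp add: x)
  show ?case unfolding ms using key add[OF u(2) s] by simp
qed

text \<open>The product of the factors \<chi>^w - \<chi>^w(q) and of the leftover monomial has zero
  jets at all points attached to \<sigma>, so it is good. It differs from \<chi>^u by terms covered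
  by \<open>low\<close>.\<close>

lemma monomial_reduction:
  assumes u: "to_real u \<in> dual_cone \<sigma>" and s: "summands (dual_cone \<sigma>) (weight \<sigma>) u"
    and low: "\<And>w. to_real w \<in> dual_cone \<sigma> \<Longrightarrow> to_real (u - w) \<in> dual_cone \<sigma> \<Longrightarrow> 0 < to_real (u - w) \<bullet> v \<Longrightarrow>
      Poly_Mapping.single w 1 \<in> good \<sigma>"
  shows "Poly_Mapping.single u 1 \<in> good \<sigma>"
proof -
  obtain us where us: "length us = weight \<sigma>" "\<forall>w\<in>set us. w \<noteq> 0 \<and> to_real w \<in> dual_cone \<sigma>"
    "to_real (u - sum_list us) \<in> dual_cone \<sigma>" using s unfolding summands_def by blast
  have "finite {p \<in> X. T p = \<sigma>}" using finX by simp
  \<comment> \<open>\<open>weight \<sigma>\<close> is the number of these points counted with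
    multiplicity, so summands and points can be paired off in any order.\<close>
  from list_with_multiplicities[OF this, of mlt] obtain ps where ps: "length ps = weight \<sigma>"
    "\<forall>p\<in>{p \<in> X. T p = \<sigma>}. count_list ps p = mlt p" "set ps \<subseteq> {p \<in> X. T p = \<sigma>}" unfolding weight_def by blast
  define l where "l = zip us ps"
  have l: "map fst l = us" "map snd l = ps" using us(1) ps(1) by (auto simp: l_def)
  have lset: "\<forall>w\<in>set l. fst w \<noteq> 0 \<and> to_real (fst w) \<in> dual_cone \<sigma> \<and> snd w \<in> X \<and> T (snd w) = \<sigma>"
  proof
    fix w assume "w \<in> set l"
    then have "fst w \<in> set us" "snd w \<in> set ps" unfolding l[symmetric] by auto
    then show "fst w \<noteq> 0 \<and> to_real (fst w) \<in> dual_cone \<sigma> \<and> snd w \<in> X \<and> T (snd w) = \<sigma>" using us(2) ps(3) by blast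
  qed
  define e where "e = (Poly_Mapping.single (u - sum_list us) 1 :: ('n, 'k) laurent)"
  have eA: "e \<in> A \<sigma>" unfolding e_def by (rule single_in_semigroup_algebra[OF us(3)])
  have fA: "factors l \<in> A \<sigma>" by (rule factors_in_A) (use lset in blast)
  have "e * factors l \<in> good \<sigma>"
  proof (rule small_good[OF ring_A(4)[OF eA fA]])
    fix p assume p: "p \<in> X" "T p = \<sigma>"
    have "\<forall>w\<in>set l. to_real (fst w) \<in> dual_cone (T p)" using lset p(2) by blast
    from factors_in_ideal_power[OF p(1) this] obtain g r where
      gr: "emb (factors l) = g * r" "g \<in> ideal_power (O\<^sub>p p) (\<mm> p) (count_list (map snd l) p)" "r \<in> O\<^sub>p p" by blast
    have g: "g \<in> ideal_power (O\<^sub>p p) (\<mm> p) (mlt p)" using gr(2) ps(2) p unfolding l(2) by simp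
    have eO: "emb e \<in> O\<^sub>p p" by (rule emb_ring[OF p(1)]) (use eA p(2) in simp)
    have "emb (e * factors l) = g * (emb e * r)" unfolding emb_simps(3) gr(1) by (simp only: mult.left_commute)
    then show "character (vtx \<sigma>) * emb (e * factors l) \<in> small p"
      using smallI[OF p(1) g ring_p(4)[OF p(1) eO gr(3)]] p(2) by simp
  qed
  moreover have "e * factors l - Poly_Mapping.single u 1 \<in> good \<sigma>"
  proof (rule good_of_keys)
    fix w assume w: "w \<in> Poly_Mapping.keys (e * factors l - Poly_Mapping.single u 1)"
    have "e * factors l - Poly_Mapping.single u 1 = e * (factors l - Poly_Mapping.single (sum_list us) 1)"
      by (simp add: e_def right_diff_distrib mult_single)
    then obtain w' where w': "w' \<in> Poly_Mapping.keys (factors l - Poly_Mapping.single (sum_list us) 1)"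
      "w = (u - sum_list us) + w'" using w keys_single_mult(2) unfolding e_def by metis
    have k: "to_real w' \<in> dual_cone \<sigma>" "to_real (sum_list us - w') \<in> dual_cone \<sigma>" "0 < to_real (sum_list us - w') \<bullet> v"
      using factors_leading_term[OF lset] w'(1) unfolding l(1) by blast+
    have uw: "u - w = sum_list us - w'" using w'(2) by simp
    have "to_real w = to_real (u - sum_list us) + to_real w'" unfolding w'(2) by (rule to_real_simps(1))
    then have "to_real w \<in> dual_cone \<sigma>" using convex_cone_add[OF convex_cone_dual_cone us(3) k(1)] by simp
    then show "Poly_Mapping.single w 1 \<in> good \<sigma>" using k(2,3) by (intro low) (simp_all only: uw)
  qed
  moreover have "Poly_Mapping.single u 1 = e * factors l +
      Poly_Mapping.single 0 (- 1) * (e * factors l - Poly_Mapping.single u 1)"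
    by (simp add: single_uminus)
  ultimately show ?thesis using good_add good_scale by metis
qed

text \<open>A monomial of order below \<open>weight \<sigma>\<close> is a lattice point of the
  polytope and covered by assumption; any other is reduced. The induction runs over the height
  \<xi>, a nonnegative integer lowered by each reduction, since pairings with \<open>v\<close> need
  be neither integral nor bounded below on the chart.\<close>

lemma monomials_below:
  assumes \<sigma>: "\<sigma> \<in> maximal_cones \<Delta>"
    and P: "\<And>m. to_real m \<in> P \<Longrightarrow> to_real m \<bullet> v < c \<Longrightarrow> Poly_Mapping.single (m - vtx \<sigma>) 1 \<in> good \<sigma>"
    and w: "weight \<sigma> \<le> k + 1"
  shows "to_real u \<in> dual_cone \<sigma> \<Longrightarrow> (pvtx \<sigma> + to_real u) \<bullet> v < c \<Longrightarrow> Poly_Mapping.single u 1 \<in> good \<sigma>"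
proof -
  note S = maximal_coneD[OF \<sigma>]
  obtain \<xi> :: "'n lattice" where \<xi>: "\<And>u. u \<in> dual_cone \<sigma> \<Longrightarrow> u \<noteq> 0 \<Longrightarrow> 0 < u \<bullet> to_real \<xi>"
    by (rule full_cone_dual_positive[OF S(2,3)]) blast
  show "to_real u \<in> dual_cone \<sigma> \<Longrightarrow> (pvtx \<sigma> + to_real u) \<bullet> v < c \<Longrightarrow> Poly_Mapping.single u 1 \<in> good \<sigma>"
  proof (induction "nat (pairing u \<xi>)" arbitrary: u rule: less_induct)
    case less
    note u = less.prems
    show ?case
    proof (cases "ord \<sigma> u < weight \<sigma>")
      case True
      \<comment> \<open>The order is strictly below a number that is at most k + 1, hence in the
        range where the point stays in the polytope.\<close>
      then have "ord \<sigma> u \<le> k" using w by simp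
      then have "to_real (vtx \<sigma> + u) \<in> P" using small_order_in_polytope[OF \<sigma> u(1)] by simp
      from P[OF this] u(2) show ?thesis by simp
    next
      case False
      have "summands (dual_cone \<sigma>) (weight \<sigma>) u"
        using summands_mono[OF convex_cone_dual_cone _ order_at_fixed_point(1)[OF S(2,3) u(1), of K]] False by simp
      then show ?thesis
      proof (rule monomial_reduction[OF u(1)])
        fix x assume x: "to_real x \<in> dual_cone \<sigma>" "to_real (u - x) \<in> dual_cone \<sigma>" "0 < to_real (u - x) \<bullet> v"
        have "u - x \<noteq> 0" using x(3) by auto
        then have "0 < to_real (u - x) \<bullet> to_real \<xi>" using \<xi>[OF x(2)] by (simp del: to_real_simps)
        then have "to_real x \<bullet> to_real \<xi> < to_real u \<bullet> to_real \<xi>" by (simp add: inner_diff_left)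
        moreover have "0 \<le> to_real x \<bullet> to_real \<xi>" using \<xi>[OF x(1)] by (cases "x = 0") auto
        ultimately have "nat (pairing x \<xi>) < nat (pairing u \<xi>)" by (simp add: inner_to_real)
        moreover have "(pvtx \<sigma> + to_real x) \<bullet> v < c"
          using u(2) x(3) by (simp add: inner_add_left inner_diff_left)
        ultimately show "Poly_Mapping.single x 1 \<in> good \<sigma>" using less.hyps x(1) by blast
      qed
    qed
  qed
qed

lemma weight_le: "weight \<sigma> \<le> k + 1"
  unfolding weight_def mlt[symmetric] using finX by (intro sum_mono2) auto

lemma weight_add_le:
  assumes "\<sigma> \<noteq> \<tau>" shows "weight \<sigma> + weight \<tau> \<le> k + 1"
proof -
  have "weight \<sigma> + weight \<tau> = (\<Sum>p\<in>{p \<in> X. T p = \<sigma>} \<union> {p \<in> X. T p = \<tau>}. mlt p)"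
    unfolding weight_def using finX assms by (intro sum.union_disjoint[symmetric]) auto
  also have "\<dots> \<le> k + 1" unfolding mlt[symmetric] using finX by (intro sum_mono2) auto
  finally show ?thesis .
qed

lemma finite_polytope_points: "finite {m :: 'n lattice. to_real m \<in> P}"
  by (rule finite_lattice_bounded[OF compact_imp_bounded[OF polytope_P(3)]])

text \<open>
  At all cones but at most one the monomial \<open>m\<close> reduces to monomials of lower weight; at the remaining
  one it is hit by the global section \<open>\<chi>\<^sup>m\<close>, corrected at the other cones.
\<close>

lemma polytope_monomials_good:
  "to_real m \<in> P \<Longrightarrow> \<sigma> \<in> maximal_cones \<Delta> \<Longrightarrow> Poly_Mapping.single (m - vtx \<sigma>) 1 \<in> good \<sigma>"
\<comment> \<open>As \<open>v\<close> is real, the induction counts the lattice points of smaller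
  v-weight instead of using the v-weight.\<close>
proof (induction "card {m'. to_real m' \<in> P \<and> to_real m' \<bullet> v < to_real m \<bullet> v}" arbitrary: m \<sigma> rule: less_induct)
  case less
  have m: "to_real m \<in> P" by (rule less.prems)
  have IH: "Poly_Mapping.single (m' - vtx \<tau>) 1 \<in> good \<tau>"
    if m': "to_real m' \<in> P" "to_real m' \<bullet> v < to_real m \<bullet> v" and \<tau>: "\<tau> \<in> maximal_cones \<Delta>" for m' \<tau>
  proof (rule less.hyps[OF _ m'(1) \<tau>])
    have "finite {m'. to_real m' \<in> P \<and> to_real m' \<bullet> v < to_real m \<bullet> v}"
      by (rule finite_subset[OF _ finite_polytope_points]) auto
    then show "card {m''. to_real m'' \<in> P \<and> to_real m'' \<bullet> v < to_real m' \<bullet> v} <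
        card {m'. to_real m' \<in> P \<and> to_real m' \<bullet> v < to_real m \<bullet> v}"
      by (rule psubset_card_mono) (use m' in auto)
  qed
  have dual: "to_real (m - vtx \<tau>) \<in> dual_cone \<tau>" if "\<tau> \<in> maximal_cones \<Delta>" for \<tau>
    using m mem_polytope_iff that by simp
  have step: "Poly_Mapping.single (m - vtx \<tau>) 1 \<in> good \<tau>"
    if \<tau>: "\<tau> \<in> maximal_cones \<Delta>" and big: "weight \<tau> \<le> ord \<tau> (m - vtx \<tau>)" for \<tau>
  proof (rule monomial_reduction[OF dual[OF \<tau>]])
    show "summands (dual_cone \<tau>) (weight \<tau>) (m - vtx \<tau>)"
      using summands_mono[OF convex_cone_dual_cone big order_at_fixed_point(1)[OF maximal_coneD(2,3)[OF \<tau>] dual[OF \<tau>]]] .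
    fix x assume x: "to_real x \<in> dual_cone \<tau>" "to_real (m - vtx \<tau> - x) \<in> dual_cone \<tau>" "0 < to_real (m - vtx \<tau> - x) \<bullet> v"
    show "Poly_Mapping.single x 1 \<in> good \<tau>"
      by (rule monomials_below[OF \<tau> IH[OF _ _ \<tau>] weight_le x(1), of "to_real m \<bullet> v"])
        (use x(3) in \<open>auto simp: inner_add_left inner_diff_left\<close>)
  qed
  show ?case
  proof (cases "weight \<sigma> \<le> ord \<sigma> (m - vtx \<sigma>)")
    case True
    then show ?thesis by (rule step[OF less.prems(2)])
  next
    case False
    let ?M = "maximal_cones \<Delta> - {\<sigma>}"
    have oth: "Poly_Mapping.single (m - vtx \<tau>) 1 \<in> good \<tau>" if \<tau>: "\<tau> \<in> ?M" for \<tau>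
    proof (rule step)
      show "\<tau> \<in> maximal_cones \<Delta>" using \<tau> by blast
      then have "k \<le> ord \<sigma> (m - vtx \<sigma>) + ord \<tau> (m - vtx \<tau>)"
        using orders_at_two_vertices[OF less.prems(2) _ _ m] \<tau> by blast
      moreover have "weight \<sigma> + weight \<tau> \<le> k + 1" using weight_add_le \<tau> by blast
      \<comment> \<open>The order at \<sigma> is at most \<open>weight \<sigma> - 1\<close>, so the
        order at \<tau> is at least k + 1 - \<open>weight \<sigma>\<close>, which is at least
        \<open>weight \<tau>\<close>.\<close>
      ultimately show "weight \<tau> \<le> ord \<tau> (m - vtx \<tau>)" using False by linarith
    qed
    have ch: "character (vtx \<tau>) * emb (Poly_Mapping.single (m - vtx \<tau>) 1) = (character m :: ('n, 'k) function_field)" for \<tau>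
      using character_mult[of "vtx \<tau>" "m - vtx \<tau>"] by (simp add: character_def)
    define Q where "Q \<tau> F \<longleftrightarrow> F \<in> V \<and> (\<forall>p\<in>X. (T p = \<tau> \<longrightarrow> F - character m \<in> small p) \<and> (T p \<noteq> \<tau> \<longrightarrow> F \<in> small p))"
      for \<tau> F
    have "\<exists>F. Q \<tau> F" if \<tau>: "\<tau> \<in> ?M" for \<tau>
    proof -
      obtain F where "F \<in> V" "\<forall>p\<in>X. (T p = \<tau> \<longrightarrow> F - character (vtx \<tau>) * emb (Poly_Mapping.single (m - vtx \<tau>) 1) \<in> small p) \<and>
          (T p \<noteq> \<tau> \<longrightarrow> F \<in> small p)" using oth[OF \<tau>] unfolding good_def by blast
      then have "Q \<tau> F" unfolding Q_def ch by blast
      then show ?thesis by blast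
    qed
    then obtain F where F': "\<And>\<tau>. \<tau> \<in> ?M \<Longrightarrow> Q \<tau> (F \<tau>)" by metis
    have F: "\<forall>\<tau>\<in>?M. F \<tau> \<in> V \<and>
        (\<forall>p\<in>X. (T p = \<tau> \<longrightarrow> F \<tau> - character m \<in> small p) \<and> (T p \<noteq> \<tau> \<longrightarrow> F \<tau> \<in> small p))"
      using F' unfolding Q_def by blast
    \<comment> \<open>\<chi>^m has the right jets at the points of \<sigma>; its jets at the points
      of another cone \<tau> are cancelled by \<open>F \<tau>\<close>, whose jets elsewhere are
      zero.\<close>
    define G where "G = character m - (\<Sum>\<tau>\<in>?M. F \<tau>)"
    have "G \<in> V" unfolding G_def using F by (intro sections_diff sections_character[OF m] sections_sum) blast
    moreover have "(T p = \<sigma> \<longrightarrow> G - character m \<in> small p) \<and> (T p \<noteq> \<sigma> \<longrightarrow> G \<in> small p)" if p: "p \<in> X" for p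
    proof (intro conjI impI)
      assume "T p = \<sigma>"
      then have "(\<Sum>\<tau>\<in>?M. F \<tau>) \<in> small p" using F p by (intro small_sum) blast
      from small_uminus[OF p this] show "G - character m \<in> small p" by (simp add: G_def)
    next
      assume "T p \<noteq> \<sigma>"
      then have Tp: "T p \<in> ?M" using T[OF p] by blast
      have fin: "finite ?M" using finite_maximal_cones by simp
      have "G = - (F (T p) - character m) - (\<Sum>\<tau>\<in>?M - {T p}. F \<tau>)"
        unfolding G_def sum.remove[OF fin Tp, of F] by simp
      moreover have "- (F (T p) - character m) \<in> small p" using F Tp p by (intro small_uminus) blast+
      moreover have "(\<Sum>\<tau>\<in>?M - {T p}. F \<tau>) \<in> small p" using F p by (intro small_sum) blast
      ultimately show "G \<in> small p" using small_diff[OF p] by metis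
    qed
    moreover have "Poly_Mapping.single (m - vtx \<sigma>) 1 \<in> A \<sigma>"
      by (rule single_in_semigroup_algebra[OF dual[OF less.prems(2)]])
    ultimately show ?thesis unfolding good_def mem_Collect_eq ch by blast
  qed
qed

lemma all_good:
  assumes \<sigma>: "\<sigma> \<in> maximal_cones \<Delta>" and h: "h \<in> A \<sigma>" shows "h \<in> good \<sigma>"
proof (rule good_of_keys)
  fix u assume "u \<in> Poly_Mapping.keys h"
  then have u: "to_real u \<in> dual_cone \<sigma>" using h by (auto simp: semigroup_algebra_iff)
  \<comment> \<open>All lattice points of the polytope are good by now, so any bound above the
    v-weight of the monomial serves.\<close>
  show "Poly_Mapping.single u 1 \<in> good \<sigma>"
    by (rule monomials_below[OF \<sigma> polytope_monomials_good[OF _ \<sigma>] weight_le u, of "(pvtx \<sigma> + to_real u) \<bullet> v + 1"]) simp_all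
qed

end

subsection \<open>Interpolation of jets\<close>

context jet_points
begin

text \<open>The denominator is scaled to the value 1 at \<open>p\<close>, so n = 1 - d b lies in the
  maximal ideal there. The geometric series for 1 / (d b) is truncated at the multiplicity of
  \<open>p\<close>, with an error divisible by n to that power.\<close>

lemma fraction_approximation:
  assumes p: "p \<in> X" and r: "r \<in> O\<^sub>p p"
  obtains c where "c \<in> A (T p)" "character (vtx (T p)) * (emb c - r) \<in> small p"
proof -
  obtain a b where ab: "r = Fract a b" "a \<in> A (T p)" "b \<in> A (T p)" "eval_at (pt p) b \<noteq> 0"
    using r unfolding chart_ring_def by blast
  have bn: "b \<noteq> 0" using ab(4) by auto
  define d where "d = (Poly_Mapping.single 0 (inverse (eval_at (pt p) b)) :: ('n, 'k) laurent)"
  define n where "n = 1 - d * b"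
  define j where "j = mlt p"
  define c where "c = a * d * (\<Sum>i<j. n ^ i)"
  have dA: "d \<in> A (T p)" unfolding d_def by (rule constant_in_A)
  have dbA: "d * b \<in> A (T p)" by (rule ring_A(4)[OF dA ab(3)])
  have nA: "n \<in> A (T p)" unfolding n_def by (rule ring_A(3)[OF ring_A(1) dbA])
  have "eval_at (pt p) n = 1 - eval_at (pt p) d * eval_at (pt p) b"
    unfolding n_def eval_at_diff eval_at_1[OF pt_affine[OF p]] eval_at_mult[OF pt_affine[OF p] dA ab(3)] ..
  also have "\<dots> = 0" unfolding d_def eval_at_constant[OF pt_affine[OF p]] using ab(4) by simp
  finally have n0: "emb n \<in> \<mm> p" by (rule emb_ideal[OF p nA])
  have "(\<Sum>i<j. n ^ i) \<in> A (T p)"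
    by (intro subring_set_sum[OF subring_set_semigroup_algebra[OF convex_cone_dual_cone]]
        subring_set_power[OF subring_set_semigroup_algebra[OF convex_cone_dual_cone] nA])
  then have cA: "c \<in> A (T p)" unfolding c_def by (rule ring_A(4)[OF ring_A(4)[OF ab(2) dA]])
  have "c * b = a * ((1 - n) * (\<Sum>i<j. n ^ i))" by (simp add: c_def n_def algebra_simps)
  also have "\<dots> = a * (1 - n ^ j)" using one_diff_power_eq[of n j] by simp
  finally have cb: "c * b - a = - (a * n ^ j)" by (simp add: algebra_simps)
  have "emb c - r = Fract (c * b - a * 1) (1 * b)" unfolding ab(1) by (rule diff_fract[OF one_neq_zero bn])
  also have "\<dots> = emb n ^ j * - r" unfolding emb_power[symmetric] ab(1) using cb by (simp add: mult.commute)
  finally have e: "emb c - r = emb n ^ j * - r" .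
  have "emb n ^ j \<in> ideal_power (O\<^sub>p p) (\<mm> p) (mlt p)"
    unfolding j_def by (rule power_in_ideal_power[OF ring_p(1)[OF p] n0])
  from smallI[OF p this ring_p(5)[OF p r]] have "character (vtx (T p)) * (emb c - r) \<in> small p" unfolding e .
  then show ?thesis using that cA by blast
qed

text \<open>Distinct points of one chart differ at some character, and an affine function of that
  character takes the values 1 and 0.\<close>

lemma point_separator:
  assumes p: "p \<in> X" and q: "q \<in> X" and T: "T p = T q" and ne: "p \<noteq> q"
  obtains s where "s \<in> A (T p)" "eval_at (pt p) s = 1" "eval_at (pt q) s = 0"
proof -
  have "pt p \<noteq> pt q"
  proof
    assume "pt p = pt q"
    then have "p = q" using point_rep(3)[OF pX[OF p] pt[OF p]] point_rep(3)[OF pX[OF q] pt[OF q]] T by simp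
    then show False using ne by simp
  qed
  then obtain u where u: "to_real u \<in> dual_cone (T p)" "pt p u \<noteq> pt q u"
    using affine_point_eqI[OF pt_affine[OF p], of "pt q"] pt_affine[OF q] T by auto
  define d where "d = (Poly_Mapping.single 0 (inverse (pt p u - pt q u)) :: ('n, 'k) laurent)"
  define g where "g = (Poly_Mapping.single u 1 - Poly_Mapping.single 0 (pt q u) :: ('n, 'k) laurent)"
  have dA: "d \<in> A (T p)" unfolding d_def by (rule constant_in_A)
  have gA: "g \<in> A (T p)" unfolding g_def by (rule factor_in_A[OF u(1)])
  have gp: "eval_at (pt p) g = pt p u - pt q u"
    unfolding g_def eval_at_diff eval_at_constant[OF pt_affine[OF p]] by (simp add: eval_at_single)
  have gq: "eval_at (pt q) g = 0"
    unfolding g_def eval_at_diff eval_at_constant[OF pt_affine[OF q]] by (simp add: eval_at_single)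
  have "eval_at (pt p) (d * g) = 1"
    unfolding eval_at_mult[OF pt_affine[OF p] dA gA] gp unfolding d_def eval_at_constant[OF pt_affine[OF p]]
    using u(2) by simp
  moreover have "eval_at (pt q) (d * g) = 0"
    using eval_at_mult[OF pt_affine[OF q], of d g] dA gA T gq by simp
  ultimately show ?thesis using that ring_A(4)[OF dA gA] by blast
qed

text \<open>The product e of separators raised to the multiplicities has zero jets at the other
  points of the chart, but at \<open>p\<close> only its value is 1. Replacing e by 1 - (1 - e)^j
  with j the multiplicity of \<open>p\<close>, which is still divisible by e, makes the jet at
  \<open>p\<close> equal to 1.\<close>

lemma point_idempotent:
  assumes p: "p \<in> X"
  obtains g where "g \<in> A (T p)" "character (vtx (T p)) * (emb g - 1) \<in> small p"
    "\<And>q. q \<in> X \<Longrightarrow> T q = T p \<Longrightarrow> q \<noteq> p \<Longrightarrow> character (vtx (T p)) * emb g \<in> small q"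
proof -
  define Y where "Y = {q \<in> X. T q = T p \<and> q \<noteq> p}"
  have fY: "finite Y" using finX by (simp add: Y_def)
  have "\<exists>s. s \<in> A (T p) \<and> eval_at (pt p) s = 1 \<and> eval_at (pt q) s = 0" if "q \<in> Y" for q
    using point_separator[OF p, of q] that unfolding Y_def by (metis (mono_tags, lifting) mem_Collect_eq)
  then obtain s where s: "\<And>q. q \<in> Y \<Longrightarrow> s q \<in> A (T p)" "\<And>q. q \<in> Y \<Longrightarrow> eval_at (pt p) (s q) = 1"
    "\<And>q. q \<in> Y \<Longrightarrow> eval_at (pt q) (s q) = 0" by metis
  have spA: "s q ^ mlt q \<in> A (T p)" if "q \<in> Y" for q
    by (rule subring_set_power[OF subring_set_semigroup_algebra[OF convex_cone_dual_cone] s(1)[OF that]])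
  define e where "e = (\<Prod>q\<in>Y. s q ^ mlt q)"
  have eA: "e \<in> A (T p)" and ev: "eval_at (pt p) e = (\<Prod>q\<in>Y. eval_at (pt p) (s q ^ mlt q))"
    unfolding e_def using eval_at_prod[OF pt_affine[OF p], of Y "\<lambda>q. s q ^ mlt q"] spA by blast+
  have e1: "eval_at (pt p) e = 1"
    unfolding ev using eval_at_power[OF pt_affine[OF p] s(1)] s(2) by (intro prod.neutral) simp
  define n where "n = 1 - e"
  have nA: "n \<in> A (T p)" unfolding n_def by (rule ring_A(3)[OF ring_A(1) eA])
  have n0: "emb n \<in> \<mm> p"
    by (rule emb_ideal[OF p nA]) (simp add: n_def eval_at_diff eval_at_1[OF pt_affine[OF p]] e1)
  define z where "z = (\<Sum>i<mlt p. n ^ i)"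
  have zA: "z \<in> A (T p)" unfolding z_def
    by (intro subring_set_sum[OF subring_set_semigroup_algebra[OF convex_cone_dual_cone]]
        subring_set_power[OF subring_set_semigroup_algebra[OF convex_cone_dual_cone] nA])
  define g where "g = e * z"
  have g: "g = 1 - n ^ mlt p" unfolding g_def z_def using one_diff_power_eq[of n "mlt p"] by (simp add: n_def)
  have gA: "g \<in> A (T p)" unfolding g_def by (rule ring_A(4)[OF eA zA])
  have "emb g - 1 = emb n ^ mlt p * - 1" unfolding g emb_simps emb_power by simp
  moreover have "emb n ^ mlt p \<in> ideal_power (O\<^sub>p p) (\<mm> p) (mlt p)"
    by (rule power_in_ideal_power[OF ring_p(1)[OF p] n0])
  ultimately have 1: "character (vtx (T p)) * (emb g - 1) \<in> small p"
    using smallI[OF p _ ring_p(5)[OF p ring_p(1)[OF p]]] by metis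
  have 2: "character (vtx (T p)) * emb g \<in> small q" if q: "q \<in> X" "T q = T p" "q \<noteq> p" for q
  proof -
    have qY: "q \<in> Y" using q by (simp add: Y_def)
    have sm: "emb (s q) \<in> \<mm> q" by (rule emb_ideal[OF q(1)]) (use s(1,3)[OF qY] q(2) in auto)
    define r where "r = (\<Prod>q'\<in>Y - {q}. s q' ^ mlt q')"
    have rA: "r \<in> A (T p)" unfolding r_def
      using eval_at_prod[OF pt_affine[OF p], of "Y - {q}" "\<lambda>q. s q ^ mlt q"] spA by blast
    have "e = s q ^ mlt q * r" unfolding e_def r_def by (rule prod.remove[OF fY qY])
    then have "g = s q ^ mlt q * (r * z)" by (simp add: g_def mult.assoc)
    then have eg: "emb g = emb (s q) ^ mlt q * emb (r * z)" by (simp only: emb_simps(3) emb_power)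
    have "r * z \<in> A (T p)" by (rule ring_A(4)[OF rA zA])
    then have "emb (r * z) \<in> O\<^sub>p q" using emb_ring[OF q(1)] q(2) by metis
    from smallI[OF q(1) power_in_ideal_power[OF ring_p(1)[OF q(1)] sm] this]
    show ?thesis unfolding eg using q(2) by simp
  qed
  show ?thesis using that[OF gA 1 2] .
qed

text \<open>The Chinese remainder construction: regular functions approximating the single jets are
  glued by approximate idempotents.\<close>

lemma chart_interpolation:
  assumes f: "\<And>p. p \<in> X \<Longrightarrow> f p \<in> divisor_stalk \<Delta> D p"
  obtains h where "h \<in> A \<sigma>" "\<And>p. p \<in> X \<Longrightarrow> T p = \<sigma> \<Longrightarrow> character (vtx \<sigma>) * emb h - f p \<in> small p"
proof -
  define Y where "Y = {p \<in> X. T p = \<sigma>}"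
  have fY: "finite Y" using finX by (simp add: Y_def)
  define Q where "Q p c g \<longleftrightarrow> c \<in> A \<sigma> \<and> g \<in> A \<sigma> \<and> character (vtx \<sigma>) * emb c - f p \<in> small p \<and>
      character (vtx \<sigma>) * (emb g - 1) \<in> small p \<and> (\<forall>q\<in>Y. q \<noteq> p \<longrightarrow> character (vtx \<sigma>) * emb g \<in> small q)" for p c g
  have "\<exists>c g. Q p c g" if "p \<in> Y" for p
  proof -
    have p: "p \<in> X" "T p = \<sigma>" using that by (auto simp: Y_def)
    obtain r where r: "f p = character (vtx (T p)) * r" "r \<in> O\<^sub>p p" using f[OF p(1)] stalk_p(1)[OF p(1)] by blast
    obtain c where c: "c \<in> A (T p)" "character (vtx (T p)) * (emb c - r) \<in> small p"
      by (rule fraction_approximation[OF p(1) r(2)])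
    obtain g where g: "g \<in> A (T p)" "character (vtx (T p)) * (emb g - 1) \<in> small p"
      "\<And>q. q \<in> X \<Longrightarrow> T q = T p \<Longrightarrow> q \<noteq> p \<Longrightarrow> character (vtx (T p)) * emb g \<in> small q"
      by (rule point_idempotent[OF p(1)]) blast
    have "Q p c g" unfolding Q_def r(1) using c g p(2) by (auto simp: Y_def right_diff_distrib)
    then show ?thesis by blast
  qed
  then obtain c g where cg: "\<And>p. p \<in> Y \<Longrightarrow> Q p (c p) (g p)" by metis
  note cg' = cg[unfolded Q_def]
  define h where "h = (\<Sum>p\<in>Y. g p * c p)"
  have "g p * c p \<in> A \<sigma>" if "p \<in> Y" for p using cg'[OF that] ring_A(4)[of "g p" \<sigma> "c p"] by blast
  then have "h \<in> A \<sigma>" unfolding h_def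
    by (intro subring_set_sum[OF subring_set_semigroup_algebra[OF convex_cone_dual_cone]])
  moreover have "character (vtx \<sigma>) * emb h - f p \<in> small p" if p: "p \<in> X" "T p = \<sigma>" for p
  proof -
    have pY: "p \<in> Y" using p by (simp add: Y_def)
    let ?\<chi> = "character (vtx \<sigma>) :: ('n, 'k) function_field"
    have "emb h = emb (g p) * emb (c p) + (\<Sum>q\<in>Y - {p}. emb (g q) * emb (c q))"
      unfolding h_def emb_sum emb_simps(3) by (rule sum.remove[OF fY pY])
    then have "?\<chi> * emb h - f p = (?\<chi> * (emb (g p) - 1)) * emb (c p) + (?\<chi> * emb (c p) - f p) +
        ?\<chi> * (\<Sum>q\<in>Y - {p}. emb (g q) * emb (c q))"
      by (simp only: algebra_simps) simp
    also have "?\<chi> * (\<Sum>q\<in>Y - {p}. emb (g q) * emb (c q)) = (\<Sum>q\<in>Y - {p}. (?\<chi> * emb (g q)) * emb (c q))"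
      unfolding sum_distrib_left by (simp only: mult.assoc)
    finally have e: "?\<chi> * emb h - f p = (?\<chi> * (emb (g p) - 1)) * emb (c p) + (?\<chi> * emb (c p) - f p) +
        (\<Sum>q\<in>Y - {p}. (?\<chi> * emb (g q)) * emb (c q))" .
    have sc: "x * emb (c q) \<in> small p" if "q \<in> Y" "x \<in> small p" for q x
      using small_emb_scale[OF p(1) _ that(2), of "c q"] cg'[OF that(1)] p(2) by blast
    have "(\<Sum>q\<in>Y - {p}. (?\<chi> * emb (g q)) * emb (c q)) \<in> small p"
    proof (rule small_sum)
      fix q assume q: "q \<in> Y - {p}"
      then have "?\<chi> * emb (g q) \<in> small p" using cg'[of q] pY by blast
      then show "(?\<chi> * emb (g q)) * emb (c q) \<in> small p" using q by (intro sc) blast+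
    qed
    then show ?thesis unfolding e using cg'[OF pY] sc[OF pY] by (intro small_add) blast+
  qed
  ultimately show ?thesis using that by blast
qed

theorem jet_interpolation:
  assumes f: "\<And>p. p \<in> X \<Longrightarrow> f p \<in> divisor_stalk \<Delta> D p"
  obtains F where "F \<in> V" "\<And>p. p \<in> X \<Longrightarrow> F - f p \<in> small p"
proof -
  let ?M = "maximal_cones \<Delta>"
  define Q where "Q \<sigma> F \<longleftrightarrow> F \<in> V \<and> (\<forall>p\<in>X. (T p = \<sigma> \<longrightarrow> F - f p \<in> small p) \<and> (T p \<noteq> \<sigma> \<longrightarrow> F \<in> small p))" for \<sigma> F
  have "\<exists>F. Q \<sigma> F" if \<sigma>: "\<sigma> \<in> ?M" for \<sigma>
  proof -
    obtain h where h: "h \<in> A \<sigma>" "\<And>p. p \<in> X \<Longrightarrow> T p = \<sigma> \<Longrightarrow> character (vtx \<sigma>) * emb h - f p \<in> small p"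
      by (rule chart_interpolation[of f, OF f]) blast+
    obtain F where F: "F \<in> V" "\<forall>p\<in>X. (T p = \<sigma> \<longrightarrow> F - character (vtx \<sigma>) * emb h \<in> small p) \<and> (T p \<noteq> \<sigma> \<longrightarrow> F \<in> small p)"
      using all_good[OF \<sigma> h(1)] unfolding good_def by blast
    have "F - f p \<in> small p" if p: "p \<in> X" "T p = \<sigma>" for p
    proof -
      have "(F - character (vtx \<sigma>) * emb h) + (character (vtx \<sigma>) * emb h - f p) \<in> small p"
        using F(2) h(2) p by (intro small_add) blast+
      then show ?thesis by simp
    qed
    then show ?thesis using F unfolding Q_def by blast
  qed
  then obtain F where "\<And>\<sigma>. \<sigma> \<in> ?M \<Longrightarrow> Q \<sigma> (F \<sigma>)" by metis
  note F = this[unfolded Q_def]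
  have "(\<Sum>\<sigma>\<in>?M. F \<sigma>) \<in> V" using F by (intro sections_sum) blast
  moreover have "(\<Sum>\<sigma>\<in>?M. F \<sigma>) - f p \<in> small p" if p: "p \<in> X" for p
  proof -
    have "(\<Sum>\<sigma>\<in>?M. F \<sigma>) = F (T p) + (\<Sum>\<sigma>\<in>?M - {T p}. F \<sigma>)"
      by (rule sum.remove[OF finite_maximal_cones T[OF p]])
    then have e: "(\<Sum>\<sigma>\<in>?M. F \<sigma>) - f p = (F (T p) - f p) + (\<Sum>\<sigma>\<in>?M - {T p}. F \<sigma>)" by simp
    have "(\<Sum>\<sigma>\<in>?M - {T p}. F \<sigma>) \<in> small p"
    proof (rule small_sum)
      fix \<sigma> assume s: "\<sigma> \<in> ?M - {T p}"
      then have "T p \<noteq> \<sigma>" by blast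
      then show "F \<sigma> \<in> small p" using F[of \<sigma>] s p by blast
    qed
    moreover have "F (T p) - f p \<in> small p" using F[OF T[OF p]] p by blast
    ultimately show ?thesis unfolding e by (intro small_add)
  qed
  ultimately show ?thesis using that by blast
qed

end

section \<open>From jets at the points to the quotient sheaf\<close>

lemma one_in_jet_ideal_stalk:
  assumes "1 \<in> local_ring p" shows "p \<notin> fst ` set xs \<Longrightarrow> 1 \<in> jet_ideal_stalk xs p"
proof (induction xs)
  case (Cons x xs)
  obtain q j where x: "x = (q, j)" by (cases x)
  have "1 * 1 \<in> ideal_mult (ideal_power (local_ring p) (local_ring p) j) (jet_ideal_stalk xs p)"
    using Cons one_in_ideal_power[OF assms] by (intro ideal_multI) auto
  moreover have "p \<noteq> q" using Cons.prems x by auto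
  ultimately show ?case by (simp add: x jet_ideal_stalk_def point_ideal_stalk_def)
qed (use assms in \<open>simp add: jet_ideal_stalk_def\<close>)

text \<open>The other points contribute the whole local ring at \<open>p\<close>, so the power
  belonging to \<open>p\<close> is contained in the product. This direction suffices, as a
  difference has to be shown to lie in the product.\<close>

lemma ideal_power_subset_jet_ideal_stalk:
  assumes "1 \<in> local_ring p"
  shows "distinct (map fst xs) \<Longrightarrow> (p, j) \<in> set xs \<Longrightarrow>
    ideal_power (local_ring p) (max_ideal_at p) j \<subseteq> jet_ideal_stalk xs p"
proof (induction xs)
  case (Cons x xs)
  obtain q i where x: "x = (q, i)" by (cases x)
  show ?case
  proof
    fix y assume y: "y \<in> ideal_power (local_ring p) (max_ideal_at p) j"
    show "y \<in> jet_ideal_stalk (x # xs) p"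
    proof (cases "q = p")
      case True
      have "p \<notin> fst ` set xs" using Cons.prems(1) x True by auto
      then have "1 \<in> jet_ideal_stalk xs p" by (rule one_in_jet_ideal_stalk[OF assms])
      moreover have "i = j" using Cons.prems x True by (force simp: image_iff)
      ultimately have "y * 1 \<in> ideal_mult (ideal_power (local_ring p) (max_ideal_at p) i) (jet_ideal_stalk xs p)"
        using y by (intro ideal_multI) auto
      then show ?thesis using True by (simp add: x jet_ideal_stalk_def point_ideal_stalk_def)
    next
      case False
      then have "(p, j) \<in> set xs" using Cons.prems(2) x by auto
      then have "y \<in> jet_ideal_stalk xs p" using Cons y by auto
      then have "1 * y \<in> ideal_mult (ideal_power (local_ring p) (local_ring p) i) (jet_ideal_stalk xs p)"
        using one_in_ideal_power[OF assms] by (intro ideal_multI) auto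
      then show ?thesis using False by (simp add: x jet_ideal_stalk_def point_ideal_stalk_def)
    qed
  qed
qed simp

context jet_toric_fan
begin

lemma local_ring_one:
  fixes p :: "('n, 'k) point"
  assumes "p \<in> toric_variety \<Delta>" shows "1 \<in> local_ring p" "- 1 \<in> local_ring p"
proof -
  obtain \<sigma> x where x: "(\<sigma>, x) \<in> p" by (rule point_obtain[OF assms])
  note S = subring_setD[OF subring_set_chart_ring(1)[OF point_rep(2)[OF assms x]]]
  show "1 \<in> local_ring p" "- 1 \<in> local_ring p"
    unfolding local_ring_eq(1)[OF assms x] using S(1) S(5)[OF S(1)] by auto
qed

lemma stalk_chart:
  fixes p :: "('n, 'k) point"
  assumes "p \<in> toric_variety \<Delta>"
  obtains \<tau> x where "\<tau> \<in> maximal_cones \<Delta>" "(\<tau>, x) \<in> p" "local_datum \<Delta> D \<tau> (vtx \<tau>)"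
proof -
  obtain v where "generic v" by (rule generic_exists)
  from attracting_chart[OF this assms] that vertex_datum show ?thesis by blast
qed

lemma stalk_module:
  fixes p :: "('n, 'k) point"
  assumes p: "p \<in> toric_variety \<Delta>"
  shows "r \<in> local_ring p \<Longrightarrow> g \<in> divisor_stalk \<Delta> D p \<Longrightarrow> r * g \<in> divisor_stalk \<Delta> D p"
    and "f \<in> divisor_stalk \<Delta> D p \<Longrightarrow> g \<in> divisor_stalk \<Delta> D p \<Longrightarrow> f - g \<in> divisor_stalk \<Delta> D p"
proof -
  obtain \<tau> x where t: "\<tau> \<in> maximal_cones \<Delta>" "(\<tau>, x) \<in> p" "local_datum \<Delta> D \<tau> (vtx \<tau>)" by (rule stalk_chart[OF p])
  note M = divisor_stalk_module[OF p t(2,3)]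
  show m: "r \<in> local_ring p \<Longrightarrow> g \<in> divisor_stalk \<Delta> D p \<Longrightarrow> r * g \<in> divisor_stalk \<Delta> D p" for r g by (rule M(2))
  show "f - g \<in> divisor_stalk \<Delta> D p" if "f \<in> divisor_stalk \<Delta> D p" "g \<in> divisor_stalk \<Delta> D p"
    using M(1)[OF that(1) m[OF local_ring_one(2)[OF p] that(2)]] by simp
qed

lemma jet_class_eqI:
  fixes p :: "('n, 'k) point"
  assumes p: "p \<in> toric_variety \<Delta>" and d: "f - f' \<in> ideal_mult (jet_ideal_stalk xs p) (divisor_stalk \<Delta> D p)"
  shows "jet_class \<Delta> D xs f p = jet_class \<Delta> D xs f' p"
proof -
  let ?I = "ideal_mult (jet_ideal_stalk xs p) (divisor_stalk \<Delta> D p)"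
  have sub: "{f + g | g. g \<in> ?I} \<subseteq> {f' + g | g. g \<in> ?I}" if "f - f' \<in> ?I" for f f'
  proof
    fix y assume "y \<in> {f + g | g. g \<in> ?I}"
    then obtain g where g: "y = f + g" "g \<in> ?I" by blast
    have "y = f' + ((f - f') + g)" using g(1) by simp
    moreover have "(f - f') + g \<in> ?I" by (rule ideal_mult_add[OF that g(2)])
    ultimately show "y \<in> {f' + g | g. g \<in> ?I}" by blast
  qed
  have "- 1 * (f - f') \<in> ?I" by (rule ideal_mult_scale[OF stalk_module(1)[OF p local_ring_one(2)[OF p]] d])
  then have "f' - f \<in> ?I" by simp
  then show ?thesis unfolding jet_class_def using sub[OF d] sub[of f' f] by blast
qed

lemma zariski_open_toric_variety: "zariski_open \<Delta> (toric_variety \<Delta> :: ('n, 'k) point set)"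
  unfolding zariski_open_def
proof (intro conjI ballI impI order_refl)
  fix \<sigma> and x :: "'n lattice \<Rightarrow> 'k" assume \<sigma>: "\<sigma> \<in> \<Delta>" "x \<in> affine_points \<sigma>"
  show "\<exists>f\<in>semigroup_algebra (dual_cone \<sigma>). eval_at x f \<noteq> 0 \<and>
      (\<forall>y\<in>affine_points \<sigma>. eval_at y f \<noteq> 0 \<longrightarrow> gluing \<Delta> `` {(\<sigma>, y)} \<in> toric_variety \<Delta>)"
    using subring_setD(1)[OF subring_set_semigroup_algebra[OF convex_cone_dual_cone]] eval_at_1[OF \<sigma>(2)]
      point_in(1)[OF \<sigma>(1)] by (intro bexI[of _ 1]) auto
qed

theorem jet_ample_toric: "jet_ample K k \<Delta> D"
  unfolding jet_ample_def
proof (intro allI impI)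
  fix xs :: "(('n, 'k) point \<times> nat) list"
  assume xs: "distinct (map fst xs) \<and> (\<forall>(x, j)\<in>set xs. x \<in> toric_variety \<Delta> \<and> j > 0) \<and> sum_list (map snd xs) = k + 1"
  define X where "X = set (map fst xs)"
  define mlt where "mlt p = the (map_of xs p)" for p
  have mlt_eq: "mlt p = j" if "(p, j) \<in> set xs" for p j
    using that xs by (simp add: mlt_def)
  have sm: "sum mlt X = k + 1"
  proof -
    have "sum mlt X = sum_list (map mlt (map fst xs))" unfolding X_def using xs by (intro sum.distinct_set_conv_list) simp
    also have "map mlt (map fst xs) = map snd xs" using mlt_eq by (auto simp: map_eq_conv)
    finally show ?thesis using xs by simp
  qed
  have XV: "X \<subseteq> toric_variety \<Delta>" using xs by (auto simp: X_def)
  obtain v where v: "generic v" by (rule generic_exists)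
  define Q where "Q p \<tau> x \<longleftrightarrow> \<tau> \<in> maximal_cones \<Delta> \<and> (\<tau>, x) \<in> p \<and>
    (\<forall>u. to_real u \<in> dual_cone \<tau> \<longrightarrow> x u \<noteq> 0 \<longrightarrow> u = 0 \<or> 0 < to_real u \<bullet> v)"
    for p :: "('n, 'k) point" and \<tau> x
  have "\<exists>\<tau> x. Q p \<tau> x" if "p \<in> X" for p
    unfolding Q_def by (rule attracting_chart[OF v subsetD[OF XV that]])
  then obtain T pt where "\<And>p. p \<in> X \<Longrightarrow> Q p (T p) (pt p)" by metis
  note TP = this[unfolded Q_def]
  interpret jet_points \<Delta> D K k X mlt v T pt
    by unfold_locales (use TP XV sm in \<open>auto simp: X_def\<close>)
  show "jet_evaluation \<Delta> D xs ` sections \<Delta> D (toric_variety \<Delta>) = jet_sections \<Delta> D xs"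
  proof
    show "jet_evaluation \<Delta> D xs ` sections \<Delta> D (toric_variety \<Delta>) \<subseteq> jet_sections \<Delta> D xs"
    proof (rule image_subsetI)
      fix f assume f: "f \<in> sections \<Delta> D (toric_variety \<Delta> :: ('n, 'k) point set)"
      show "jet_evaluation \<Delta> D xs f \<in> jet_sections \<Delta> D xs"
        unfolding jet_sections_def jet_evaluation_def
      proof (intro CollectI conjI ballI restrict_extensional)
        fix p :: "('n, 'k) point" assume "p \<in> toric_variety \<Delta>"
        then show "\<exists>V g. zariski_open \<Delta> V \<and> p \<in> V \<and> g \<in> sections \<Delta> D V \<and>
            (\<forall>q\<in>V. restrict (jet_class \<Delta> D xs f) (toric_variety \<Delta>) q = jet_class \<Delta> D xs g q)"
          using zariski_open_toric_variety f by (intro exI[of _ "toric_variety \<Delta>"] exI[of _ f]) simp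
      qed
    qed
    show "jet_sections \<Delta> D xs \<subseteq> jet_evaluation \<Delta> D xs ` sections \<Delta> D (toric_variety \<Delta>)"
    proof
      fix s assume s: "s \<in> jet_sections \<Delta> D xs"
      \<comment> \<open>A section of the quotient sheaf is determined by its residue classes at the
        closed points, so germs may be chosen at each point separately, without
        compatibility.\<close>
      have "\<exists>g. g \<in> divisor_stalk \<Delta> D p \<and> s p = jet_class \<Delta> D xs g p" if p: "p \<in> toric_variety \<Delta>" for p
      proof -
        obtain V g where "p \<in> V" "g \<in> sections \<Delta> D V" "\<forall>q\<in>V. s q = jet_class \<Delta> D xs g q"
          using s p unfolding jet_sections_def by blast
        then show ?thesis by (auto simp: sections_def)
      qed
      then obtain f where f: "\<And>p. p \<in> toric_variety \<Delta> \<Longrightarrow> f p \<in> divisor_stalk \<Delta> D p"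
        "\<And>p. p \<in> toric_variety \<Delta> \<Longrightarrow> s p = jet_class \<Delta> D xs (f p) p" by metis
      obtain F where F: "F \<in> sections \<Delta> D (toric_variety \<Delta>)" "\<And>p. p \<in> X \<Longrightarrow> F - f p \<in> small p"
        by (rule jet_interpolation[of f, OF f(1)]) (use XV in blast)+
      have "s = jet_evaluation \<Delta> D xs F"
      proof (rule extensionalityI)
        show "s \<in> extensional (toric_variety \<Delta>)" using s by (simp add: jet_sections_def)
        show "jet_evaluation \<Delta> D xs F \<in> extensional (toric_variety \<Delta>)" by (simp add: jet_evaluation_def)
        fix p :: "('n, 'k) point" assume p: "p \<in> toric_variety \<Delta>"
        have "F - f p \<in> ideal_mult (jet_ideal_stalk xs p) (divisor_stalk \<Delta> D p)"
        proof (cases "p \<in> X")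
          case True
          then obtain j where j: "(p, j) \<in> set xs" by (auto simp: X_def)
          have "distinct (map fst xs)" using xs by blast
          from ideal_power_subset_jet_ideal_stalk[OF local_ring_one(1)[OF p] this j]
          show ?thesis using F(2)[OF True] ideal_mult_mono unfolding small_def mlt_eq[OF j] by blast
        next
          \<comment> \<open>Away from the given points the jet ideal is the whole local ring, so all
            germs of the line bundle have the same class.\<close>
          case False
          have "F \<in> divisor_stalk \<Delta> D p" using F(1) p by (simp add: sections_def)
          then have "1 * (F - f p) \<in> ideal_mult (jet_ideal_stalk xs p) (divisor_stalk \<Delta> D p)"
            using False f(1)[OF p] stalk_module(2)[OF p] one_in_jet_ideal_stalk[OF local_ring_one(1)[OF p], of xs]
            by (intro ideal_multI) (auto simp: X_def)
          then show ?thesis by simp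
        qed
        from jet_class_eqI[OF p this] show "s p = jet_evaluation \<Delta> D xs F p"
          using f(2)[OF p] p by (simp add: jet_evaluation_def)
      qed
      then show "s \<in> jet_evaluation \<Delta> D xs ` sections \<Delta> D (toric_variety \<Delta>)" using F(1) by blast
    qed
  qed
qed

end

theorem theorem1p7:
  fixes \<Delta> :: "(real ^ 'n::{finite,linorder}) set set"
    and D :: "'n tdivisor"
    and k :: nat
  assumes "fan \<Delta>"
    and "projective_toric TYPE('k::alg_closed_field) \<Delta>"
    and "cartier \<Delta> D"
    and "ample TYPE('k) \<Delta> D"
    and "\<And>\<sigma>. \<sigma> \<in> maximal_cones \<Delta> \<Longrightarrow>
           min_edge_length \<Delta> D \<sigma> \<ge> real k + Gamma_const TYPE('k) (dual_cone \<sigma>)"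
  shows "jet_ample TYPE('k) k \<Delta> D"
proof -
  interpret toric_fan \<Delta> by unfold_locales (rule assms(1))
  interpret complete_toric_fan \<Delta> by unfold_locales (rule complete_of_projective[OF assms(2)])
  have datum: "local_datum \<Delta> D \<sigma> (cone_vertex \<Delta> D \<sigma>)" if \<sigma>: "\<sigma> \<in> maximal_cones \<Delta>" for \<sigma>
    unfolding cone_vertex_def
  proof (rule theI')
    \<comment> \<open>Existence is the Cartier property; uniqueness holds because the maximal cones
      of a complete fan are full-dimensional. This gives the description in
      \<open>cone_vertex\<close> its meaning.\<close>
    show "\<exists>!u. local_datum \<Delta> D \<sigma> u"
      using assms(3) maximal_coneD[OF \<sigma>] local_datum_unique unfolding cartier_def by blast
  qed
  interpret jet_toric_fan \<Delta> D "TYPE('k)" k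
  proof unfold_locales
    fix \<sigma> \<tau> assume \<sigma>: "\<sigma> \<in> maximal_cones \<Delta>"
    show "local_datum \<Delta> D \<sigma> (cone_vertex \<Delta> D \<sigma>)" by (rule datum[OF \<sigma>])
    show "real k + Gamma_const TYPE('k) (dual_cone \<sigma>) \<le> min_edge_length \<Delta> D \<sigma>" by (rule assms(5)[OF \<sigma>])
    assume \<tau>: "\<tau> \<in> maximal_cones \<Delta>"
    note av = ample_vertices[OF assms(4,3) \<sigma> datum[OF \<sigma>] \<tau> datum[OF \<tau>]]
    show "to_real (cone_vertex \<Delta> D \<sigma> - cone_vertex \<Delta> D \<tau>) \<in> dual_cone \<tau>" by (rule av(1))
    show "cone_vertex \<Delta> D \<sigma> \<noteq> cone_vertex \<Delta> D \<tau>" if "\<sigma> \<noteq> \<tau>" using av(2) that by metis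
  qed
  show ?thesis by (rule jet_ample_toric)
qed

end
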